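(* The modular function field $\mathcal A_0(\Gamma(14))$ is the splitting field over $\mathcal A_0(\Gamma(7))=\mathbf C(\psi,\upsilon)$ of the cubic \[ P_{\upsilon}(T)=T^3+T^2-\frac{\upsilon^2-1}{\upsilon}T+\frac{(\upsilon-1)^2}{\upsilon}. \] More precisely, \[ \mathcal A_0(\Gamma(14))=\mathbf C(\upsilon,\psi,g_1,\delta)=\mathbf C(\upsilon,\psi,g_1,g_2), \] where $g_1,g_2,g_3$ are the three roots of $P_\upsilon(T)$ and \[ \delta=\frac{\upsilon^2}{2(\upsilon-1)}(g_1-g_2)(g_2-g_3)(g_3-g_1) \] is a normalized square root of the discriminant of $P_\upsilon(T)$. Consequently an affine model of the modular curve $X(14)$ is given by \[ \left\{ \begin{aligned} &Y^7=X^4(X-1),\\ &XZ^3+XZ^2-(X^2-1)Z+(X-1)^2=0,\\ &W^2=X(X-1)(X^3-8X^2+5X+1), \end{aligned} \right. \] where $X=\upsilon$, $Y=\psi$, $Z=g_1$ and $W=\delta$.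
   Context: For a congruence subgroup $G\subset\mathrm{SL}_2(\mathbf Z)$, $\mathcal A_0(G)$ denotes the field of modular functions for $G$ over $\mathbf C$ (weight $0$, meromorphic on the upper half-plane and at the cusps), i.e. the function field of the associated compact modular curve. "Affine model" means an affine curve whose function field is that of the modular curve. For $k=1,2,3$ put $a_k(\tau)=\sum_{n\in\mathbf Z}(-1)^{n+k+1}q^{(14n+7-2k)^2/56}$, where $q^r=e^{2\pi i r\tau}$, and $\psi=-a_2a_3/a_1^2$, $\upsilon=a_2^2a_3/a_1^3$, $\phi_1=-a_3/a_2$, $\phi_2=-a_2/a_1$. Then $\psi^7=\upsilon^4(\upsilon-1)$ and $\mathcal A_0(\Gamma(7))=\mathbf C(\psi,\upsilon)$. The three roots of $P_{\upsilon(\tau)}(T)$ are $g_1(\tau)=\phi_1(\tau)^2/\phi_1(2\tau)$, $g_2(\tau)=\phi_1(\tau)\phi_1(\tau/2)\phi_1(2\tau)-\phi_1(2\tau)/\phi_2(\tau)$, $g_3(\tau)=-\phi_1(\tau)\phi_1(\tau/2)\phi_1(2\tau)-\phi_1(\tau)^2\phi_2(\tau)/\phi_2(2\tau)$. *)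

theory Defs
  imports
    "HOL-Complex_Analysis.Complex_Analysis"
    "HOL-Number_Theory.Cong"
    "HOL-Library.Poly_Mapping"
    "HOL-Library.Extended_Nat"
    "HOL-Algebra.Generated_Fields"
    "HOL-Algebra.Algebraic_Closure_Type"
begin

definition uhp :: "complex set" where
  "uhp = {z. Im z > 0}"

lemma open_uhp: "open uhp"
  unfolding uhp_def by (rule open_halfspace_Im_gt)

lemma connected_uhp: "connected uhp"
  unfolding uhp_def by (intro convex_connected convex_halfspace_Im_gt)

text \<open>
  The representative of a meromorphic function is normalised to have no removable singularities,
  to be 0 at its poles (both via \<^const>\<open>nicely_meromorphic_on\<close>) and to be 0 outside the upper
  half-plane. Hence equality of elements of the type is equality as meromorphic functions on the
  upper half-plane.
\<close>

typedef mero_uhp = "{f. f nicely_meromorphic_on uhp \<and> (\<forall>z. z \<notin> uhp \<longrightarrow> f z = 0)}"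
  morphisms eval_mero Abs_mero_uhp
  by (rule exI[of _ "\<lambda>_. 0"]) auto

setup_lifting type_definition_mero_uhp

text \<open>
  The element represented by a function that is meromorphic on the upper half-plane;
  functions that are not meromorphic there are sent to 0.
\<close>

lift_definition mero_of :: "(complex \<Rightarrow> complex) \<Rightarrow> mero_uhp" is
  "\<lambda>f z. if f meromorphic_on uhp \<and> z \<in> uhp then remove_sings f z else 0"
proof (intro CollectI conjI)
  fix f :: "complex \<Rightarrow> complex"
  show "(\<lambda>z. if f meromorphic_on uhp \<and> z \<in> uhp then remove_sings f z else 0)
          nicely_meromorphic_on uhp" (is "?g nicely_meromorphic_on _")
  proof (cases "f meromorphic_on uhp")
    case True
    have ev: "eventually (\<lambda>w. ?g w = remove_sings f w) (at z)" if "z \<in> uhp" for z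
      using eventually_at_in_open'[OF open_uhp that] by eventually_elim (use True in auto)
    have nice: "remove_sings f nicely_meromorphic_on uhp"
      using True by (rule remove_sings_nicely_meromorphic)
    have "?g meromorphic_on uhp \<longleftrightarrow> remove_sings f meromorphic_on uhp"
      by (intro meromorphic_on_cong ev) auto
    moreover have "(is_pole ?g z \<and> ?g z = 0) \<or> ?g \<midarrow>z\<rightarrow> ?g z" if z: "z \<in> uhp" for z
    proof -
      have "is_pole ?g z \<longleftrightarrow> is_pole (remove_sings f) z"
        by (intro is_pole_cong ev z refl)
      moreover have "(?g \<midarrow>z\<rightarrow> c) \<longleftrightarrow> (remove_sings f \<midarrow>z\<rightarrow> c)" for c
        by (intro filterlim_cong ev z refl)
      ultimately show ?thesis
        using nice z True unfolding nicely_meromorphic_on_def by auto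
    qed
    ultimately show ?thesis
      using nice unfolding nicely_meromorphic_on_def by blast
  next
    case False
    thus ?thesis by auto
  qed
qed auto

lemma nicely_meromorphic_eval_mero: "eval_mero f nicely_meromorphic_on uhp"
  using eval_mero[of f] by simp

lemma meromorphic_eval_mero: "eval_mero f meromorphic_on uhp"
  using nicely_meromorphic_eval_mero[of f] unfolding nicely_meromorphic_on_def by blast

lemma eval_mero_outside: "z \<notin> uhp \<Longrightarrow> eval_mero f z = 0"
  using eval_mero[of f] by simp

lemma remove_sings_eval_mero:
  assumes "z \<in> uhp"
  shows   "remove_sings (eval_mero f) z = eval_mero f z"
  using nicely_meromorphic_eval_mero[of f] assms
  unfolding nicely_meromorphic_on_def by (metis remove_sings_at_pole remove_sings_eqI)

lemma mero_uhp_eqI: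
  assumes "\<And>z. z \<in> uhp \<Longrightarrow> eventually (\<lambda>w. eval_mero f w = eval_mero g w) (at z)"
  shows   "f = g"
proof -
  have "eval_mero f z = eval_mero g z" for z
  proof (cases "z \<in> uhp")
    case True
    have "remove_sings (eval_mero f) z = remove_sings (eval_mero g) z"
      by (intro remove_sings_cong assms True refl)
    thus ?thesis using True by (simp add: remove_sings_eval_mero)
  qed (simp add: eval_mero_outside)
  thus ?thesis by (metis eval_mero_inject ext)
qed

lemma eventually_eval_mero_of:
  assumes "f meromorphic_on uhp" "z \<in> uhp"
  shows   "eventually (\<lambda>w. eval_mero (mero_of f) w = f w) (at z)"
proof -
  have "isolated_singularity_at f z"
    using assms by (meson meromorphic_onE)
  from eventually_remove_sings_eq_at[OF this] eventually_at_in_open'[OF open_uhp assms(2)]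
  show ?thesis
    by eventually_elim (simp add: mero_of.rep_eq assms(1))
qed

instantiation mero_uhp :: "{zero, one, plus, minus, uminus, times, inverse}"
begin

definition zero_mero_uhp :: mero_uhp where
  "zero_mero_uhp = mero_of (\<lambda>_. 0)"
definition one_mero_uhp :: mero_uhp where
  "one_mero_uhp = mero_of (\<lambda>_. 1)"
definition plus_mero_uhp :: "mero_uhp \<Rightarrow> mero_uhp \<Rightarrow> mero_uhp" where
  "plus_mero_uhp f g = mero_of (\<lambda>z. eval_mero f z + eval_mero g z)"
definition minus_mero_uhp :: "mero_uhp \<Rightarrow> mero_uhp \<Rightarrow> mero_uhp" where
  "minus_mero_uhp f g = mero_of (\<lambda>z. eval_mero f z - eval_mero g z)"
definition uminus_mero_uhp :: "mero_uhp \<Rightarrow> mero_uhp" where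
  "uminus_mero_uhp f = mero_of (\<lambda>z. - eval_mero f z)"
definition times_mero_uhp :: "mero_uhp \<Rightarrow> mero_uhp \<Rightarrow> mero_uhp" where
  "times_mero_uhp f g = mero_of (\<lambda>z. eval_mero f z * eval_mero g z)"
definition inverse_mero_uhp :: "mero_uhp \<Rightarrow> mero_uhp" where
  "inverse_mero_uhp f = mero_of (\<lambda>z. inverse (eval_mero f z))"
definition divide_mero_uhp :: "mero_uhp \<Rightarrow> mero_uhp \<Rightarrow> mero_uhp" where
  "divide_mero_uhp f g = mero_of (\<lambda>z. eval_mero f z / eval_mero g z)"

instance ..

end

lemma eventually_eval_mero_ops:
  fixes f g :: mero_uhp
  assumes "z \<in> uhp"
  shows "eventually (\<lambda>w. eval_mero 0 w = 0) (at z)"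
        "eventually (\<lambda>w. eval_mero 1 w = 1) (at z)"
        "eventually (\<lambda>w. eval_mero (f + g) w = eval_mero f w + eval_mero g w) (at z)"
        "eventually (\<lambda>w. eval_mero (f - g) w = eval_mero f w - eval_mero g w) (at z)"
        "eventually (\<lambda>w. eval_mero (- f) w = - eval_mero f w) (at z)"
        "eventually (\<lambda>w. eval_mero (f * g) w = eval_mero f w * eval_mero g w) (at z)"
        "eventually (\<lambda>w. eval_mero (inverse f) w = inverse (eval_mero f w)) (at z)"
        "eventually (\<lambda>w. eval_mero (f / g) w = eval_mero f w / eval_mero g w) (at z)"
  unfolding zero_mero_uhp_def one_mero_uhp_def plus_mero_uhp_def minus_mero_uhp_def
    uminus_mero_uhp_def times_mero_uhp_def inverse_mero_uhp_def divide_mero_uhp_def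
  by (intro eventually_eval_mero_of meromorphic_intros meromorphic_eval_mero assms)+

lemma eventually_eval_mero_nonzero:
  assumes "f \<noteq> 0" "z \<in> uhp"
  shows   "eventually (\<lambda>w. eval_mero f w \<noteq> 0) (at z)"
proof (rule ccontr)
  assume "\<not> ?thesis"
  hence "frequently (\<lambda>w. eval_mero f w = 0) (at z)"
    by (simp add: frequently_def)
  hence *: "eval_mero f w = 0" if "w \<in> uhp" for w
    using frequently_eq_meromorphic_imp_constant[OF _ nicely_meromorphic_eval_mero open_uhp
            connected_uhp assms(2)] that by blast
  have "f = 0"
  proof (rule mero_uhp_eqI)
    fix z assume z: "z \<in> uhp"
    from eventually_at_in_open'[OF open_uhp z] eventually_eval_mero_ops(1)[OF z]
    show "eventually (\<lambda>w. eval_mero f w = eval_mero 0 w) (at z)"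
      by eventually_elim (simp add: *)
  qed
  with assms(1) show False by contradiction
qed

instance mero_uhp :: field
proof
  fix f g h :: mero_uhp
  show "f + g + h = f + (g + h)"
  proof (rule mero_uhp_eqI)
    fix z assume z: "z \<in> uhp"
    note ops = eventually_eval_mero_ops[OF z]
    from ops(3)[of "f + g" h] ops(3)[of f g] ops(3)[of f "g + h"] ops(3)[of g h]
    show "\<forall>\<^sub>F w in at z. eval_mero (f + g + h) w = eval_mero (f + (g + h)) w"
      by eventually_elim simp
  qed
  show "f + g = g + f"
    by (simp add: plus_mero_uhp_def add.commute)
  show "0 + f = f"
  proof (rule mero_uhp_eqI)
    fix z assume z: "z \<in> uhp"
    note ops = eventually_eval_mero_ops[OF z]
    from ops(3)[of 0 f] ops(1)
    show "\<forall>\<^sub>F w in at z. eval_mero (0 + f) w = eval_mero f w"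
      by eventually_elim simp
  qed
  show "- f + f = 0"
  proof (rule mero_uhp_eqI)
    fix z assume z: "z \<in> uhp"
    note ops = eventually_eval_mero_ops[OF z]
    from ops(3)[of "- f" f] ops(5)[of f] ops(1)
    show "\<forall>\<^sub>F w in at z. eval_mero (- f + f) w = eval_mero 0 w"
      by eventually_elim simp
  qed
  show "f - g = f + - g"
  proof (rule mero_uhp_eqI)
    fix z assume z: "z \<in> uhp"
    note ops = eventually_eval_mero_ops[OF z]
    from ops(4)[of f g] ops(3)[of f "- g"] ops(5)[of g]
    show "\<forall>\<^sub>F w in at z. eval_mero (f - g) w = eval_mero (f + - g) w"
      by eventually_elim simp
  qed
  show "f * g * h = f * (g * h)"
  proof (rule mero_uhp_eqI)
    fix z assume z: "z \<in> uhp"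
    note ops = eventually_eval_mero_ops[OF z]
    from ops(6)[of "f * g" h] ops(6)[of f g] ops(6)[of f "g * h"] ops(6)[of g h]
    show "\<forall>\<^sub>F w in at z. eval_mero (f * g * h) w = eval_mero (f * (g * h)) w"
      by eventually_elim simp
  qed
  show "f * g = g * f"
    by (simp add: times_mero_uhp_def mult.commute)
  show "1 * f = f"
  proof (rule mero_uhp_eqI)
    fix z assume z: "z \<in> uhp"
    note ops = eventually_eval_mero_ops[OF z]
    from ops(6)[of 1 f] ops(2)
    show "\<forall>\<^sub>F w in at z. eval_mero (1 * f) w = eval_mero f w"
      by eventually_elim simp
  qed
  show "(f + g) * h = f * h + g * h"
  proof (rule mero_uhp_eqI)
    fix z assume z: "z \<in> uhp"
    note ops = eventually_eval_mero_ops[OF z]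
    from ops(6)[of "f + g" h] ops(3)[of f g] ops(3)[of "f * h" "g * h"] ops(6)[of f h] ops(6)[of g h]
    show "\<forall>\<^sub>F w in at z. eval_mero ((f + g) * h) w = eval_mero (f * h + g * h) w"
      by eventually_elim (simp add: algebra_simps)
  qed
  show "(0 :: mero_uhp) \<noteq> 1"
  proof
    assume eq: "(0 :: mero_uhp) = 1"
    have i: "\<i> \<in> uhp" by (simp add: uhp_def)
    from eventually_eval_mero_ops(1)[OF i] eventually_eval_mero_ops(2)[OF i]
    have "\<forall>\<^sub>F w in at \<i>. False"
      by eventually_elim (simp add: eq)
    thus False by simp
  qed
  show "inverse f * f = 1" if "f \<noteq> 0"
  proof (rule mero_uhp_eqI)
    fix z assume z: "z \<in> uhp"
    note ops = eventually_eval_mero_ops[OF z]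
    from ops(6)[of "inverse f" f] ops(7)[of f] ops(2) eventually_eval_mero_nonzero[OF that z]
    show "\<forall>\<^sub>F w in at z. eval_mero (inverse f * f) w = eval_mero 1 w"
      by eventually_elim simp
  qed
  show "f / g = f * inverse g"
  proof (rule mero_uhp_eqI)
    fix z assume z: "z \<in> uhp"
    note ops = eventually_eval_mero_ops[OF z]
    from ops(8)[of f g] ops(6)[of f "inverse g"] ops(7)[of g]
    show "\<forall>\<^sub>F w in at z. eval_mero (f / g) w = eval_mero (f * inverse g) w"
      by eventually_elim (simp add: field_simps)
  qed
  show "inverse (0 :: mero_uhp) = 0"
  proof (rule mero_uhp_eqI)
    fix z assume z: "z \<in> uhp"
    note ops = eventually_eval_mero_ops[OF z]
    from ops(7)[of 0] ops(1)
    show "\<forall>\<^sub>F w in at z. eval_mero (inverse 0) w = eval_mero 0 w"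
      by eventually_elim simp
  qed
qed

definition mero_const :: "complex \<Rightarrow> mero_uhp" where
  "mero_const c = mero_of (\<lambda>_. c)"

abbreviation mero_field :: "mero_uhp ring" where
  "mero_field \<equiv> ring_of_type_algebra"

definition adjoin_C :: "mero_uhp set \<Rightarrow> mero_uhp set"  (\<open>\<complex>'(_')\<close>) where
  "adjoin_C S = generate_field mero_field (range mero_const \<union> S)"

definition SL2Z :: "(int ^ 2 ^ 2) set" where
  "SL2Z = {A. det A = 1}"

definition principal_congruence_subgroup :: "nat \<Rightarrow> (int ^ 2 ^ 2) set"  (\<open>\<Gamma>'(_')\<close>) where
  "principal_congruence_subgroup N =
     {A \<in> SL2Z. \<forall>i j. [A $ i $ j = (mat 1 :: int ^ 2 ^ 2) $ i $ j] (mod int N)}"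

definition moebius_act :: "int ^ 2 ^ 2 \<Rightarrow> complex \<Rightarrow> complex" where
  "moebius_act A z = (of_int (A $ 1 $ 1) * z + of_int (A $ 1 $ 2)) /
                 (of_int (A $ 2 $ 1) * z + of_int (A $ 2 $ 2))"

text \<open>
  A function invariant under a congruence subgroup is meromorphic at the cusp \<open>A \<infinity>\<close> iff
  \<open>f \<circ> A\<close> is, near \<open>\<i>\<infinity>\<close>, a function of \<open>exp (2\<pi>\<i>z/N)\<close> that is meromorphic at 0, where
  \<open>N\<close> is some positive integer period of \<open>f \<circ> A\<close>. Every cusp is of the form \<open>A \<infinity>\<close>
  with \<open>A\<close> in the full modular group.
\<close>

definition meromorphic_at_cusps :: "mero_uhp \<Rightarrow> bool" where
  "meromorphic_at_cusps f \<longleftrightarrow>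
     (\<forall>A\<in>SL2Z. \<exists>(N::nat)>0. \<exists>F b. F meromorphic_on {0} \<and>
        (\<forall>z\<in>uhp. Im z > b \<longrightarrow>
           eval_mero f (moebius_act A z) = F (exp (2 * of_real pi * \<i> * z / of_nat N))))"

definition modular_functions :: "(int ^ 2 ^ 2) set \<Rightarrow> mero_uhp set"  (\<open>\<A>\<^sub>0\<close>) where
  "modular_functions G =
     {f. (\<forall>A\<in>G. \<forall>z\<in>uhp. eval_mero f (moebius_act A z) = eval_mero f z) \<and> meromorphic_at_cusps f}"

definition theta_a :: "int \<Rightarrow> complex \<Rightarrow> complex" where
  "theta_a k \<tau> = (\<Sum>\<^sub>\<infinity>n::int. (-1) powi (n + k + 1) *
      exp (2 * of_real pi * \<i> * (of_int ((14 * n + 7 - 2 * k)\<^sup>2) / 56) * \<tau>))"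

definition phi1 :: "complex \<Rightarrow> complex" where
  "phi1 \<tau> = - theta_a 3 \<tau> / theta_a 2 \<tau>"

definition phi2 :: "complex \<Rightarrow> complex" where
  "phi2 \<tau> = - theta_a 2 \<tau> / theta_a 1 \<tau>"

definition psi :: mero_uhp  (\<open>\<psi>\<close>) where
  "\<psi> = mero_of (\<lambda>\<tau>. - (theta_a 2 \<tau> * theta_a 3 \<tau>) / theta_a 1 \<tau> ^ 2)"

definition upsilon :: mero_uhp  (\<open>\<upsilon>\<close>) where
  "\<upsilon> = mero_of (\<lambda>\<tau>. theta_a 2 \<tau> ^ 2 * theta_a 3 \<tau> / theta_a 1 \<tau> ^ 3)"

definition g1 :: mero_uhp where
  "g1 = mero_of (\<lambda>\<tau>. phi1 \<tau> ^ 2 / phi1 (2 * \<tau>))"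

definition g2 :: mero_uhp where
  "g2 = mero_of (\<lambda>\<tau>. phi1 \<tau> * phi1 (\<tau> / 2) * phi1 (2 * \<tau>) - phi1 (2 * \<tau>) / phi2 \<tau>)"

definition g3 :: mero_uhp where
  "g3 = mero_of (\<lambda>\<tau>. - phi1 \<tau> * phi1 (\<tau> / 2) * phi1 (2 * \<tau>)
                      - phi1 \<tau> ^ 2 * phi2 \<tau> / phi2 (2 * \<tau>))"

definition P_upsilon :: "mero_uhp poly"  (\<open>P\<^sub>\<upsilon>\<close>) where
  "P\<^sub>\<upsilon> = [: (\<upsilon> - 1)\<^sup>2 / \<upsilon>, - ((\<upsilon>\<^sup>2 - 1) / \<upsilon>), 1, 1 :]"

definition delta :: mero_uhp  (\<open>\<delta>\<close>) where
  "\<delta> = \<upsilon>\<^sup>2 / (2 * (\<upsilon> - 1)) * ((g1 - g2) * (g2 - g3) * (g3 - g1))"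

definition splitting_field_over :: "'a :: field set \<Rightarrow> 'a poly \<Rightarrow> 'a set \<Rightarrow> bool" where
  "splitting_field_over K p L \<longleftrightarrow>
     subfield K ring_of_type_algebra \<and> p \<noteq> 0 \<and> set (coeffs p) \<subseteq> K \<and>
     (\<exists>rs. set rs \<subseteq> L \<and> p = Polynomial.smult (Polynomial.lead_coeff p) (\<Prod>r\<leftarrow>rs. [:- r, 1:]) \<and>
           L = generate_field ring_of_type_algebra (K \<union> set rs))"

definition cubic_discriminant :: "'a :: comm_ring_1 poly \<Rightarrow> 'a" where
  "cubic_discriminant p =
     (let a = poly.coeff p 3; b = poly.coeff p 2; c = poly.coeff p 1; d = poly.coeff p 0
      in b\<^sup>2 * c\<^sup>2 - 4 * a * c ^ 3 - 4 * b ^ 3 * d - 27 * a\<^sup>2 * d\<^sup>2 + 18 * a * b * c * d)"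

text \<open>A polynomial maps each monomial (an exponent vector) to its coefficient.\<close>

type_synonym 'n cpoly = "('n \<Rightarrow>\<^sub>0 nat) \<Rightarrow>\<^sub>0 complex"

definition cpoly_const :: "complex \<Rightarrow> 'n cpoly" where
  "cpoly_const c = Poly_Mapping.single 0 c"

definition cpoly_var :: "'n \<Rightarrow> 'n cpoly" where
  "cpoly_var i = Poly_Mapping.single (Poly_Mapping.single i 1) 1"

definition cpoly_eval :: "'n :: finite cpoly \<Rightarrow> complex ^ 'n \<Rightarrow> complex" where
  "cpoly_eval p x = (\<Sum>m\<in>Poly_Mapping.keys p.
     Poly_Mapping.lookup p m * (\<Prod>i\<in>UNIV. (x $ i) ^ Poly_Mapping.lookup m i))"

definition zariski_closed :: "(complex ^ 'n :: finite) set \<Rightarrow> bool" where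
  "zariski_closed V \<longleftrightarrow> (\<exists>S. V = {x. \<forall>p\<in>S. cpoly_eval p x = 0})"

definition affine_variety :: "(complex ^ 'n :: finite) set \<Rightarrow> bool" where
  "affine_variety V \<longleftrightarrow> zariski_closed V \<and> V \<noteq> {} \<and>
     (\<forall>A B. zariski_closed A \<longrightarrow> zariski_closed B \<longrightarrow> V \<subseteq> A \<union> B \<longrightarrow> V \<subseteq> A \<or> V \<subseteq> B)"

definition zariski_dim :: "(complex ^ 'n :: finite) set \<Rightarrow> enat" where
  "zariski_dim V = Sup {enat n | n. \<exists>C. (\<forall>i\<le>n. affine_variety (C i) \<and> C i \<subseteq> V) \<and>
                                       (\<forall>i<n. C i \<subset> C (Suc i))}"

definition affine_curve :: "(complex ^ 'n :: finite) set \<Rightarrow> bool" where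
  "affine_curve V \<longleftrightarrow> affine_variety V \<and> zariski_dim V = 1"

definition vanishing_ideal :: "(complex ^ 'n :: finite) set \<Rightarrow> 'n cpoly set" where
  "vanishing_ideal V = {p. \<forall>x\<in>V. cpoly_eval p x = 0}"

text \<open>
  The field of fractions of the coordinate ring of \<open>V\<close>. Its elements are represented by fractions
  of polynomials whose denominator does not vanish identically on \<open>V\<close>, two fractions being
  identified iff cross-multiplication yields an equality on \<open>V\<close>.
\<close>

definition ratfun_rel ::
    "(complex ^ 'n :: finite) set \<Rightarrow> (('n cpoly \<times> 'n cpoly) \<times> ('n cpoly \<times> 'n cpoly)) set" where
  "ratfun_rel V = {((p, q), (p', q')). q \<notin> vanishing_ideal V \<and> q' \<notin> vanishing_ideal V \<and>
                                       p * q' - p' * q \<in> vanishing_ideal V}"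

definition ratfun ::
    "(complex ^ 'n :: finite) set \<Rightarrow> 'n cpoly \<Rightarrow> 'n cpoly \<Rightarrow> ('n cpoly \<times> 'n cpoly) set" where
  "ratfun V p q = ratfun_rel V `` {(p, q)}"

definition function_field ::
    "(complex ^ 'n :: finite) set \<Rightarrow> ('n cpoly \<times> 'n cpoly) set ring" where
  "function_field V =
     \<lparr> carrier = (UNIV \<times> (- vanishing_ideal V)) // ratfun_rel V,
       mult = (\<lambda>A B. \<Union>(p, q)\<in>A. \<Union>(p', q')\<in>B. ratfun V (p * p') (q * q')),
       one = ratfun V 1 1,
       zero = ratfun V 0 1,
       add = (\<lambda>A B. \<Union>(p, q)\<in>A. \<Union>(p', q')\<in>B. ratfun V (p * q' + p' * q) (q * q')) \<rparr>"

text \<open>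
  \<open>V\<close> is an affine model of the curve with function field \<open>K\<close>, the coordinate functions on \<open>V\<close>
  corresponding to the given elements \<open>x\<close> of \<open>K\<close>.
\<close>

definition affine_model ::
    "mero_uhp set \<Rightarrow> (complex ^ 'n :: finite) set \<Rightarrow> mero_uhp ^ 'n \<Rightarrow> bool" where
  "affine_model K V x \<longleftrightarrow> affine_curve V \<and>
     (\<exists>h \<in> ring_iso (function_field V) (mero_field\<lparr>carrier := K\<rparr>).
        (\<forall>c. h (ratfun V (cpoly_const c) 1) = mero_const c) \<and>
        (\<forall>i. h (ratfun V (cpoly_var i) 1) = x $ i))"

definition X14_model :: "(complex ^ 4) set" where
  "X14_model = {p. let x = p $ 1; y = p $ 2; z = p $ 3; w = p $ 4 in
     y ^ 7 = x ^ 4 * (x - 1) \<and>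
     x * z ^ 3 + x * z\<^sup>2 - (x\<^sup>2 - 1) * z + (x - 1)\<^sup>2 = 0 \<and>
     w\<^sup>2 = x * (x - 1) * (x ^ 3 - 8 * x\<^sup>2 + 5 * x + 1)}"

end

theory Submission
  imports Defs
begin

text \<open>
  Up to constants, \<open>a\<^sub>k(\<tau>)\<close> is the Klein form of characteristic \<open>(k/7, 0)\<close> at \<open>7\<tau>\<close>. The transformation law
  of Klein forms shows that \<open>\<upsilon>\<close> is invariant under \<open>\<Gamma>\<^sub>1(7)\<close>, that \<open>\<psi>\<close> is multiplied by 7th roots of unity,
  and that the only pole of \<open>\<upsilon>\<close> is a simple one at the cusp \<open>\<infinity>\<close>. By Liouville's theorem the modular
  functions for \<open>\<Gamma>\<^sub>1(7)\<close> are therefore the rational functions of \<open>\<upsilon>\<close>, and Lagrange interpolation over the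
  conjugates of a primitive element reduces the fields of levels 7 and 14 to the computation of stabilisers.

  Riemann's theta relations give the cubic equation of \<open>g1\<close> over \<open>\<complex>(\<upsilon>)\<close>. The function \<open>g1\<close> is fixed by the
  matrices in \<open>\<Gamma>\<^sub>1(7)\<close> with even lower left entry, and \<open>\<Gamma>\<^sub>1(7)\<close> permutes its three conjugates
  \<open>g1, g2, g3\<close> as it permutes the nonzero vectors of \<open>(\<int>/2\<int>)\<^sup>2\<close>; hence only \<open>\<Gamma>(14)\<close> fixes \<open>\<psi>\<close>, \<open>g1\<close> and \<open>g2\<close>.

  For the affine model, a polynomial vanishes on the curve iff it vanishes at \<open>(\<upsilon>, \<psi>, g1, \<delta>)\<close>: the values
  of \<open>\<upsilon>\<close> are dense in the plane, \<open>\<Gamma>\<^sub>1(7)\<close> acts transitively on the points of the curve above each value,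
  and roots depend continuously on coefficients. So the vanishing ideal is prime and its fraction field
  is generated by the four functions. Proper closed subsets are finite because norms to \<open>\<complex>(\<upsilon>)\<close>
  of nonzero functions are nonzero.
\<close>

no_notation fps_nth (infixl \<open>$\<close> 75)

section \<open>The modular group\<close>

definition mat2 :: "int \<Rightarrow> int \<Rightarrow> int \<Rightarrow> int \<Rightarrow> int ^ 2 ^ 2" where
  "mat2 a b c d = vector [vector [a, b], vector [c, d]]"

lemma mat2_entries [simp]:
  "mat2 a b c d $ 1 $ 1 = a" "mat2 a b c d $ 1 $ 2 = b" "mat2 a b c d $ 2 $ 1 = c" "mat2 a b c d $ 2 $ 2 = d"
  by (simp_all add: mat2_def vector_2)

lemma mat2_eqI:
  fixes A B :: "int ^ 2 ^ 2"
  assumes "A $ 1 $ 1 = B $ 1 $ 1" "A $ 1 $ 2 = B $ 1 $ 2" "A $ 2 $ 1 = B $ 2 $ 1" "A $ 2 $ 2 = B $ 2 $ 2"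
  shows "A = B"
  using assms by (simp add: vec_eq_iff forall_2)

lemma mat1_entries [simp]:
  "(mat 1 :: int ^ 2 ^ 2) $ 1 $ 1 = 1" "(mat 1 :: int ^ 2 ^ 2) $ 1 $ 2 = 0"
  "(mat 1 :: int ^ 2 ^ 2) $ 2 $ 1 = 0" "(mat 1 :: int ^ 2 ^ 2) $ 2 $ 2 = 1"
  by (simp_all add: mat_def)

lemma matmul_entry: "((A :: int ^ 2 ^ 2) ** B) $ i $ j = A $ i $ 1 * B $ 1 $ j + A $ i $ 2 * B $ 2 $ j"
  by (simp add: matrix_matrix_mult_def sum_2)

lemma SL2Z_iff: "A \<in> SL2Z \<longleftrightarrow> A $ 1 $ 1 * A $ 2 $ 2 - A $ 1 $ 2 * A $ 2 $ 1 = 1"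
  by (simp add: SL2Z_def det_2)

lemma SL2Z_uminus: "A \<in> SL2Z \<Longrightarrow> - A \<in> SL2Z"
  by (simp add: SL2Z_iff)

definition mat2_inv :: "int ^ 2 ^ 2 \<Rightarrow> int ^ 2 ^ 2" where
  "mat2_inv A = mat2 (A $ 2 $ 2) (- A $ 1 $ 2) (- A $ 2 $ 1) (A $ 1 $ 1)"

lemma mat2_inv_entries [simp]:
  "mat2_inv A $ 1 $ 1 = A $ 2 $ 2" "mat2_inv A $ 1 $ 2 = - A $ 1 $ 2"
  "mat2_inv A $ 2 $ 1 = - A $ 2 $ 1" "mat2_inv A $ 2 $ 2 = A $ 1 $ 1"
  by (simp_all add: mat2_inv_def)

lemma SL2Z_mult: "A \<in> SL2Z \<Longrightarrow> B \<in> SL2Z \<Longrightarrow> A ** B \<in> SL2Z"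
  by (simp add: SL2Z_def det_mul)

lemma SL2Z_one [simp]: "mat 1 \<in> SL2Z" by (simp add: SL2Z_iff)

lemma SL2Z_mat2_inv: "A \<in> SL2Z \<Longrightarrow> mat2_inv A \<in> SL2Z"
  by (simp add: SL2Z_iff algebra_simps)

lemma mat2_inv_right: "A \<in> SL2Z \<Longrightarrow> A ** mat2_inv A = mat 1"
  and mat2_inv_left: "A \<in> SL2Z \<Longrightarrow> mat2_inv A ** A = mat 1"
  by (intro mat2_eqI; simp add: matmul_entry SL2Z_iff algebra_simps)+

lemma mult_mat2_inv_cancel: "B \<in> SL2Z \<Longrightarrow> (A ** mat2_inv B) ** B = A"
  by (simp add: matrix_mul_assoc[symmetric] mat2_inv_left)

lemma upper_triangular_decomposition:
  fixes M :: "int ^ 2 ^ 2"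
  assumes "det M > 0"
  obtains B r and p m :: nat where "B \<in> SL2Z" "p > 0" "m > 0" "M = B ** mat2 (int p) r 0 (int m)"
proof -
  define g where "g = gcd (M $ 1 $ 1) (M $ 2 $ 1)"
  have det: "M $ 1 $ 1 * M $ 2 $ 2 - M $ 1 $ 2 * M $ 2 $ 1 > 0" using assms by (simp add: det_2)
  hence g_pos: "g > 0" by (auto simp: g_def)
  obtain a c where ac: "M $ 1 $ 1 = g * a" "M $ 2 $ 1 = g * c" by (metis g_def gcd_dvd1 gcd_dvd2 dvdE)
  obtain u v where "u * M $ 1 $ 1 + v * M $ 2 $ 1 = g" using bezout_int unfolding g_def by metis
  hence "g * (u * a + v * c) = g * 1" by (simp add: ac algebra_simps)
  hence bezout: "u * a + v * c = 1" using g_pos by simp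
  define B where "B = mat2 a (- v) c u"
  define r m where "r = u * M $ 1 $ 2 + v * M $ 2 $ 2" and "m = a * M $ 2 $ 2 - c * M $ 1 $ 2"
  have "g * m > 0" using det by (simp add: m_def ac algebra_simps)
  hence m_pos: "m > 0" using g_pos by (simp add: zero_less_mult_iff)
  have B: "B \<in> SL2Z" using bezout by (simp add: B_def SL2Z_iff algebra_simps)
  have "a * r - v * m = (u * a + v * c) * M $ 1 $ 2" "c * r + u * m = (u * a + v * c) * M $ 2 $ 2"
    by (simp_all add: r_def m_def algebra_simps)
  hence "M = B ** mat2 g r 0 m"
    unfolding bezout by (intro mat2_eqI) (simp_all add: matmul_entry B_def ac)
  thus ?thesis using that[of B "nat g" "nat m" r] B g_pos m_pos by simp
qed

abbreviation moebius_denom :: "int ^ 2 ^ 2 \<Rightarrow> complex \<Rightarrow> complex" where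
  "moebius_denom A z \<equiv> of_int (A $ 2 $ 1) * z + of_int (A $ 2 $ 2)"

lemma Im_moebius:
  "Im (moebius_act A z) = of_int (det A) * Im z / (norm (moebius_denom A z))\<^sup>2"
proof -
  have "Im ((of_int (A $ 1 $ 1) * z + of_int (A $ 1 $ 2)) * cnj (moebius_denom A z)) = of_int (det A) * Im z"
    by (simp add: det_2 algebra_simps)
  thus ?thesis
    unfolding moebius_act_def by (subst complex_div_cnj) (simp add: Im_divide_of_real flip: of_real_power)
qed

lemma moebius_denom_nonzero:
  assumes "A \<in> SL2Z" "z \<in> uhp"
  shows "moebius_denom A z \<noteq> 0"
proof
  assume zero: "moebius_denom A z = 0"
  hence "Im (moebius_denom A z) = 0" by simp
  hence "A $ 2 $ 1 = 0" using assms(2) by (simp add: uhp_def)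
  thus False using zero assms(1) by (simp add: SL2Z_iff)
qed

lemma moebius_in_uhp:
  assumes "A \<in> SL2Z" "z \<in> uhp"
  shows "moebius_act A z \<in> uhp"
  using assms moebius_denom_nonzero[OF assms] by (simp add: uhp_def Im_moebius SL2Z_def)

lemma moebius_mult:
  assumes "moebius_denom B z \<noteq> 0"
  shows "moebius_act (A ** B) z = moebius_act A (moebius_act B z)"
proof -
  have "of_int (A $ i $ 1) * moebius_act B z + of_int (A $ i $ 2) =
      (of_int ((A ** B) $ i $ 1) * z + of_int ((A ** B) $ i $ 2)) / moebius_denom B z" for i
    using assms by (simp add: moebius_act_def matmul_entry eq_divide_eq distrib_right) (simp add: algebra_simps)
  thus ?thesis using assms unfolding moebius_act_def[of A] moebius_act_def[of "A ** B"] by simp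
qed

lemmas moebius_mult_SL2Z = moebius_mult[OF moebius_denom_nonzero]

lemma moebius_one [simp]: "moebius_act (mat 1) z = z"
  by (simp add: moebius_act_def)

lemma moebius_uminus [simp]: "moebius_act (- A) z = moebius_act A z"
proof -
  have "moebius_act (- A) z =
      (- (of_int (A $ 1 $ 1) * z + of_int (A $ 1 $ 2))) / (- (of_int (A $ 2 $ 1) * z + of_int (A $ 2 $ 2)))"
    by (simp add: moebius_act_def)
  thus ?thesis by (simp only: moebius_act_def divide_minus_left divide_minus_right minus_minus)
qed

lemma moebius_inv:
  assumes "A \<in> SL2Z" "z \<in> uhp"
  shows "moebius_act (mat2_inv A) (moebius_act A z) = z" "moebius_act A (moebius_act (mat2_inv A) z) = z"
  using moebius_mult_SL2Z[OF assms, of "mat2_inv A"]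
    moebius_mult_SL2Z[OF SL2Z_mat2_inv[OF assms(1)] assms(2), of A]
  by (simp_all add: mat2_inv_left[OF assms(1)] mat2_inv_right[OF assms(1)])

lemma moebius_inj: "A \<in> SL2Z \<Longrightarrow> inj_on (moebius_act A) uhp"
  by (rule inj_on_inverseI[of _ "moebius_act (mat2_inv A)"]) (rule moebius_inv)

lemma moebius_analytic: "A \<in> SL2Z \<Longrightarrow> moebius_act A analytic_on uhp"
  unfolding moebius_act_def by (intro analytic_intros) (use moebius_denom_nonzero in auto)

lemma moebius_filterlim:
  assumes "A \<in> SL2Z" "z \<in> uhp"
  shows "filterlim (moebius_act A) (at (moebius_act A z)) (at z)"
proof -
  have "isCont (moebius_act A) z"
    using moebius_analytic[OF assms(1)] assms(2) by (meson analytic_at_imp_isCont analytic_on_analytic_at)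
  moreover have "eventually (\<lambda>w. moebius_act A w \<noteq> moebius_act A z) (at z)"
    using eventually_at_in_open[OF open_uhp assms(2)]
    by eventually_elim (use moebius_inj[OF assms(1)] assms(2) in \<open>auto simp: inj_on_def\<close>)
  ultimately show ?thesis by (simp add: filterlim_at isCont_def)
qed

section \<open>Congruence subgroups and a fundamental strip\<close>

definition mat_cong :: "nat \<Rightarrow> int ^ 2 ^ 2 \<Rightarrow> int ^ 2 ^ 2 \<Rightarrow> bool" where
  "mat_cong N A B \<longleftrightarrow> (\<forall>i j. [A $ i $ j = B $ i $ j] (mod int N))"

lemma mat_cong_mult: "mat_cong N A A' \<Longrightarrow> mat_cong N B B' \<Longrightarrow> mat_cong N (A ** B) (A' ** B')"
  unfolding mat_cong_def matmul_entry by (auto intro!: cong_add cong_mult)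

lemma mat_cong_refl [simp]: "mat_cong N A A" by (simp add: mat_cong_def)

lemma mat_cong_sym: "mat_cong N A B \<Longrightarrow> mat_cong N B A" by (simp add: mat_cong_def cong_sym)

lemma mat_cong_trans: "mat_cong N A B \<Longrightarrow> mat_cong N B C \<Longrightarrow> mat_cong N A C"
  unfolding mat_cong_def by (meson cong_trans)

lemma Gamma_iff: "A \<in> \<Gamma>(N) \<longleftrightarrow> A \<in> SL2Z \<and> mat_cong N A (mat 1)"
  by (simp add: principal_congruence_subgroup_def mat_cong_def)

lemma Gamma_subset: "\<Gamma>(N) \<subseteq> SL2Z" by (auto simp: Gamma_iff)

lemma mat_cong_imp_Gamma:
  assumes "A \<in> SL2Z" "B \<in> SL2Z" "mat_cong N A B"
  shows "A ** mat2_inv B \<in> \<Gamma>(N)"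
  using mat_cong_mult[OF assms(3) mat_cong_refl[of N "mat2_inv B"]] assms
  by (auto simp: Gamma_iff SL2Z_mult SL2Z_mat2_inv mat2_inv_right)

lemma Gamma_entries:
  "A \<in> \<Gamma>(N) \<longleftrightarrow> A \<in> SL2Z \<and> int N dvd A $ 1 $ 1 - 1 \<and> int N dvd A $ 1 $ 2 \<and>
      int N dvd A $ 2 $ 1 \<and> int N dvd A $ 2 $ 2 - 1"
  unfolding Gamma_iff mat_cong_def forall_2 cong_iff_dvd_diff mat1_entries by simp

definition transversal :: "nat \<Rightarrow> (int ^ 2 ^ 2) set \<Rightarrow> (int ^ 2 ^ 2) set \<Rightarrow> bool" where
  "transversal N G R \<longleftrightarrow> finite R \<and> R \<subseteq> G \<and> (\<forall>A\<in>G. \<exists>!B. B \<in> R \<and> mat_cong N A B)"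

lemma exists_transversal:
  assumes "N > 0"
  obtains R where "transversal N G R"
proof -
  define residues where "residues = {0..<int N}"
  define red where
    "red A = mat2 (A $ 1 $ 1 mod int N) (A $ 1 $ 2 mod int N) (A $ 2 $ 1 mod int N) (A $ 2 $ 2 mod int N)"
    for A :: "int ^ 2 ^ 2"
  have red: "mat_cong N A B \<longleftrightarrow> red A = red B" for A B
    unfolding mat_cong_def forall_2 cong_def red_def by (metis (no_types) mat2_entries)
  have "red ` G \<subseteq> (\<lambda>(a, b, c, d). mat2 a b c d) ` (residues \<times> residues \<times> residues \<times> residues)"
    using assms by (auto simp: residues_def red_def image_iff intro!: bexI)
  hence fin: "finite (red ` G)" by (rule finite_subset) (simp add: residues_def)
  define s where "s r = (SOME A. A \<in> G \<and> red A = r)" for r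
  have s: "s r \<in> G \<and> red (s r) = r" if "r \<in> red ` G" for r
    unfolding s_def by (rule someI_ex) (use that in auto)
  have "\<exists>!B. B \<in> s ` red ` G \<and> mat_cong N A B" if "A \<in> G" for A
    unfolding red using that by (intro ex1I[of _ "s (red A)"]) (use s in auto)
  hence "transversal N G (s ` red ` G)" unfolding transversal_def using fin s by auto
  thus ?thesis by (rule that)
qed

definition Gamma1 :: "nat \<Rightarrow> (int ^ 2 ^ 2) set"  (\<open>\<Gamma>\<^sub>1'(_')\<close>) where
  "\<Gamma>\<^sub>1(N) = {A \<in> SL2Z. int N dvd A $ 1 $ 1 - 1 \<and> int N dvd A $ 2 $ 1}"

lemma Gamma1D:
  assumes "A \<in> \<Gamma>\<^sub>1(N)"
  shows "A \<in> SL2Z" "int N dvd A $ 1 $ 1 - 1" "int N dvd A $ 2 $ 1" "int N dvd A $ 2 $ 2 - 1"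
proof -
  show A: "A \<in> SL2Z" "int N dvd A $ 1 $ 1 - 1" "int N dvd A $ 2 $ 1" using assms by (auto simp: Gamma1_def)
  have "A $ 2 $ 2 - 1 = A $ 1 $ 2 * A $ 2 $ 1 - (A $ 1 $ 1 - 1) * A $ 2 $ 2"
    using A(1) by (simp add: SL2Z_iff algebra_simps)
  thus "int N dvd A $ 2 $ 2 - 1" using A(2,3) by simp
qed

lemma Gamma1_subset: "\<Gamma>\<^sub>1(N) \<subseteq> SL2Z"
  using Gamma1D(1) by blast

lemma Gamma1_mult:
  assumes A: "A \<in> \<Gamma>\<^sub>1(N)" and B: "B \<in> \<Gamma>\<^sub>1(N)"
  shows "A ** B \<in> \<Gamma>\<^sub>1(N)"
proof -
  note a = Gamma1D[OF A] and b = Gamma1D[OF B]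
  have "(A ** B) $ 1 $ 1 - 1 = (A $ 1 $ 1 - 1) * B $ 1 $ 1 + (B $ 1 $ 1 - 1) + A $ 1 $ 2 * B $ 2 $ 1"
    by (simp add: matmul_entry algebra_simps)
  also have "int N dvd \<dots>" using a b by (intro dvd_add dvd_mult dvd_mult2)
  finally show ?thesis using a b by (simp add: Gamma1_def SL2Z_mult matmul_entry)
qed

lemma Gamma1_mat2_inv:
  assumes "A \<in> \<Gamma>\<^sub>1(N)"
  shows "mat2_inv A \<in> \<Gamma>\<^sub>1(N)"
  using Gamma1D(3,4)[OF assms] SL2Z_mat2_inv[OF Gamma1D(1)[OF assms]] by (simp add: Gamma1_def)

lemma Gamma_iff_Gamma1: "A \<in> \<Gamma>(N) \<longleftrightarrow> A \<in> \<Gamma>\<^sub>1(N) \<and> int N dvd A $ 1 $ 2"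
proof
  assume A: "A \<in> \<Gamma>\<^sub>1(N) \<and> int N dvd A $ 1 $ 2"
  thus "A \<in> \<Gamma>(N)" using Gamma1D[OF conjunct1[OF A]] by (simp add: Gamma_entries)
qed (simp add: Gamma_entries Gamma1_def)

lemma Gamma_subset_Gamma1: "\<Gamma>(N) \<subseteq> \<Gamma>\<^sub>1(N)"
  by (simp add: subset_iff Gamma_iff_Gamma1)

lemma Gamma_antimono:
  assumes "M dvd N"
  shows "\<Gamma>(N) \<subseteq> \<Gamma>(M)"
proof -
  have "int M dvd x" if "int N dvd x" for x using assms that by (meson dvd_trans int_dvd_int_iff)
  thus ?thesis by (simp add: subset_iff Gamma_entries)
qed

definition fund_strip :: "complex set" where
  "fund_strip = {z. \<bar>Re z\<bar> \<le> 1/2 \<and> Im z \<ge> 1/2}"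

lemma fund_strip_subset: "fund_strip \<subseteq> uhp"
  by (auto simp: fund_strip_def uhp_def)

lemma compact_fund_strip_below: "compact (fund_strip \<inter> {z. Im z \<le> b})"
proof -
  have "fund_strip \<inter> {z. Im z \<le> b} = cbox (Complex (- 1/2) (1/2)) (Complex (1/2) b)"
    by (auto simp: fund_strip_def in_cbox_complex_iff)
  thus ?thesis by simp
qed

lemma norm_lattice_ge:
  "norm (of_int c * z + of_int d) \<ge> \<bar>of_int c\<bar> * \<bar>Im z\<bar>"
  "norm (of_int c * z + of_int d) \<ge> \<bar>of_int d\<bar> - \<bar>of_int c\<bar> * norm z" for c d :: int
proof -
  have "\<bar>Im (of_int c * z + of_int d)\<bar> \<le> norm (of_int c * z + of_int d)" by (rule abs_Im_le_cmod)
  thus "norm (of_int c * z + of_int d) \<ge> \<bar>of_int c\<bar> * \<bar>Im z\<bar>" by (simp add: abs_mult)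
  have "norm (of_int d :: complex) \<le> norm (of_int c * z + of_int d) + norm (of_int c * z)"
    using norm_triangle_ineq4[of "of_int c * z + of_int d" "of_int c * z"] by simp
  thus "norm (of_int c * z + of_int d) \<ge> \<bar>of_int d\<bar> - \<bar>of_int c\<bar> * norm z" by (simp add: norm_mult)
qed

lemma finite_lattice_points_norm_le:
  assumes "z \<in> uhp"
  shows "finite {(c::int, d::int). norm (of_int c * z + of_int d) \<le> b}"
proof (rule finite_subset)
  define cmax where "cmax = \<lceil>b / Im z\<rceil>"
  define dmax where "dmax = \<lceil>b + of_int cmax * norm z\<rceil>"
  have Im_z: "Im z > 0" using assms by (simp add: uhp_def)
  have "\<bar>c\<bar> \<le> cmax \<and> \<bar>d\<bar> \<le> dmax" if le: "norm (of_int c * z + of_int d) \<le> b" for c d :: int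
  proof
    have "\<bar>of_int c\<bar> * Im z \<le> b" using norm_lattice_ge(1)[of c z d] le Im_z by simp
    hence "\<bar>real_of_int c\<bar> \<le> b / Im z" using Im_z by (simp add: field_simps)
    thus c: "\<bar>c\<bar> \<le> cmax" unfolding cmax_def by linarith
    have "\<bar>of_int d\<bar> \<le> b + \<bar>of_int c\<bar> * norm z" using norm_lattice_ge(2)[of d c z] le by simp
    also have "\<dots> \<le> b + of_int cmax * norm z" using c by (intro add_left_mono mult_right_mono) auto
    finally show "\<bar>d\<bar> \<le> dmax" unfolding dmax_def by linarith
  qed
  thus "{(c, d). norm (of_int c * z + of_int d) \<le> b} \<subseteq> {-cmax..cmax} \<times> {-dmax..dmax}" by fastforce
qed simp

lemma exists_minimal_moebius_denom:
  assumes "z \<in> uhp"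
  obtains A where "A \<in> SL2Z" "\<And>B. B \<in> SL2Z \<Longrightarrow> norm (moebius_denom A z) \<le> norm (moebius_denom B z)"
proof -
  define rows where "rows = (\<lambda>A. (A $ 2 $ 1, A $ 2 $ 2)) ` {A \<in> SL2Z. norm (moebius_denom A z) \<le> 1}"
  define size where "size = (\<lambda>(c::int, d::int). norm (of_int c * z + of_int d))"
  have "rows \<subseteq> {(c, d). norm (of_int c * z + of_int d) \<le> 1}" by (auto simp: rows_def)
  hence fin: "finite rows" using finite_lattice_points_norm_le[OF assms] finite_subset by blast
  have one: "(0, 1) \<in> rows" unfolding rows_def by (rule image_eqI[of _ _ "mat 1"]) auto
  obtain row where row: "row \<in> rows" "\<And>row'. row' \<in> rows \<Longrightarrow> size row \<le> size row'"
    using arg_min_if_finite[OF fin, of size] one by (metis empty_iff linorder_not_le)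
  obtain A where A: "A \<in> SL2Z" "row = (A $ 2 $ 1, A $ 2 $ 2)" using row(1) by (auto simp: rows_def)
  have "norm (moebius_denom A z) \<le> norm (moebius_denom B z)" if "B \<in> SL2Z" for B
  proof (cases "norm (moebius_denom B z) \<le> 1")
    case True
    thus ?thesis using row(2)[of "(B $ 2 $ 1, B $ 2 $ 2)"] that by (auto simp: rows_def size_def A(2))
  qed (use row(2)[OF one] in \<open>simp add: size_def A(2)\<close>)
  thus ?thesis using that A(1) by blast
qed

lemma exists_fund_strip_rep:
  assumes "z \<in> uhp"
  obtains A where "A \<in> SL2Z" "moebius_act A z \<in> fund_strip"
proof -
  obtain A where A: "A \<in> SL2Z" and min: "\<And>B. B \<in> SL2Z \<Longrightarrow> norm (moebius_denom A z) \<le> norm (moebius_denom B z)"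
    using exists_minimal_moebius_denom[OF assms] by blast
  define k where "k = - round (Re (moebius_act A z))"
  define A' where "A' = mat2 1 k 0 1 ** A"
  have A': "A' \<in> SL2Z" using A by (simp add: A'_def SL2Z_mult SL2Z_iff[of "mat2 1 k 0 1"])
  define w where "w = moebius_act A' z"
  have w: "w = moebius_act A z + of_int k"
    unfolding w_def A'_def moebius_mult_SL2Z[OF A assms] by (simp add: moebius_act_def[of "mat2 1 k 0 1"])
  have Re_w: "\<bar>Re w\<bar> \<le> 1/2"
    using of_int_round_abs_le[of "Re (moebius_act A z)"] by (simp add: w k_def abs_minus_commute)
  have Im_w: "Im w > 0" using moebius_in_uhp[OF A' assms] by (simp add: w_def uhp_def)
  have denom: "moebius_denom A' z = moebius_denom A z" "moebius_denom A z \<noteq> 0"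
    using moebius_denom_nonzero[OF A assms] by (simp_all add: A'_def matmul_entry)
  have "moebius_denom (mat2 0 (- 1) 1 0 ** A') z = w * moebius_denom A' z"
    using denom by (simp add: w_def moebius_act_def matmul_entry)
  moreover have "mat2 0 (- 1) 1 0 ** A' \<in> SL2Z"
    using A' by (simp add: SL2Z_mult SL2Z_iff[of "mat2 0 (- 1) 1 0"])
  ultimately have "norm (moebius_denom A z) \<le> norm w * norm (moebius_denom A z)"
    using min[of "mat2 0 (- 1) 1 0 ** A'"] denom(1) by (simp add: norm_mult)
  hence "norm w \<ge> 1" using denom(2) by simp
  hence "1 \<le> (Re w)\<^sup>2 + (Im w)\<^sup>2" unfolding cmod_power2[symmetric] by (simp add: one_le_power)
  moreover have "(Re w)\<^sup>2 \<le> (1/2)\<^sup>2" using Re_w abs_le_square_iff[of "Re w" "1/2"] by simp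
  ultimately have "(1/2)\<^sup>2 \<le> (Im w)\<^sup>2" by (simp add: power2_eq_square)
  hence "1/2 \<le> Im w" using Im_w abs_le_square_iff[of "1/2" "Im w"] by simp
  thus ?thesis using that[OF A'] Re_w by (simp add: fund_strip_def w_def)
qed

lemma fund_strip_rep_mod:
  assumes R: "transversal N SL2Z R" and "z \<in> uhp"
  obtains A A' w where "A \<in> R" "A' \<in> SL2Z" "mat_cong N A' A" "w \<in> fund_strip" "z = moebius_act A' w"
proof -
  obtain B where B: "B \<in> SL2Z" "moebius_act B z \<in> fund_strip" using exists_fund_strip_rep[OF assms(2)] .
  obtain A where "A \<in> R" "mat_cong N (mat2_inv B) A"
    using R SL2Z_mat2_inv[OF B(1)] unfolding transversal_def by blast
  thus ?thesis
    using that[of A "mat2_inv B" "moebius_act B z"] B SL2Z_mat2_inv moebius_inv(1)[OF B(1) assms(2)] by simp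
qed

section \<open>Meromorphy at a point and at the cusp \<open>\<i>\<infinity>\<close>\<close>

lemma meromorphic_Bfun_imp_tendsto:
  assumes "F meromorphic_on {w}" "Bfun F (at w)"
  obtains L where "F \<midarrow>w\<rightarrow> L"
proof -
  have "\<not> is_pole F w"
  proof
    assume pole: "is_pole F w"
    obtain B where "eventually (\<lambda>z. norm (F z) \<le> B) (at w)" using assms(2) unfolding Bfun_def by blast
    moreover have "eventually (\<lambda>z. norm (F z) \<ge> B + 1) (at w)"
      using pole unfolding is_pole_def filterlim_at_infinity_conv_norm_at_top filterlim_at_top by auto
    ultimately have "eventually (\<lambda>_. False) (at w)" by eventually_elim auto
    thus False by simp
  qed
  moreover have "not_essential F w" using assms(1) by (meson insertI1 meromorphic_onE)
  ultimately show ?thesis using that unfolding not_essential_def by blast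
qed

lemma meromorphic_tendsto_0_imp_divide:
  assumes "G meromorphic_on {w}" "G \<midarrow>w\<rightarrow> 0"
  obtains d where "(\<lambda>z. G z / (z - w)) \<midarrow>w\<rightarrow> d"
proof -
  have iso: "isolated_singularity_at G w" using assms(1) by (meson insertI1 meromorphic_onE)
  hence "remove_sings G analytic_on {w}" using assms(2) by (rule remove_sings_analytic_at)
  then obtain d where "(remove_sings G has_field_derivative d) (at w)"
    using analytic_on_imp_differentiable_at unfolding field_differentiable_def by blast
  hence "(\<lambda>z. remove_sings G z / (z - w)) \<midarrow>w\<rightarrow> d"
    unfolding has_field_derivative_iff using assms(2) by (simp add: remove_sings_eqI)
  moreover have "eventually (\<lambda>z. remove_sings G z / (z - w) = G z / (z - w)) (at w)"
    using eventually_remove_sings_eq_at[OF iso] by eventually_elim simp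
  ultimately have "(\<lambda>z. G z / (z - w)) \<midarrow>w\<rightarrow> d"
    by (rule Lim_transform_eventually)
  thus ?thesis by (rule that)
qed

lemma meromorphic_order_bound:
  assumes "F meromorphic_on {w}"
  obtains k l where "(\<lambda>z. (z - w) ^ k * F z) \<midarrow>w\<rightarrow> l"
proof (cases "is_pole F w")
  case False
  have "not_essential F w" using assms by (meson insertI1 meromorphic_onE)
  then obtain l where "F \<midarrow>w\<rightarrow> l" using False unfolding not_essential_def by blast
  thus ?thesis using that[of 0 l] by simp
next
  case True
  have "isolated_singularity_at F w" using assms by (meson insertI1 meromorphic_onE)
  then obtain r where r: "r > 0" "F analytic_on ball w r - {w}" unfolding isolated_singularity_at_def by blast
  define k where "k = nat (- zorder F w)"
  obtain s where s: "s > 0" "zor_poly F w holomorphic_on cball w s"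
    "\<And>z. z \<in> cball w s - {w} \<Longrightarrow> F z = zor_poly F w z / (z - w) ^ k"
    using zorder_exist_pole[OF analytic_imp_holomorphic[OF r(2)] open_ball _ True] r(1) unfolding k_def by auto
  have "isCont (zor_poly F w) w"
    using s(1,2) by (metis ball_subset_cball centre_in_ball continuous_on_eq_continuous_at
        holomorphic_on_imp_continuous_on holomorphic_on_subset open_ball)
  hence "zor_poly F w \<midarrow>w\<rightarrow> zor_poly F w w" by (simp add: isCont_def)
  moreover have "eventually (\<lambda>z. z \<in> ball w s - {w}) (at w)"
    using eventually_at_in_open[OF open_ball, of w w s] s(1) by simp
  hence "eventually (\<lambda>z. zor_poly F w z = (z - w) ^ k * F z) (at w)"
    by eventually_elim (simp add: s(3))
  ultimately have "(\<lambda>z. (z - w) ^ k * F z) \<midarrow>w\<rightarrow> zor_poly F w w"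
    by (rule Lim_transform_eventually)
  thus ?thesis by (rule that)
qed

lemma meromorphic_zero_clears_pole:
  assumes F: "F meromorphic_on {w}" and U: "U meromorphic_on {w}" "U \<midarrow>w\<rightarrow> L"
  obtains k l where "(\<lambda>z. (U z - L) ^ k * F z) \<midarrow>w\<rightarrow> l"
proof -
  obtain k l where kl: "(\<lambda>z. (z - w) ^ k * F z) \<midarrow>w\<rightarrow> l" using meromorphic_order_bound[OF F] .
  have "(\<lambda>z. U z - L) meromorphic_on {w}" "(\<lambda>z. U z - L) \<midarrow>w\<rightarrow> 0"
    using U by (auto intro!: meromorphic_intros LIM_zero)
  then obtain d where d: "(\<lambda>z. (U z - L) / (z - w)) \<midarrow>w\<rightarrow> d" by (rule meromorphic_tendsto_0_imp_divide)
  have "(\<lambda>z. ((U z - L) / (z - w)) ^ k * ((z - w) ^ k * F z)) \<midarrow>w\<rightarrow> d ^ k * l"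
    by (intro tendsto_intros d kl)
  moreover have "eventually (\<lambda>z. ((U z - L) / (z - w)) ^ k * ((z - w) ^ k * F z) = (U z - L) ^ k * F z) (at w)"
    unfolding eventually_at_filter by (simp add: power_divide)
  ultimately have "(\<lambda>z. (U z - L) ^ k * F z) \<midarrow>w\<rightarrow> d ^ k * l"
    by (rule Lim_transform_eventually)
  thus ?thesis by (rule that)
qed

lemma finite_poles_on_compact:
  assumes "h meromorphic_on K" "compact K"
  shows "finite {w \<in> K. is_pole h w}"
  using sparse_in_compact_finite[of "{w. is_pole h w}" K]
    meromorphic_on_imp_not_pole_cosparse[OF assms(1)] assms(2)
  by (simp add: eventually_cosparse Int_def)

abbreviation at_ii_inf :: "complex filter" where "at_ii_inf \<equiv> filtercomap Im at_top"

lemma eventually_at_ii_inf: "eventually P at_ii_inf \<longleftrightarrow> (\<exists>b>0. \<forall>z. Im z > b \<longrightarrow> P z)"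
proof
  assume "eventually P at_ii_inf"
  then obtain b where b: "\<And>z. Im z \<ge> b \<Longrightarrow> P z"
    unfolding eventually_filtercomap eventually_at_top_linorder by auto
  show "\<exists>b>0. \<forall>z. Im z > b \<longrightarrow> P z" by (rule exI[of _ "max b 1"]) (auto intro: b)
next
  assume "\<exists>b>0. \<forall>z. Im z > b \<longrightarrow> P z"
  then obtain b where b: "\<And>z. Im z > b \<Longrightarrow> P z" by blast
  show "eventually P at_ii_inf" unfolding eventually_filtercomap
    by (rule exI[of _ "\<lambda>y. y > b"]) (auto intro: b simp: eventually_gt_at_top)
qed

lemma eventually_at_ii_infI: "(\<And>\<tau>. \<tau> \<in> uhp \<Longrightarrow> P \<tau>) \<Longrightarrow> eventually P at_ii_inf"
  unfolding eventually_at_ii_inf uhp_def by (rule exI[of _ 1]) auto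

lemma eventually_uhp_at_ii_inf: "eventually (\<lambda>\<tau>. \<tau> \<in> uhp) at_ii_inf"
  by (rule eventually_at_ii_infI)

lemma at_ii_inf_neq_bot [simp]: "at_ii_inf \<noteq> bot"
proof -
  have "\<exists>z. Im z > b" for b by (rule exI[of _ "Complex 0 (b + 1)"]) simp
  hence "\<not> eventually (\<lambda>_. False) at_ii_inf" unfolding eventually_at_ii_inf by blast
  thus ?thesis by (auto simp: trivial_limit_def)
qed

lemma filterlim_at_ii_inf_linear:
  assumes "p > 0" "m > 0"
  shows "filterlim (\<lambda>\<tau>. (of_nat p * \<tau> + of_int r) / of_nat m) at_ii_inf at_ii_inf"
proof -
  have "filterlim (\<lambda>y::real. real p / real m * y) at_top at_top"
    using assms by (intro filterlim_tendsto_pos_mult_at_top[OF tendsto_const] filterlim_ident) auto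
  hence "filterlim (\<lambda>\<tau>. real p / real m * Im \<tau>) at_top at_ii_inf"
    by (rule filterlim_compose[OF _ filterlim_filtercomap])
  hence "filterlim (\<lambda>\<tau>. Im ((of_nat p * \<tau> + of_int r) / of_nat m)) at_top at_ii_inf"
    by (simp add: Im_divide_of_nat)
  thus ?thesis by (simp add: filterlim_filtercomap_iff o_def)
qed

lemma exp_2pi_i_times_int: "exp (2 * of_real pi * \<i> * of_int n) = 1"
  using exp_integer_2pi[of "of_int n"] by (simp add: mult_ac)

lemma exp_pi_i_times_int: "exp (of_real pi * \<i> * of_int m) = (- 1) powi m"
proof -
  have "exp (of_real pi * \<i> * of_int m) = exp (of_int m * (of_real pi * \<i>))"
    by (simp add: mult_ac)
  also have "\<dots> = exp (of_real pi * \<i>) powi m" by (rule exp_power_int[symmetric])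
  finally show ?thesis by simp
qed

lemma minus_one_powi_minus: "(- 1 :: complex) powi (- m) = (- 1) powi m"
  by (cases "even m") (auto elim!: evenE oddE simp: power_int_add power_int_mult power_int_minus)

definition to_q :: "nat \<Rightarrow> complex \<Rightarrow> complex" where
  "to_q N \<tau> = exp (2 * of_real pi * \<i> * \<tau> / of_nat N)"

lemma to_q_nonzero [simp]: "to_q N \<tau> \<noteq> 0" by (simp add: to_q_def)

lemma to_q_add: "to_q N (x + y) = to_q N x * to_q N y"
  by (simp add: to_q_def exp_add[symmetric] distrib_left add_divide_distrib)

lemma norm_to_q: "norm (to_q N \<tau>) = exp (- (2 * pi * Im \<tau> / of_nat N))"
  by (simp add: to_q_def Im_divide_of_nat Re_divide_of_nat)

lemma norm_to_q_less_1: "Im \<tau> > 0 \<Longrightarrow> N > 0 \<Longrightarrow> norm (to_q N \<tau>) < 1"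
  by (simp add: norm_to_q)

lemma to_q_power: "N > 0 \<Longrightarrow> M > 0 \<Longrightarrow> to_q (N * M) \<tau> ^ M = to_q N \<tau>"
  unfolding to_q_def exp_of_nat_mult[symmetric] by simp

lemma to_q_holomorphic: "to_q N holomorphic_on S"
  unfolding to_q_def by (intro holomorphic_intros) auto

lemma to_q_surj:
  assumes "N > 0" "w \<noteq> 0"
  obtains \<tau> where "to_q N \<tau> = w"
proof (rule that[of "of_nat N * Ln w / (2 * of_real pi * \<i>)"])
  show "to_q N (of_nat N * Ln w / (2 * of_real pi * \<i>)) = w"
    using assms by (simp add: to_q_def)
qed

lemma to_q_tendsto_0:
  assumes "N > 0"
  shows "filterlim (to_q N) (at 0) at_ii_inf"
proof -
  have "filterlim (\<lambda>y::real. 2 * pi / of_nat N * y) at_top at_top"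
    using assms by (intro filterlim_tendsto_pos_mult_at_top[OF tendsto_const] filterlim_ident) auto
  hence "filterlim (\<lambda>y::real. - (2 * pi * y / of_nat N)) at_bot at_top"
    by (subst filterlim_uminus_at_top[symmetric]) (simp add: filterlim_uminus_at_bot)
  hence "filterlim (\<lambda>y::real. exp (- (2 * pi * y / of_nat N))) (nhds 0) at_top"
    by (rule filterlim_compose[OF exp_at_bot])
  hence "((\<lambda>\<tau>. norm (to_q N \<tau>)) \<longlongrightarrow> 0) at_ii_inf"
    unfolding norm_to_q by (rule filterlim_compose[OF _ filterlim_filtercomap])
  hence "(to_q N \<longlongrightarrow> 0) at_ii_inf" by (rule tendsto_norm_zero_cancel)
  thus ?thesis by (simp add: filterlim_at)
qed

lemma filtermap_to_q_at_ii_inf: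
  assumes "N > 0"
  shows "filtermap (to_q N) at_ii_inf = at 0"
proof (rule antisym)
  show "filtermap (to_q N) at_ii_inf \<le> at 0" using to_q_tendsto_0[OF assms] by (simp add: filterlim_def)
  show "at 0 \<le> filtermap (to_q N) at_ii_inf"
  proof (rule filter_leI)
    fix P assume "eventually P (filtermap (to_q N) at_ii_inf)"
    then obtain b where b: "\<And>\<tau>. Im \<tau> > b \<Longrightarrow> P (to_q N \<tau>)"
      unfolding eventually_filtermap eventually_at_ii_inf by blast
    have "P w" if "w \<noteq> 0" "norm w < exp (- (2 * pi * b / of_nat N))" for w
    proof -
      obtain \<tau> where \<tau>: "to_q N \<tau> = w" using to_q_surj[OF assms \<open>w \<noteq> 0\<close>] .
      have "Im \<tau> > b" using that(2) assms by (simp add: \<tau>[symmetric] norm_to_q field_simps)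
      thus ?thesis using b \<tau> by blast
    qed
    thus "eventually P (at 0)" unfolding eventually_at
      by (intro exI[of _ "exp (- (2 * pi * b / of_nat N))"]) auto
  qed
qed

lemma tendsto_to_q_iff:
  "N > 0 \<Longrightarrow> ((\<lambda>\<tau>. F (to_q N \<tau>)) \<longlongrightarrow> L) at_ii_inf \<longleftrightarrow> F \<midarrow>0\<rightarrow> L"
  by (metis filterlim_filtermap filtermap_to_q_at_ii_inf)

definition zeta :: "nat \<Rightarrow> int \<Rightarrow> complex" where
  "zeta N x = to_q N (of_int x)"

lemma zeta_nonzero [simp]: "zeta N x \<noteq> 0" and zeta_0 [simp]: "zeta N 0 = 1"
  by (simp_all add: zeta_def to_q_def)

lemma zeta_add: "zeta N (x + y) = zeta N x * zeta N y"
  by (simp add: zeta_def to_q_add)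

lemma zeta_power: "zeta N x ^ n = zeta N (int n * x)"
  by (induction n) (simp_all add: zeta_add algebra_simps)

lemma zeta_mult_cancel: "k > 0 \<Longrightarrow> zeta (k * N) (int k * x) = zeta N x"
  by (simp add: zeta_def to_q_def mult_ac)

lemma zeta_2: "zeta 2 n = (- 1) powi n"
  using exp_pi_i_times_int[of n] by (simp add: zeta_def to_q_def mult_ac)

lemma zeta_eq_1_iff:
  assumes "N > 0"
  shows "zeta N x = 1 \<longleftrightarrow> int N dvd x"
proof
  assume "zeta N x = 1"
  then obtain n :: int where "Im (2 * of_real pi * \<i> * of_int x / of_nat N) = of_int (2 * n) * pi"
    unfolding zeta_def to_q_def exp_eq_1 by blast
  hence "real_of_int x = of_int (n * int N)" using assms by (simp add: Im_divide_of_nat field_simps)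
  hence "x = n * int N" by (simp only: of_int_eq_iff)
  thus "int N dvd x" by simp
next
  assume "int N dvd x"
  then obtain n where "x = int N * n" by (elim dvdE)
  thus "zeta N x = 1" using assms exp_2pi_i_times_int[of n] by (simp add: zeta_def to_q_def mult_ac)
qed

lemma zeta_cong: "N > 0 \<Longrightarrow> int N dvd x - y \<Longrightarrow> zeta N x = zeta N y"
  using zeta_add[of N "x - y" y] zeta_eq_1_iff[of N "x - y"] by simp

lemma sum_zeta:
  assumes "N > 0"
  shows "(\<Sum>j<N. zeta N (n * int j)) = (if int N dvd n then of_nat N else 0)"
proof -
  have "(\<Sum>j<N. zeta N (n * int j)) = (\<Sum>j<N. zeta N n ^ j)" by (simp add: zeta_power mult.commute)
  moreover have "zeta N n ^ N = 1" using assms by (simp add: zeta_power zeta_eq_1_iff)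
  ultimately show ?thesis using assms
    by (cases "int N dvd n") (simp_all add: sum_gp_strict zeta_eq_1_iff[symmetric])
qed

definition meromorphic_at_ii_inf :: "(complex \<Rightarrow> complex) \<Rightarrow> bool" where
  "meromorphic_at_ii_inf f \<longleftrightarrow>
     (\<exists>N>0. \<exists>F. F meromorphic_on {0} \<and> eventually (\<lambda>\<tau>. f \<tau> = F (to_q N \<tau>)) at_ii_inf)"

lemma meromorphic_at_ii_infI:
  "N > 0 \<Longrightarrow> F meromorphic_on {0} \<Longrightarrow> (\<And>\<tau>. \<tau> \<in> uhp \<Longrightarrow> f \<tau> = F (to_q N \<tau>)) \<Longrightarrow> meromorphic_at_ii_inf f"
  unfolding meromorphic_at_ii_inf_def using eventually_at_ii_infI[of "\<lambda>\<tau>. f \<tau> = F (to_q _ \<tau>)"] by blast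

lemma meromorphic_at_ii_inf_cong:
  assumes "meromorphic_at_ii_inf f" "eventually (\<lambda>\<tau>. f \<tau> = g \<tau>) at_ii_inf"
  shows "meromorphic_at_ii_inf g"
proof -
  obtain N F where "N > 0" "F meromorphic_on {0}" and ev: "eventually (\<lambda>\<tau>. f \<tau> = F (to_q N \<tau>)) at_ii_inf"
    using assms(1) unfolding meromorphic_at_ii_inf_def by blast
  moreover have "eventually (\<lambda>\<tau>. g \<tau> = F (to_q N \<tau>)) at_ii_inf" using ev assms(2) by eventually_elim simp
  ultimately show ?thesis unfolding meromorphic_at_ii_inf_def by blast
qed

lemma meromorphic_scaled_power:
  assumes "F meromorphic_on {0}" "c \<noteq> 0" "p > 0"
  shows "(\<lambda>w. F (c * w ^ p)) meromorphic_on {0}"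
proof (rule meromorphic_on_compose[OF assms(1)])
  show "(\<lambda>w. c * w ^ p) analytic_on {0}" by (intro analytic_intros)
qed (use assms in auto)

lemma meromorphic_at_ii_inf_common:
  assumes "meromorphic_at_ii_inf f" "meromorphic_at_ii_inf g"
  obtains N F G where "N > 0" "F meromorphic_on {0}" "G meromorphic_on {0}"
    "eventually (\<lambda>\<tau>. f \<tau> = F (to_q N \<tau>)) at_ii_inf" "eventually (\<lambda>\<tau>. g \<tau> = G (to_q N \<tau>)) at_ii_inf"
proof -
  obtain N F where F: "N > 0" "F meromorphic_on {0}" "eventually (\<lambda>\<tau>. f \<tau> = F (to_q N \<tau>)) at_ii_inf"
    using assms(1) unfolding meromorphic_at_ii_inf_def by blast
  obtain M G where G: "M > 0" "G meromorphic_on {0}" "eventually (\<lambda>\<tau>. g \<tau> = G (to_q M \<tau>)) at_ii_inf"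
    using assms(2) unfolding meromorphic_at_ii_inf_def by blast
  show ?thesis
  proof (rule that[of "N * M" "\<lambda>w. F (w ^ M)" "\<lambda>w. G (w ^ N)"])
    show "(\<lambda>w. F (w ^ M)) meromorphic_on {0}" "(\<lambda>w. G (w ^ N)) meromorphic_on {0}"
      using meromorphic_scaled_power[OF F(2), of 1 M] meromorphic_scaled_power[OF G(2), of 1 N] F G by auto
    show "\<forall>\<^sub>F \<tau> in at_ii_inf. f \<tau> = F (to_q (N * M) \<tau> ^ M)" "\<forall>\<^sub>F \<tau> in at_ii_inf. g \<tau> = G (to_q (N * M) \<tau> ^ N)"
      using F G to_q_power[OF F(1) G(1)] to_q_power[OF G(1) F(1)] by (simp_all add: mult.commute)
  qed (use F G in auto)
qed

lemma meromorphic_at_ii_inf_const: "meromorphic_at_ii_inf (\<lambda>_. c)"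
  by (rule meromorphic_at_ii_infI[of 1 "\<lambda>_. c"]) auto

lemma meromorphic_at_ii_inf_binop:
  assumes "meromorphic_at_ii_inf f" "meromorphic_at_ii_inf g"
    and op: "\<And>F G. F meromorphic_on {0} \<Longrightarrow> G meromorphic_on {0} \<Longrightarrow> (\<lambda>w. op (F w) (G w)) meromorphic_on {0}"
  shows "meromorphic_at_ii_inf (\<lambda>\<tau>. op (f \<tau>) (g \<tau>))"
proof -
  obtain N F G where "N > 0" and mero: "F meromorphic_on {0}" "G meromorphic_on {0}"
    and ev: "eventually (\<lambda>\<tau>. f \<tau> = F (to_q N \<tau>)) at_ii_inf" "eventually (\<lambda>\<tau>. g \<tau> = G (to_q N \<tau>)) at_ii_inf"
    using meromorphic_at_ii_inf_common[OF assms(1,2)] by metis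
  have "eventually (\<lambda>\<tau>. op (f \<tau>) (g \<tau>) = (\<lambda>w. op (F w) (G w)) (to_q N \<tau>)) at_ii_inf"
    using ev by eventually_elim simp
  thus ?thesis using \<open>N > 0\<close> op[OF mero] unfolding meromorphic_at_ii_inf_def by blast
qed

lemma meromorphic_at_ii_inf_add: "meromorphic_at_ii_inf f \<Longrightarrow> meromorphic_at_ii_inf g \<Longrightarrow>
    meromorphic_at_ii_inf (\<lambda>\<tau>. f \<tau> + g \<tau>)"
  and meromorphic_at_ii_inf_mult: "meromorphic_at_ii_inf f \<Longrightarrow> meromorphic_at_ii_inf g \<Longrightarrow>
      meromorphic_at_ii_inf (\<lambda>\<tau>. f \<tau> * g \<tau>)"
  and meromorphic_at_ii_inf_divide: "meromorphic_at_ii_inf f \<Longrightarrow> meromorphic_at_ii_inf g \<Longrightarrow>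
      meromorphic_at_ii_inf (\<lambda>\<tau>. f \<tau> / g \<tau>)"
  by (rule meromorphic_at_ii_inf_binop; auto intro!: meromorphic_intros)+

lemma meromorphic_at_ii_inf_linear:
  assumes "meromorphic_at_ii_inf f" "p > 0" "m > 0"
  shows "meromorphic_at_ii_inf (\<lambda>\<tau>. f ((of_nat p * \<tau> + of_int r) / of_nat m))"
proof -
  obtain N F where F: "N > 0" "F meromorphic_on {0}" "eventually (\<lambda>\<tau>. f \<tau> = F (to_q N \<tau>)) at_ii_inf"
    using assms(1) unfolding meromorphic_at_ii_inf_def by blast
  define c where "c = to_q (N * m) (of_int r)"
  have "to_q N ((of_nat p * \<tau> + of_int r) / of_nat m) = c * to_q (N * m) \<tau> ^ p" for \<tau>
    unfolding to_q_def c_def exp_of_nat_mult[symmetric] exp_add[symmetric]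
    by (rule arg_cong[where f = exp]) (simp add: add_divide_distrib algebra_simps)
  hence "eventually (\<lambda>\<tau>. f ((of_nat p * \<tau> + of_int r) / of_nat m) = (\<lambda>w. F (c * w ^ p))
      (to_q (N * m) \<tau>)) at_ii_inf"
    using eventually_compose_filterlim[OF F(3) filterlim_at_ii_inf_linear[OF assms(2,3), of r]] by simp
  moreover have "(\<lambda>w. F (c * w ^ p)) meromorphic_on {0}"
    using F(2) assms by (intro meromorphic_scaled_power) (auto simp: c_def)
  moreover have "N * m > 0" using F(1) assms(3) by simp
  ultimately show ?thesis unfolding meromorphic_at_ii_inf_def by blast
qed

lemma meromorphic_at_ii_inf_analytic:
  assumes "meromorphic_at_ii_inf f"
  shows "eventually (\<lambda>\<tau>. f analytic_on {\<tau>}) at_ii_inf"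
proof -
  obtain N F where F: "N > 0" "F meromorphic_on {0}" and ev: "eventually (\<lambda>\<tau>. f \<tau> = F (to_q N \<tau>)) at_ii_inf"
    using assms unfolding meromorphic_at_ii_inf_def by blast
  have "isolated_singularity_at F 0" using F(2) by (meson meromorphic_onE insertI1)
  then obtain r where r: "r > 0" "F analytic_on ball 0 r - {0}"
    unfolding isolated_singularity_at_def by blast
  have "eventually (\<lambda>w. w \<in> ball 0 r - {0}) (at 0)"
    using eventually_at_in_open[OF open_ball, of 0 0 r] r(1) by simp
  hence "eventually (\<lambda>\<tau>. to_q N \<tau> \<in> ball 0 r - {0}) at_ii_inf"
    by (rule eventually_compose_filterlim[OF _ to_q_tendsto_0[OF F(1)]])
  with ev have "eventually (\<lambda>\<tau>. f \<tau> = F (to_q N \<tau>) \<and> to_q N \<tau> \<in> ball 0 r - {0}) at_ii_inf"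
    by eventually_elim simp
  then obtain b where b: "b > 0" "\<And>\<tau>. Im \<tau> > b \<Longrightarrow> f \<tau> = F (to_q N \<tau>) \<and> to_q N \<tau> \<in> ball 0 r - {0}"
    unfolding eventually_at_ii_inf by blast
  have "f analytic_on {\<tau>}" if \<tau>: "Im \<tau> > b" for \<tau>
  proof -
    have "F analytic_on to_q N ` {\<tau>}"
      by (rule analytic_on_subset[OF r(2)]) (use b(2)[OF \<tau>] in auto)
    moreover have "to_q N analytic_on {\<tau>}" using to_q_holomorphic[of N UNIV] analytic_at by blast
    ultimately have "(F \<circ> to_q N) analytic_on {\<tau>}" using analytic_on_compose by blast
    moreover have "eventually (\<lambda>t. t \<in> {t. Im t > b}) (nhds \<tau>)"
      using \<tau> open_halfspace_Im_gt by (intro eventually_nhds_in_open) auto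
    hence "eventually (\<lambda>t. f t = (F \<circ> to_q N) t) (nhds \<tau>)" by eventually_elim (use b(2) in auto)
    ultimately show ?thesis using analytic_at_cong by blast
  qed
  thus ?thesis unfolding eventually_at_ii_inf using b(1) by blast
qed

lemma meromorphic_at_ii_inf_Bfun_imp_tendsto:
  assumes "meromorphic_at_ii_inf h" "Bfun h at_ii_inf"
  obtains L where "(h \<longlongrightarrow> L) at_ii_inf"
proof -
  obtain N F where F: "N > 0" "F meromorphic_on {0}" and ev: "eventually (\<lambda>\<tau>. h \<tau> = F (to_q N \<tau>)) at_ii_inf"
    using assms(1) unfolding meromorphic_at_ii_inf_def by blast
  obtain B where "eventually (\<lambda>\<tau>. norm (h \<tau>) \<le> B) at_ii_inf" using assms(2) unfolding Bfun_def by blast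
  with ev have "eventually (\<lambda>\<tau>. norm (F (to_q N \<tau>)) \<le> B) at_ii_inf" by eventually_elim simp
  hence "Bfun F (at 0)"
    by (intro BfunI[of _ B]) (simp add: filtermap_to_q_at_ii_inf[OF F(1), symmetric] eventually_filtermap)
  then obtain L where "F \<midarrow>0\<rightarrow> L" using meromorphic_Bfun_imp_tendsto[OF F(2)] by blast
  hence "((\<lambda>\<tau>. F (to_q N \<tau>)) \<longlongrightarrow> L) at_ii_inf" by (simp add: tendsto_to_q_iff[OF F(1)])
  hence "(h \<longlongrightarrow> L) at_ii_inf"
    by (rule Lim_transform_eventually) (use ev in eventually_elim, simp)
  thus ?thesis by (rule that)
qed

lemma meromorphic_at_ii_inf_order_bound:
  assumes "N > 0" "F meromorphic_on {0}" "eventually (\<lambda>\<tau>. h \<tau> = F (to_q N \<tau>)) at_ii_inf"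
  obtains k l where "((\<lambda>\<tau>. to_q N \<tau> ^ k * h \<tau>) \<longlongrightarrow> l) at_ii_inf"
proof -
  obtain k l where "(\<lambda>w. (w - 0) ^ k * F w) \<midarrow>0\<rightarrow> l" using meromorphic_order_bound[OF assms(2)] .
  hence "((\<lambda>\<tau>. (to_q N \<tau> - 0) ^ k * F (to_q N \<tau>)) \<longlongrightarrow> l) at_ii_inf"
    by (rule filterlim_compose[OF _ to_q_tendsto_0[OF assms(1)]])
  hence "((\<lambda>\<tau>. to_q N \<tau> ^ k * h \<tau>) \<longlongrightarrow> l) at_ii_inf"
    by (rule Lim_transform_eventually) (use assms(3) in eventually_elim, simp)
  thus ?thesis by (rule that)
qed

lemma pole_order_lower_at_ii_inf:
  assumes "N > 0" "F meromorphic_on {0}" and ev: "eventually (\<lambda>\<tau>. h \<tau> = F (to_q N \<tau>)) at_ii_inf"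
    and lim: "((\<lambda>\<tau>. to_q N \<tau> ^ Suc k * h \<tau>) \<longlongrightarrow> 0) at_ii_inf"
  obtains L where "((\<lambda>\<tau>. to_q N \<tau> ^ k * h \<tau>) \<longlongrightarrow> L) at_ii_inf"
proof -
  define G where "G = (\<lambda>w. w ^ Suc k * F w)"
  have "G meromorphic_on {0}" unfolding G_def by (intro meromorphic_intros assms(2))
  moreover have "((\<lambda>\<tau>. G (to_q N \<tau>)) \<longlongrightarrow> 0) at_ii_inf"
    by (rule Lim_transform_eventually[OF lim]) (use ev in eventually_elim, simp add: G_def)
  hence "G \<midarrow>0\<rightarrow> 0" by (simp add: tendsto_to_q_iff[OF assms(1)])
  ultimately obtain d where "(\<lambda>w. G w / (w - 0)) \<midarrow>0\<rightarrow> d" by (rule meromorphic_tendsto_0_imp_divide)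
  hence "((\<lambda>\<tau>. G (to_q N \<tau>) / (to_q N \<tau> - 0)) \<longlongrightarrow> d) at_ii_inf"
    by (rule filterlim_compose[OF _ to_q_tendsto_0[OF assms(1)]])
  hence "((\<lambda>\<tau>. to_q N \<tau> ^ k * h \<tau>) \<longlongrightarrow> d) at_ii_inf"
    by (rule Lim_transform_eventually) (use ev in eventually_elim, simp add: G_def)
  thus ?thesis by (rule that)
qed

lemma meromorphic_at_ii_inf_zero_clears_pole:
  assumes "meromorphic_at_ii_inf f" "meromorphic_at_ii_inf u" and lim: "(u \<longlongrightarrow> L) at_ii_inf"
  obtains k l where "((\<lambda>\<tau>. (u \<tau> - L) ^ k * f \<tau>) \<longlongrightarrow> l) at_ii_inf"
proof -
  obtain N F U where N: "N > 0" and mero: "F meromorphic_on {0}" "U meromorphic_on {0}"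
    and ev: "eventually (\<lambda>\<tau>. f \<tau> = F (to_q N \<tau>)) at_ii_inf" "eventually (\<lambda>\<tau>. u \<tau> = U (to_q N \<tau>)) at_ii_inf"
    using meromorphic_at_ii_inf_common[OF assms(1,2)] by metis
  have "((\<lambda>\<tau>. U (to_q N \<tau>)) \<longlongrightarrow> L) at_ii_inf"
    by (rule Lim_transform_eventually[OF lim]) (use ev(2) in eventually_elim, simp)
  hence "U \<midarrow>0\<rightarrow> L" by (simp add: tendsto_to_q_iff[OF N])
  then obtain k l where "(\<lambda>z. (U z - L) ^ k * F z) \<midarrow>0\<rightarrow> l"
    using meromorphic_zero_clears_pole[OF mero] by blast
  hence "((\<lambda>\<tau>. (U (to_q N \<tau>) - L) ^ k * F (to_q N \<tau>)) \<longlongrightarrow> l) at_ii_inf"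
    by (rule filterlim_compose[OF _ to_q_tendsto_0[OF N]])
  hence "((\<lambda>\<tau>. (u \<tau> - L) ^ k * f \<tau>) \<longlongrightarrow> l) at_ii_inf"
    by (rule Lim_transform_eventually) (use ev in eventually_elim, simp)
  thus ?thesis by (rule that)
qed

lemma periodic_pole_order_dvd:
  assumes "N > 0" "L \<noteq> 0" and lim: "((\<lambda>\<tau>. to_q N \<tau> ^ k * h \<tau>) \<longlongrightarrow> L) at_ii_inf"
    and periodic: "\<And>\<tau>. \<tau> \<in> uhp \<Longrightarrow> h (\<tau> + 1) = h \<tau>"
  shows "N dvd k"
proof -
  define g where "g = (\<lambda>\<tau>. to_q N \<tau> ^ k * h \<tau>)"
  have "filterlim (\<lambda>\<tau>. \<tau> + 1) at_ii_inf at_ii_inf" using filterlim_at_ii_inf_linear[of 1 1 1] by simp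
  hence "((\<lambda>\<tau>. g (\<tau> + 1)) \<longlongrightarrow> L) at_ii_inf" unfolding g_def by (rule filterlim_compose[OF lim])
  moreover have "eventually (\<lambda>\<tau>. g (\<tau> + 1) = zeta N 1 ^ k * g \<tau>) at_ii_inf"
    by (rule eventually_at_ii_infI) (simp add: g_def to_q_add zeta_def periodic power_mult_distrib)
  ultimately have "((\<lambda>\<tau>. zeta N 1 ^ k * g \<tau>) \<longlongrightarrow> L) at_ii_inf" by (rule Lim_transform_eventually)
  moreover have "((\<lambda>\<tau>. zeta N 1 ^ k * g \<tau>) \<longlongrightarrow> zeta N 1 ^ k * L) at_ii_inf"
    unfolding g_def by (intro tendsto_intros lim)
  ultimately have "zeta N 1 ^ k * L = L" using tendsto_unique[OF at_ii_inf_neq_bot] by blast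
  hence "zeta N (int k) = 1" using assms(2) by (simp add: zeta_power)
  thus ?thesis using assms(1) by (simp add: zeta_eq_1_iff)
qed

section \<open>Theta series with characteristics\<close>

lemma summable_on_exp_minus_abs_int: "(\<lambda>n::int. exp (- \<bar>real_of_int n\<bar>)) summable_on UNIV"
proof -
  have nat: "(\<lambda>n::nat. exp (- real n)) summable_on UNIV"
  proof (rule norm_summable_imp_summable_on)
    have "summable (\<lambda>n. exp (-1::real) ^ n)" by (rule summable_geometric) simp
    thus "summable (\<lambda>n. norm (exp (- real n)))" by (simp add: exp_of_nat_mult[symmetric])
  qed
  have "(\<lambda>n::int. exp (- \<bar>real_of_int n\<bar>)) summable_on range int"
    "(\<lambda>n::int. exp (- \<bar>real_of_int n\<bar>)) summable_on range (\<lambda>n. - int n)"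
    by (subst summable_on_reindex; use nat in \<open>auto simp: o_def inj_def\<close>)+
  moreover have "(UNIV :: int set) = range int \<union> range (\<lambda>n. - int n)"
    by (auto simp: image_iff) (metis nonneg_int_cases nonpos_int_cases nle_le)
  ultimately show ?thesis using summable_on_union by fastforce
qed

lemma summable_on_exp_quadratic:
  fixes p q a :: real
  assumes "p > 0"
  shows "(\<lambda>n::int. exp (- p * (of_int n + a)\<^sup>2 + q * (of_int n + a))) summable_on UNIV"
proof (rule summable_on_comparison_test)
  define C where "C = exp ((\<bar>q\<bar> + 1)\<^sup>2 / (4 * p) + \<bar>a\<bar>)"
  show "(\<lambda>n::int. C * exp (- \<bar>real_of_int n\<bar>)) summable_on UNIV"
    by (intro summable_on_cmult_right summable_on_exp_minus_abs_int)
  fix n :: int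
  define x where "x = real_of_int n + a"
  have "0 \<le> (2 * p * \<bar>x\<bar> - (\<bar>q\<bar> + 1))\<^sup>2 / (4 * p)" using assms by simp
  also have "\<dots> = p * x\<^sup>2 - (\<bar>q\<bar> + 1) * \<bar>x\<bar> + (\<bar>q\<bar> + 1)\<^sup>2 / (4 * p)"
    using assms by (simp add: field_simps power2_eq_square)
  finally have "- p * x\<^sup>2 + \<bar>q\<bar> * \<bar>x\<bar> \<le> - \<bar>x\<bar> + (\<bar>q\<bar> + 1)\<^sup>2 / (4 * p)"
    by (simp add: algebra_simps)
  moreover have "q * x \<le> \<bar>q\<bar> * \<bar>x\<bar>" by (metis abs_ge_self abs_mult)
  moreover have "\<bar>real_of_int n\<bar> \<le> \<bar>x\<bar> + \<bar>a\<bar>" by (auto simp: x_def)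
  ultimately have "- p * x\<^sup>2 + q * x \<le> (\<bar>q\<bar> + 1)\<^sup>2 / (4 * p) + \<bar>a\<bar> - \<bar>real_of_int n\<bar>" by linarith
  thus "exp (- p * (of_int n + a)\<^sup>2 + q * (of_int n + a)) \<le> C * exp (- \<bar>real_of_int n\<bar>)"
    by (simp add: C_def exp_add[symmetric] x_def)
qed auto

lemma infsum_holomorphic_on:
  fixes f :: "'i \<Rightarrow> complex \<Rightarrow> complex"
  assumes hol: "\<And>n. n \<in> I \<Longrightarrow> f n holomorphic_on S"
    and bound: "\<And>z. z \<in> S \<Longrightarrow> \<exists>r M. r > 0 \<and> cball z r \<subseteq> S \<and> M summable_on I \<and>
                  (\<forall>n\<in>I. \<forall>w\<in>cball z r. norm (f n w) \<le> M n)"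
  shows "(\<lambda>z. \<Sum>\<^sub>\<infinity>n\<in>I. f n z) holomorphic_on S"
proof -
  have "(\<lambda>z. \<Sum>\<^sub>\<infinity>n\<in>I. f n z) analytic_on {z}" if z: "z \<in> S" for z
  proof -
    obtain r M where r: "r > 0" "cball z r \<subseteq> S"
      and M: "M summable_on I" "\<And>n w. n \<in> I \<Longrightarrow> w \<in> cball z r \<Longrightarrow> norm (f n w) \<le> M n"
      using bound[OF z] by blast
    have "uniform_limit (cball z r) (\<lambda>Y w. \<Sum>n\<in>Y. f n w) (\<lambda>w. \<Sum>\<^sub>\<infinity>n\<in>I. f n w) (finite_subsets_at_top I)"
      by (rule Weierstrass_m_test_general) (use M in auto)
    moreover have "\<forall>\<^sub>F Y in finite_subsets_at_top I. continuous_on (cball z r) (\<lambda>w. \<Sum>n\<in>Y. f n w) \<and>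
        (\<lambda>w. \<Sum>n\<in>Y. f n w) holomorphic_on ball z r"
    proof (rule eventually_finite_subsets_at_top_weakI)
      fix Y assume "finite Y" "Y \<subseteq> I"
      hence "(\<lambda>w. \<Sum>n\<in>Y. f n w) holomorphic_on S" using hol by (intro holomorphic_intros) auto
      thus "continuous_on (cball z r) (\<lambda>w. \<Sum>n\<in>Y. f n w) \<and> (\<lambda>w. \<Sum>n\<in>Y. f n w) holomorphic_on ball z r"
        using r ball_subset_cball[of z r] holomorphic_on_subset[of _ S]
          holomorphic_on_imp_continuous_on by blast
    qed
    ultimately have "(\<lambda>z. \<Sum>\<^sub>\<infinity>n\<in>I. f n z) holomorphic_on ball z r"
      using holomorphic_uniform_limit[of z r "\<lambda>Y w. \<Sum>n\<in>Y. f n w" "finite_subsets_at_top I"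
          "\<lambda>w. \<Sum>\<^sub>\<infinity>n\<in>I. f n w"] finite_subsets_at_top_neq_bot by blast
    thus ?thesis using r(1) analytic_at_ball by blast
  qed
  thus ?thesis by (meson analytic_imp_holomorphic analytic_on_analytic_at)
qed

definition theta_char_term :: "real \<Rightarrow> complex \<Rightarrow> complex \<Rightarrow> int \<Rightarrow> complex" where
  "theta_char_term a z \<tau> n = exp (of_real pi * \<i> * (of_real (of_int n + a))\<^sup>2 * \<tau>
                          + 2 * of_real pi * \<i> * of_real (of_int n + a) * z)"

definition theta_char :: "real \<Rightarrow> complex \<Rightarrow> complex \<Rightarrow> complex" where
  "theta_char a z \<tau> = (\<Sum>\<^sub>\<infinity>n. theta_char_term a z \<tau> n)"

lemma norm_theta_char_term:
  "norm (theta_char_term a z \<tau> n) =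
     exp (- (pi * Im \<tau>) * (of_int n + a)\<^sup>2 + (- 2 * pi * Im z) * (of_int n + a))"
proof -
  have "of_real pi * \<i> * (of_real (of_int n + a))\<^sup>2 * \<tau> + 2 * of_real pi * \<i> * of_real (of_int n + a) * z =
      of_real (pi * (of_int n + a)\<^sup>2) * (\<i> * \<tau>) + of_real (2 * pi * (of_int n + a)) * (\<i> * z)"
    by simp
  also have "Re \<dots> = - (pi * Im \<tau>) * (of_int n + a)\<^sup>2 + (- 2 * pi * Im z) * (of_int n + a)"
    by (simp only: plus_complex.sel complex_scaleR scaleR_conv_of_real[symmetric] scaleR_complex.sel) simp
  finally show ?thesis by (simp only: theta_char_term_def norm_exp_eq_Re)
qed

lemma theta_char_term_abs_summable:
  assumes "Im \<tau> > 0"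
  shows "(\<lambda>n. norm (theta_char_term a z \<tau> n)) summable_on UNIV"
  unfolding norm_theta_char_term by (rule summable_on_exp_quadratic) (use assms in auto)

lemma norm_theta_char_term_le:
  assumes "\<bar>Im z\<bar> \<le> B"
  shows "norm (theta_char_term a z \<tau> n) \<le>
    exp (- (pi * Im \<tau>) * (of_int n + a)\<^sup>2 + 2 * pi * B * (of_int n + a)) +
    exp (- (pi * Im \<tau>) * (of_int n + a)\<^sup>2 + (- 2 * pi * B) * (of_int n + a))"
proof -
  define x where "x = of_int n + a"
  have "- Im z * x \<le> \<bar>Im z\<bar> * \<bar>x\<bar>" by (metis abs_ge_self abs_minus_cancel abs_mult)
  also have "\<dots> \<le> B * \<bar>x\<bar>" using assms by (intro mult_right_mono) auto
  finally have "2 * pi * (- Im z * x) \<le> 2 * pi * (B * \<bar>x\<bar>)" by (intro mult_left_mono) auto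
  hence "norm (theta_char_term a z \<tau> n) \<le> exp (- (pi * Im \<tau>) * x\<^sup>2 + 2 * pi * B * \<bar>x\<bar>)"
    unfolding norm_theta_char_term x_def[symmetric] by (simp add: mult_ac)
  also have "\<dots> \<le> exp (- (pi * Im \<tau>) * x\<^sup>2 + 2 * pi * B * x) + exp (- (pi * Im \<tau>) * x\<^sup>2 + (- 2 * pi * B) * x)"
    by (cases "x \<ge> 0") (simp_all add: add_increasing add_increasing2 abs_if)
  finally show ?thesis unfolding x_def .
qed

lemma theta_char_entire:
  assumes "Im \<tau> > 0"
  shows "(\<lambda>z. theta_char a z \<tau>) holomorphic_on S"
proof -
  have "(\<lambda>z. theta_char a z \<tau>) holomorphic_on UNIV"
    unfolding theta_char_def
  proof (rule infsum_holomorphic_on)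
    fix n show "(\<lambda>z. theta_char_term a z \<tau> n) holomorphic_on UNIV"
      unfolding theta_char_term_def by (intro holomorphic_intros)
  next
    fix z :: complex
    define B where "B = norm z + 1"
    define M where "M n = exp (- (pi * Im \<tau>) * (of_int n + a)\<^sup>2 + 2 * pi * B * (of_int n + a)) +
      exp (- (pi * Im \<tau>) * (of_int n + a)\<^sup>2 + (- 2 * pi * B) * (of_int n + a))" for n
    have "M summable_on UNIV"
      unfolding M_def by (intro summable_on_add summable_on_exp_quadratic) (use assms in auto)
    moreover have "norm (theta_char_term a w \<tau> n) \<le> M n" if "w \<in> cball z 1" for w n
    proof -
      have "\<bar>Im w\<bar> \<le> B"
        using that abs_Im_le_cmod[of w] norm_triangle_ineq2[of w z]
        by (simp add: B_def dist_norm norm_minus_commute)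
      thus ?thesis unfolding M_def by (rule norm_theta_char_term_le)
    qed
    ultimately show "\<exists>r M. r > 0 \<and> cball z r \<subseteq> UNIV \<and> M summable_on UNIV \<and>
        (\<forall>n\<in>UNIV. \<forall>w\<in>cball z r. norm (theta_char_term a w \<tau> n) \<le> M n)"
      by (intro exI[of _ 1] exI[of _ M]) auto
  qed
  thus ?thesis using holomorphic_on_subset by blast
qed

lemma theta_char_shift: "theta_char a (z + of_real b * \<tau>) \<tau> =
    exp (- (of_real pi * \<i> * (of_real b)\<^sup>2 * \<tau>) - 2 * of_real pi * \<i> * of_real b * z) * theta_char (a + b) z \<tau>"
proof -
  have "theta_char_term a (z + of_real b * \<tau>) \<tau> n =
    exp (- (of_real pi * \<i> * (of_real b)\<^sup>2 * \<tau>) - 2 * of_real pi * \<i> * of_real b * z) *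
        theta_char_term (a + b) z \<tau> n" for n
    unfolding theta_char_term_def exp_add[symmetric]
    by (rule arg_cong[where f = exp]) (simp add: algebra_simps power2_eq_square)
  thus ?thesis by (simp add: theta_char_def infsum_cmult_right')
qed

lemma theta_char_characteristic_add_int: "theta_char (a + of_int m) z \<tau> = theta_char a z \<tau>"
proof -
  have "theta_char (a + of_int m) z \<tau> = (\<Sum>\<^sub>\<infinity>n. theta_char_term a z \<tau> (n + m))"
    unfolding theta_char_def theta_char_term_def by (simp add: algebra_simps)
  also have "\<dots> = infsum (theta_char_term a z \<tau>) (range (\<lambda>n. n + m))"
    by (subst infsum_reindex) (auto simp: o_def)
  also have "range (\<lambda>n::int. n + m) = UNIV" by simp
  finally show ?thesis by (simp add: theta_char_def)
qed

lemma theta_char_minus: "theta_char (- a) (- z) \<tau> = theta_char a z \<tau>"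
proof -
  have "theta_char (- a) (- z) \<tau> = (\<Sum>\<^sub>\<infinity>n. theta_char_term a z \<tau> (- n))"
    unfolding theta_char_def theta_char_term_def by (simp add: algebra_simps power2_eq_square)
  also have "\<dots> = infsum (theta_char_term a z \<tau>) (range (\<lambda>n. - n))"
    by (subst infsum_reindex) (auto simp: o_def)
  also have "range (\<lambda>n::int. - n) = UNIV" by (metis surj_uminus)
  finally show ?thesis by (simp add: theta_char_def)
qed

lemma theta_char_add_int:
  "theta_char a (z + of_int m) \<tau> = exp (2 * of_real pi * \<i> * of_real a * of_int m) * theta_char a z \<tau>"
proof -
  have "theta_char_term a (z + of_int m) \<tau> n =
      exp (2 * of_real pi * \<i> * of_real a * of_int m) * theta_char_term a z \<tau> n" for n
  proof -
    have "theta_char_term a (z + of_int m) \<tau> n = exp (2 * of_real pi * \<i> * of_int (n * m)) *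
        (exp (2 * of_real pi * \<i> * of_real a * of_int m) * theta_char_term a z \<tau> n)"
      unfolding theta_char_term_def exp_add[symmetric]
      by (rule arg_cong[where f = exp]) (simp add: algebra_simps)
    thus ?thesis unfolding exp_2pi_i_times_int by simp
  qed
  thus ?thesis by (simp add: theta_char_def infsum_cmult_right')
qed

lemma infsum_bounded_powers_holomorphic_on:
  fixes c :: "int \<Rightarrow> complex" and k :: "int \<Rightarrow> nat"
  assumes "A > 0" and c: "\<And>n. norm (c n) \<le> 1" and k: "\<And>n. real (k n) = A * (of_int n + a)\<^sup>2 - E"
  shows "(\<lambda>w. \<Sum>\<^sub>\<infinity>n. c n * w ^ k n) holomorphic_on ball 0 1"
proof (rule infsum_holomorphic_on)
  fix z :: complex assume "z \<in> ball 0 1"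
  define s where "s = (1 - norm z) / 2"
  define r where "r = norm z + s"
  define M where "M n = exp (- ln r * E) * exp (- (- ln r * A) * (of_int n + a)\<^sup>2 + 0 * (of_int n + a))"
    for n :: int
  have s: "s > 0" and r: "0 < r" "r < 1"
    using \<open>z \<in> ball 0 1\<close> by (auto simp: s_def r_def field_simps add_pos_nonneg)
  have norm_le: "norm w \<le> r" if "w \<in> cball z s" for w
    using that norm_triangle_ineq2[of w z] by (simp add: r_def dist_norm norm_minus_commute)
  hence subset: "cball z s \<subseteq> ball 0 1" using r by fastforce
  have "M summable_on UNIV"
    unfolding M_def using r assms(1)
    by (intro summable_on_cmult_right summable_on_exp_quadratic) (auto simp: mult_neg_pos)
  moreover have "norm (c n * w ^ k n) \<le> M n" if "w \<in> cball z s" for w n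
  proof -
    have "norm (c n * w ^ k n) \<le> 1 * r ^ k n"
      unfolding norm_mult norm_power using norm_le[OF that] by (intro mult_mono c power_mono) auto
    also have "\<dots> = exp (real (k n) * ln r)" using r(1) by (simp add: exp_of_nat_mult)
    also have "\<dots> = M n" unfolding k M_def exp_add[symmetric]
      by (rule arg_cong[where f = exp]) (simp add: algebra_simps)
    finally show ?thesis .
  qed
  ultimately show "\<exists>r M. r > 0 \<and> cball z r \<subseteq> ball 0 1 \<and> M summable_on UNIV \<and>
      (\<forall>n\<in>UNIV. \<forall>w\<in>cball z r. norm (c n * w ^ k n) \<le> M n)"
    using s subset by (intro exI[of _ s] exI[of _ M]) auto
qed (auto intro!: holomorphic_intros)

lemma theta_char_term_qexp:
  fixes p e :: int and m :: nat and \<beta> :: real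
  assumes "m > 0" "e\<^sup>2 \<le> (int m * n + p)\<^sup>2"
  shows "theta_char_term (of_int p / of_nat m) (of_real \<beta>) \<tau> n =
    exp (of_real pi * \<i> * \<tau> * of_int (e\<^sup>2) / of_nat (m\<^sup>2)) *
      (exp (2 * of_real pi * \<i> * of_real ((of_int n + of_int p / of_nat m) * \<beta>)) *
        to_q (2 * m\<^sup>2) \<tau> ^ nat ((int m * n + p)\<^sup>2 - e\<^sup>2))"
proof -
  define x where "x = real_of_int n + of_int p / of_nat m"
  have "real (nat ((int m * n + p)\<^sup>2 - e\<^sup>2)) = of_int ((int m * n + p)\<^sup>2 - e\<^sup>2)" using assms(2) by simp
  also have "\<dots> = (real m)\<^sup>2 * x\<^sup>2 - of_int (e\<^sup>2)"
    using assms(1) by (simp add: x_def distrib_left flip: power_mult_distrib)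
  finally have "complex_of_real (real (nat ((int m * n + p)\<^sup>2 - e\<^sup>2))) =
      (of_nat m)\<^sup>2 * (of_real x)\<^sup>2 - of_int (e\<^sup>2)" by simp
  hence exponent: "(of_nat (nat ((int m * n + p)\<^sup>2 - e\<^sup>2)) :: complex) =
      (of_nat m)\<^sup>2 * (of_real x)\<^sup>2 - of_int (e\<^sup>2)" by simp
  show ?thesis
    unfolding theta_char_term_def to_q_def exp_of_nat_mult[symmetric] exp_add[symmetric]
      x_def[symmetric] exponent
    using assms(1) by (intro arg_cong[where f = exp]) (simp add: field_simps)
qed

lemma theta_char_qexp:
  fixes p e :: int and m :: nat and \<beta> :: real
  assumes "m > 0" and e: "\<And>n. e\<^sup>2 \<le> (int m * n + p)\<^sup>2"
  obtains H where "H holomorphic_on ball 0 1"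
    "H 0 = (\<Sum>\<^sub>\<infinity>n\<in>{n. (int m * n + p)\<^sup>2 = e\<^sup>2}. exp (2 * of_real pi * \<i> *
        of_real ((of_int n + of_int p / of_nat m) * \<beta>)))"
    "\<And>\<tau>. theta_char (of_int p / of_nat m) (of_real \<beta>) \<tau> =
       exp (of_real pi * \<i> * \<tau> * of_int (e\<^sup>2) / of_nat (m\<^sup>2)) * H (to_q (2 * m\<^sup>2) \<tau>)"
proof -
  define x where "x n = real_of_int n + of_int p / of_nat m" for n
  define c where "c n = exp (2 * of_real pi * \<i> * of_real (x n * \<beta>))" for n
  define k where "k n = nat ((int m * n + p)\<^sup>2 - e\<^sup>2)" for n
  define H where "H w = (\<Sum>\<^sub>\<infinity>n. c n * w ^ k n)" for w
  have k: "real (k n) = (real m)\<^sup>2 * (x n)\<^sup>2 - of_int (e\<^sup>2)" for n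
  proof -
    have "real (k n) = of_int ((int m * n + p)\<^sup>2 - e\<^sup>2)" using e[of n] by (simp add: k_def)
    also have "\<dots> = (real m * x n)\<^sup>2 - of_int (e\<^sup>2)" using assms(1) by (simp add: x_def distrib_left)
    finally show ?thesis by (simp add: power_mult_distrib)
  qed
  show ?thesis
  proof (rule that[of H])
    have "norm (c n) \<le> 1" for n using norm_exp_i_times[of "2 * pi * (x n * \<beta>)"] by (simp add: c_def mult_ac)
    thus "H holomorphic_on ball 0 1"
      unfolding H_def using assms(1) k
      by (intro infsum_bounded_powers_holomorphic_on[of "(real m)\<^sup>2" _ _ "of_int p / of_nat m"])
        (auto simp: x_def)
    have "H 0 = infsum c {n. (int m * n + p)\<^sup>2 = e\<^sup>2}"
      unfolding H_def by (rule infsum_cong_neutral) (use e in \<open>auto simp: k_def power_0_left intro: antisym\<close>)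
    thus "H 0 = (\<Sum>\<^sub>\<infinity>n\<in>{n. (int m * n + p)\<^sup>2 = e\<^sup>2}. exp (2 * of_real pi * \<i> *
        of_real ((of_int n + of_int p / of_nat m) * \<beta>)))"
      unfolding c_def x_def .
  next
    fix \<tau> :: complex
    have "theta_char_term (of_int p / of_nat m) (of_real \<beta>) \<tau> n =
        exp (of_real pi * \<i> * \<tau> * of_int (e\<^sup>2) / of_nat (m\<^sup>2)) * (c n * to_q (2 * m\<^sup>2) \<tau> ^ k n)" for n
      unfolding c_def k_def x_def by (rule theta_char_term_qexp[OF assms(1) e])
    thus "theta_char (of_int p / of_nat m) (of_real \<beta>) \<tau> =
       exp (of_real pi * \<i> * \<tau> * of_int (e\<^sup>2) / of_nat (m\<^sup>2)) * H (to_q (2 * m\<^sup>2) \<tau>)"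
      unfolding theta_char_def H_def infsum_cmult_right'[symmetric] by (intro infsum_cong) (simp only:)
  qed
qed

definition theta11 :: "complex \<Rightarrow> complex \<Rightarrow> complex" where
  "theta11 z \<tau> = theta_char (1 / 2) (z + 1 / 2) \<tau>"

lemma theta11_entire: "Im \<tau> > 0 \<Longrightarrow> (\<lambda>z. theta11 z \<tau>) holomorphic_on S"
proof -
  assume "Im \<tau> > 0"
  hence "(\<lambda>z. theta_char (1 / 2) z \<tau>) \<circ> (\<lambda>z. z + 1 / 2) holomorphic_on S"
    by (intro holomorphic_on_compose holomorphic_intros theta_char_entire)
  thus ?thesis by (simp add: theta11_def o_def)
qed

lemma theta11_minus: "theta11 (- z) \<tau> = - theta11 z \<tau>"
proof -
  have "theta11 (- z) \<tau> = theta_char (1/2) (-(z - 1/2)) \<tau>" by (simp add: theta11_def)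
  also have "\<dots> = theta_char (- (1/2)) (z - 1/2) \<tau>" using theta_char_minus[of "- (1/2)" "z - 1/2" \<tau>] by simp
  also have "\<dots> = theta_char (1/2) (z - 1/2) \<tau>" using theta_char_characteristic_add_int[of "-(1/2)" 1] by simp
  also have "\<dots> = - theta_char (1/2) (z - 1/2 + of_int 1) \<tau>"
    by (subst theta_char_add_int) simp
  finally show ?thesis by (simp add: theta11_def add.commute)
qed

lemma theta11_quasi:
  "theta11 (z + of_int m * \<tau> + of_int n) \<tau> =
     (- 1) powi (m + n) * exp (- (of_real pi * \<i> * of_int (m\<^sup>2) * \<tau>) - 2 * of_real pi * \<i> * of_int m * z) *
         theta11 z \<tau>"
proof -
  define E where "E = exp (- (of_real pi * \<i> * (of_real (of_int m))\<^sup>2 * \<tau>) -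
      2 * of_real pi * \<i> * of_real (of_int m) * (z + 1/2 + of_int n))"
  have "theta11 (z + of_int m * \<tau> + of_int n) \<tau> = theta_char (1/2)
      ((z + 1/2 + of_int n) + of_real (of_int m) * \<tau>) \<tau>"
    by (simp add: theta11_def algebra_simps)
  also have "\<dots> = E * (exp (of_real pi * \<i> * of_int n) * theta11 z \<tau>)"
    unfolding E_def by (subst theta_char_shift, subst theta_char_characteristic_add_int, subst theta_char_add_int) (simp add: theta11_def)
  also have "E = exp (- (of_real pi * \<i> * of_int (m\<^sup>2) * \<tau>) - 2 * of_real pi * \<i> * of_int m * z) *
      exp (of_real pi * \<i> * of_int (- m)) * exp (2 * of_real pi * \<i> * of_int (- m * n))"
    unfolding E_def exp_add[symmetric] by (rule arg_cong[where f = exp]) (simp add: algebra_simps)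
  finally show ?thesis
    unfolding exp_2pi_i_times_int exp_pi_i_times_int minus_one_powi_minus by (simp add: power_int_add)
qed

lemma theta_char_term_product_odd:
  "theta_char_term (1/2) (x + y + 1/2) \<tau> (p + r) * theta_char_term (1/2) (x - y + 1/2) \<tau> (p - r - 1) =
   theta_char_term 0 (2 * x) (2 * \<tau>) p * theta_char_term (1/2) (2 * y) (2 * \<tau>) r"
proof -
  define P R k where "P = complex_of_int p" and "R = complex_of_int r" and "k = of_real pi * \<i>"
  have exponents: "k * (P + R + h)\<^sup>2 * \<tau> + 2 * k * (P + R + h) * (x + y + h) +
      (k * (P - R - h)\<^sup>2 * \<tau> + 2 * k * (P - R - h) * (x - y + h)) =
      2 * k * P * (2 * h) + (k * P\<^sup>2 * (2 * \<tau>) + 2 * k * P * (2 * x) +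
      (k * (R + h)\<^sup>2 * (2 * \<tau>) + 2 * k * (R + h) * (2 * y)))" for h
    by (simp add: power2_eq_square algebra_simps)
  have casts: "complex_of_real (of_int (p + r) + 1/2) = P + R + 1/2"
    "complex_of_real (of_int (p - r - 1) + 1/2) = P - R - 1/2"
    "complex_of_real (of_int p + 0) = P" "complex_of_real (of_int r + 1/2) = R + 1/2"
    by (simp_all add: P_def R_def)
  have "exp (2 * k * P) = 1" using exp_2pi_i_times_int[of p] by (simp add: k_def P_def mult.assoc)
  hence "theta_char_term 0 (2 * x) (2 * \<tau>) p * theta_char_term (1/2) (2 * y) (2 * \<tau>) r =
      exp (2 * k * P) * (theta_char_term 0 (2 * x) (2 * \<tau>) p * theta_char_term (1/2) (2 * y) (2 * \<tau>) r)" by simp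
  also have "\<dots> = theta_char_term (1/2) (x + y + 1/2) \<tau> (p + r) * theta_char_term (1/2)
      (x - y + 1/2) \<tau> (p - r - 1)"
    unfolding theta_char_term_def casts mult.assoc[of 2 "of_real pi" \<i>] k_def[symmetric] exp_add[symmetric]
    by (subst exponents[of "1/2"]) simp
  finally show ?thesis by simp
qed

lemma theta_char_term_product_even:
  "theta_char_term (1/2) (x + y + 1/2) \<tau> (p + r) * theta_char_term (1/2) (x - y + 1/2) \<tau> (p - r) =
   - (theta_char_term (1/2) (2 * x) (2 * \<tau>) p * theta_char_term 0 (2 * y) (2 * \<tau>) r)"
proof -
  define P R k where "P = complex_of_int p" and "R = complex_of_int r" and "k = of_real pi * \<i>"
  have exponents: "k * (P + R + h)\<^sup>2 * \<tau> + 2 * k * (P + R + h) * (x + y + h) +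
      (k * (P - R + h)\<^sup>2 * \<tau> + 2 * k * (P - R + h) * (x - y + h)) =
      k * (2 * P + 2 * h) * (2 * h) + (k * (P + h)\<^sup>2 * (2 * \<tau>) + 2 * k * (P + h) * (2 * x) +
      (k * R\<^sup>2 * (2 * \<tau>) + 2 * k * R * (2 * y)))" for h
    by (simp add: power2_eq_square algebra_simps)
  have casts: "complex_of_real (of_int (p + r) + 1/2) = P + R + 1/2"
    "complex_of_real (of_int (p - r) + 1/2) = P - R + 1/2"
    "complex_of_real (of_int r + 0) = R" "complex_of_real (of_int p + 1/2) = P + 1/2"
    by (simp_all add: P_def R_def)
  have "exp (k * (2 * P + 1)) = (- 1) powi (2 * p + 1)"
    using exp_pi_i_times_int[of "2 * p + 1"] by (simp add: k_def P_def)
  hence "exp (k * (2 * P + 1)) = - 1" by (simp add: power_int_add power_int_mult)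
  hence "- (theta_char_term (1/2) (2 * x) (2 * \<tau>) p * theta_char_term 0 (2 * y) (2 * \<tau>) r) =
      exp (k * (2 * P + 1)) * (theta_char_term (1/2) (2 * x) (2 * \<tau>) p * theta_char_term 0 (2 * y) (2 * \<tau>) r)"
        by simp
  also have "\<dots> = theta_char_term (1/2) (x + y + 1/2) \<tau> (p + r) * theta_char_term (1/2) (x - y + 1/2) \<tau> (p - r)"
    unfolding theta_char_term_def casts mult.assoc[of 2 "of_real pi" \<i>] k_def[symmetric] exp_add[symmetric]
    by (subst exponents[of "1/2"]) simp
  finally show ?thesis by simp
qed

lemma has_sum_product_abs:
  fixes f :: "'a \<Rightarrow> complex" and g :: "'b \<Rightarrow> complex"
  assumes f: "(\<lambda>x. norm (f x)) summable_on A" and g: "(\<lambda>y. norm (g y)) summable_on B"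
  shows "((\<lambda>(x, y). f x * g y) has_sum (infsum f A * infsum g B)) (A \<times> B)"
proof -
  define S where "S = (\<Sum>\<^sub>\<infinity>y\<in>B. norm (g y))"
  have "S \<ge> 0" unfolding S_def by (rule infsum_nonneg) simp
  hence "norm (\<Sum>\<^sub>\<infinity>y\<in>B. norm (f x * g y)) = norm (f x) * S" for x
    unfolding norm_mult infsum_cmult_right' S_def[symmetric] by (simp add: abs_mult)
  hence "(\<lambda>p. norm ((\<lambda>(x, y). f x * g y) p)) summable_on A \<times> B"
    using f g by (subst Infinite_Sum.abs_summable_on_Sigma_iff)
      (auto simp: norm_mult intro!: summable_on_cmult_right summable_on_cmult_left)
  hence summable: "(\<lambda>(x, y). f x * g y) summable_on A \<times> B" by (rule abs_summable_summable)
  have "infsum (\<lambda>(x, y). f x * g y) (A \<times> B) = (\<Sum>\<^sub>\<infinity>x\<in>A. \<Sum>\<^sub>\<infinity>y\<in>B. f x * g y)"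
    by (subst infsum_Sigma'_banach[symmetric]) (use summable in auto)
  also have "\<dots> = infsum f A * infsum g B" by (simp add: infsum_cmult_right' infsum_cmult_left')
  finally show ?thesis using summable by (simp add: has_sum_infsum summable_iff_has_sum_infsum)
qed

lemma has_sum_int_pairs_by_parity:
  fixes f :: "int \<times> int \<Rightarrow> 'a :: topological_comm_monoid_add"
  assumes odd: "((\<lambda>(p, r). f (p + r, p - r - 1)) has_sum s) UNIV"
    and even: "((\<lambda>(p, r). f (p + r, p - r)) has_sum t) UNIV"
  shows "(f has_sum (s + t)) UNIV"
proof -
  define od ev :: "int \<times> int \<Rightarrow> int \<times> int" where "od = (\<lambda>(p, r). (p + r, p - r - 1))"
    and "ev = (\<lambda>(p, r). (p + r, p - r))"
  have "inj od" "inj ev" by (auto simp: od_def ev_def inj_def)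
  moreover have "((f \<circ> od) has_sum s) UNIV" "((f \<circ> ev) has_sum t) UNIV"
    using odd even by (simp_all add: od_def ev_def o_def case_prod_unfold)
  ultimately have sums: "(f has_sum s) (range od)" "(f has_sum t) (range ev)"
    by (simp_all add: has_sum_reindex)
  have "od u \<noteq> ev v" for u v by (cases u; cases v) (simp add: od_def ev_def, presburger)
  hence disj: "range od \<inter> range ev = {}" by blast
  have "(n, m) \<in> range od \<union> range ev" for n m
  proof (cases "Parity.even (n + m)")
    case True
    hence "(n + m) div 2 + (n - m) div 2 = n" "(n + m) div 2 - (n - m) div 2 = m" by presburger+
    hence "(n, m) = ev ((n + m) div 2, (n - m) div 2)" unfolding ev_def by simp
    thus ?thesis by blast
  next
    case False
    hence "(n + m + 1) div 2 + (n - m - 1) div 2 = n" "(n + m + 1) div 2 - (n - m - 1) div 2 - 1 = m"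
      by presburger+
    hence "(n, m) = od ((n + m + 1) div 2, (n - m - 1) div 2)" unfolding od_def by simp
    thus ?thesis by blast
  qed
  hence "range od \<union> range ev = UNIV" by auto
  thus ?thesis using has_sum_Un_disjoint[OF sums disj] by simp
qed

lemma theta11_product:
  assumes "Im \<tau> > 0"
  shows "theta11 (x + y) \<tau> * theta11 (x - y) \<tau> =
     theta_char 0 (2 * x) (2 * \<tau>) * theta_char (1/2) (2 * y) (2 * \<tau>) -
     theta_char (1/2) (2 * x) (2 * \<tau>) * theta_char 0 (2 * y) (2 * \<tau>)"
proof -
  define f where "f = (\<lambda>(n, m). theta_char_term (1/2) (x + y + 1/2) \<tau> n * theta_char_term (1/2)
      (x - y + 1/2) \<tau> m)"
  have product: "((\<lambda>(n, m). theta_char_term a z t n * theta_char_term b w t m) has_sum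
      (theta_char a z t * theta_char b w t)) UNIV" if "Im t > 0" for a b z w t
    using has_sum_product_abs[of "theta_char_term a z t" UNIV "theta_char_term b w t" UNIV]
      theta_char_term_abs_summable[OF that] by (simp add: theta_char_def)
  have "((\<lambda>(p, r). f (p + r, p - r - 1)) has_sum (theta_char 0 (2 * x)
      (2 * \<tau>) * theta_char (1/2) (2 * y) (2 * \<tau>))) UNIV"
    unfolding f_def prod.case theta_char_term_product_odd by (rule product) (use assms in simp)
  moreover have "((\<lambda>(p, r). f (p + r, p - r)) has_sum -
      (theta_char (1/2) (2 * x) (2 * \<tau>) * theta_char 0 (2 * y) (2 * \<tau>))) UNIV"
    using product[of "2 * \<tau>" "1/2" "2 * x" 0 "2 * y"] assms
    unfolding f_def prod.case theta_char_term_product_even by (simp add: case_prod_unfold has_sum_uminus)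
  ultimately have "(f has_sum (theta_char 0 (2 * x) (2 * \<tau>) * theta_char (1/2) (2 * y) (2 * \<tau>) +
      - (theta_char (1/2) (2 * x) (2 * \<tau>) * theta_char 0 (2 * y) (2 * \<tau>)))) UNIV"
    by (rule has_sum_int_pairs_by_parity)
  moreover have "(f has_sum (theta11 (x + y) \<tau> * theta11 (x - y) \<tau>)) UNIV"
    unfolding f_def theta11_def by (rule product[OF assms])
  ultimately show ?thesis using has_sum_unique by fastforce
qed

lemma theta_char_half_even: "theta_char (1/2) (- x) \<tau> = theta_char (1/2) x \<tau>"
  using theta_char_minus[of "-(1/2)" x \<tau>] theta_char_characteristic_add_int[of "-(1/2)" 1] by simp

lemma theta_char_zero_even: "theta_char 0 (- x) \<tau> = theta_char 0 x \<tau>"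
  using theta_char_minus[of 0 x \<tau>] by simp

lemma theta11_duplication:
  assumes "Im \<tau> > 0"
  shows "theta11 z \<tau> * theta11 (z + 1/2) \<tau> = theta11 (2 * z) (2 * \<tau>) * (- theta_char 0 (1/2) (2 * \<tau>))"
proof -
  have "theta_char (1/2) (1/2) (2 * \<tau>) = theta_char (1/2) (- (1/2) + of_int 1) (2 * \<tau>)" by simp
  also have "\<dots> = - theta_char (1/2) (1/2) (2 * \<tau>)"
    by (subst theta_char_add_int) (simp add: theta_char_half_even)
  finally have vanishing: "theta_char (1/2) (1/2) (2 * \<tau>) = 0" by simp
  have "theta11 z \<tau> * theta11 (z + 1/2) \<tau> = theta11 ((z + 1/4) + 1/4) \<tau> * theta11 ((z + 1/4) - 1/4) \<tau>"
    by (simp add: mult.commute add.commute)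
  also have "\<dots> = - (theta_char (1/2) (2 * (z + 1/4)) (2 * \<tau>) * theta_char 0 (2 * (1/4)) (2 * \<tau>))"
    by (subst theta11_product[OF assms]) (use vanishing in simp)
  also have "theta_char (1/2) (2 * (z + 1/4)) (2 * \<tau>) = theta11 (2 * z) (2 * \<tau>)"
    by (simp add: theta11_def algebra_simps)
  finally show ?thesis by simp
qed

section \<open>Zeros and modular transformation of the theta function\<close>

lemma entire_eventually_nonzero:
  assumes "f holomorphic_on UNIV" "f z0 \<noteq> 0"
  shows "eventually (\<lambda>w. f w \<noteq> 0) (at p)"
  using non_zero_neighbour_alt[OF assms(1), of p z0] assms(2)
  by (auto elim!: eventually_mono)

lemma entire_zorder_facts:
  assumes "f holomorphic_on UNIV" "f z0 \<noteq> 0"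
  shows "isolated_singularity_at f p" "not_essential f p" "frequently (\<lambda>w. f w \<noteq> 0) (at p)"
    "zorder f p \<ge> 0" "f meromorphic_on {p}"
proof -
  have analytic: "f analytic_on {p}" using assms(1) by (metis UNIV_I analytic_at open_UNIV)
  show "isolated_singularity_at f p" "not_essential f p"
    using analytic isolated_singularity_at_analytic not_essential_analytic by blast+
  show frequently: "frequently (\<lambda>w. f w \<noteq> 0) (at p)"
    using entire_eventually_nonzero[OF assms] by (simp add: eventually_frequently)
  show "zorder f p \<ge> 0" by (rule zorder_ge_0[OF analytic frequently])
  show "f meromorphic_on {p}" by (rule analytic_on_imp_meromorphic_on[OF analytic])
qed

lemma zorder_translate: "zorder (\<lambda>z. f (z + c)) p = zorder f (p + c)" for c p :: complex
  by (subst (1 2) zorder_shift) (simp add: add_ac)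

lemma eventually_eq_at_imp_eq:
  fixes u v :: "'a :: {perfect_space, t2_space} \<Rightarrow> 'b :: t2_space"
  assumes "isCont u p" "isCont v p" "eventually (\<lambda>w. u w = v w) (at p)"
  shows "u p = v p"
proof -
  have "v \<midarrow>p\<rightarrow> u p" using assms(1,3) unfolding isCont_def by (rule Lim_transform_eventually)
  thus ?thesis using assms(2) unfolding isCont_def by (rule LIM_unique)
qed

lemma entire_imp_isCont:
  assumes "f holomorphic_on UNIV"
  shows "isCont f p"
  using holomorphic_on_imp_continuous_on[OF assms] by (simp add: continuous_on_eq_continuous_at)

lemma entire_quotient:
  assumes f: "f holomorphic_on UNIV" and g: "g holomorphic_on UNIV" and nonzero: "f z1 \<noteq> 0" "g z2 \<noteq> 0"
    and ord: "\<And>p. zorder g p \<le> zorder f p"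
  obtains h where "h holomorphic_on UNIV" "\<And>z. f z = h z * g z"
proof -
  note f_facts = entire_zorder_facts[OF f nonzero(1)] and g_facts = entire_zorder_facts[OF g nonzero(2)]
  define h where "h = remove_sings (\<lambda>z. f z / g z)"
  have "h analytic_on {p}" for p
  proof -
    have iso: "isolated_singularity_at (\<lambda>z. f z / g z) p" and "not_essential (\<lambda>z. f z / g z) p"
      using isolated_singularity_at_divide[of f p g] not_essential_divide[of f p g] f_facts g_facts by blast+
    moreover have "zorder (\<lambda>z. f z / g z) p = zorder f p - zorder g p"
      using zorder_divide f_facts g_facts by blast
    hence "\<not> is_pole (\<lambda>z. f z / g z) p"
      using isolated_pole_imp_neg_zorder[OF iso] ord[of p] by fastforce
    ultimately obtain l where "(\<lambda>z. f z / g z) \<midarrow>p\<rightarrow> l" unfolding not_essential_def by blast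
    thus ?thesis unfolding h_def using iso by (rule remove_sings_analytic_at[rotated])
  qed
  hence h: "h holomorphic_on UNIV" using analytic_imp_holomorphic analytic_on_analytic_at by blast
  have h_eq: "h w = f w / g w" if "g w \<noteq> 0" for w
  proof -
    have "(\<lambda>z. f z / g z) analytic_on {w}"
      using f g that by (intro analytic_intros) (auto simp: analytic_on_holomorphic intro: exI[of _ UNIV])
    thus ?thesis by (simp add: h_def)
  qed
  have "f p = h p * g p" for p
  proof (rule eventually_eq_at_imp_eq[where u = f and v = "\<lambda>w. h w * g w"])
    show "eventually (\<lambda>w. f w = h w * g w) (at p)"
      using entire_eventually_nonzero[OF g nonzero(2)] by eventually_elim (simp add: h_eq)
  qed (intro continuous_intros entire_imp_isCont f g h)+
  thus ?thesis using that h by blast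
qed

lemma norm_doubly_periodic_entire_constant:
  assumes h: "h holomorphic_on UNIV" and \<tau>: "Im \<tau> > 0"
    and periodic: "\<And>m n z. norm (h (z + of_int m * \<tau> + of_int n)) = norm (h z)"
  obtains c where "\<And>z. h z = c"
proof -
  define K where "K = (\<lambda>(x, y). of_real x + of_real y * \<tau>) ` ({0..1} \<times> {0..1::real})"
  have "compact K" unfolding K_def
    by (intro compact_continuous_image compact_Times compact_Icc)
       (auto simp: case_prod_unfold intro!: continuous_intros)
  hence "bounded (h ` K)"
    using h by (meson compact_continuous_image compact_imp_bounded holomorphic_on_imp_continuous_on
        holomorphic_on_subset top_greatest)
  then obtain B where B: "\<And>w. w \<in> K \<Longrightarrow> norm (h w) \<le> B" unfolding bounded_iff by blast
  have "norm (h z) \<le> B" for z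
  proof -
    define y where "y = Im z / Im \<tau>"
    define x where "x = Re z - y * Re \<tau>"
    have "z = of_real x + of_real y * \<tau>" using \<tau> by (simp add: complex_eq_iff x_def y_def)
    hence "z + of_int (- \<lfloor>y\<rfloor>) * \<tau> + of_int (- \<lfloor>x\<rfloor>) = of_real (frac x) + of_real (frac y) * \<tau>"
      by (simp add: frac_def algebra_simps)
    also have "\<dots> \<in> K"
      unfolding K_def by (rule image_eqI[of _ _ "(frac x, frac y)"])
        (auto simp: frac_ge_0 less_imp_le[OF frac_lt_1])
    finally show ?thesis using B periodic[of z "- \<lfloor>y\<rfloor>" "- \<lfloor>x\<rfloor>"] by fastforce
  qed
  hence "bounded (range h)" unfolding bounded_iff by blast
  thus ?thesis using Liouville_theorem[OF h] that unfolding constant_on_def by blast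
qed

lemma entire_ratio_constant:
  fixes f g :: "complex \<Rightarrow> complex"
  assumes f: "f holomorphic_on UNIV" and g: "g holomorphic_on UNIV" and nonzero: "f z1 \<noteq> 0" "g z2 \<noteq> 0"
    and ord: "\<And>p. zorder g p \<le> zorder f p" and \<tau>: "Im \<tau> > 0"
    and factor: "\<And>m n z. norm (f (z + of_int m * \<tau> + of_int n)) * norm (g z) =
                            norm (g (z + of_int m * \<tau> + of_int n)) * norm (f z)"
  obtains c where "\<And>z. f z = c * g z"
proof -
  obtain h where h: "h holomorphic_on UNIV" "\<And>z. f z = h z * g z"
    using entire_quotient[OF f g nonzero ord] by blast
  have "norm (h (p + of_int m * \<tau> + of_int n)) = norm (h p)" for p m n
  proof (rule eventually_eq_at_imp_eq[where u = "\<lambda>w. norm (h (w + of_int m * \<tau> + of_int n))" and v = "\<lambda>w. norm (h w)"])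
    define \<omega> where "\<omega> = of_int m * \<tau> + of_int n"
    have "eventually (\<lambda>w. g w \<noteq> 0) (at (p + \<omega>))" by (rule entire_eventually_nonzero[OF g nonzero(2)])
    hence "eventually (\<lambda>w. g (w + \<omega>) \<noteq> 0) (at p)"
      unfolding eventually_at_to_0[of _ "p + \<omega>"] eventually_at_to_0[of _ p] by (simp add: add_ac)
    with entire_eventually_nonzero[OF g nonzero(2), of p]
    show "eventually (\<lambda>w. norm (h (w + of_int m * \<tau> + of_int n)) = norm (h w)) (at p)"
    proof eventually_elim
      case (elim w)
      thus ?case using factor[of w m n] by (simp add: h(2) norm_mult \<omega>_def add.assoc)
    qed
    show "isCont (\<lambda>w. norm (h (w + of_int m * \<tau> + of_int n))) p"
      by (intro continuous_intros
        isCont_o2[OF _ entire_imp_isCont[OF h(1)], of p "\<lambda>w. w + of_int m * \<tau> + of_int n"])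
  qed (intro continuous_intros entire_imp_isCont h)
  then obtain c where "\<And>z. h z = c" using norm_doubly_periodic_entire_constant[OF h(1) \<tau>] by blast
  thus ?thesis using that h(2) by metis
qed

lemma infsum_finite_sum:
  fixes f :: "'j \<Rightarrow> 'i \<Rightarrow> 'a :: {topological_comm_monoid_add, t2_space}"
  assumes "finite J" "\<And>j. j \<in> J \<Longrightarrow> f j summable_on A"
  shows "(\<Sum>\<^sub>\<infinity>n\<in>A. \<Sum>j\<in>J. f j n) = (\<Sum>j\<in>J. infsum (f j) A)"
proof -
  have "(\<Sum>\<^sub>\<infinity>n\<in>A. \<Sum>j\<in>J. f j n) = (\<Sum>j\<in>J. infsum (f j) A) \<and> (\<lambda>n. \<Sum>j\<in>J. f j n) summable_on A"
    using assms by (induction rule: finite_induct) (auto simp: infsum_add summable_on_add)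
  thus ?thesis by blast
qed

lemma theta_char_average:
  assumes "Im \<tau> > 0" "N > 0"
  shows "(\<Sum>j<N. exp (- (2 * of_real pi * \<i> * of_real a * of_nat j / of_nat N)) *
      theta_char a (of_nat j / of_nat N) \<tau>) =
    of_nat N * infsum (theta_char_term a 0 \<tau>) {n. int N dvd n}"
proof -
  define t where "t = theta_char_term a 0 \<tau>"
  have "exp (- (2 * of_real pi * \<i> * of_real a * of_nat j / of_nat N)) *
      theta_char_term a (of_nat j / of_nat N) \<tau> n =
      t n * zeta N (n * int j)" for n j
    unfolding t_def theta_char_term_def zeta_def to_q_def exp_add[symmetric]
    by (rule arg_cong[where f = exp]) (simp add: field_simps add_divide_distrib)
  hence "(\<Sum>j<N. exp (- (2 * of_real pi * \<i> * of_real a * of_nat j / of_nat N)) *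
      theta_char a (of_nat j / of_nat N) \<tau>) =
      (\<Sum>j<N. \<Sum>\<^sub>\<infinity>n. t n * zeta N (n * int j))"
    unfolding theta_char_def by (simp add: infsum_cmult_right'[symmetric])
  also have "\<dots> = (\<Sum>\<^sub>\<infinity>n. \<Sum>j<N. t n * zeta N (n * int j))"
  proof (rule infsum_finite_sum[symmetric])
    fix j
    have "(\<lambda>n. norm (t n * zeta N (n * int j))) summable_on UNIV"
      using theta_char_term_abs_summable[OF assms(1)] by (simp add: t_def norm_mult zeta_def norm_to_q)
    thus "(\<lambda>n. t n * zeta N (n * int j)) summable_on UNIV" by (rule abs_summable_summable)
  qed simp
  also have "\<dots> = (\<Sum>\<^sub>\<infinity>n. of_nat N * (if int N dvd n then t n else 0))"
    unfolding sum_distrib_left[symmetric] sum_zeta[OF assms(2)] by (intro infsum_cong) simp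
  also have "\<dots> = of_nat N * infsum (\<lambda>n. if int N dvd n then t n else 0) UNIV"
    by (rule infsum_cmult_right')
  also have "infsum (\<lambda>n. if int N dvd n then t n else 0) UNIV = infsum t {n. int N dvd n}"
    by (rule infsum_cong_neutral) auto
  finally show ?thesis by (simp add: t_def)
qed

text \<open>For large \<open>N\<close> the sum over the nonzero multiples of \<open>N\<close> is smaller than any given positive number.\<close>

lemma infsum_multiples_eq_0_imp_0:
  fixes t :: "int \<Rightarrow> complex"
  assumes summable: "(\<lambda>n. norm (t n)) summable_on UNIV"
    and zero: "\<And>N::nat. N > 0 \<Longrightarrow> infsum t {n. int N dvd n} = 0"
  shows "t 0 = 0"
proof (rule ccontr)
  assume t0: "t 0 \<noteq> 0"
  define S where "S = (\<Sum>\<^sub>\<infinity>n. norm (t n))"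
  have "((\<lambda>n. norm (t n)) has_sum S) UNIV" unfolding S_def using summable by simp
  hence "\<forall>\<^sub>F F in finite_subsets_at_top UNIV. dist (\<Sum>n\<in>F. norm (t n)) S < norm (t 0)"
    unfolding has_sum_def tendsto_iff using t0 by simp
  then obtain F where F: "finite F" "dist (\<Sum>n\<in>F. norm (t n)) S < norm (t 0)"
    unfolding eventually_finite_subsets_at_top by blast
  define N where "N = nat (Max (insert 0 (abs ` F))) + 1"
  have N: "\<bar>n\<bar> < int N" if "n \<in> F" for n
  proof -
    have "\<bar>n\<bar> \<le> Max (insert 0 (abs ` F))" "0 \<le> Max (insert 0 (abs ` F))" using F(1) that
      by (auto intro!: Max_ge)
    thus ?thesis by (simp add: N_def)
  qed
  define D where "D = {n. int N dvd n} - {0}"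
  have "int N \<le> \<bar>n\<bar>" if "n \<in> D" for n using dvd_imp_le_int[of n "int N"] that by (simp add: D_def)
  hence D: "D \<inter> F = {}" using N by force
  have "0 = infsum t (D \<union> {0})" using zero[of N] by (simp add: D_def N_def insert_absorb)
  also have "\<dots> = infsum t D + t 0"
    using abs_summable_summable[OF summable]
    by (subst infsum_Un_disjoint) (auto simp: D_def intro: summable_on_subset_banach)
  finally have "norm (t 0) = norm (infsum t D)" by (metis add.inverse_unique norm_minus_cancel)
  also have "\<dots> \<le> infsum (\<lambda>n. norm (t n)) D"
    by (rule norm_infsum_bound) (use summable summable_on_subset_banach in blast)
  also have "\<dots> \<le> infsum (\<lambda>n. norm (t n)) (- F)"
    by (rule infsum_mono2) (use D summable_on_subset_banach[OF summable] in auto)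
  also have "\<dots> = S - (\<Sum>n\<in>F. norm (t n))"
    unfolding S_def Compl_eq_Diff_UNIV by (subst infsum_Diff) (use summable F in auto)
  also have "\<dots> < norm (t 0)" using F(2) by (simp add: dist_real_def abs_if split: if_splits)
  finally show False by simp
qed

lemma theta_char_not_identically_zero:
  assumes "Im \<tau> > 0"
  obtains z where "theta_char a z \<tau> \<noteq> 0"
proof (rule ccontr)
  assume "\<not> thesis"
  hence "theta_char a z \<tau> = 0" for z using that by blast
  hence "infsum (theta_char_term a 0 \<tau>) {n. int N dvd n} = 0" if "N > 0" for N
    using theta_char_average[OF assms that, of a] that by simp
  hence "theta_char_term a 0 \<tau> 0 = 0"
    using infsum_multiples_eq_0_imp_0[OF theta_char_term_abs_summable[OF assms]] by blast
  thus False by (simp add: theta_char_term_def)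
qed

lemma theta11_not_identically_zero:
  assumes "Im \<tau> > 0"
  obtains z where "theta11 z \<tau> \<noteq> 0"
proof -
  obtain z where "theta_char (1/2) z \<tau> \<noteq> 0" using theta_char_not_identically_zero[OF assms] .
  hence "theta11 (z - 1/2) \<tau> \<noteq> 0" by (simp add: theta11_def)
  thus ?thesis using that by blast
qed

lemma nonneg_arithmetic_progression_constant:
  fixes d :: "int \<Rightarrow> int"
  assumes linear: "\<And>k. d (k + 1) + d (k - 1) = 2 * d k" and nonneg: "\<And>k. d k \<ge> 0"
  shows "d 1 = d 0"
proof -
  define e where "e = d 1 - d 0"
  have "d (k + 1) - d k = e \<and> d k = d 0 + k * e" for k
  proof (induction k rule: int_induct[where k = 0])
    case (step1 i)
    thus ?case using linear[of "i + 1"] by (simp add: algebra_simps)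
  next
    case (step2 i)
    thus ?case using linear[of i] by (simp add: algebra_simps)
  qed (simp add: e_def)
  hence "0 \<le> d 0 + (d 0 + 1) * e" "0 \<le> d 0 - (d 0 + 1) * e"
    using nonneg[of "d 0 + 1"] nonneg[of "- (d 0 + 1)"] by (metis, metis mult_minus_left add_uminus_conv_diff)
  hence "(d 0 + 1) * \<bar>e\<bar> < (d 0 + 1) * 1" by (cases "e \<ge> 0") simp_all
  hence "e = 0" using nonneg[of 0] by (subst (asm) mult_less_cancel_left) auto
  thus ?thesis by (simp add: e_def)
qed

definition theta_factor :: "complex \<Rightarrow> int \<Rightarrow> int \<Rightarrow> complex \<Rightarrow> complex" where
  "theta_factor \<tau> m n z = (- 1) powi (m + n) *
      exp (- (of_real pi * \<i> * of_int (m\<^sup>2) * \<tau>) - 2 * of_real pi * \<i> * of_int m * z)"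

lemma theta_factor_nonzero [simp]: "theta_factor \<tau> m n z \<noteq> 0"
  by (simp add: theta_factor_def)

lemma theta_factor_entire: "theta_factor \<tau> m n holomorphic_on UNIV"
  unfolding theta_factor_def by (intro holomorphic_intros)

lemmas theta11_lattice_translate = theta11_quasi[folded theta_factor_def]

lemma theta11_shift_entire: "Im \<tau> > 0 \<Longrightarrow> (\<lambda>z. theta11 (z + c) \<tau>) holomorphic_on UNIV"
  using holomorphic_on_compose[of "\<lambda>z. z + c" UNIV "\<lambda>z. theta11 z \<tau>"] theta11_entire
  by (simp add: o_def holomorphic_intros)

text \<open>At a zero \<open>z\<^sub>0\<close> the two sections \<open>theta_char 0 (2 z) (2 \<tau>)\<close> and \<open>theta_char (1/2) (2 z) (2 \<tau>)\<close> have
  proportional values at \<open>0\<close> and \<open>z\<^sub>0\<close>.\<close>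

lemma theta11_zero_symmetric_product:
  assumes \<tau>: "Im \<tau> > 0" and z0: "theta11 z0 \<tau> = 0"
  obtains c where "\<And>z. theta11 (z + z0) \<tau> * theta11 (z + - z0) \<tau> = c * (theta11 z \<tau> * theta11 z \<tau>)"
proof -
  define A where "A = (\<lambda>x. theta_char 0 (2 * x) (2 * \<tau>))"
  define B where "B = (\<lambda>x. theta_char (1/2) (2 * x) (2 * \<tau>))"
  have prod: "theta11 (x + y) \<tau> * theta11 (x - y) \<tau> = A x * B y - B x * A y" for x y
    unfolding A_def B_def by (rule theta11_product[OF \<tau>])
  have proportional: "A 0 * B z0 = B 0 * A z0" using prod[of 0 z0] z0 by simp
  obtain z1 where "theta11 z1 \<tau> \<noteq> 0" using theta11_not_identically_zero[OF \<tau>] .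
  hence "A 0 \<noteq> 0 \<or> B 0 \<noteq> 0" using prod[of z1 0] by auto
  then obtain c where c: "A z0 = c * A 0" "B z0 = c * B 0"
  proof
    assume "A 0 \<noteq> 0"
    thus ?thesis using that[of "A z0 / A 0"] proportional by (simp add: field_simps)
  next
    assume "B 0 \<noteq> 0"
    thus ?thesis using that[of "B z0 / B 0"] proportional by (simp add: field_simps)
  qed
  have "theta11 (z + z0) \<tau> * theta11 (z + - z0) \<tau> = c * (theta11 z \<tau> * theta11 z \<tau>)" for z
  proof -
    have "theta11 (z + z0) \<tau> * theta11 (z + - z0) \<tau> = c * (A z * B 0 - B z * A 0)"
      using prod[of z z0] c by (simp add: algebra_simps)
    thus ?thesis using prod[of z 0] by simp
  qed
  thus ?thesis by (rule that)
qed

lemma zorder_theta11_translate_zero: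
  assumes \<tau>: "Im \<tau> > 0" and z0: "theta11 z0 \<tau> = 0"
  shows "zorder (\<lambda>z. theta11 z \<tau>) (p + z0) = zorder (\<lambda>z. theta11 z \<tau>) p"
proof -
  let ?\<theta> = "\<lambda>z. theta11 z \<tau>"
  obtain z1 where z1: "theta11 z1 \<tau> \<noteq> 0" using theta11_not_identically_zero[OF \<tau>] .
  have shift: "eventually (\<lambda>z. theta11 (z + c) \<tau> \<noteq> 0) (at p)" "frequently (\<lambda>z. theta11 (z + c) \<tau> \<noteq> 0) (at p)"
    "(\<lambda>z. theta11 (z + c) \<tau>) meromorphic_on {p}" for c p
    using entire_zorder_facts[OF theta11_shift_entire[OF \<tau>], of "z1 - c" c]
      entire_eventually_nonzero[OF theta11_shift_entire[OF \<tau>], of "z1 - c" c] z1 by auto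
  obtain c where c: "\<And>z. theta11 (z + z0) \<tau> * theta11 (z + - z0) \<tau> = c * (theta11 z \<tau> * theta11 z \<tau>)"
    using theta11_zero_symmetric_product[OF assms] by blast
  have "eventually (\<lambda>z. theta11 (z + z0) \<tau> * theta11 (z + - z0) \<tau> \<noteq> 0) (at 0)"
    using shift(1)[of z0 0] shift(1)[of "- z0" 0] by eventually_elim simp
  hence "c \<noteq> 0" unfolding c by (auto dest: eventually_happens)
  have "zorder ?\<theta> (p + z0) + zorder ?\<theta> (p - z0) = 2 * zorder ?\<theta> p" for p
  proof -
    have "zorder ?\<theta> (p + z0) + zorder ?\<theta> (p - z0) = zorder (\<lambda>z. theta11 (z + z0) \<tau> * theta11 (z + - z0) \<tau>) p"
      using zorder_mult[OF shift(3,2) shift(3,2), of z0 "- z0" p]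
        zorder_translate[of ?\<theta> z0 p] zorder_translate[of ?\<theta> "- z0" p] by simp
    also have "\<dots> = zorder (\<lambda>z. theta11 z \<tau> * theta11 z \<tau>) p" unfolding c by (rule zorder_cmult[OF \<open>c \<noteq> 0\<close>])
    also have "\<dots> = 2 * zorder ?\<theta> p"
      using zorder_mult[OF shift(3,2) shift(3,2), of 0 0 p] by simp
    finally show ?thesis .
  qed
  from this[of "p + of_int _ * z0"] show ?thesis
    using nonneg_arithmetic_progression_constant[of "\<lambda>k. zorder ?\<theta> (p + of_int k * z0)"]
      entire_zorder_facts(4)[OF theta11_entire[OF \<tau>] z1] by (simp add: algebra_simps)
qed

lemma zorder_exp_theta11_translate_zero:
  assumes \<tau>: "Im \<tau> > 0" and z0: "theta11 z0 \<tau> = 0"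
  shows "zorder (\<lambda>z. exp (a * z) * theta11 (z + z0) \<tau>) p = zorder (\<lambda>z. theta11 z \<tau>) p"
proof -
  obtain z1 where z1: "theta11 z1 \<tau> \<noteq> 0" using theta11_not_identically_zero[OF \<tau>] .
  have exp_entire: "(\<lambda>z. exp (a * z)) holomorphic_on UNIV" by (intro holomorphic_intros)
  have "zorder (\<lambda>z. exp (a * z) * theta11 (z + z0) \<tau>) p =
      zorder (\<lambda>z. exp (a * z)) p + zorder (\<lambda>z. theta11 (z + z0) \<tau>) p"
    using entire_zorder_facts[OF exp_entire, of 0] z1
      entire_zorder_facts[OF theta11_shift_entire[OF \<tau>], of "z1 - z0" z0] by (intro zorder_mult) auto
  moreover have "zorder (\<lambda>z. exp (a * z)) p = 0" by (rule zorder_eq_0I) (auto intro!: analytic_intros)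
  ultimately show ?thesis
    using zorder_theta11_translate_zero[OF assms, of p] by (simp add: zorder_translate[of "\<lambda>z. theta11 z \<tau>"])
qed

lemma exp_theta11_lattice_translate:
  fixes \<rho> \<sigma> :: real
  assumes "z0 = of_real \<rho> * \<tau> + of_real \<sigma>"
  shows "exp (2 * of_real pi * \<i> * of_real \<rho> * (z + of_int m * \<tau> + of_int n)) *
      theta11 (z + of_int m * \<tau> + of_int n + z0) \<tau> =
    theta_factor \<tau> m n z * exp (2 * of_real pi * \<i> * of_real (of_int n * \<rho> - of_int m * \<sigma>)) *
      (exp (2 * of_real pi * \<i> * of_real \<rho> * z) * theta11 (z + z0) \<tau>)"
proof -
  have "exp (2 * of_real pi * \<i> * of_real \<rho> * (z + of_int m * \<tau> + of_int n)) * theta_factor \<tau> m n (z + z0) =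
      theta_factor \<tau> m n z * exp (2 * of_real pi * \<i> * of_real (of_int n * \<rho> - of_int m * \<sigma>)) *
        exp (2 * of_real pi * \<i> * of_real \<rho> * z)"
    unfolding theta_factor_def mult.assoc[of _ "exp _"] mult.left_commute[of "exp _"] exp_add[symmetric]
    by (intro arg_cong2[where f = times] arg_cong[where f = exp] refl) (simp add: assms algebra_simps)
  thus ?thesis using theta11_lattice_translate[of "z + z0" m \<tau> n] by (simp add: add_ac)
qed

lemma exp_2pi_i_times_eq_1D:
  assumes "exp (2 * of_real pi * \<i> * of_real x) = 1"
  obtains n :: int where "x = of_int n"
proof -
  obtain n :: int where "2 * pi * x = of_int (2 * n) * pi" using assms unfolding exp_eq_1 by auto
  hence "2 * pi * x = 2 * pi * of_int n" by simp
  thus ?thesis using that unfolding mult_cancel_left by simp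
qed

text \<open>Writing \<open>z\<^sub>0 = \<rho> \<tau> + \<sigma>\<close>, the function \<open>exp (2 \<pi> \<i> \<rho> z) \<theta>(z + z\<^sub>0)\<close> has the zeros of \<open>\<theta>\<close> and, up to a
  unitary character, its automorphy factor. So it is a multiple of \<open>\<theta>\<close> and the character is trivial.\<close>

theorem theta11_zeros:
  assumes \<tau>: "Im \<tau> > 0" and z0: "theta11 z0 \<tau> = 0"
  shows "\<exists>m n. z0 = of_int m * \<tau> + of_int n"
proof -
  let ?\<theta> = "\<lambda>z. theta11 z \<tau>"
  obtain z1 where z1: "theta11 z1 \<tau> \<noteq> 0" using theta11_not_identically_zero[OF \<tau>] .
  define \<rho> where "\<rho> = Im z0 / Im \<tau>"
  define \<sigma> where "\<sigma> = Re z0 - \<rho> * Re \<tau>"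
  have z0_eq: "z0 = of_real \<rho> * \<tau> + of_real \<sigma>" using \<tau> by (simp add: complex_eq_iff \<rho>_def \<sigma>_def)
  define f where "f = (\<lambda>z. exp (2 * of_real pi * \<i> * of_real \<rho> * z) * theta11 (z + z0) \<tau>)"
  define \<kappa> where "\<kappa> m n = exp (2 * of_real pi * \<i> * of_real (of_int n * \<rho> - of_int m * \<sigma>))" for m n :: int
  have f_translate: "f (z + of_int m * \<tau> + of_int n) = theta_factor \<tau> m n z * \<kappa> m n * f z" for z m n
    unfolding f_def \<kappa>_def by (rule exp_theta11_lattice_translate[OF z0_eq])
  have f_entire: "f holomorphic_on UNIV" unfolding f_def
    by (intro holomorphic_intros theta11_shift_entire[OF \<tau>])
  have "zorder ?\<theta> p = zorder f p" for p
    unfolding f_def by (rule zorder_exp_theta11_translate_zero[OF assms, symmetric])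
  moreover have "norm (\<kappa> m n) = 1" for m n
    using norm_exp_i_times[of "2 * pi * (of_int n * \<rho> - of_int m * \<sigma>)"] by (simp add: \<kappa>_def mult_ac)
  hence "norm (f (z + of_int m * \<tau> + of_int n)) * norm (theta11 z \<tau>) =
      norm (theta11 (z + of_int m * \<tau> + of_int n) \<tau>) * norm (f z)" for m n z
    by (simp add: f_translate theta11_lattice_translate norm_mult)
  moreover have f_nonzero: "f (z1 - z0) \<noteq> 0" using z1 by (simp add: f_def)
  ultimately obtain c where c: "\<And>z. f z = c * theta11 z \<tau>"
    using entire_ratio_constant[OF f_entire theta11_entire[OF \<tau>] f_nonzero z1 _ \<tau>] order_eq_refl by metis
  have "c \<noteq> 0" using c f_nonzero by fastforce
  hence trivial: "\<kappa> m n = 1" for m n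
    using f_translate[of z1 m n] z1 by (simp add: c theta11_lattice_translate)
  then obtain m n :: int where "\<rho> = of_int m" "- \<sigma> = of_int n"
    using exp_2pi_i_times_eq_1D[of \<rho>] exp_2pi_i_times_eq_1D[of "- \<sigma>"] trivial[of 0 1] trivial[of 1 0]
    unfolding \<kappa>_def by (metis add_0 diff_0 diff_0_right mult_1 mult_zero_left of_int_0 of_int_1)
  moreover from this(2) have "\<sigma> = of_int (- n)" by simp
  ultimately have "z0 = of_int m * \<tau> + of_int (- n)" unfolding z0_eq by simp
  thus ?thesis by blast
qed

definition theta_like :: "complex \<Rightarrow> (complex \<Rightarrow> complex) \<Rightarrow> bool" where
  "theta_like \<tau> f \<longleftrightarrow> f holomorphic_on UNIV \<and> (\<exists>z. f z \<noteq> 0) \<and>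
     (\<forall>m n z. f (z + of_int m * \<tau> + of_int n) = theta_factor \<tau> m n z * f z) \<and>
     (\<forall>z. f z = 0 \<longrightarrow> (\<exists>m n. z = of_int m * \<tau> + of_int n))"

lemma theta_like_theta11:
  assumes "Im \<tau> > 0"
  shows "theta_like \<tau> (\<lambda>z. theta11 z \<tau>)"
proof -
  obtain z1 where "theta11 z1 \<tau> \<noteq> 0" using theta11_not_identically_zero[OF assms] .
  thus ?thesis
    using theta11_entire[OF assms] theta11_zeros[OF assms] theta11_lattice_translate
    unfolding theta_like_def by blast
qed

lemma theta_like_zorder_lattice:
  assumes "theta_like \<tau> f"
  shows "zorder f (of_int m * \<tau> + of_int n) = zorder f 0"
proof -
  have f: "f holomorphic_on UNIV"
    and translate: "f (z + (of_int m * \<tau> + of_int n)) = theta_factor \<tau> m n z * f z" for z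
    using assms unfolding theta_like_def by (blast, simp add: add.assoc)
  obtain z1 where z1: "f z1 \<noteq> 0" using assms unfolding theta_like_def by blast
  have "zorder f (0 + (of_int m * \<tau> + of_int n)) = zorder (\<lambda>z. theta_factor \<tau> m n z * f z) 0"
    by (subst zorder_translate[symmetric]) (simp add: translate)
  also have "\<dots> = zorder (theta_factor \<tau> m n) 0 + zorder f 0"
    using entire_zorder_facts[OF f z1] entire_zorder_facts[OF theta_factor_entire theta_factor_nonzero]
    by (intro zorder_mult) auto
  also have "zorder (theta_factor \<tau> m n) 0 = 0"
    using theta_factor_entire by (intro zorder_eq_0I) (auto simp: analytic_on_holomorphic)
  finally show ?thesis by simp
qed

lemma theta_like_zorder_le:
  assumes f: "theta_like \<tau> f" and g: "theta_like \<tau> g" and order_at_0: "zorder g 0 \<le> zorder f 0"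
  shows "zorder g p \<le> zorder f p"
proof (cases "g p = 0")
  case True
  then obtain m n where "p = of_int m * \<tau> + of_int n" using g unfolding theta_like_def by blast
  thus ?thesis using theta_like_zorder_lattice[OF f] theta_like_zorder_lattice[OF g] order_at_0 by simp
next
  case False
  have "g holomorphic_on UNIV" using g unfolding theta_like_def by blast
  hence "zorder g p = 0"
    using False by (intro zorder_eq_0I) (auto simp: analytic_on_holomorphic)
  moreover obtain z where "f z \<noteq> 0" "f holomorphic_on UNIV" using f unfolding theta_like_def by blast
  ultimately show ?thesis using entire_zorder_facts(4) by simp
qed

lemma theta_like_unique:
  assumes f: "theta_like \<tau> f" and g: "theta_like \<tau> g" and \<tau>: "Im \<tau> > 0"
  obtains c where "c \<noteq> 0" "\<And>z. f z = c * g z"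
proof -
  have multiple: "\<exists>c. c \<noteq> 0 \<and> (\<forall>z. f z = c * g z)"
    if f: "theta_like \<tau> f" and g: "theta_like \<tau> g" and order_at_0: "zorder g 0 \<le> zorder f 0" for f g
  proof -
    note theta_likeD = f[unfolded theta_like_def] g[unfolded theta_like_def]
    obtain z1 z2 where z12: "f z1 \<noteq> 0" "g z2 \<noteq> 0" using theta_likeD by blast
    have entire: "f holomorphic_on UNIV" "g holomorphic_on UNIV" using theta_likeD by blast+
    have "norm (f (z + of_int m * \<tau> + of_int n)) * norm (g z) =
        norm (g (z + of_int m * \<tau> + of_int n)) * norm (f z)" for m n z
      using theta_likeD by (simp add: norm_mult)
    then obtain c where "\<And>z. f z = c * g z"
      by (rule entire_ratio_constant[OF entire z12 theta_like_zorder_le[OF f g order_at_0] \<tau>]) blast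
    thus ?thesis using z12(1) by (metis mult_zero_left)
  qed
  show ?thesis
  proof (cases "zorder g 0 \<le> zorder f 0")
    case True
    thus ?thesis using multiple[OF f g] that by blast
  next
    case False
    then obtain c where c: "c \<noteq> 0" "\<And>z. g z = c * f z" using multiple[OF g f] by auto
    show ?thesis by (rule that[of "1 / c"]) (use c in auto)
  qed
qed

lemma minus_one_powi_cong: "(even m \<longleftrightarrow> even n) \<Longrightarrow> (- 1 :: complex) powi m = (- 1) powi n"
  unfolding zeta_2[symmetric] by (rule zeta_cong) simp_all

lemma theta_factor_moebius_exponent:
  fixes a b c d m n m' n' :: int and j t z \<tau> \<omega> :: complex
  assumes j: "j = of_int c * \<tau> + of_int d" "j \<noteq> 0" and t: "t * j = of_int a * \<tau> + of_int b"
    and \<omega>: "\<omega> = of_int m * \<tau> + of_int n" "\<omega> = (of_int m' * t + of_int n') * j" and m': "m' = d * m - c * n"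
  shows "of_int c * (z + \<omega>)\<^sup>2 / j + (of_int m')\<^sup>2 * t + 2 * of_int m' * (z / j) =
    of_int c * z\<^sup>2 / j + ((of_int m)\<^sup>2 * \<tau> + 2 * of_int m * z) + of_int (m * n - m' * n')"
proof -
  have lattice: "of_int c * \<omega> + of_int m' = of_int m * j" by (simp add: \<omega>(1) j(1) m' algebra_simps)
  have "(of_int c * (z + \<omega>)\<^sup>2 / j + (of_int m')\<^sup>2 * t + 2 * of_int m' * (z / j)) * j =
      of_int c * (z + \<omega>)\<^sup>2 + (of_int m')\<^sup>2 * (t * j) + 2 * of_int m' * z"
    using j(2) by (simp add: distrib_right mult.assoc)
  also have "\<dots> = of_int c * z\<^sup>2 + (2 * z + \<omega>) * (of_int c * \<omega> + of_int m') +
      of_int m' * (of_int m' * (t * j) - \<omega>)"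
    by (simp add: algebra_simps power2_eq_square)
  also have "of_int m' * (t * j) - \<omega> = - of_int n' * j" by (simp add: \<omega>(2) algebra_simps)
  also have "of_int c * z\<^sup>2 + (2 * z + \<omega>) * (of_int c * \<omega> + of_int m') + of_int m' * (- of_int n' * j) =
      (of_int c * z\<^sup>2 / j + ((of_int m)\<^sup>2 * \<tau> + 2 * of_int m * z) + of_int (m * n - m' * n')) * j"
    unfolding lattice using j(2) by (simp add: \<omega>(1) algebra_simps power2_eq_square)
  finally show ?thesis using j(2) by simp
qed

lemma theta_factor_moebius:
  fixes a b c d m n :: int
  assumes det: "a * d - b * c = 1" and j: "j = of_int c * \<tau> + of_int d" "j \<noteq> 0"
    and t: "t * j = of_int a * \<tau> + of_int b"
    and \<omega>: "\<omega> = of_int m * \<tau> + of_int n" and m': "m' = d * m - c * n" and n': "n' = a * n - b * m"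
  shows "\<omega> / j = of_int m' * t + of_int n'"
    "exp (- (of_real pi * \<i> * of_int c * (z + \<omega>)\<^sup>2 / j)) * theta_factor t m' n' (z / j) =
     theta_factor \<tau> m n z * exp (- (of_real pi * \<i> * of_int c * z\<^sup>2 / j))"
proof -
  have mn: "m = a * m' + c * n'" "n = b * m' + d * n'"
    using arg_cong[OF det, of "\<lambda>x. x * m"] arg_cong[OF det, of "\<lambda>x. x * n"]
    by (simp_all add: m' n' algebra_simps)
  have "(of_int m' * t + of_int n') * j = of_int m' * (t * j) + of_int n' * j" by (simp add: algebra_simps)
  also have "\<dots> = of_int (a * m' + c * n') * \<tau> + of_int (b * m' + d * n')"
    unfolding t unfolding j(1) by (simp add: algebra_simps)
  also have "\<dots> = \<omega>" unfolding mn[symmetric] \<omega> ..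
  finally have \<omega>_eq: "\<omega> = (of_int m' * t + of_int n') * j" ..
  thus "\<omega> / j = of_int m' * t + of_int n'" using j(2) by simp
  have "exp (- (of_real pi * \<i> * of_int c * (z + \<omega>)\<^sup>2 / j)) * theta_factor t m' n' (z / j) =
      (- 1) powi (m' + n') * exp (- (of_real pi * \<i>) *
          (of_int c * (z + \<omega>)\<^sup>2 / j + (of_int m')\<^sup>2 * t + 2 * of_int m' * (z / j)))"
    unfolding theta_factor_def mult.left_commute[of "exp _"] exp_add[symmetric] by (simp add: algebra_simps)
  also have "\<dots> = (- 1) powi (m' + n') * exp (of_real pi * \<i> * of_int (m' * n' - m * n)) *
      (exp (- (of_real pi * \<i> * of_int (m\<^sup>2) * \<tau>) - 2 * of_real pi * \<i> * of_int m * z) *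
          exp (- (of_real pi * \<i> * of_int c * z\<^sup>2 / j)))"
    unfolding theta_factor_moebius_exponent[OF j t \<omega> \<omega>_eq m']
    unfolding mult.assoc exp_add[symmetric] by (simp add: algebra_simps)
  also have "(- 1) powi (m' + n') * exp (of_real pi * \<i> * of_int (m' * n' - m * n)) =
      (- 1) powi (m' + n' + (m' * n' - m * n))"
    unfolding exp_pi_i_times_int by (simp add: power_int_add)
  also have "\<dots> = (- 1) powi (m + n)"
  proof (rule minus_one_powi_cong)
    have "even m \<and> even n" if "even m'" "even n'" unfolding mn using that by simp
    moreover have "even m' \<and> even n'" if "even m" "even n" unfolding m' n' using that by simp
    ultimately have "even m' \<and> even n' \<longleftrightarrow> even m \<and> even n" by blast
    thus "even (m' + n' + (m' * n' - m * n)) \<longleftrightarrow> even (m + n)" by auto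
  qed
  finally show "exp (- (of_real pi * \<i> * of_int c * (z + \<omega>)\<^sup>2 / j)) * theta_factor t m' n' (z / j) =
     theta_factor \<tau> m n z * exp (- (of_real pi * \<i> * of_int c * z\<^sup>2 / j))"
    by (simp add: theta_factor_def mult_ac)
qed

lemma theta_like_moebius:
  assumes A: "A \<in> SL2Z" and \<tau>: "\<tau> \<in> uhp"
  shows "theta_like \<tau> (\<lambda>z. exp (- (of_real pi * \<i> * of_int (A $ 2 $ 1) * z\<^sup>2 / moebius_denom A \<tau>)) *
           theta11 (z / moebius_denom A \<tau>) (moebius_act A \<tau>))" (is "theta_like \<tau> ?F")
  unfolding theta_like_def
proof (intro conjI allI impI)
  define j t where "j = moebius_denom A \<tau>" and "t = moebius_act A \<tau>"
  have j: "j \<noteq> 0" unfolding j_def by (rule moebius_denom_nonzero[OF assms])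
  have tj: "t * j = of_int (A $ 1 $ 1) * \<tau> + of_int (A $ 1 $ 2)" using j
    by (simp add: t_def j_def moebius_act_def)
  have t: "Im t > 0" using moebius_in_uhp[OF assms] by (simp add: t_def uhp_def)
  have det: "A $ 1 $ 1 * A $ 2 $ 2 - A $ 1 $ 2 * A $ 2 $ 1 = 1" using A by (simp add: SL2Z_iff)
  have "(\<lambda>z. theta11 z t) \<circ> (\<lambda>z. z / j) holomorphic_on UNIV"
    by (intro holomorphic_on_compose holomorphic_intros theta11_entire[OF t]) (use j in auto)
  thus "?F holomorphic_on UNIV"
    unfolding o_def j_def[symmetric] t_def[symmetric] by (intro holomorphic_intros) (use j in auto)
  obtain z1 where "theta11 z1 t \<noteq> 0" using theta11_not_identically_zero[OF t] .
  thus "\<exists>z. ?F z \<noteq> 0" using j by (intro exI[of _ "z1 * j"]) (simp flip: j_def t_def)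
  show "?F (z + of_int m * \<tau> + of_int n) = theta_factor \<tau> m n z * ?F z" for m n z
  proof -
    define \<omega> where "\<omega> = of_int m * \<tau> + of_int n"
    define m' n' where "m' = A $ 2 $ 2 * m - A $ 2 $ 1 * n" and "n' = A $ 1 $ 1 * n - A $ 1 $ 2 * m"
    note factor = theta_factor_moebius[OF det j_def j tj \<omega>_def m'_def n'_def]
    have "theta11 ((z + \<omega>) / j) t = theta_factor t m' n' (z / j) * theta11 (z / j) t"
      unfolding add_divide_distrib factor(1) add.assoc[symmetric] by (rule theta11_lattice_translate)
    thus ?thesis using factor(2)[of z] unfolding add.assoc \<omega>_def[symmetric] j_def[symmetric] t_def[symmetric]
      by (simp add: mult.assoc[symmetric])
  qed
  show "\<exists>m n. z = of_int m * \<tau> + of_int n" if "?F z = 0" for z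
  proof -
    have "theta11 (z / j) t = 0" using that by (simp flip: j_def t_def)
    then obtain m n where "z / j = of_int m * t + of_int n" using theta11_zeros[OF t] by blast
    hence "z = of_int m * (t * j) + of_int n * j" using j by (simp add: field_simps)
    hence "z = of_int (m * A $ 1 $ 1 + n * A $ 2 $ 1) * \<tau> + of_int (m * A $ 1 $ 2 + n * A $ 2 $ 2)"
      unfolding tj by (simp add: j_def algebra_simps)
    thus ?thesis by blast
  qed
qed

theorem theta11_modular:
  assumes "A \<in> SL2Z" "\<tau> \<in> uhp"
  obtains C where "C \<noteq> 0" "\<And>z. theta11 (z / moebius_denom A \<tau>) (moebius_act A \<tau>) =
        C * exp (of_real pi * \<i> * of_int (A $ 2 $ 1) * z\<^sup>2 / moebius_denom A \<tau>) * theta11 z \<tau>"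
proof -
  have \<tau>: "Im \<tau> > 0" using assms(2) by (simp add: uhp_def)
  obtain C where C: "C \<noteq> 0" "\<And>z. exp (- (of_real pi * \<i> * of_int (A $ 2 $ 1) * z\<^sup>2 / moebius_denom A \<tau>)) *
      theta11 (z / moebius_denom A \<tau>) (moebius_act A \<tau>) = C * theta11 z \<tau>"
    using theta_like_unique[OF theta_like_moebius[OF assms] theta_like_theta11[OF \<tau>] \<tau>] by blast
  show ?thesis by (rule that[OF C(1)]) (use C(2) in \<open>simp add: exp_minus field_simps\<close>)
qed

section \<open>Klein forms\<close>

definition q_leading :: "nat \<Rightarrow> (complex \<Rightarrow> complex) \<Rightarrow> int \<Rightarrow> complex \<Rightarrow> bool" where
  "q_leading N f e c \<longleftrightarrow> ((\<lambda>\<tau>. f \<tau> / to_q N \<tau> powi e) \<longlongrightarrow> c) at_ii_inf"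

lemma to_q_powi: "to_q N \<tau> powi e = exp (2 * of_real pi * \<i> * of_int e * \<tau> / of_nat N)"
  by (simp add: to_q_def exp_power_int mult_ac)

lemma q_leading_const: "q_leading N (\<lambda>_. c) 0 c"
  by (simp add: q_leading_def)

lemma q_leading_cong:
  assumes "q_leading N f e c" "\<And>\<tau>. \<tau> \<in> uhp \<Longrightarrow> f \<tau> = g \<tau>"
  shows "q_leading N g e c"
  using assms(1) unfolding q_leading_def
  by (rule Lim_transform_eventually) (intro eventually_at_ii_infI, simp add: assms(2))

lemma q_leading_mult:
  assumes "q_leading N f e c" "q_leading N g e' c'"
  shows "q_leading N (\<lambda>\<tau>. f \<tau> * g \<tau>) (e + e') (c * c')"
  using tendsto_mult[OF assms[unfolded q_leading_def]]
  by (simp add: q_leading_def power_int_add times_divide_times_eq)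

lemma q_leading_divide:
  assumes "q_leading N f e c" "q_leading N g e' c'" "c' \<noteq> 0"
  shows "q_leading N (\<lambda>\<tau>. f \<tau> / g \<tau>) (e - e') (c / c')"
  using tendsto_divide[OF assms(1,2)[unfolded q_leading_def] assms(3)]
  by (simp add: q_leading_def power_int_diff divide_divide_times_eq mult.commute)

lemma q_leading_power: "q_leading N f e c \<Longrightarrow> q_leading N (\<lambda>\<tau>. f \<tau> ^ n) (int n * e) (c ^ n)"
  by (induction n) (use q_leading_mult in \<open>auto simp: q_leading_const algebra_simps\<close>)

lemma q_leading_rescale:
  assumes "k > 0"
  shows "q_leading (k * N) f (int k * e) c \<longleftrightarrow> q_leading N f e c"
proof -
  have "2 * of_real pi * \<i> * of_int (int k * e) * \<tau> = of_nat k * (2 * of_real pi * \<i> * of_int e * \<tau>)" for \<tau>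
    by simp
  hence "to_q (k * N) \<tau> powi (int k * e) = to_q N \<tau> powi e" for \<tau>
    unfolding to_q_powi of_nat_mult using assms by (simp only: mult_divide_mult_cancel_left) simp
  thus ?thesis by (simp add: q_leading_def)
qed

lemma q_leading_linear:
  assumes "q_leading N f e c" "p > 0" "m > 0"
  shows "q_leading (N * m) (\<lambda>\<tau>. f ((of_nat p * \<tau> + of_int r) / of_nat m)) (int p * e)
      (c * zeta (N * m) (r * e))"
proof -
  have "to_q N ((of_nat p * \<tau> + of_int r) / of_nat m) powi e =
      to_q (N * m) \<tau> powi (int p * e) * zeta (N * m) (r * e)" for \<tau>
    unfolding zeta_def to_q_powi unfolding to_q_def exp_add[symmetric]
    by (intro arg_cong[where f = exp]) (simp add: add_divide_distrib distrib_left mult_ac)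
  moreover have "((\<lambda>\<tau>. f ((of_nat p * \<tau> + of_int r) / of_nat m) /
      to_q N ((of_nat p * \<tau> + of_int r) / of_nat m) powi e) \<longlongrightarrow> c) at_ii_inf"
    using filterlim_compose[OF assms(1)[unfolded q_leading_def] filterlim_at_ii_inf_linear[OF assms(2,3)]] .
  ultimately have "((\<lambda>\<tau>. f ((of_nat p * \<tau> + of_int r) / of_nat m) / to_q (N *
      m) \<tau> powi (int p * e) / zeta (N * m) (r * e)) \<longlongrightarrow> c) at_ii_inf"
    by (simp add: divide_divide_eq_left)
  from tendsto_mult[OF this tendsto_const[of "zeta (N * m) (r * e)"]] show ?thesis by (simp add: q_leading_def)
qed

lemma q_leading_0_iff: "q_leading N f 0 c \<longleftrightarrow> (f \<longlongrightarrow> c) at_ii_inf"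
  by (simp add: q_leading_def)

lemma to_q_powi_tendsto_0:
  assumes "N > 0" "e > 0"
  shows "((\<lambda>\<tau>. to_q N \<tau> powi e) \<longlongrightarrow> 0) at_ii_inf"
proof -
  have "(\<lambda>w::complex. w ^ nat e) \<midarrow>0\<rightarrow> 0" using assms(2) by (auto intro!: tendsto_eq_intros)
  hence "((\<lambda>\<tau>. to_q N \<tau> ^ nat e) \<longlongrightarrow> 0) at_ii_inf" using tendsto_to_q_iff[OF assms(1), of "\<lambda>w. w ^ nat e" 0]
    by simp
  thus ?thesis using assms(2) by (simp add: power_int_def)
qed

lemma q_leading_pos_imp_tendsto_0:
  assumes "N > 0" "q_leading N f e c" "e > 0"
  shows "(f \<longlongrightarrow> 0) at_ii_inf"
  using tendsto_mult[OF assms(2)[unfolded q_leading_def] to_q_powi_tendsto_0[OF assms(1,3)]] by simp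

lemma q_leading_neg_imp_filterlim_at_infinity:
  assumes "N > 0" "q_leading N f e c" "e < 0" "c \<noteq> 0"
  shows "filterlim f at_infinity at_ii_inf"
proof -
  have "((\<lambda>\<tau>. inverse (f \<tau> / to_q N \<tau> powi e) * to_q N \<tau> powi (- e)) \<longlongrightarrow> inverse c * 0) at_ii_inf"
    by (intro tendsto_intros assms(2)[unfolded q_leading_def] to_q_powi_tendsto_0) (use assms in auto)
  hence "((\<lambda>\<tau>. inverse (f \<tau>)) \<longlongrightarrow> 0) at_ii_inf" by (simp add: power_int_minus field_simps)
  moreover have "\<forall>\<^sub>F \<tau> in at_ii_inf. f \<tau> \<noteq> 0"
    using tendsto_imp_eventually_ne[OF assms(2)[unfolded q_leading_def] assms(4)] by eventually_elim auto
  ultimately have "filterlim (\<lambda>\<tau>. inverse (f \<tau>)) (at 0) at_ii_inf" by (simp add: filterlim_at)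
  from filterlim_compose[OF filterlim_inverse_at_infinity this] show ?thesis by simp
qed

definition klein :: "real \<Rightarrow> real \<Rightarrow> complex \<Rightarrow> complex" where
  "klein \<alpha> \<beta> \<tau> = exp (of_real pi * \<i> * of_real \<alpha> * (of_real \<alpha> * \<tau> + of_real \<beta>)) *
      theta11 (of_real \<alpha> * \<tau> + of_real \<beta>) \<tau>"

lemma klein_modular:
  assumes A: "A \<in> SL2Z" and \<tau>: "\<tau> \<in> uhp"
  obtains C where "C \<noteq> 0" "\<And>\<alpha> \<beta>. klein \<alpha> \<beta> (moebius_act A \<tau>) =
     C * klein (\<alpha> * of_int (A $ 1 $ 1) + \<beta> * of_int (A $ 2 $ 1))
         (\<alpha> * of_int (A $ 1 $ 2) + \<beta> * of_int (A $ 2 $ 2)) \<tau>"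
proof -
  define j t where "j = moebius_denom A \<tau>" and "t = moebius_act A \<tau>"
  obtain C where C: "C \<noteq> 0" "\<And>z. theta11 (z / j) t =
      C * exp (of_real pi * \<i> * of_int (A $ 2 $ 1) * z\<^sup>2 / j) * theta11 z \<tau>"
    using theta11_modular[OF assms] unfolding j_def t_def by blast
  have j: "j \<noteq> 0" unfolding j_def by (rule moebius_denom_nonzero[OF assms])
  have tj: "t * j = of_int (A $ 1 $ 1) * \<tau> + of_int (A $ 1 $ 2)" using j
    by (simp add: t_def j_def moebius_act_def)
  have det: "of_int (A $ 1 $ 1) * of_int (A $ 2 $ 2) - of_int (A $ 1 $ 2) * of_int (A $ 2 $ 1) = (1 :: complex)"
    using arg_cong[OF A[unfolded SL2Z_iff], of complex_of_int] by simp
  have "klein \<alpha> \<beta> t = C * klein (\<alpha> * of_int (A $ 1 $ 1) + \<beta> * of_int (A $ 2 $ 1))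
      (\<alpha> * of_int (A $ 1 $ 2) + \<beta> * of_int (A $ 2 $ 2)) \<tau>" for \<alpha> \<beta>
  proof -
    define \<alpha>' \<beta>' where "\<alpha>' = \<alpha> * of_int (A $ 1 $ 1) + \<beta> * of_int (A $ 2 $ 1)"
      and "\<beta>' = \<alpha> * of_int (A $ 1 $ 2) + \<beta> * of_int (A $ 2 $ 2)"
    define z where "z = of_real \<alpha>' * \<tau> + of_real \<beta>'"
    have "(of_real \<alpha> * t + of_real \<beta>) * j = of_real \<alpha> * (t * j) + of_real \<beta> * j" by (simp add: algebra_simps)
    also have "\<dots> = z" unfolding tj by (simp add: z_def j_def \<alpha>'_def \<beta>'_def algebra_simps)
    finally have zj: "of_real \<alpha> * t + of_real \<beta> = z / j" using j by (simp add: eq_divide_eq)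
    have "of_real \<alpha>' * j - of_int (A $ 2 $ 1) * z =
        of_real \<alpha> * (of_int (A $ 1 $ 1) * of_int (A $ 2 $ 2) - of_int (A $ 1 $ 2) * of_int (A $ 2 $ 1))"
      by (simp add: j_def z_def \<alpha>'_def \<beta>'_def algebra_simps)
    hence "of_real \<alpha> + of_int (A $ 2 $ 1) * z = of_real \<alpha>' * j" unfolding det by (simp add: algebra_simps)
    hence "(of_real \<alpha> + of_int (A $ 2 $ 1) * z) * (z / j) = of_real \<alpha>' * z" using j by simp
    hence exponent: "of_real \<alpha> * (z / j) + of_int (A $ 2 $ 1) * z\<^sup>2 / j = of_real \<alpha>' * z"
      by (simp add: algebra_simps power2_eq_square)
    have "klein \<alpha> \<beta> t = C * exp (of_real pi * \<i> * (of_real \<alpha> * (z / j) + of_int (A $ 2 $ 1) * z\<^sup>2 / j)) *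
        theta11 z \<tau>"
      unfolding klein_def zj C(2) distrib_left exp_add by (simp add: mult_ac)
    thus ?thesis unfolding exponent \<alpha>'_def[symmetric] \<beta>'_def[symmetric] by (simp add: klein_def z_def mult_ac)
  qed
  thus ?thesis using that C(1) unfolding t_def by blast
qed

lemma klein_add_int:
  "klein (\<alpha> + of_int m) (\<beta> + of_int n) \<tau> =
   (- 1) powi (m + n + m * n) * exp (of_real pi * \<i> * of_real (of_int n * \<alpha> - of_int m * \<beta>)) * klein \<alpha> \<beta> \<tau>"
proof -
  define z where "z = of_real \<alpha> * \<tau> + of_real \<beta>"
  have "klein (\<alpha> + of_int m) (\<beta> + of_int n) \<tau> =
     exp (of_real pi * \<i> * of_real (\<alpha> + of_int m) * (z + of_int m * \<tau> + of_int n)) *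
         theta11 (z + of_int m * \<tau> + of_int n) \<tau>"
    by (simp add: klein_def z_def algebra_simps)
  also have "\<dots> = (- 1) powi (m + n) *
      (exp (of_real pi * \<i> * of_real (\<alpha> + of_int m) * (z + of_int m * \<tau> + of_int n)) *
     exp (- (of_real pi * \<i> * of_int (m\<^sup>2) * \<tau>) - 2 * of_real pi * \<i> * of_int m * z)) * theta11 z \<tau>"
    unfolding theta11_quasi by (simp only: mult_ac)
  also have "exp (of_real pi * \<i> * of_real (\<alpha> + of_int m) * (z + of_int m * \<tau> + of_int n)) *
     exp (- (of_real pi * \<i> * of_int (m\<^sup>2) * \<tau>) - 2 * of_real pi * \<i> * of_int m * z) =
     exp (of_real pi * \<i> * of_int (m * n)) * exp (of_real pi * \<i> * of_real (of_int n * \<alpha> - of_int m * \<beta>)) *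
         exp (of_real pi * \<i> * of_real \<alpha> * z)"
    unfolding exp_add[symmetric] z_def
    by (rule arg_cong[where f = exp]) (simp add: algebra_simps power2_eq_square)
  also have "exp (of_real pi * \<i> * of_int (m * n)) = (- 1) powi (m * n)" by (rule exp_pi_i_times_int)
  finally show ?thesis by (simp add: klein_def z_def power_int_add mult_ac)
qed

lemma klein_minus: "klein (- \<alpha>) (- \<beta>) \<tau> = - klein \<alpha> \<beta> \<tau>"
proof -
  have "of_real (- \<alpha>) * \<tau> + of_real (- \<beta>) = - (of_real \<alpha> * \<tau> + of_real \<beta>)" by simp
  thus ?thesis unfolding klein_def by (simp only: theta11_minus) (simp add: algebra_simps)
qed

lemma klein_eq_theta_char:
  "klein \<alpha> \<beta> \<tau> = exp (- (of_real pi * \<i> * of_real (\<alpha> * (\<beta> + 1)))) * theta_char (1/2 + \<alpha>) (of_real (\<beta> + 1/2)) \<tau>"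
proof -
  have "theta11 (of_real \<alpha> * \<tau> + of_real \<beta>) \<tau> = theta_char (1/2) (of_real (\<beta> + 1/2) + of_real \<alpha> * \<tau>) \<tau>"
    by (simp add: theta11_def add_ac)
  also have "\<dots> = exp (- (of_real pi * \<i> * (of_real \<alpha>)\<^sup>2 * \<tau>) - 2 * of_real pi *
      \<i> * of_real \<alpha> * of_real (\<beta> + 1/2)) *
      theta_char (1/2 + \<alpha>) (of_real (\<beta> + 1/2)) \<tau>" by (rule theta_char_shift)
  finally have "klein \<alpha> \<beta> \<tau> = (exp (of_real pi * \<i> * of_real \<alpha> * (of_real \<alpha> * \<tau> + of_real \<beta>)) *
     exp (- (of_real pi * \<i> * (of_real \<alpha>)\<^sup>2 * \<tau>) - 2 * of_real pi * \<i> * of_real \<alpha> * of_real (\<beta> + 1/2))) *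
      theta_char (1/2 + \<alpha>) (of_real (\<beta> + 1/2)) \<tau>" by (simp add: klein_def)
  also have "exp (of_real pi * \<i> * of_real \<alpha> * (of_real \<alpha> * \<tau> + of_real \<beta>)) *
     exp (- (of_real pi * \<i> * (of_real \<alpha>)\<^sup>2 * \<tau>) - 2 * of_real pi * \<i> * of_real \<alpha> * of_real (\<beta> + 1/2)) =
     exp (- (of_real pi * \<i> * of_real (\<alpha> * (\<beta> + 1))))"
    unfolding exp_add[symmetric] by (rule arg_cong[where f = exp]) (simp add: algebra_simps power2_eq_square)
  finally show ?thesis .
qed

lemma klein_nonzero:
  assumes "Im \<tau> > 0" "\<alpha> \<notin> \<int> \<or> \<beta> \<notin> \<int>"
  shows "klein \<alpha> \<beta> \<tau> \<noteq> 0"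
proof
  assume "klein \<alpha> \<beta> \<tau> = 0"
  hence "theta11 (of_real \<alpha> * \<tau> + of_real \<beta>) \<tau> = 0" by (simp add: klein_def)
  then obtain m n where lattice_point: "of_real \<alpha> * \<tau> + of_real \<beta> = of_int m * \<tau> + of_int n"
    using theta11_zeros[OF assms(1)] by blast
  hence "\<alpha> * Im \<tau> = of_int m * Im \<tau>" by (simp add: complex_eq_iff)
  hence "\<alpha> = of_int m" using assms(1) by simp
  moreover from this lattice_point have "\<beta> = of_int n" by (simp add: complex_eq_iff)
  ultimately show False using assms(2) by simp
qed

lemma klein_qexp:
  fixes e j :: int
  assumes "N > 0" and e: "\<And>n. e\<^sup>2 \<le> (2 * int N * n + (int N + 2 * j))\<^sup>2"
  obtains H where "H holomorphic_on ball 0 1"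
    "H 0 = exp (- (of_real pi * \<i> * of_real (of_int j / of_nat N * (\<beta> + 1)))) *
       (\<Sum>\<^sub>\<infinity>n\<in>{n. (2 * int N * n + (int N + 2 * j))\<^sup>2 = e\<^sup>2}.
          exp (2 * of_real pi * \<i> * of_real ((of_int n + of_int (int N + 2 * j) / of_nat (2 * N)) *
              (\<beta> + 1/2))))"
    "\<And>\<tau>. klein (of_int j / of_nat N) \<beta> \<tau> = to_q (8 * N\<^sup>2) \<tau> powi e\<^sup>2 * H (to_q (8 * N\<^sup>2) \<tau>)"
proof -
  have "e\<^sup>2 \<le> (int (2 * N) * n + (int N + 2 * j))\<^sup>2" for n using e[of n] by simp
  then obtain H where H: "H holomorphic_on ball 0 1"
    "H 0 = (\<Sum>\<^sub>\<infinity>n\<in>{n. (int (2 * N) * n + (int N + 2 * j))\<^sup>2 = e\<^sup>2}.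
       exp (2 * of_real pi * \<i> * of_real ((of_int n + of_int (int N + 2 * j) / of_nat (2 * N)) * (\<beta> + 1/2))))"
    "\<And>\<tau>. theta_char (of_int (int N + 2 * j) / of_nat (2 * N)) (of_real (\<beta> + 1/2)) \<tau> =
       exp (of_real pi * \<i> * \<tau> * of_int (e\<^sup>2) / of_nat ((2 * N)\<^sup>2)) * H (to_q (2 * (2 * N)\<^sup>2) \<tau>)"
    using theta_char_qexp[of "2 * N" e "int N + 2 * j" "\<beta> + 1/2"] assms(1) by auto
  define K where "K = exp (- (of_real pi * \<i> * of_real (of_int j / of_nat N * (\<beta> + 1))))"
  show ?thesis
  proof (rule that[of "\<lambda>w. K * H w"])
    show "(\<lambda>w. K * H w) holomorphic_on ball 0 1" by (intro holomorphic_intros H(1))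
    fix \<tau> :: complex
    have "1 / 2 + real_of_int j / of_nat N = of_int (int N + 2 * j) / of_nat (2 * N)"
      using assms(1) by (simp add: add_divide_distrib)
    moreover have "exp (of_real pi * \<i> * \<tau> * of_int (e\<^sup>2) / of_nat ((2 * N)\<^sup>2)) = to_q (8 * N\<^sup>2) \<tau> powi e\<^sup>2"
      unfolding to_q_powi by (rule arg_cong[where f = exp]) (simp add: field_simps power_mult_distrib)
    ultimately show "klein (of_int j / of_nat N) \<beta> \<tau> = to_q (8 * N\<^sup>2) \<tau> powi e\<^sup>2 * (K * H (to_q (8 * N\<^sup>2) \<tau>))"
      using H(3)[of \<tau>] by (simp add: klein_eq_theta_char K_def power_mult_distrib mult_ac)
  qed (use H(2) in \<open>simp add: K_def\<close>)
qed

lemma klein_eq_holomorphic_to_q: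
  assumes "N > 0"
  obtains H where "H holomorphic_on ball 0 1" "\<And>\<tau>. klein (of_int j / of_nat N) \<beta> \<tau> = H (to_q (8 * N\<^sup>2) \<tau>)"
  using klein_qexp[OF assms, of 0 j \<beta>] by auto

lemma klein_meromorphic_at_ii_inf:
  assumes "N > 0"
  shows "meromorphic_at_ii_inf (klein (of_int j / of_nat N) \<beta>)"
proof -
  obtain H where H: "H holomorphic_on ball 0 1" "\<And>\<tau>. klein (of_int j / of_nat N) \<beta> \<tau> = H (to_q (8 * N\<^sup>2) \<tau>)"
    using klein_eq_holomorphic_to_q[OF assms] by blast
  have "H analytic_on {0}" using H(1) by (meson analytic_at centre_in_ball open_ball zero_less_one)
  thus ?thesis
    using assms by (intro meromorphic_at_ii_infI[of "8 * N\<^sup>2" H])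
      (simp_all add: H(2) analytic_on_imp_meromorphic_on)
qed

lemma klein_holomorphic:
  assumes "N > 0"
  shows "klein (of_int j / of_nat N) \<beta> holomorphic_on uhp"
proof -
  obtain H where H: "H holomorphic_on ball 0 1" "\<And>\<tau>. klein (of_int j / of_nat N) \<beta> \<tau> = H (to_q (8 * N\<^sup>2) \<tau>)"
    using klein_eq_holomorphic_to_q[OF assms] by blast
  have "to_q (8 * N\<^sup>2) ` uhp \<subseteq> ball 0 1" using assms by (auto simp: uhp_def intro!: norm_to_q_less_1)
  moreover have "klein (of_int j / of_nat N) \<beta> = H \<circ> to_q (8 * N\<^sup>2)" by (simp add: fun_eq_iff H(2))
  ultimately show ?thesis using holomorphic_on_compose_gen[OF to_q_holomorphic H(1)] by simp
qed

lemma q_leading_holomorphic_to_q: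
  assumes "N > 0" "H holomorphic_on ball 0 1" "\<And>\<tau>. f \<tau> = to_q N \<tau> powi e * H (to_q N \<tau>)"
  shows "q_leading N f e (H 0)"
proof -
  have "isCont H 0"
    using assms(2) by (meson centre_in_ball continuous_on_eq_continuous_at holomorphic_on_imp_continuous_on
      open_ball zero_less_one)
  thus ?thesis using tendsto_to_q_iff[OF assms(1), of H "H 0"] by (simp add: q_leading_def assms(3) isCont_def)
qed

lemma klein_exponent_minimal:
  fixes N j n :: int
  assumes "0 < j" "j < N" "n \<noteq> -1"
  shows "(N - 2 * j)\<^sup>2 < (2 * N * n + (N + 2 * j))\<^sup>2"
proof -
  have "\<bar>N - 2 * j\<bar> < \<bar>2 * N * n + (N + 2 * j)\<bar>"
  proof (cases "n \<ge> 0")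
    case True
    hence "0 \<le> N * n" using assms by simp
    thus ?thesis using assms by (simp add: abs_if)
  next
    case False
    hence "N * n \<le> N * (- 2)" using assms by (intro mult_left_mono) auto
    thus ?thesis using assms by (simp add: abs_if)
  qed
  thus ?thesis by (meson abs_le_square_iff linorder_not_less)
qed

lemma klein_leading:
  assumes "0 < j" "j < int N"
  shows "q_leading (8 * N\<^sup>2) (klein (of_int j / of_nat N) \<beta>) ((int N - 2 * j)\<^sup>2)
           (exp (of_real pi * \<i> * of_real (\<beta> * (of_int j / of_nat N - 1) - 1/2)))"
proof -
  have N: "N > 0" using assms by simp
  have at_minus_1: "2 * int N * (- 1) + (int N + 2 * j) = - (int N - 2 * j)" by simp
  have minimal: "(int N - 2 * j)\<^sup>2 \<le> (2 * int N * n + (int N + 2 * j))\<^sup>2" for n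
  proof (cases "n = -1")
    case True
    thus ?thesis by (simp only: at_minus_1 power2_minus order_refl)
  next
    case False
    thus ?thesis by (intro less_imp_le klein_exponent_minimal assms)
  qed
  have unique: "{n. (2 * int N * n + (int N + 2 * j))\<^sup>2 = (int N - 2 * j)\<^sup>2} = {-1}"
  proof (intro equalityI subsetI)
    fix n assume "n \<in> {n. (2 * int N * n + (int N + 2 * j))\<^sup>2 = (int N - 2 * j)\<^sup>2}"
    thus "n \<in> {-1}" using klein_exponent_minimal[OF assms, of n] by fastforce
  qed (simp only: mem_Collect_eq singleton_iff at_minus_1 power2_minus)
  obtain H where H: "H holomorphic_on ball 0 1"
    "H 0 = exp (- (of_real pi * \<i> * of_real (of_int j / of_nat N * (\<beta> + 1)))) *
       exp (2 * of_real pi * \<i> * of_real ((of_int (- 1) + of_int (int N + 2 * j) / of_nat (2 * N)) *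
           (\<beta> + 1/2)))"
    "\<And>\<tau>. klein (of_int j / of_nat N) \<beta> \<tau> = to_q (8 * N\<^sup>2) \<tau> powi (int N - 2 * j)\<^sup>2 * H (to_q (8 * N\<^sup>2) \<tau>)"
    using klein_qexp[OF N minimal, of \<beta>] unfolding unique by auto
  define x where "x = of_int j / real N"
  have shift: "of_int (int N + 2 * j) / of_nat (2 * N) = 1/2 + of_int j / real N"
    using N by (simp add: add_divide_distrib)
  have "H 0 = exp (of_real pi * \<i> * of_real (\<beta> * (of_int j / of_nat N - 1) - 1/2))"
    unfolding H(2) shift x_def[symmetric] exp_add[symmetric]
    by (intro arg_cong[where f = exp]) (simp add: algebra_simps)
  thus ?thesis using q_leading_holomorphic_to_q[OF _ H(1,3)] N by simp
qed

lemma klein_zero_leading: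
  assumes "N > 0"
  shows "q_leading (8 * N\<^sup>2) (klein 0 \<beta>) ((int N)\<^sup>2) (of_real (- 2 * sin (pi * \<beta>)))"
proof -
  have odd_multiple: "2 * int N * n + (int N + 2 * 0) = int N * (2 * n + 1)" for n by (simp add: algebra_simps)
  have "1\<^sup>2 \<le> (2 * n + 1)\<^sup>2" for n :: int unfolding abs_le_square_iff[symmetric] by presburger
  hence minimal: "(int N)\<^sup>2 \<le> (2 * int N * n + (int N + 2 * 0))\<^sup>2" for n
    unfolding odd_multiple power_mult_distrib by (simp add: mult_le_cancel_left1)
  have "(2 * n + 1)\<^sup>2 = 1\<^sup>2 \<longleftrightarrow> n \<in> {0, -1}" for n :: int unfolding power2_eq_iff by auto
  hence two: "{n. (2 * int N * n + (int N + 2 * 0))\<^sup>2 = (int N)\<^sup>2} = {0, -1}"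
    unfolding odd_multiple power_mult_distrib using assms by auto
  obtain H where H: "H holomorphic_on ball 0 1"
    "H 0 = (\<Sum>n\<in>{0, -1}. exp (2 * of_real pi * \<i> *
        of_real ((of_int n + of_int (int N + 2 * 0) / of_nat (2 * N)) * (\<beta> + 1/2))))"
    "\<And>\<tau>. klein (of_int 0 / of_nat N) \<beta> \<tau> = to_q (8 * N\<^sup>2) \<tau> powi (int N)\<^sup>2 * H (to_q (8 * N\<^sup>2) \<tau>)"
    using klein_qexp[OF assms minimal, of \<beta>] unfolding two by auto
  have "H 0 = exp (\<i> * of_real (pi * (\<beta> + 1/2))) + exp (- (\<i> * of_real (pi * (\<beta> + 1/2))))"
    using assms by (simp add: H(2) algebra_simps minus_diff_commute)
  also have "\<dots> = 2 * cos (of_real (pi * (\<beta> + 1/2)))" by (simp add: cos_exp_eq)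
  also have "\<dots> = of_real (2 * cos (pi * \<beta> + pi / 2))" by (simp add: cos_of_real[symmetric] algebra_simps)
  also have "cos (pi * \<beta> + pi / 2) = - sin (pi * \<beta>)" by (simp add: cos_add)
  finally have "H 0 = of_real (- 2 * sin (pi * \<beta>))" by simp
  thus ?thesis using q_leading_holomorphic_to_q[OF _ H(1,3)] assms by simp
qed

lemma klein_leading_exists:
  fixes j :: int
  assumes "N > 0" "int N dvd j \<Longrightarrow> \<beta> \<notin> \<int>"
  obtains c where "c \<noteq> 0" "q_leading (8 * N\<^sup>2) (klein (of_int j / of_nat N) \<beta>)
      ((int N - 2 * (j mod int N))\<^sup>2) c"
proof -
  define r k where "r = j mod int N" and "k = j div int N"
  define u where "u = (- 1) powi k * exp (of_real pi * \<i> * of_real (- of_int k * \<beta>))"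
  obtain c where c: "c \<noteq> 0" "q_leading (8 * N\<^sup>2) (klein (of_int r / of_nat N) \<beta>) ((int N - 2 * r)\<^sup>2) c"
  proof (cases "r = 0")
    case True
    hence "\<beta> \<notin> \<int>" using assms(2) by (simp add: r_def dvd_eq_mod_eq_0)
    hence "sin (pi * \<beta>) \<noteq> 0" by (auto simp: sin_zero_iff_int2)
    thus ?thesis using that[of "of_real (- 2 * sin (pi * \<beta>))"] klein_zero_leading[OF assms(1), of \<beta>] True
      by simp
  next
    case False
    moreover have "0 \<le> r" "r < int N" using assms(1) by (simp_all add: r_def)
    ultimately have "0 < r" "r < int N" by simp_all
    thus ?thesis using that[OF exp_not_eq_zero klein_leading[of r N \<beta>]] by blast
  qed
  have "real_of_int j = of_int (r + int N * k)" by (simp only: r_def k_def mod_mult_div_eq)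
  hence "of_int j / of_nat N = of_int r / of_nat N + (of_int k :: real)" using assms(1)
    by (simp add: add_divide_distrib)
  hence "klein (of_int j / of_nat N) \<beta> \<tau> = u * klein (of_int r / of_nat N) \<beta> \<tau>" for \<tau>
    using klein_add_int[of "of_int r / of_nat N" k \<beta> 0 \<tau>] by (simp add: u_def)
  hence "q_leading (8 * N\<^sup>2) (klein (of_int j / of_nat N) \<beta>) ((int N - 2 * r)\<^sup>2) (u * c)"
    using q_leading_mult[OF q_leading_const c(2), of u] by (simp add: q_leading_def)
  thus ?thesis using that[of "u * c"] c(1) by (simp add: u_def r_def)
qed

section \<open>The modular action on meromorphic functions\<close>

abbreviation holomorphic_mero :: "mero_uhp \<Rightarrow> bool" where
  "holomorphic_mero f \<equiv> eval_mero f holomorphic_on uhp"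

lemma mero_eqI: "(\<And>z. z \<in> uhp \<Longrightarrow> eval_mero f z = eval_mero g z) \<Longrightarrow> f = g"
  by (metis eval_mero_inject eval_mero_outside ext)

lemma eval_mero_eqI:
  assumes "w \<in> uhp" "eventually (\<lambda>z. eval_mero f z = h z) (at w)" "h analytic_on {w}"
  shows "eval_mero f w = h w"
proof -
  have "remove_sings (eval_mero f) w = remove_sings h w"
    by (intro remove_sings_cong assms(2) refl)
  thus ?thesis using assms by (simp add: remove_sings_eval_mero)
qed

lemma holomorphic_mero_iff: "holomorphic_mero f \<longleftrightarrow> (\<forall>z\<in>uhp. eval_mero f analytic_on {z})"
  using open_uhp by (meson analytic_on_analytic_at analytic_on_open)

lemma eval_mero_eq_holomorphic:
  assumes h: "h holomorphic_on uhp" and ev: "\<And>z. z \<in> uhp \<Longrightarrow> eventually (\<lambda>w. eval_mero f w = h w) (at z)"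
  shows "holomorphic_mero f" "\<And>z. z \<in> uhp \<Longrightarrow> eval_mero f z = h z"
proof -
  show eq: "eval_mero f z = h z" if "z \<in> uhp" for z
    using eval_mero_eqI[OF that ev[OF that]] h that open_uhp analytic_at by blast
  show "holomorphic_mero f" by (rule holomorphic_transform[OF h]) (simp add: eq)
qed

lemma
  assumes "h holomorphic_on uhp"
  shows holomorphic_mero_of: "holomorphic_mero (mero_of h)"
    and eval_mero_of: "z \<in> uhp \<Longrightarrow> eval_mero (mero_of h) z = h z"
  using eval_mero_eq_holomorphic[OF assms] eventually_eval_mero_of assms open_uhp
    analytic_on_imp_meromorphic_on analytic_on_open by blast+

lemma holomorphic_mero_const: "holomorphic_mero (mero_const c)"
  and eval_mero_const: "z \<in> uhp \<Longrightarrow> eval_mero (mero_const c) z = c"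
  unfolding mero_const_def by (rule holomorphic_mero_of eval_mero_of; simp)+

lemma mero_const_0: "mero_const 0 = 0" and mero_const_1: "mero_const 1 = 1"
  by (simp_all add: mero_const_def zero_mero_uhp_def one_mero_uhp_def)

lemma holomorphic_mero_0: "holomorphic_mero 0" and holomorphic_mero_1: "holomorphic_mero 1"
  and eval_mero_0: "z \<in> uhp \<Longrightarrow> eval_mero 0 z = 0" and eval_mero_1: "z \<in> uhp \<Longrightarrow> eval_mero 1 z = 1"
  using holomorphic_mero_const[of 0] holomorphic_mero_const[of 1] eval_mero_const[of z 0]
    eval_mero_const[of z 1]
  by (simp_all add: mero_const_0 mero_const_1)

lemma holomorphic_mero_uminus: "holomorphic_mero f \<Longrightarrow> holomorphic_mero (- f)"
  and eval_mero_uminus: "holomorphic_mero f \<Longrightarrow> z \<in> uhp \<Longrightarrow> eval_mero (- f) z = - eval_mero f z"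
  by (rule eval_mero_eq_holomorphic[OF holomorphic_on_minus eventually_eval_mero_ops(5)]; assumption)+

lemma eval_mero_mult_at:
  assumes "eval_mero f analytic_on {z}" "eval_mero g analytic_on {z}" "z \<in> uhp"
  shows "eval_mero (f * g) z = eval_mero f z * eval_mero g z"
  by (rule eval_mero_eqI[OF assms(3) eventually_eval_mero_ops(6)[OF assms(3)]]) (intro analytic_intros assms)

lemma
  assumes "holomorphic_mero f" "holomorphic_mero g"
  shows holomorphic_mero_add: "holomorphic_mero (f + g)"
    and eval_mero_add: "z \<in> uhp \<Longrightarrow> eval_mero (f + g) z = eval_mero f z + eval_mero g z"
    and holomorphic_mero_diff: "holomorphic_mero (f - g)"
    and eval_mero_diff: "z \<in> uhp \<Longrightarrow> eval_mero (f - g) z = eval_mero f z - eval_mero g z"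
    and holomorphic_mero_mult: "holomorphic_mero (f * g)"
    and eval_mero_mult: "z \<in> uhp \<Longrightarrow> eval_mero (f * g) z = eval_mero f z * eval_mero g z"
  by ((rule eval_mero_eq_holomorphic[OF holomorphic_on_add[OF assms] eventually_eval_mero_ops(3)]
         eval_mero_eq_holomorphic[OF holomorphic_on_diff[OF assms] eventually_eval_mero_ops(4)]
         eval_mero_eq_holomorphic[OF holomorphic_on_mult[OF assms] eventually_eval_mero_ops(6)]; assumption?)+)

lemma
  assumes "holomorphic_mero f" "holomorphic_mero g" "\<And>z. z \<in> uhp \<Longrightarrow> eval_mero g z \<noteq> 0"
  shows holomorphic_mero_divide: "holomorphic_mero (f / g)"
    and eval_mero_divide: "z \<in> uhp \<Longrightarrow> eval_mero (f / g) z = eval_mero f z / eval_mero g z"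
  by ((rule eval_mero_eq_holomorphic[OF holomorphic_on_divide[OF assms] eventually_eval_mero_ops(8)]; assumption?)+)

lemma
  assumes "holomorphic_mero f"
  shows holomorphic_mero_power: "holomorphic_mero (f ^ n)"
    and eval_mero_power: "z \<in> uhp \<Longrightarrow> eval_mero (f ^ n) z = eval_mero f z ^ n"
proof -
  have "holomorphic_mero (f ^ n) \<and> (\<forall>z\<in>uhp. eval_mero (f ^ n) z = eval_mero f z ^ n)"
    by (induction n) (simp_all add: holomorphic_mero_1 eval_mero_1 holomorphic_mero_mult eval_mero_mult assms)
  thus "holomorphic_mero (f ^ n)" "z \<in> uhp \<Longrightarrow> eval_mero (f ^ n) z = eval_mero f z ^ n" by blast+
qed

lemma
  assumes "\<And>i. i \<in> I \<Longrightarrow> holomorphic_mero (f i)"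
  shows holomorphic_mero_sum: "holomorphic_mero (\<Sum>i\<in>I. f i)"
    and eval_mero_sum: "z \<in> uhp \<Longrightarrow> eval_mero (\<Sum>i\<in>I. f i) z = (\<Sum>i\<in>I. eval_mero (f i) z)"
    and holomorphic_mero_prod: "holomorphic_mero (\<Prod>i\<in>I. f i)"
    and eval_mero_prod: "z \<in> uhp \<Longrightarrow> eval_mero (\<Prod>i\<in>I. f i) z = (\<Prod>i\<in>I. eval_mero (f i) z)"
proof -
  have "(\<forall>i\<in>I. holomorphic_mero (f i)) \<longrightarrow> holomorphic_mero (\<Sum>i\<in>I. f i) \<and> holomorphic_mero (\<Prod>i\<in>I. f i) \<and>
      (\<forall>z\<in>uhp. eval_mero (\<Sum>i\<in>I. f i) z = (\<Sum>i\<in>I. eval_mero (f i) z) \<and>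
         eval_mero (\<Prod>i\<in>I. f i) z = (\<Prod>i\<in>I. eval_mero (f i) z))"
    by (induction I rule: infinite_finite_induct)
       (auto simp: holomorphic_mero_0 holomorphic_mero_1 eval_mero_0 eval_mero_1
         holomorphic_mero_add eval_mero_add
         holomorphic_mero_mult eval_mero_mult)
  thus "holomorphic_mero (\<Sum>i\<in>I. f i)" "z \<in> uhp \<Longrightarrow> eval_mero (\<Sum>i\<in>I. f i) z = (\<Sum>i\<in>I. eval_mero (f i) z)"
    "holomorphic_mero (\<Prod>i\<in>I. f i)" "z \<in> uhp \<Longrightarrow> eval_mero (\<Prod>i\<in>I. f i) z = (\<Prod>i\<in>I. eval_mero (f i) z)"
    using assms by auto
qed

lemmas holomorphic_mero_intros =
  holomorphic_mero_const holomorphic_mero_0 holomorphic_mero_1 holomorphic_mero_uminus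
    holomorphic_mero_add holomorphic_mero_diff
  holomorphic_mero_mult holomorphic_mero_power holomorphic_mero_sum holomorphic_mero_prod

lemmas eval_mero_simps =
  eval_mero_const eval_mero_0 eval_mero_1 eval_mero_uminus eval_mero_add eval_mero_diff
    eval_mero_mult eval_mero_power
  eval_mero_sum eval_mero_prod

lemma mero_const_add: "mero_const (a + b) = mero_const a + mero_const b"
  and mero_const_mult: "mero_const (a * b) = mero_const a * mero_const b"
  by (rule mero_eqI; simp add: eval_mero_simps holomorphic_mero_intros)+

lemma mero_const_numeral: "mero_const (numeral n) = numeral n"
proof -
  have "mero_const (of_nat k) = of_nat k" for k
    by (induction k) (simp_all add: mero_const_0 mero_const_1 mero_const_add)
  from this[of "numeral n"] show ?thesis by simp
qed

lemma holomorphic_mero_numeral: "holomorphic_mero (numeral n)"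
  and eval_mero_numeral: "z \<in> uhp \<Longrightarrow> eval_mero (numeral n) z = numeral n"
  using holomorphic_mero_const[of "numeral n"] eval_mero_const[of z "numeral n"]
  by (simp_all add: mero_const_numeral)

lemma mero_const_minus_1: "mero_const (- 1) = - 1"
  using mero_const_add[of "- 1" 1] by (simp add: mero_const_0 mero_const_1 eq_neg_iff_add_eq_0)

lemma inj_mero_const: "inj mero_const"
proof (rule injI)
  fix a b assume "mero_const a = mero_const b"
  hence "eval_mero (mero_const a) \<i> = eval_mero (mero_const b) \<i>" by simp
  thus "a = b" by (simp add: eval_mero_const uhp_def)
qed

lemma mero_const_divide: "mero_const (a / b) = mero_const a / mero_const b"
proof (cases "b = 0")
  case False
  hence "mero_const b \<noteq> 0" unfolding mero_const_0[symmetric] inj_eq[OF inj_mero_const] .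
  moreover have "mero_const (a / b) * mero_const b = mero_const a" using False by (simp flip: mero_const_mult)
  ultimately show ?thesis by (simp add: eq_divide_eq)
qed (simp add: mero_const_0)

definition peval :: "complex poly \<Rightarrow> mero_uhp \<Rightarrow> mero_uhp" where
  "peval p x = poly (map_poly mero_const p) x"

lemma peval_simps [simp]:
  "peval 0 x = 0" "peval (pCons c p) x = mero_const c + x * peval p x" "peval 1 x = 1"
  by (simp_all add: peval_def map_poly_pCons mero_const_0 mero_const_1 one_pCons)

lemma peval_add: "peval (p + q) x = peval p x + peval q x"
proof -
  have "map_poly mero_const (p + q) = map_poly mero_const p + map_poly mero_const q"
    by (rule poly_eqI) (simp add: coeff_map_poly mero_const_0 mero_const_add)
  thus ?thesis by (simp add: peval_def)
qed

lemma peval_smult: "peval (Polynomial.smult c p) x = mero_const c * peval p x"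
  by (induction p) (simp_all add: mero_const_mult algebra_simps)

lemma peval_mult: "peval (p * q) x = peval p x * peval q x"
  by (induction p) (simp_all add: peval_add peval_smult mero_const_0 algebra_simps)

lemma
  assumes "holomorphic_mero u"
  shows holomorphic_mero_peval: "holomorphic_mero (peval q u)"
    and eval_mero_peval: "z \<in> uhp \<Longrightarrow> eval_mero (peval q u) z = poly q (eval_mero u z)"
proof -
  have "holomorphic_mero (peval q u) \<and> (\<forall>z\<in>uhp. eval_mero (peval q u) z = poly q (eval_mero u z))"
    by (induction q) (simp_all add: eval_mero_simps holomorphic_mero_intros assms)
  thus "holomorphic_mero (peval q u)" "z \<in> uhp \<Longrightarrow> eval_mero (peval q u) z = poly q (eval_mero u z)" by auto
qed

definition act :: "int ^ 2 ^ 2 \<Rightarrow> mero_uhp \<Rightarrow> mero_uhp" where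
  "act A f = mero_of (\<lambda>z. eval_mero f (moebius_act A z))"

lemma eval_act:
  assumes "A \<in> SL2Z" "z \<in> uhp"
  shows "eval_mero (act A f) z = eval_mero f (moebius_act A z)"
proof -
  let ?g = "\<lambda>z. eval_mero f (moebius_act A z)"
  have mer: "?g meromorphic_on uhp"
    by (rule meromorphic_on_compose[OF meromorphic_eval_mero moebius_analytic[OF assms(1)]])
       (use moebius_in_uhp[OF assms(1)] in auto)
  have "(is_pole (eval_mero f) (moebius_act A z) \<and> eval_mero f (moebius_act A z) = 0) \<or>
      eval_mero f \<midarrow>moebius_act A z\<rightarrow> eval_mero f (moebius_act A z)"
    using nicely_meromorphic_eval_mero[of f] moebius_in_uhp[OF assms]
    unfolding nicely_meromorphic_on_def by blast
  hence "remove_sings ?g z = ?g z"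
  proof
    assume p: "is_pole (eval_mero f) (moebius_act A z) \<and> eval_mero f (moebius_act A z) = 0"
    hence "is_pole ?g z"
      unfolding is_pole_def using filterlim_compose[OF _ moebius_filterlim[OF assms]] by blast
    thus ?thesis using p by simp
  next
    assume "eval_mero f \<midarrow>moebius_act A z\<rightarrow> eval_mero f (moebius_act A z)"
    hence "?g \<midarrow>z\<rightarrow> ?g z" using filterlim_compose[OF _ moebius_filterlim[OF assms]] by blast
    thus ?thesis by (rule remove_sings_eqI)
  qed
  thus ?thesis by (simp add: act_def mero_of.rep_eq mer assms(2))
qed

lemma act_op:
  assumes A: "A \<in> SL2Z"
    and ev: "\<And>f g z. z \<in> uhp \<Longrightarrow> eventually (\<lambda>w. eval_mero (op f g) w = op' (eval_mero f w) (eval_mero g w))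
        (at z)"
  shows "act A (op f g) = op (act A f) (act A g)"
proof (rule mero_uhp_eqI)
  fix z assume z: "z \<in> uhp"
  have "eventually (\<lambda>w. eval_mero (op f g) (moebius_act A w) =
      op' (eval_mero f (moebius_act A w)) (eval_mero g (moebius_act A w))) (at z)"
    using eventually_compose_filterlim[OF ev[OF moebius_in_uhp[OF A z]] moebius_filterlim[OF A z]] .
  with ev[OF z, of "act A f" "act A g"] eventually_at_in_open'[OF open_uhp z]
  show "eventually (\<lambda>w. eval_mero (act A (op f g)) w = eval_mero (op (act A f) (act A g)) w) (at z)"
    by eventually_elim (simp add: eval_act[OF A])
qed

lemma act_add: "A \<in> SL2Z \<Longrightarrow> act A (f + g) = act A f + act A g"
  by (rule act_op[of _ "(+)" "(+)"]) (assumption, rule eventually_eval_mero_ops)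

lemma act_mult: "A \<in> SL2Z \<Longrightarrow> act A (f * g) = act A f * act A g"
  by (rule act_op[of _ times times]) (assumption, rule eventually_eval_mero_ops)

lemma act_diff: "A \<in> SL2Z \<Longrightarrow> act A (f - g) = act A f - act A g"
  by (rule act_op[of _ "(-)" "(-)"]) (assumption, rule eventually_eval_mero_ops)

lemma act_divide: "A \<in> SL2Z \<Longrightarrow> act A (f / g) = act A f / act A g"
  by (rule act_op[of _ "(/)" "(/)"]) (assumption, rule eventually_eval_mero_ops)

lemma act_const: "A \<in> SL2Z \<Longrightarrow> act A (mero_const c) = mero_const c"
  by (rule mero_eqI) (simp add: eval_act eval_mero_const moebius_in_uhp)

lemma act_0 [simp]: "A \<in> SL2Z \<Longrightarrow> act A 0 = 0" and act_1 [simp]: "A \<in> SL2Z \<Longrightarrow> act A 1 = 1"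
  using act_const[of A 0] act_const[of A 1] by (simp_all add: mero_const_0 mero_const_1)

lemma act_uminus: "A \<in> SL2Z \<Longrightarrow> act A (- f) = - act A f"
  using act_diff[of A 0 f] by simp

lemma act_uminus_matrix [simp]: "act (- A) f = act A f"
  by (simp add: act_def)

lemma act_power: "A \<in> SL2Z \<Longrightarrow> act A (f ^ n) = act A f ^ n"
  by (induction n) (simp_all add: act_mult)

lemma act_sum: "A \<in> SL2Z \<Longrightarrow> act A (sum f I) = (\<Sum>i\<in>I. act A (f i))"
  by (induction I rule: infinite_finite_induct) (simp_all add: act_add)

lemma act_peval: "A \<in> SL2Z \<Longrightarrow> act A (peval q u) = peval q (act A u)"
  by (induction q) (simp_all add: act_add act_mult act_const)

lemma act_comp:
  assumes "A \<in> SL2Z" "B \<in> SL2Z"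
  shows "act (A ** B) f = act B (act A f)"
  by (rule mero_eqI) (use assms in \<open>simp add: eval_act SL2Z_mult moebius_mult_SL2Z moebius_in_uhp\<close>)

lemma act_mat1 [simp]: "act (mat 1) f = f"
  by (rule mero_eqI) (simp add: eval_act)

lemma act_inj: "A \<in> SL2Z \<Longrightarrow> act A f = act A g \<Longrightarrow> f = g"
  by (metis act_comp act_mat1 SL2Z_mat2_inv mat2_inv_right)

lemma act_eq_0_iff: "A \<in> SL2Z \<Longrightarrow> act A f = 0 \<longleftrightarrow> f = 0"
  using act_inj[of A f 0] by auto

lemma holomorphic_mero_act:
  assumes "A \<in> SL2Z" "holomorphic_mero f"
  shows "holomorphic_mero (act A f)"
proof -
  have "eval_mero f \<circ> moebius_act A holomorphic_on uhp"
    by (rule holomorphic_on_compose_gen[OF analytic_imp_holomorphic[OF moebius_analytic[OF assms(1)]] assms(2)])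
       (use moebius_in_uhp[OF assms(1)] in auto)
  thus ?thesis by (rule holomorphic_transform) (simp add: eval_act[OF assms(1)])
qed

lemma eval_mero_translate:
  assumes "act (mat2 1 1 0 1) f = f" "z \<in> uhp"
  shows "eval_mero f (z + 1) = eval_mero f z"
  using eval_act[of "mat2 1 1 0 1" z f] assms by (simp add: SL2Z_iff moebius_act_def)

section \<open>Fields of modular functions\<close>

lemma meromorphic_at_ii_inf_eval:
  assumes "meromorphic_at_ii_inf h" "\<And>z. z \<in> uhp \<Longrightarrow> eventually (\<lambda>w. eval_mero f w = h w) (at z)"
  shows "meromorphic_at_ii_inf (eval_mero f)"
proof (rule meromorphic_at_ii_inf_cong[OF assms(1)])
  show "eventually (\<lambda>z. h z = eval_mero f z) at_ii_inf"
    using meromorphic_at_ii_inf_analytic[OF assms(1)] eventually_uhp_at_ii_inf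
    by eventually_elim (intro eval_mero_eqI[symmetric] assms(2), auto)
qed

lemma meromorphic_at_cusps_iff:
  "meromorphic_at_cusps f \<longleftrightarrow> (\<forall>A\<in>SL2Z. meromorphic_at_ii_inf (eval_mero (act A f)))"
proof -
  have "(\<exists>N>0. \<exists>F b. F meromorphic_on {0} \<and> (\<forall>z\<in>uhp. Im z > b \<longrightarrow>
           eval_mero f (moebius_act A z) = F (exp (2 * of_real pi * \<i> * z / of_nat N)))) \<longleftrightarrow>
        meromorphic_at_ii_inf (eval_mero (act A f))" (is "?L \<longleftrightarrow> ?R") if A: "A \<in> SL2Z" for A
  proof
    assume ?L
    then obtain N F b where F: "N > 0" "F meromorphic_on {0}"
      "\<And>z. z \<in> uhp \<Longrightarrow> Im z > b \<Longrightarrow> eval_mero f (moebius_act A z) = F (exp (2 * of_real pi * \<i> * z / of_nat N))"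
        by blast
    have "eventually (\<lambda>z. eval_mero (act A f) z = F (to_q N z)) at_ii_inf" unfolding eventually_at_ii_inf
      by (rule exI[of _ "max b 1"]) (auto simp: eval_act[OF A] uhp_def F(3) to_q_def)
    thus ?R using F unfolding meromorphic_at_ii_inf_def by blast
  next
    assume ?R
    then obtain N F b where "N > 0" "F meromorphic_on {0}" "b > 0"
      "\<And>z. Im z > b \<Longrightarrow> eval_mero (act A f) z = F (to_q N z)"
        unfolding meromorphic_at_ii_inf_def eventually_at_ii_inf by blast
    thus ?L by (intro exI[of _ N] conjI exI[of _ F] exI[of _ b]) (auto simp: eval_act[OF A, symmetric] to_q_def)
  qed
  thus ?thesis unfolding meromorphic_at_cusps_def by simp
qed

lemma meromorphic_at_cusps_const: "meromorphic_at_cusps (mero_const c)"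
proof -
  have "meromorphic_at_ii_inf (eval_mero (mero_const c))"
    by (rule meromorphic_at_ii_inf_cong[OF meromorphic_at_ii_inf_const[of c]])
       (rule eventually_at_ii_infI, simp add: eval_mero_const)
  thus ?thesis by (simp add: meromorphic_at_cusps_iff act_const)
qed

lemma meromorphic_at_cusps_add: "meromorphic_at_cusps f \<Longrightarrow> meromorphic_at_cusps g \<Longrightarrow> meromorphic_at_cusps (f + g)"
  and meromorphic_at_cusps_mult: "meromorphic_at_cusps f \<Longrightarrow> meromorphic_at_cusps g \<Longrightarrow>
      meromorphic_at_cusps (f * g)"
  and meromorphic_at_cusps_divide: "meromorphic_at_cusps f \<Longrightarrow> meromorphic_at_cusps g \<Longrightarrow>
      meromorphic_at_cusps (f / g)"
  unfolding meromorphic_at_cusps_iff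
  by (auto simp: act_add act_mult act_divide
      intro!: meromorphic_at_ii_inf_eval[OF meromorphic_at_ii_inf_add eventually_eval_mero_ops(3)]
        meromorphic_at_ii_inf_eval[OF meromorphic_at_ii_inf_mult eventually_eval_mero_ops(6)]
        meromorphic_at_ii_inf_eval[OF meromorphic_at_ii_inf_divide eventually_eval_mero_ops(8)])

lemma meromorphic_at_cusps_act: "A \<in> SL2Z \<Longrightarrow> meromorphic_at_cusps f \<Longrightarrow> meromorphic_at_cusps (act A f)"
  unfolding meromorphic_at_cusps_iff by (metis act_comp SL2Z_mult)

lemma modular_functions_iff:
  assumes "G \<subseteq> SL2Z"
  shows "f \<in> \<A>\<^sub>0 G \<longleftrightarrow> (\<forall>A\<in>G. act A f = f) \<and> meromorphic_at_cusps f"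
proof -
  have "(\<forall>z\<in>uhp. eval_mero f (moebius_act A z) = eval_mero f z) \<longleftrightarrow> act A f = f" if "A \<in> SL2Z" for A
    using that by (metis eval_act mero_eqI)
  thus ?thesis using assms unfolding modular_functions_def by auto
qed

lemma modular_functions_antimono: "G \<subseteq> H \<Longrightarrow> \<A>\<^sub>0 H \<subseteq> \<A>\<^sub>0 G"
  by (auto simp: modular_functions_def)

lemma act_Gamma_mat_cong:
  assumes f: "f \<in> \<A>\<^sub>0 \<Gamma>(N)" and "A \<in> SL2Z" "B \<in> SL2Z" "mat_cong N A B"
  shows "act A f = act B f"
proof -
  have G: "A ** mat2_inv B \<in> \<Gamma>(N)" by (rule mat_cong_imp_Gamma[OF assms(2-4)])
  have "act A f = act ((A ** mat2_inv B) ** B) f" using assms by (simp add: mult_mat2_inv_cancel)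
  also have "\<dots> = act B (act (A ** mat2_inv B) f)" using assms G Gamma_subset by (intro act_comp) auto
  finally show ?thesis using f G by (simp add: modular_functions_iff[OF Gamma_subset])
qed

lemma act_Gamma_closed:
  assumes f: "f \<in> \<A>\<^sub>0 \<Gamma>(N)" and A: "A \<in> SL2Z"
  shows "act A f \<in> \<A>\<^sub>0 \<Gamma>(N)"
proof -
  have "act B (act A f) = act A f" if B: "B \<in> \<Gamma>(N)" for B
  proof -
    have "mat_cong N (A ** B) (A ** mat 1)" using B by (intro mat_cong_mult) (auto simp: Gamma_iff)
    thus ?thesis using act_Gamma_mat_cong[OF f, of "A ** B" A] A B Gamma_subset
      by (simp add: SL2Z_mult act_comp subset_iff)
  qed
  thus ?thesis using f A by (auto simp: modular_functions_iff[OF Gamma_subset] meromorphic_at_cusps_act)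
qed

definition C_subfield :: "mero_uhp set \<Rightarrow> bool" where
  "C_subfield K \<longleftrightarrow> range mero_const \<subseteq> K \<and> (\<forall>x\<in>K. \<forall>y\<in>K. x + y \<in> K \<and> x * y \<in> K \<and> x / y \<in> K)"

lemma
  assumes "C_subfield K"
  shows C_subfield_const: "mero_const c \<in> K"
    and C_subfield_add: "x \<in> K \<Longrightarrow> y \<in> K \<Longrightarrow> x + y \<in> K"
    and C_subfield_mult: "x \<in> K \<Longrightarrow> y \<in> K \<Longrightarrow> x * y \<in> K"
    and C_subfield_divide: "x \<in> K \<Longrightarrow> y \<in> K \<Longrightarrow> x / y \<in> K"
  using assms by (auto simp: C_subfield_def)

lemma
  assumes "C_subfield K"
  shows C_subfield_0: "0 \<in> K" and C_subfield_1: "1 \<in> K"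
  using C_subfield_const[OF assms, of 0] C_subfield_const[OF assms, of 1]
  by (simp_all add: mero_const_0 mero_const_1)

lemma C_subfield_uminus: "C_subfield K \<Longrightarrow> x \<in> K \<Longrightarrow> - x \<in> K"
  using C_subfield_mult[OF _ C_subfield_const[of K "- 1"]] by (fastforce simp: mero_const_minus_1)

lemma C_subfield_diff: "C_subfield K \<Longrightarrow> x \<in> K \<Longrightarrow> y \<in> K \<Longrightarrow> x - y \<in> K"
  using C_subfield_add[of K x "- y"] C_subfield_uminus[of K y] by simp

lemma C_subfield_inverse: "C_subfield K \<Longrightarrow> x \<in> K \<Longrightarrow> inverse x \<in> K"
  using C_subfield_divide[of K 1 x] C_subfield_1[of K] by (simp add: inverse_eq_divide)

lemma C_subfield_power: "C_subfield K \<Longrightarrow> x \<in> K \<Longrightarrow> x ^ n \<in> K"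
  by (induction n) (auto intro: C_subfield_mult C_subfield_1)

lemma C_subfield_sum: "C_subfield K \<Longrightarrow> (\<And>i. i \<in> I \<Longrightarrow> f i \<in> K) \<Longrightarrow> sum f I \<in> K"
  by (induction I rule: infinite_finite_induct) (auto intro: C_subfield_0 C_subfield_add)

lemma C_subfield_prod: "C_subfield K \<Longrightarrow> (\<And>i. i \<in> I \<Longrightarrow> f i \<in> K) \<Longrightarrow> prod f I \<in> K"
  by (induction I rule: infinite_finite_induct) (auto intro: C_subfield_1 C_subfield_mult)

lemmas C_subfield_intros =
  C_subfield_const C_subfield_0 C_subfield_1 C_subfield_add C_subfield_diff C_subfield_uminus
  C_subfield_mult C_subfield_divide C_subfield_inverse C_subfield_power C_subfield_sum C_subfield_prod

lemma C_subfield_peval: "C_subfield K \<Longrightarrow> x \<in> K \<Longrightarrow> peval p x \<in> K"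
  by (induction p) (auto intro: C_subfield_intros)

lemma C_subfield_modular_functions:
  assumes "G \<subseteq> SL2Z"
  shows "C_subfield (\<A>\<^sub>0 G)"
  unfolding C_subfield_def using assms
  by (auto simp: modular_functions_iff act_const meromorphic_at_cusps_const act_add act_mult act_divide
      meromorphic_at_cusps_add meromorphic_at_cusps_mult meromorphic_at_cusps_divide subset_iff)

lemma mero_field_simps:
  "carrier mero_field = UNIV" "mult mero_field = times" "one mero_field = 1"
    "zero mero_field = 0" "add mero_field = (+)"
  by (simp_all add: ring_of_type_algebra_def)

lemma mero_field_a_inv: "\<ominus>\<^bsub>mero_field\<^esub> x = - x"
proof -
  interpret field mero_field by (rule field_from_type_algebra)
  show ?thesis by (rule minus_equality) (simp_all add: mero_field_simps)
qed

lemma mero_field_m_inv: "x \<noteq> 0 \<Longrightarrow> inv\<^bsub>mero_field\<^esub> x = inverse x"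
proof -
  interpret field mero_field by (rule field_from_type_algebra)
  assume "x \<noteq> 0"
  thus ?thesis by (intro comm_inv_char) (simp_all add: mero_field_simps)
qed

lemma generate_field_least:
  assumes "C_subfield K" "H \<subseteq> K"
  shows "generate_field mero_field H \<subseteq> K"
proof
  fix x assume "x \<in> generate_field mero_field H"
  thus "x \<in> K"
    by induction (use assms in \<open>auto simp: mero_field_simps mero_field_a_inv
      mero_field_m_inv intro: C_subfield_intros\<close>)
qed

lemma adjoin_C_least:
  assumes "C_subfield K" "S \<subseteq> K"
  shows "\<complex>(S) \<subseteq> K"
  unfolding adjoin_C_def by (rule generate_field_least) (use assms C_subfield_const in auto)

lemma C_subfield_generate_field:
  assumes "range mero_const \<subseteq> H"
  shows "C_subfield (generate_field mero_field H)"
proof -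
  have inv: "inverse x \<in> generate_field mero_field H" if "x \<in> generate_field mero_field H" for x
  proof (cases "x = 0")
    case False
    thus ?thesis using generate_field.m_inv[OF that] mero_field_m_inv by (simp add: mero_field_simps)
  qed (use that in simp)
  show ?thesis unfolding C_subfield_def divide_inverse
    using subsetD[OF assms] inv generate_field.incl[of _ H mero_field] generate_field.eng_add[of _ mero_field H]
      generate_field.eng_mult[of _ mero_field H]
    by (auto simp: mero_field_simps image_subset_iff)
qed

lemma C_subfield_adjoin_C: "C_subfield \<complex>(S)"
  unfolding adjoin_C_def by (rule C_subfield_generate_field) auto

lemma adjoin_C_superset: "S \<subseteq> \<complex>(S)"
  unfolding adjoin_C_def by (auto intro: generate_field.incl)

section \<open>Galois descent along congruence subgroups\<close>

definition coeffs_in :: "'a :: zero set \<Rightarrow> 'a poly \<Rightarrow> bool" where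
  "coeffs_in K p \<longleftrightarrow> (\<forall>i. poly.coeff p i \<in> K)"

lemma coeffs_in_0: "C_subfield K \<Longrightarrow> coeffs_in K 0" and coeffs_in_1: "C_subfield K \<Longrightarrow> coeffs_in K 1"
  by (auto simp: coeffs_in_def coeff_1 intro: C_subfield_0 C_subfield_1)

lemma coeffs_in_pCons_iff: "coeffs_in K (pCons a p) \<longleftrightarrow> a \<in> K \<and> coeffs_in K p"
  unfolding coeffs_in_def by (metis coeff_pCons_0 coeff_pCons_Suc not0_implies_Suc)

lemma coeffs_in_linear: "C_subfield K \<Longrightarrow> c \<in> K \<Longrightarrow> coeffs_in K [:- c, 1:]"
  by (simp add: coeffs_in_pCons_iff coeffs_in_0 C_subfield_1 C_subfield_uminus)

lemma coeffs_in_smult: "C_subfield K \<Longrightarrow> c \<in> K \<Longrightarrow> coeffs_in K p \<Longrightarrow> coeffs_in K (Polynomial.smult c p)"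
  by (simp add: coeffs_in_def C_subfield_mult)

lemma coeffs_in_mult: "C_subfield K \<Longrightarrow> coeffs_in K p \<Longrightarrow> coeffs_in K q \<Longrightarrow> coeffs_in K (p * q)"
  by (simp add: coeffs_in_def coeff_mult C_subfield_sum C_subfield_mult)

lemma coeffs_in_sum: "C_subfield K \<Longrightarrow> (\<And>i. i \<in> I \<Longrightarrow> coeffs_in K (p i)) \<Longrightarrow> coeffs_in K (sum p I)"
  by (simp add: coeffs_in_def coeff_sum C_subfield_sum)

lemma coeffs_in_prod: "C_subfield K \<Longrightarrow> (\<And>i. i \<in> I \<Longrightarrow> coeffs_in K (p i)) \<Longrightarrow> coeffs_in K (prod p I)"
  by (induction I rule: infinite_finite_induct) (simp_all add: coeffs_in_1 coeffs_in_mult)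

lemma C_subfield_poly: "C_subfield K \<Longrightarrow> coeffs_in K p \<Longrightarrow> x \<in> K \<Longrightarrow> poly p x \<in> K"
  by (induction p) (auto simp: coeffs_in_pCons_iff intro: C_subfield_intros)

lemma coeff_map_poly_act: "A \<in> SL2Z \<Longrightarrow> poly.coeff (map_poly (act A) p) i = act A (poly.coeff p i)"
  by (simp add: coeff_map_poly)

lemma map_poly_act_add: "A \<in> SL2Z \<Longrightarrow> map_poly (act A) (p + q) = map_poly (act A) p + map_poly (act A) q"
  by (rule poly_eqI) (simp add: coeff_map_poly_act act_add)

lemma map_poly_act_mult: "A \<in> SL2Z \<Longrightarrow> map_poly (act A) (p * q) = map_poly (act A) p * map_poly (act A) q"
  by (rule poly_eqI) (simp add: coeff_map_poly_act coeff_mult act_sum act_mult)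

lemma map_poly_act_smult:
  "A \<in> SL2Z \<Longrightarrow> map_poly (act A) (Polynomial.smult c p) = Polynomial.smult (act A c) (map_poly (act A) p)"
  by (rule poly_eqI) (simp add: coeff_map_poly_act act_mult)

lemma map_poly_act_linear: "A \<in> SL2Z \<Longrightarrow> map_poly (act A) [:- c, 1:] = [:- act A c, 1:]"
  by (simp add: map_poly_pCons act_uminus)

lemma map_poly_act_sum: "A \<in> SL2Z \<Longrightarrow> map_poly (act A) (sum p I) = (\<Sum>i\<in>I. map_poly (act A) (p i))"
  by (induction I rule: infinite_finite_induct) (simp_all add: map_poly_act_add)

lemma map_poly_act_prod: "A \<in> SL2Z \<Longrightarrow> map_poly (act A) (prod p I) = (\<Prod>i\<in>I. map_poly (act A) (p i))"
  by (induction I rule: infinite_finite_induct) (simp_all add: map_poly_act_mult map_poly_1)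

lemma act_poly: "A \<in> SL2Z \<Longrightarrow> act A (poly p x) = poly (map_poly (act A) p) (act A x)"
  by (induction p) (simp_all add: map_poly_pCons act_add act_mult)

text \<open>\<open>R\<close> represents the quotient of \<open>G\<close> by \<open>\<Gamma>(N)\<close>, through which \<open>G\<close> acts on the modular functions of level \<open>N\<close>.\<close>

locale congruence_group =
  fixes G :: "(int ^ 2 ^ 2) set" and N :: nat and R :: "(int ^ 2 ^ 2) set"
  assumes G_subset: "G \<subseteq> SL2Z" and N_pos: "N > 0" and Gamma_subset_G: "\<Gamma>(N) \<subseteq> G"
    and G_mult: "A \<in> G \<Longrightarrow> B \<in> G \<Longrightarrow> A ** B \<in> G" and G_mat2_inv: "A \<in> G \<Longrightarrow> mat2_inv A \<in> G"
    and R_transversal: "transversal N G R"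
begin

lemma finite_R: "finite R" and R_subset: "R \<subseteq> G"
  and R_unique: "A \<in> G \<Longrightarrow> \<exists>!B. B \<in> R \<and> mat_cong N A B"
  using R_transversal by (auto simp: transversal_def)

lemma C_subfield_level: "C_subfield (\<A>\<^sub>0 \<Gamma>(N))" and C_subfield_invariants: "C_subfield (\<A>\<^sub>0 G)"
  by (intro C_subfield_modular_functions Gamma_subset G_subset)+

lemma G_one: "mat 1 \<in> G" using Gamma_subset_G by (auto simp: Gamma_iff)

lemma modular_functions_G_iff: "f \<in> \<A>\<^sub>0 G \<longleftrightarrow> f \<in> \<A>\<^sub>0 \<Gamma>(N) \<and> (\<forall>A\<in>G. act A f = f)"
  using modular_functions_iff[OF G_subset] modular_functions_iff[OF Gamma_subset] Gamma_subset_G by blast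

lemma translation_permutes_reps:
  assumes C: "C \<in> G"
  obtains \<pi> where "bij_betw \<pi> R R" "\<And>A f. A \<in> R \<Longrightarrow> f \<in> \<A>\<^sub>0 \<Gamma>(N) \<Longrightarrow> act C (act A f) = act (\<pi> A) f"
proof -
  define \<pi> where "\<pi> A = (THE B. B \<in> R \<and> mat_cong N (A ** C) B)" for A
  have \<pi>: "\<pi> A \<in> R" "mat_cong N (A ** C) (\<pi> A)" if "A \<in> R" for A
    using theI'[OF R_unique[of "A ** C"]] that R_subset C G_mult unfolding \<pi>_def by blast+
  have "inj_on \<pi> R"
  proof (rule inj_onI)
    fix A B assume AB: "A \<in> R" "B \<in> R" "\<pi> A = \<pi> B"
    have "mat_cong N (A ** C) (B ** C)" using \<pi>(2)[OF AB(1)] \<pi>(2)[OF AB(2)] AB(3)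
      by (metis mat_cong_sym mat_cong_trans)
    hence "mat_cong N (A ** C ** mat2_inv C) (B ** C ** mat2_inv C)" by (rule mat_cong_mult) simp
    hence "mat_cong N A B" using C G_subset by (auto simp: matrix_mul_assoc[symmetric] mat2_inv_right)
    thus "A = B" using R_unique[of A] AB R_subset mat_cong_refl[of N A] by blast
  qed
  moreover from this have "\<pi> ` R = R" using \<pi>(1) finite_R by (intro endo_inj_surj) auto
  ultimately have "bij_betw \<pi> R R" by (simp add: bij_betw_def)
  moreover have "act C (act A f) = act (\<pi> A) f" if "A \<in> R" "f \<in> \<A>\<^sub>0 \<Gamma>(N)" for A f
  proof -
    have SL2Z: "A \<in> SL2Z" "C \<in> SL2Z" "\<pi> A \<in> SL2Z" using that C \<pi>(1)[OF that(1)] R_subset G_subset by auto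
    hence "act C (act A f) = act (A ** C) f" by (simp add: act_comp)
    also have "\<dots> = act (\<pi> A) f" using act_Gamma_mat_cong[OF that(2) _ SL2Z(3) \<pi>(2)[OF that(1)]] SL2Z SL2Z_mult
      by blast
    finally show ?thesis .
  qed
  ultimately show ?thesis using that by blast
qed

lemma identity_rep:
  obtains I where "I \<in> R" "mat_cong N (mat 1) I" "\<And>f. f \<in> \<A>\<^sub>0 \<Gamma>(N) \<Longrightarrow> act I f = f"
proof -
  obtain I where I: "I \<in> R" "mat_cong N (mat 1) I" using R_unique[OF G_one] by blast
  have "act I f = f" if "f \<in> \<A>\<^sub>0 \<Gamma>(N)" for f
    using act_Gamma_mat_cong[OF that, of "mat 1" I] I R_subset G_subset by auto
  thus ?thesis using that I by blast
qed

lemma act_R_closed: "f \<in> \<A>\<^sub>0 \<Gamma>(N) \<Longrightarrow> A \<in> R \<Longrightarrow> act A f \<in> \<A>\<^sub>0 \<Gamma>(N)"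
  using act_Gamma_closed R_subset G_subset by blast

lemma coeffs_in_invariantsI:
  assumes "coeffs_in (\<A>\<^sub>0 \<Gamma>(N)) p" "\<And>A. A \<in> G \<Longrightarrow> map_poly (act A) p = p"
  shows "coeffs_in (\<A>\<^sub>0 G) p"
  unfolding coeffs_in_def modular_functions_G_iff
  using assms G_subset coeff_map_poly_act by (metis coeffs_in_def subsetD)

definition char_poly :: "mero_uhp \<Rightarrow> mero_uhp poly" where
  "char_poly f = (\<Prod>A\<in>R. [:- act A f, 1:])"

lemma poly_char_poly_eq_0_iff: "poly (char_poly f) x = 0 \<longleftrightarrow> (\<exists>A\<in>R. x = act A f)"
  unfolding char_poly_def poly_prod using finite_R by (auto simp: prod_zero_iff)

lemma coeffs_in_char_poly:
  assumes f: "f \<in> \<A>\<^sub>0 \<Gamma>(N)"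
  shows "coeffs_in (\<A>\<^sub>0 G) (char_poly f)"
proof (rule coeffs_in_invariantsI)
  show "coeffs_in (\<A>\<^sub>0 \<Gamma>(N)) (char_poly f)"
    unfolding char_poly_def by (intro coeffs_in_prod coeffs_in_linear C_subfield_level act_R_closed[OF f])
  fix C assume C: "C \<in> G"
  hence CS: "C \<in> SL2Z" using G_subset by blast
  obtain \<pi> where \<pi>: "bij_betw \<pi> R R" "\<And>A f. A \<in> R \<Longrightarrow> f \<in> \<A>\<^sub>0 \<Gamma>(N) \<Longrightarrow> act C (act A f) = act (\<pi> A) f"
    using translation_permutes_reps[OF C] by blast
  have "map_poly (act C) (char_poly f) = (\<Prod>A\<in>R. [:- act (\<pi> A) f, 1:])"
    using \<pi>(2) f by (simp add: char_poly_def map_poly_act_prod[OF CS] map_poly_act_linear[OF CS])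
  also have "\<dots> = char_poly f" unfolding char_poly_def by (rule prod.reindex_bij_betw[OF \<pi>(1)])
  finally show "map_poly (act C) (char_poly f) = char_poly f" .
qed

lemma norm_relation:
  assumes f: "f \<in> \<A>\<^sub>0 \<Gamma>(N)" "f \<noteq> 0"
  obtains q c where "coeffs_in (\<A>\<^sub>0 G) q" "c \<in> \<A>\<^sub>0 G" "c \<noteq> 0" "f * poly q f = c"
proof -
  obtain c q where cq: "char_poly f = pCons c q" by (cases "char_poly f")
  have "poly (char_poly f) f = 0" using identity_rep f(1) unfolding poly_char_poly_eq_0_iff by metis
  hence "f * poly q f = - c" unfolding cq by (simp add: eq_neg_iff_add_eq_0 add.commute)
  moreover have "poly (char_poly f) 0 \<noteq> 0"
    unfolding poly_char_poly_eq_0_iff using R_subset G_subset f(2) act_eq_0_iff by (metis subsetD)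
  hence "- c \<noteq> 0" unfolding cq by simp
  moreover have "c \<in> \<A>\<^sub>0 G" "coeffs_in (\<A>\<^sub>0 G) q"
    using coeffs_in_char_poly[OF f(1)] unfolding cq coeffs_in_pCons_iff by blast+
  ultimately show ?thesis using that C_subfield_uminus[OF C_subfield_invariants] by blast
qed

text \<open>The Lagrange interpolation polynomial taking the values \<open>f \<circ> A\<close> at \<open>\<theta> \<circ> A\<close>, up to the
  factor \<open>M'\<close>, \<open>M\<close> being the characteristic polynomial of \<open>\<theta>\<close>.\<close>

definition interpolation_poly :: "mero_uhp \<Rightarrow> mero_uhp \<Rightarrow> mero_uhp poly" where
  "interpolation_poly f \<theta> = (\<Sum>A\<in>R. Polynomial.smult (act A f) (\<Prod>B\<in>R - {A}. [:- act B \<theta>, 1:]))"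

lemma coeffs_in_interpolation_poly:
  assumes f: "f \<in> \<A>\<^sub>0 \<Gamma>(N)" and \<theta>: "\<theta> \<in> \<A>\<^sub>0 \<Gamma>(N)"
  shows "coeffs_in (\<A>\<^sub>0 G) (interpolation_poly f \<theta>)"
proof (rule coeffs_in_invariantsI)
  show "coeffs_in (\<A>\<^sub>0 \<Gamma>(N)) (interpolation_poly f \<theta>)"
    unfolding interpolation_poly_def
    by (intro coeffs_in_sum coeffs_in_smult coeffs_in_prod coeffs_in_linear
      C_subfield_level act_R_closed[OF f] act_R_closed[OF \<theta>]) auto
  fix C assume C: "C \<in> G"
  hence CS: "C \<in> SL2Z" using G_subset by blast
  obtain \<pi> where \<pi>: "bij_betw \<pi> R R" "\<And>A f. A \<in> R \<Longrightarrow> f \<in> \<A>\<^sub>0 \<Gamma>(N) \<Longrightarrow> act C (act A f) = act (\<pi> A) f"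
    using translation_permutes_reps[OF C] by blast
  have "map_poly (act C) (interpolation_poly f \<theta>) =
      (\<Sum>A\<in>R. Polynomial.smult (act C (act A f)) (\<Prod>B\<in>R - {A}. [:- act C (act B \<theta>), 1:]))"
    by (simp add: interpolation_poly_def map_poly_act_sum[OF CS] map_poly_act_smult[OF CS]
      map_poly_act_prod[OF CS]
        map_poly_act_linear[OF CS])
  also have "\<dots> = (\<Sum>A\<in>R. Polynomial.smult (act (\<pi> A) f) (\<Prod>B\<in>R - {\<pi> A}. [:- act B \<theta>, 1:]))"
  proof (rule sum.cong[OF refl])
    fix A assume A: "A \<in> R"
    have "bij_betw \<pi> (R - {A}) (R - {\<pi> A})"
      using \<pi>(1) A by (auto simp: bij_betw_def inj_on_diff inj_on_image_set_diff[of \<pi> R])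
    hence "(\<Prod>B\<in>R - {A}. [:- act (\<pi> B) \<theta>, 1:]) = (\<Prod>B\<in>R - {\<pi> A}. [:- act B \<theta>, 1:])"
      by (rule prod.reindex_bij_betw)
    thus "Polynomial.smult (act C (act A f)) (\<Prod>B\<in>R - {A}. [:- act C (act B \<theta>), 1:]) =
        Polynomial.smult (act (\<pi> A) f) (\<Prod>B\<in>R - {\<pi> A}. [:- act B \<theta>, 1:])"
      using \<pi>(2) A f \<theta> by simp
  qed
  also have "\<dots> = interpolation_poly f \<theta>"
    unfolding interpolation_poly_def by (rule sum.reindex_bij_betw[OF \<pi>(1)])
  finally show "map_poly (act C) (interpolation_poly f \<theta>) = interpolation_poly f \<theta>" .
qed

lemma poly_interpolation_poly:
  assumes f: "f \<in> \<A>\<^sub>0 \<Gamma>(N)" and \<theta>: "\<theta> \<in> \<A>\<^sub>0 \<Gamma>(N)"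
    and I: "I \<in> R" "\<And>f. f \<in> \<A>\<^sub>0 \<Gamma>(N) \<Longrightarrow> act I f = f"
  shows "poly (interpolation_poly f \<theta>) \<theta> = f * (\<Prod>B\<in>R - {I}. \<theta> - act B \<theta>)"
proof -
  have vanish: "(\<Prod>B\<in>R - {A}. \<theta> - act B \<theta>) = 0" if "A \<in> R - {I}" for A
    using that finite_R I(1) I(2)[OF \<theta>] by (subst prod_zero_iff) (auto intro!: bexI[of _ I])
  have "poly (interpolation_poly f \<theta>) \<theta> = (\<Sum>A\<in>R. act A f * (\<Prod>B\<in>R - {A}. \<theta> - act B \<theta>))"
    by (simp add: interpolation_poly_def poly_sum poly_prod)
  also have "\<dots> = (\<Sum>A\<in>{I}. act A f * (\<Prod>B\<in>R - {A}. \<theta> - act B \<theta>))"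
    using I(1) vanish by (intro sum.mono_neutral_right[OF finite_R]) auto
  finally show ?thesis using I(2)[OF f] by simp
qed

lemma primitive_element_generates:
  assumes \<theta>: "\<theta> \<in> \<A>\<^sub>0 \<Gamma>(N)" and stabilizer: "\<And>A. A \<in> G \<Longrightarrow> act A \<theta> = \<theta> \<Longrightarrow> A \<in> \<Gamma>(N)"
    and L: "C_subfield L" "\<A>\<^sub>0 G \<subseteq> L" "\<theta> \<in> L"
  shows "\<A>\<^sub>0 \<Gamma>(N) \<subseteq> L"
proof
  fix f assume f: "f \<in> \<A>\<^sub>0 \<Gamma>(N)"
  obtain I where I: "I \<in> R" "mat_cong N (mat 1) I" "\<And>f. f \<in> \<A>\<^sub>0 \<Gamma>(N) \<Longrightarrow> act I f = f" using identity_rep by blast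
  define D where "D = (\<Prod>B\<in>R - {I}. \<theta> - act B \<theta>)"
  have one: "1 \<in> \<A>\<^sub>0 \<Gamma>(N)" by (rule C_subfield_1[OF C_subfield_level])
  have "act B \<theta> \<noteq> \<theta>" if B: "B \<in> R - {I}" for B
  proof
    assume "act B \<theta> = \<theta>"
    hence "mat_cong N (mat 1) B" using stabilizer[of B] B R_subset by (auto simp: Gamma_iff mat_cong_sym)
    thus False using R_unique[OF G_one] I B by blast
  qed
  hence "D \<noteq> 0" unfolding D_def using finite_R by (subst prod_zero_iff) force+
  hence "f = poly (interpolation_poly f \<theta>) \<theta> / poly (interpolation_poly 1 \<theta>) \<theta>"
    using poly_interpolation_poly[OF f \<theta> I(1,3)] poly_interpolation_poly[OF one \<theta> I(1,3)] by (simp add: D_def)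
  moreover have "poly (interpolation_poly g \<theta>) \<theta> \<in> L" if "g \<in> \<A>\<^sub>0 \<Gamma>(N)" for g
    using coeffs_in_interpolation_poly[OF that \<theta>] L by (intro C_subfield_poly) (auto simp: coeffs_in_def)
  ultimately show "f \<in> L" using C_subfield_divide[OF L(1)] f one by metis
qed

lemma primitive_element_exists:
  assumes p: "coeffs_in (\<A>\<^sub>0 \<Gamma>(N)) p"
    and stabilizer: "\<And>A. A \<in> G \<Longrightarrow> map_poly (act A) p = p \<Longrightarrow> A \<in> \<Gamma>(N)"
  obtains c where "\<And>A. A \<in> G \<Longrightarrow> act A (poly p (mero_const c)) = poly p (mero_const c) \<Longrightarrow> A \<in> \<Gamma>(N)"
proof -
  define bad where "bad = (\<Union>B\<in>R - \<Gamma>(N). {y. poly (map_poly (act B) p - p) y = 0})"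
  have nonzero: "map_poly (act B) p - p \<noteq> 0" if "B \<in> R - \<Gamma>(N)" for B
    using stabilizer[of B] that R_subset by auto
  have "finite bad" unfolding bad_def by (intro finite_UN_I finite_Diff finite_R poly_roots_finite nonzero)
  hence "finite (mero_const -` bad)" using inj_mero_const by (rule finite_vimageI)
  then obtain c where c: "mero_const c \<notin> bad" by (metis ex_new_if_finite infinite_UNIV_char_0 vimage_eq)
  show ?thesis
  proof (rule that[of c])
    fix A assume A: "A \<in> G" "act A (poly p (mero_const c)) = poly p (mero_const c)"
    obtain B where B: "B \<in> R" "mat_cong N A B" using R_unique[OF A(1)] by blast
    have SL2Z: "A \<in> SL2Z" "B \<in> SL2Z" using A B R_subset G_subset by auto
    have "poly p (mero_const c) \<in> \<A>\<^sub>0 \<Gamma>(N)"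
      by (intro C_subfield_poly C_subfield_level p C_subfield_const)
    hence "act B (poly p (mero_const c)) = poly p (mero_const c)"
      using act_Gamma_mat_cong[OF _ SL2Z B(2)] A(2) by metis
    hence "poly (map_poly (act B) p - p) (mero_const c) = 0" by (simp add: act_poly SL2Z act_const)
    hence "B \<in> \<Gamma>(N)" using c B(1) unfolding bad_def by auto
    hence "mat_cong N A (mat 1)" using B(2) by (meson Gamma_iff mat_cong_trans)
    thus "A \<in> \<Gamma>(N)" using SL2Z by (simp add: Gamma_iff)
  qed
qed

theorem modular_functions_level_subset:
  assumes p: "coeffs_in (\<A>\<^sub>0 \<Gamma>(N)) p" and L: "C_subfield L" "\<A>\<^sub>0 G \<subseteq> L" "coeffs_in L p"
    and stabilizer: "\<And>A. A \<in> G \<Longrightarrow> map_poly (act A) p = p \<Longrightarrow> A \<in> \<Gamma>(N)"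
  shows "\<A>\<^sub>0 \<Gamma>(N) \<subseteq> L"
proof -
  obtain c where c: "\<And>A. A \<in> G \<Longrightarrow> act A (poly p (mero_const c)) = poly p (mero_const c) \<Longrightarrow> A \<in> \<Gamma>(N)"
    using primitive_element_exists[OF p stabilizer] by blast
  have "poly p (mero_const c) \<in> \<A>\<^sub>0 \<Gamma>(N)" "poly p (mero_const c) \<in> L"
    by (intro C_subfield_poly C_subfield_level p L C_subfield_const)+
  thus ?thesis using primitive_element_generates[OF _ c L(1,2)] by blast
qed

end

section \<open>Liouville's theorem for modular functions\<close>

lemma act_level_one: "f \<in> \<A>\<^sub>0 SL2Z \<Longrightarrow> A \<in> SL2Z \<Longrightarrow> act A f = f"
  by (simp add: modular_functions_iff)

lemma eval_level_one_fund_strip: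
  assumes "f \<in> \<A>\<^sub>0 SL2Z" "z \<in> uhp"
  obtains w where "w \<in> fund_strip" "eval_mero f w = eval_mero f z"
proof -
  obtain A where A: "A \<in> SL2Z" "moebius_act A z \<in> fund_strip" using exists_fund_strip_rep[OF assms(2)] .
  have "eval_mero f (moebius_act A z) = eval_mero (act A f) z" by (simp add: eval_act A(1) assms(2))
  thus ?thesis using that A act_level_one[OF assms(1)] by simp
qed

lemma level_one_attains_maximum:
  assumes f: "f \<in> \<A>\<^sub>0 SL2Z" "holomorphic_mero f" and lim: "(eval_mero f \<longlongrightarrow> 0) at_ii_inf"
    and z0: "z0 \<in> uhp" "eval_mero f z0 \<noteq> 0"
  obtains w where "w \<in> uhp" "\<And>z. z \<in> uhp \<Longrightarrow> norm (eval_mero f z) \<le> norm (eval_mero f w)"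
proof -
  define \<epsilon> where "\<epsilon> = norm (eval_mero f z0)"
  have "eventually (\<lambda>\<tau>. norm (eval_mero f \<tau>) < \<epsilon>) at_ii_inf"
    using order_tendstoD(2)[OF tendsto_norm[OF lim]] z0(2) by (simp add: \<epsilon>_def)
  then obtain b where b: "\<And>\<tau>. Im \<tau> > b \<Longrightarrow> norm (eval_mero f \<tau>) < \<epsilon>" unfolding eventually_at_ii_inf by blast
  define K where "K = fund_strip \<inter> {z. Im z \<le> b}"
  obtain w0 where w0: "w0 \<in> fund_strip" "norm (eval_mero f w0) = \<epsilon>"
    using eval_level_one_fund_strip[OF f(1) z0(1)] unfolding \<epsilon>_def by metis
  hence "w0 \<in> K" using b[of w0] by (force simp: K_def)
  moreover have "continuous_on K (\<lambda>w. norm (eval_mero f w))"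
    using f(2) fund_strip_subset by (intro continuous_on_norm holomorphic_on_imp_continuous_on)
      (auto simp: K_def intro: holomorphic_on_subset)
  ultimately obtain w where w: "w \<in> K" "\<And>z. z \<in> K \<Longrightarrow> norm (eval_mero f z) \<le> norm (eval_mero f w)"
    using continuous_attains_sup[of K] compact_fund_strip_below unfolding K_def by blast
  have "norm (eval_mero f z) \<le> norm (eval_mero f w)" if "z \<in> fund_strip" for z
    using w(2)[OF \<open>w0 \<in> K\<close>] w(2)[of z] b[of z] that w0(2) by (cases "Im z \<le> b") (auto simp: K_def)
  hence "norm (eval_mero f z) \<le> norm (eval_mero f w)" if "z \<in> uhp" for z
    using eval_level_one_fund_strip[OF f(1) that] by metis
  thus ?thesis using that w(1) fund_strip_subset by (auto simp: K_def)
qed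

lemma level_one_cusp_form_eq_0:
  assumes f: "f \<in> \<A>\<^sub>0 SL2Z" "holomorphic_mero f" and lim: "(eval_mero f \<longlongrightarrow> 0) at_ii_inf"
  shows "f = 0"
proof (rule mero_eqI, rule ccontr)
  fix z0 assume z0: "z0 \<in> uhp" and "eval_mero f z0 \<noteq> eval_mero 0 z0"
  hence nonzero: "eval_mero f z0 \<noteq> 0" by (simp add: eval_mero_0)
  obtain w where "w \<in> uhp" "\<And>z. z \<in> uhp \<Longrightarrow> norm (eval_mero f z) \<le> norm (eval_mero f w)"
    using level_one_attains_maximum[OF f lim z0 nonzero] by blast
  hence "eval_mero f constant_on uhp"
    by (intro maximum_modulus_principle[OF f(2) open_uhp connected_uhp open_uhp order_refl])
  then obtain c where c: "\<And>z. z \<in> uhp \<Longrightarrow> eval_mero f z = c" unfolding constant_on_def by blast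
  have "((\<lambda>_. c) \<longlongrightarrow> 0) at_ii_inf"
    by (rule Lim_transform_eventually[OF lim]) (simp add: eventually_at_ii_infI c)
  hence "c = 0" by (simp add: tendsto_const_iff[OF at_ii_inf_neq_bot])
  thus False using c[OF z0] nonzero by simp
qed

lemma congruence_group_SL2Z: "N > 0 \<Longrightarrow> transversal N SL2Z R \<Longrightarrow> congruence_group SL2Z N R"
  using Gamma_subset by unfold_locales (auto simp: SL2Z_mult SL2Z_mat2_inv)

text \<open>With \<open>c\<close> the value of \<open>f\<close> at \<open>\<infinity>\<close>, the product of all conjugates of \<open>c - f\<close> has level one and vanishes at
  \<open>\<infinity>\<close>.\<close>

theorem modular_Liouville:
  assumes f: "f \<in> \<A>\<^sub>0 \<Gamma>(N)" and "N > 0" and hol: "holomorphic_mero f"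
    and lim: "\<And>A. A \<in> SL2Z \<Longrightarrow> \<exists>L. (eval_mero (act A f) \<longlongrightarrow> L) at_ii_inf"
  obtains c where "f = mero_const c"
proof -
  obtain R where R: "transversal N SL2Z R" using exists_transversal[OF assms(2)] .
  interpret congruence_group SL2Z N R by (rule congruence_group_SL2Z[OF assms(2) R])
  have R_SL2Z: "A \<in> SL2Z" if "A \<in> R" for A using R_subset that by blast
  obtain L where L: "\<And>A. A \<in> SL2Z \<Longrightarrow> (eval_mero (act A f) \<longlongrightarrow> L A) at_ii_inf" using lim by metis
  obtain I where I: "I \<in> R" "act I f = f" using identity_rep f by metis
  define P where "P = poly (char_poly f) (mero_const (L I))"
  have P: "P = (\<Prod>A\<in>R. mero_const (L I) - act A f)" by (simp add: P_def char_poly_def poly_prod)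
  have factor: "holomorphic_mero (mero_const (L I) - act A f)" if "A \<in> R" for A
    by (intro holomorphic_mero_intros holomorphic_mero_act R_SL2Z that hol)
  have "P = 0"
  proof (rule level_one_cusp_form_eq_0)
    show "P \<in> \<A>\<^sub>0 SL2Z" unfolding P_def
      by (intro C_subfield_poly C_subfield_invariants coeffs_in_char_poly f C_subfield_const)
    show "holomorphic_mero P" unfolding P by (intro holomorphic_mero_prod factor)
    have "((\<lambda>\<tau>. \<Prod>A\<in>R. L I - eval_mero (act A f) \<tau>) \<longlongrightarrow> (\<Prod>A\<in>R. L I - L A)) at_ii_inf"
      by (intro tendsto_intros L R_SL2Z)
    moreover have "(\<Prod>A\<in>R. L I - L A) = 0" using finite_R I(1) by (auto simp: prod_zero_iff)
    moreover have "(\<Prod>A\<in>R. L I - eval_mero (act A f) \<tau>) = eval_mero P \<tau>" if "\<tau> \<in> uhp" for \<tau>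
      unfolding P using that hol
      by (simp add: eval_mero_simps factor holomorphic_mero_intros holomorphic_mero_act R_SL2Z)
    ultimately show "(eval_mero P \<longlongrightarrow> 0) at_ii_inf"
      using Lim_transform_eventually eventually_at_ii_infI by (metis (mono_tags, lifting))
  qed
  then obtain A where A: "A \<in> R" "mero_const (L I) = act A f" unfolding P_def poly_char_poly_eq_0_iff by blast
  hence "act A f = act A (mero_const (L I))" using act_const[OF R_SL2Z[OF A(1)]] by metis
  thus ?thesis using act_inj[OF R_SL2Z[OF A(1)]] that by blast
qed

lemma modular_function_dense_image:
  assumes f: "f \<in> \<A>\<^sub>0 \<Gamma>(N)" "N > 0" "holomorphic_mero f" and nonconst: "f \<notin> range mero_const"
  shows "closure (eval_mero f ` uhp) = UNIV"
proof (rule ccontr)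
  assume "closure (eval_mero f ` uhp) \<noteq> UNIV"
  then obtain x where "x \<notin> closure (eval_mero f ` uhp)" by blast
  then obtain e where e: "e > 0" "\<And>\<tau>. \<tau> \<in> uhp \<Longrightarrow> norm (eval_mero f \<tau> - x) \<ge> e"
    unfolding closure_approachable by (force simp: dist_norm not_less)
  define d where "d = f - mero_const x"
  have d: "holomorphic_mero d" "\<And>\<tau>. \<tau> \<in> uhp \<Longrightarrow> eval_mero d \<tau> = eval_mero f \<tau> - x"
    using f(3) by (simp_all add: d_def eval_mero_simps holomorphic_mero_intros)
  have d_nonzero: "eval_mero d \<tau> \<noteq> 0" if "\<tau> \<in> uhp" for \<tau> using e(1) e(2)[OF that] d(2)[OF that] by auto
  have inverse_eval: "eval_mero (1 / d) \<tau> = 1 / (eval_mero f \<tau> - x)" if "\<tau> \<in> uhp" for \<tau>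
    using that d d_nonzero by (simp add: eval_mero_divide eval_mero_1 holomorphic_mero_1)
  have level: "1 / d \<in> \<A>\<^sub>0 \<Gamma>(N)"
    unfolding d_def by (intro C_subfield_intros C_subfield_modular_functions Gamma_subset f(1))
  have "\<exists>L. (eval_mero (act A (1 / d)) \<longlongrightarrow> L) at_ii_inf" if A: "A \<in> SL2Z" for A
  proof -
    have "norm (eval_mero (act A (1 / d)) \<tau>) \<le> 1 / e" if "\<tau> \<in> uhp" for \<tau>
      using e(1) e(2)[of "moebius_act A \<tau>"] that A
      by (simp add: eval_act inverse_eval moebius_in_uhp norm_divide frac_le)
    hence "Bfun (eval_mero (act A (1 / d))) at_ii_inf" by (intro BfunI[of _ "1 / e"] eventually_at_ii_infI)
    moreover have "meromorphic_at_ii_inf (eval_mero (act A (1 / d)))"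
      using level A unfolding modular_functions_iff[OF Gamma_subset] meromorphic_at_cusps_iff by blast
    ultimately show ?thesis using meromorphic_at_ii_inf_Bfun_imp_tendsto by metis
  qed
  moreover have "holomorphic_mero (1 / d)"
    by (rule holomorphic_mero_divide[OF holomorphic_mero_1 d(1) d_nonzero])
  ultimately obtain c where "1 / d = mero_const c" using modular_Liouville[OF level f(2)] by metis
  hence "d = 1 / mero_const c" by (metis div_by_1 divide_divide_eq_right mult_1_left)
  hence "f = mero_const (x + 1 / c)"
    by (simp add: d_def mero_const_add mero_const_divide mero_const_1 algebra_simps)
  thus False using nonconst by blast
qed

section \<open>Hauptmoduln\<close>

lemma exists_poly_clearing_poles:
  fixes u f :: "'i \<Rightarrow> 'a \<Rightarrow> 'b :: real_normed_field" and F :: "'i \<Rightarrow> 'a filter"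
  assumes "finite I" and local: "\<And>i. i \<in> I \<Longrightarrow>
    \<exists>L k l. (u i \<longlongrightarrow> L) (F i) \<and> ((\<lambda>z. (u i z - L) ^ k * f i z) \<longlongrightarrow> l) (F i)"
  obtains q where "q \<noteq> 0" "\<And>i. i \<in> I \<Longrightarrow> \<exists>l. ((\<lambda>z. poly q (u i z) * f i z) \<longlongrightarrow> l) (F i)"
proof -
  obtain L k l where lim: "\<And>i. i \<in> I \<Longrightarrow> (u i \<longlongrightarrow> L i) (F i)"
    "\<And>i. i \<in> I \<Longrightarrow> ((\<lambda>z. (u i z - L i) ^ k i * f i z) \<longlongrightarrow> l i) (F i)"
    using local by metis
  define q where "q = (\<Prod>i\<in>I. [:- L i, 1:] ^ k i)"
  have "\<exists>l. ((\<lambda>z. poly q (u i z) * f i z) \<longlongrightarrow> l) (F i)" if i: "i \<in> I" for i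
  proof -
    have poly_q: "poly q x = (\<Prod>j\<in>I - {i}. (x - L j) ^ k j) * (x - L i) ^ k i" for x
      using assms(1) i by (simp add: q_def poly_prod poly_power prod.remove mult.commute)
    have "((\<lambda>z. (\<Prod>j\<in>I - {i}. (u i z - L j) ^ k j) * ((u i z - L i) ^ k i * f i z)) \<longlongrightarrow>
        (\<Prod>j\<in>I - {i}. (L i - L j) ^ k j) * l i) (F i)"
      by (intro tendsto_intros lim i)
    thus ?thesis unfolding poly_q by (auto simp: mult.assoc)
  qed
  moreover have "q \<noteq> 0" using assms(1) by (simp add: q_def)
  ultimately show ?thesis using that by blast
qed

lemma not_pole_imp_analytic_at:
  "z \<in> uhp \<Longrightarrow> \<not> is_pole (eval_mero f) z \<Longrightarrow> eval_mero f analytic_on {z}"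
  using nicely_meromorphic_on_imp_analytic_at[OF nicely_meromorphic_eval_mero] by blast

lemma analytic_at_imp_tendsto: "f analytic_on {z} \<Longrightarrow> f \<midarrow>z\<rightarrow> f z"
  using analytic_at_imp_isCont isCont_def by blast

lemma finite_poles_fund_strip:
  assumes "meromorphic_at_ii_inf (eval_mero f)"
  shows "finite {w \<in> fund_strip. is_pole (eval_mero f) w}"
proof -
  obtain b where b: "\<And>\<tau>. Im \<tau> > b \<Longrightarrow> eval_mero f analytic_on {\<tau>}"
    using meromorphic_at_ii_inf_analytic[OF assms] unfolding eventually_at_ii_inf by blast
  have "Im w \<le> b" if "is_pole (eval_mero f) w" for w
    using b[of w] that analytic_at_imp_no_pole by force
  hence "{w \<in> fund_strip. is_pole (eval_mero f) w} \<subseteq> {w \<in> fund_strip \<inter> {z. Im z \<le> b}. is_pole (eval_mero f) w}"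
    by blast
  moreover have "finite {w \<in> fund_strip \<inter> {z. Im z \<le> b}. is_pole (eval_mero f) w}"
    using fund_strip_subset by (intro finite_poles_on_compact compact_fund_strip_below
        meromorphic_on_subset[OF meromorphic_eval_mero]) auto
  ultimately show ?thesis by (rule finite_subset)
qed

lemma holomorphic_mero_fund_stripI:
  assumes f: "f \<in> \<A>\<^sub>0 \<Gamma>(N)" and R: "transversal N SL2Z R"
    and no_pole: "\<And>A w. A \<in> R \<Longrightarrow> w \<in> fund_strip \<Longrightarrow> \<not> is_pole (eval_mero (act A f)) w"
  shows "holomorphic_mero f"
proof -
  have "\<not> is_pole (eval_mero f) z" if z: "z \<in> uhp" for z
  proof
    assume pole: "is_pole (eval_mero f) z"
    obtain A B w where A: "A \<in> R" and B: "B \<in> SL2Z" "mat_cong N B A"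
      and w: "w \<in> fund_strip" "z = moebius_act B w"
      using fund_strip_rep_mod[OF R z] .
    have w_uhp: "w \<in> uhp" using w(1) fund_strip_subset by blast
    have "filterlim (\<lambda>w. eval_mero f (moebius_act B w)) at_infinity (at w)"
      using pole unfolding is_pole_def w(2) by (rule filterlim_compose[OF _ moebius_filterlim[OF B(1) w_uhp]])
    moreover have ev: "eventually (\<lambda>w. eval_mero f (moebius_act B w) = eval_mero (act B f) w) (at w)"
      using eventually_at_in_open'[OF open_uhp w_uhp] by eventually_elim (simp add: eval_act[OF B(1)])
    ultimately have "is_pole (eval_mero (act B f)) w"
      unfolding is_pole_def using filterlim_cong[OF refl refl ev] by blast
    moreover have "act B f = act A f"
      using act_Gamma_mat_cong[OF f B(1) _ B(2)] A R unfolding transversal_def by blast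
    ultimately show False using no_pole[OF A w(1)] by simp
  qed
  thus ?thesis using not_pole_imp_analytic_at holomorphic_mero_iff by blast
qed

definition acts_trivially :: "(int ^ 2 ^ 2) set \<Rightarrow> int ^ 2 ^ 2 \<Rightarrow> bool" where
  "acts_trivially G A \<longleftrightarrow> (\<forall>f\<in>\<A>\<^sub>0 G. act A f = f)"

text \<open>A modular function \<open>u\<close> whose only pole is a simple one at the cusp \<open>\<infinity>\<close>. The alternative in the
  last assumption says that the cusp \<open>A \<infinity>\<close> is either equivalent to \<open>\<infinity>\<close> or not a pole of \<open>u\<close>.\<close>

locale hauptmodul =
  fixes G :: "(int ^ 2 ^ 2) set" and N :: nat and u :: mero_uhp
  assumes G_subset: "G \<subseteq> SL2Z" and N_pos: "N > 0" and Gamma_subset_G: "\<Gamma>(N) \<subseteq> G"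
    and translation_in_G: "mat2 1 1 0 1 \<in> G"
    and u_modular: "u \<in> \<A>\<^sub>0 G" and u_holomorphic: "holomorphic_mero u"
    and u_pole: "\<exists>c. c \<noteq> 0 \<and> q_leading 1 (eval_mero u) (- 1) c"
    and u_cusps: "A \<in> SL2Z \<Longrightarrow> acts_trivially G A \<or> (\<exists>L. (eval_mero (act A u) \<longlongrightarrow> L) at_ii_inf)"
begin

lemma modular_functions_subset_level: "\<A>\<^sub>0 G \<subseteq> \<A>\<^sub>0 \<Gamma>(N)"
  by (rule modular_functions_antimono[OF Gamma_subset_G])

lemma C_subfield_invariants: "C_subfield (\<A>\<^sub>0 G)" by (rule C_subfield_modular_functions[OF G_subset])

lemma meromorphic_at_ii_inf_act: "f \<in> \<A>\<^sub>0 G \<Longrightarrow> A \<in> SL2Z \<Longrightarrow> meromorphic_at_ii_inf (eval_mero (act A f))"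
  using modular_functions_iff[OF G_subset] meromorphic_at_cusps_iff by blast

lemma meromorphic_at_ii_inf_eval_mero: "f \<in> \<A>\<^sub>0 G \<Longrightarrow> meromorphic_at_ii_inf (eval_mero f)"
  using meromorphic_at_ii_inf_act[OF _ SL2Z_one] by simp

lemma eval_mero_peval_act:
  assumes "A \<in> SL2Z" "z \<in> uhp"
  shows "eval_mero (peval q (act A u)) z = poly q (eval_mero (act A u) z)"
  by (rule eval_mero_peval[OF holomorphic_mero_act[OF assms(1) u_holomorphic] assms(2)])

lemma peval_u_nonzero:
  assumes "q \<noteq> 0"
  shows "peval q u \<noteq> 0"
proof
  assume "peval q u = 0"
  hence root: "poly q (eval_mero u z) = 0" if "z \<in> uhp" for z
    using eval_mero_peval[OF u_holomorphic that, of q] eval_mero_0[OF that] by simp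
  have "bounded {x. poly q x = 0}" by (intro finite_imp_bounded poly_roots_finite assms)
  then obtain B where B: "\<And>x. poly q x = 0 \<Longrightarrow> norm x \<le> B" unfolding bounded_iff by blast
  have "filterlim (eval_mero u) at_infinity at_ii_inf"
    using u_pole q_leading_neg_imp_filterlim_at_infinity[of 1 "eval_mero u" "- 1"] by auto
  hence "eventually (\<lambda>\<tau>. norm (eval_mero u \<tau>) \<ge> \<bar>B\<bar> + 1) at_ii_inf"
    by (simp add: filterlim_at_infinity[OF order_refl])
  with eventually_uhp_at_ii_inf have "eventually (\<lambda>_. False) at_ii_inf"
    by eventually_elim (use B[OF root] in force)
  thus False using at_ii_inf_neq_bot by (simp add: trivial_limit_def)
qed

definition only_pole_infinity :: "mero_uhp \<Rightarrow> bool" where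
  "only_pole_infinity f \<longleftrightarrow> f \<in> \<A>\<^sub>0 G \<and> holomorphic_mero f \<and>
     (\<forall>A\<in>SL2Z. acts_trivially G A \<or> (\<exists>L. (eval_mero (act A f) \<longlongrightarrow> L) at_ii_inf))"

lemma only_pole_infinity_diff:
  assumes f: "only_pole_infinity f"
  shows "only_pole_infinity (f - peval p u)"
  unfolding only_pole_infinity_def
proof (intro conjI ballI)
  show "f - peval p u \<in> \<A>\<^sub>0 G"
    using f by (intro C_subfield_diff C_subfield_peval C_subfield_invariants u_modular)
      (simp add: only_pole_infinity_def)
  have f_hol: "holomorphic_mero f" using f by (simp add: only_pole_infinity_def)
  thus "holomorphic_mero (f - peval p u)" by (intro holomorphic_mero_diff holomorphic_mero_peval u_holomorphic)
  fix A assume A: "A \<in> SL2Z"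
  show "acts_trivially G A \<or> (\<exists>L. (eval_mero (act A (f - peval p u)) \<longlongrightarrow> L) at_ii_inf)"
  proof (cases "acts_trivially G A")
    case False
    then obtain L L' where "(eval_mero (act A u) \<longlongrightarrow> L) at_ii_inf" "(eval_mero (act A f) \<longlongrightarrow> L') at_ii_inf"
      using u_cusps[OF A] f A unfolding only_pole_infinity_def by blast
    hence "((\<lambda>\<tau>. eval_mero (act A f) \<tau> - poly p (eval_mero (act A u) \<tau>)) \<longlongrightarrow> L' - poly p L) at_ii_inf"
      by (intro tendsto_intros)
    moreover have "eval_mero (act A f) \<tau> - poly p (eval_mero (act A u) \<tau>) = eval_mero (act A (f - peval p u)) \<tau>"
      if "\<tau> \<in> uhp" for \<tau>
      using that A f_hol
      by (simp add: act_diff act_peval eval_mero_diff eval_mero_peval_act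
        holomorphic_mero_act holomorphic_mero_peval u_holomorphic)
    ultimately have "(eval_mero (act A (f - peval p u)) \<longlongrightarrow> L' - poly p L) at_ii_inf"
      by (rule Lim_transform_eventually[OF _ eventually_at_ii_infI])
    thus ?thesis by blast
  qed simp
qed

lemma subtract_leading_monomial:
  assumes "M > 0" and f: "f \<in> \<A>\<^sub>0 G" "holomorphic_mero f"
    and lim: "((\<lambda>\<tau>. to_q M \<tau> ^ k * eval_mero f \<tau>) \<longlongrightarrow> l) at_ii_inf"
  obtains a n where "((\<lambda>\<tau>. to_q M \<tau> ^ k * eval_mero (f - peval (Polynomial.monom a n) u) \<tau>) \<longlongrightarrow> 0) at_ii_inf"
proof (cases "l = 0")
  case True
  thus ?thesis using that[of 0 0] lim by simp
next
  case False
  have "act (mat2 1 1 0 1) f = f" using f(1) translation_in_G modular_functions_iff[OF G_subset] by blast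
  hence "M dvd k" using periodic_pole_order_dvd[OF assms(1) False lim] eval_mero_translate by blast
  then obtain n where k: "k = M * n" by blast
  obtain c where c: "c \<noteq> 0" "((\<lambda>\<tau>. eval_mero u \<tau> * to_q 1 \<tau>) \<longlongrightarrow> c) at_ii_inf"
    using u_pole by (auto simp: q_leading_def power_int_minus divide_inverse)
  define p where "p = Polynomial.monom (l / c ^ n) n"
  have "to_q M \<tau> ^ M = to_q 1 \<tau>" for \<tau> using assms(1) by (simp add: to_q_def exp_of_nat_mult[symmetric])
  hence power: "to_q M \<tau> ^ k = to_q 1 \<tau> ^ n" for \<tau> by (simp add: k power_mult)
  have "((\<lambda>\<tau>. to_q M \<tau> ^ k * eval_mero f \<tau> - l / c ^ n * (eval_mero u \<tau> * to_q 1 \<tau>) ^ n) \<longlongrightarrow> l -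
      l / c ^ n * c ^ n) at_ii_inf"
    by (intro tendsto_intros lim c)
  moreover have "to_q M \<tau> ^ k * eval_mero f \<tau> - l / c ^ n * (eval_mero u \<tau> * to_q 1 \<tau>) ^ n =
      to_q M \<tau> ^ k * eval_mero (f - peval p u) \<tau>" if "\<tau> \<in> uhp" for \<tau>
    using that f(2) u_holomorphic
    by (simp add: p_def power eval_mero_diff eval_mero_peval holomorphic_mero_peval
      poly_monom algebra_simps power_mult_distrib)
  ultimately have "((\<lambda>\<tau>. to_q M \<tau> ^ k * eval_mero (f - peval p u) \<tau>) \<longlongrightarrow> l - l / c ^ n * c ^ n) at_ii_inf"
    by (rule Lim_transform_eventually[OF _ eventually_at_ii_infI])
  thus ?thesis using that[of "l / c ^ n" n] c(1) by (simp add: p_def)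
qed

lemma only_pole_infinity_convergent_constant:
  assumes f: "only_pole_infinity f" and lim: "(eval_mero f \<longlongrightarrow> l) at_ii_inf"
  obtains c where "f = mero_const c"
proof (rule modular_Liouville[of f N])
  have f_modular: "f \<in> \<A>\<^sub>0 G" using f by (simp add: only_pole_infinity_def)
  thus "f \<in> \<A>\<^sub>0 \<Gamma>(N)" using modular_functions_subset_level by blast
  show "holomorphic_mero f" using f by (simp add: only_pole_infinity_def)
  show "\<exists>L. (eval_mero (act A f) \<longlongrightarrow> L) at_ii_inf" if "A \<in> SL2Z" for A
    using f f_modular lim that unfolding only_pole_infinity_def acts_trivially_def by metis
qed (use N_pos that in auto)

lemma only_pole_infinity_polynomial:
  assumes "only_pole_infinity f"
  obtains p where "f = peval p u"
proof -
  have mero: "meromorphic_at_ii_inf (eval_mero f)" "meromorphic_at_ii_inf (eval_mero u)"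
    using assms u_modular meromorphic_at_ii_inf_eval_mero by (auto simp: only_pole_infinity_def)
  obtain M F U where M: "M > 0" and F: "F meromorphic_on {0}" and U: "U meromorphic_on {0}"
    and F_eq: "eventually (\<lambda>\<tau>. eval_mero f \<tau> = F (to_q M \<tau>)) at_ii_inf"
    and U_eq: "eventually (\<lambda>\<tau>. eval_mero u \<tau> = U (to_q M \<tau>)) at_ii_inf"
    by (rule meromorphic_at_ii_inf_common[OF mero])
  obtain k l where "((\<lambda>\<tau>. to_q M \<tau> ^ k * eval_mero f \<tau>) \<longlongrightarrow> l) at_ii_inf"
    using meromorphic_at_ii_inf_order_bound[OF M F F_eq] .
  with assms F F_eq have "\<exists>p. f = peval p u"
  proof (induction k arbitrary: f F l)
    case 0
    hence "(eval_mero f \<longlongrightarrow> l) at_ii_inf" by simp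
    then obtain c where "f = mero_const c" using only_pole_infinity_convergent_constant[OF 0(1)] by blast
    hence "f = peval [:c:] u" by simp
    thus ?case by blast
  next
    case (Suc k)
    have f: "f \<in> \<A>\<^sub>0 G" "holomorphic_mero f" using Suc.prems(1) by (simp_all add: only_pole_infinity_def)
    obtain a n where lim: "((\<lambda>\<tau>. to_q M \<tau> ^ Suc k *
        eval_mero (f - peval (Polynomial.monom a n) u) \<tau>) \<longlongrightarrow> 0) at_ii_inf"
      using subtract_leading_monomial[OF M f Suc.prems(4)] .
    define g where "g = f - peval (Polynomial.monom a n) u"
    have G: "(\<lambda>w. F w - a * U w ^ n) meromorphic_on {0}" by (intro meromorphic_intros Suc.prems(2) U)
    have ev: "eventually (\<lambda>\<tau>. eval_mero g \<tau> = F (to_q M \<tau>) - a * U (to_q M \<tau>) ^ n) at_ii_inf"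
      using Suc.prems(3) U_eq eventually_uhp_at_ii_inf
      by eventually_elim (simp add: g_def eval_mero_diff f u_holomorphic
        holomorphic_mero_peval eval_mero_peval poly_monom)
    obtain l' where "((\<lambda>\<tau>. to_q M \<tau> ^ k * eval_mero g \<tau>) \<longlongrightarrow> l') at_ii_inf"
      using pole_order_lower_at_ii_inf[OF M G ev] lim unfolding g_def by blast
    then obtain p where "g = peval p u"
      using Suc.IH[OF _ G ev] only_pole_infinity_diff[OF Suc.prems(1)] unfolding g_def by blast
    hence "f = peval (p + Polynomial.monom a n) u" by (simp add: g_def peval_add algebra_simps)
    thus ?case by blast
  qed
  thus ?thesis using that by blast
qed

lemma u_act_tendsto:
  assumes "A \<in> SL2Z" "w \<in> uhp"
  shows "eval_mero (act A u) \<midarrow>w\<rightarrow> eval_mero (act A u) w"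
  using holomorphic_mero_act[OF assms(1) u_holomorphic] assms(2) analytic_at_imp_tendsto holomorphic_mero_iff
  by blast

definition clears_pole :: "complex poly \<Rightarrow> mero_uhp \<Rightarrow> int ^ 2 ^ 2 \<Rightarrow> complex filter \<Rightarrow> bool" where
  "clears_pole q f A F \<longleftrightarrow> (\<exists>l. ((\<lambda>z. poly q (eval_mero (act A u) z) * eval_mero (act A f) z) \<longlongrightarrow> l) F)"

definition pole_clearable :: "mero_uhp \<Rightarrow> int ^ 2 ^ 2 \<Rightarrow> complex filter \<Rightarrow> bool" where
  "pole_clearable f A F \<longleftrightarrow> (\<exists>L k l. (eval_mero (act A u) \<longlongrightarrow> L) F \<and>
     ((\<lambda>z. (eval_mero (act A u) z - L) ^ k * eval_mero (act A f) z) \<longlongrightarrow> l) F)"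

lemma pole_clearable_at:
  assumes A: "A \<in> SL2Z" and w: "w \<in> uhp"
  shows "pole_clearable f A (at w)"
proof -
  have meromorphic_at: "eval_mero g meromorphic_on {w}" for g
    using meromorphic_on_subset[OF meromorphic_eval_mero] w by blast
  obtain k l where "(\<lambda>z. (eval_mero (act A u) z - eval_mero (act A u) w) ^ k * eval_mero (act A f) z) \<midarrow>w\<rightarrow> l"
    using meromorphic_zero_clears_pole[OF meromorphic_at meromorphic_at u_act_tendsto[OF assms]] by blast
  thus ?thesis using u_act_tendsto[OF assms] unfolding pole_clearable_def by blast
qed

lemma pole_clearable_at_ii_inf:
  assumes f: "f \<in> \<A>\<^sub>0 G" and A: "A \<in> SL2Z" "\<not> acts_trivially G A"
  shows "pole_clearable f A at_ii_inf"
proof -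
  obtain L where L: "(eval_mero (act A u) \<longlongrightarrow> L) at_ii_inf" using u_cusps A by blast
  then obtain k l where "((\<lambda>\<tau>. (eval_mero (act A u) \<tau> - L) ^ k * eval_mero (act A f) \<tau>) \<longlongrightarrow> l) at_ii_inf"
    using meromorphic_at_ii_inf_zero_clears_pole[OF meromorphic_at_ii_inf_act[OF f A(1)]
        meromorphic_at_ii_inf_act[OF u_modular A(1)]] by blast
  thus ?thesis using L unfolding pole_clearable_def by blast
qed

lemma clears_pole_at_regular_point:
  assumes "A \<in> SL2Z" "w \<in> uhp" "\<not> is_pole (eval_mero (act A f)) w"
  shows "clears_pole q f A (at w)"
proof -
  have "eval_mero (act A f) \<midarrow>w\<rightarrow> eval_mero (act A f) w"
    using assms analytic_at_imp_tendsto not_pole_imp_analytic_at by blast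
  from tendsto_mult[OF tendsto_poly[OF u_act_tendsto[OF assms(1,2)]] this]
  show ?thesis unfolding clears_pole_def by blast
qed

lemma exists_cleared_denominator:
  assumes f: "f \<in> \<A>\<^sub>0 G" and R: "transversal N SL2Z R"
  obtains q where "q \<noteq> 0" "\<And>A w. A \<in> R \<Longrightarrow> w \<in> fund_strip \<Longrightarrow> clears_pole q f A (at w)"
    "\<And>A. A \<in> R \<Longrightarrow> \<not> acts_trivially G A \<Longrightarrow> clears_pole q f A at_ii_inf"
proof -
  have R_SL2Z: "A \<in> SL2Z" if "A \<in> R" for A using R that unfolding transversal_def by blast
  define poles where "poles A = {w \<in> fund_strip. is_pole (eval_mero (act A f)) w}" for A
  define I where "I = (SIGMA A:R. at ` poles A) \<union> {A \<in> R. \<not> acts_trivially G A} \<times> {at_ii_inf}"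
  have "finite I" using R finite_poles_fund_strip[OF meromorphic_at_ii_inf_act[OF f R_SL2Z]]
    by (auto simp: I_def poles_def transversal_def)
  moreover have "pole_clearable f (fst i) (snd i)" if "i \<in> I" for i
    using that fund_strip_subset pole_clearable_at[OF R_SL2Z] pole_clearable_at_ii_inf[OF f R_SL2Z]
    by (auto simp: I_def poles_def)
  ultimately obtain q where q: "q \<noteq> 0" "\<And>i. i \<in> I \<Longrightarrow> clears_pole q f (fst i) (snd i)"
    using exists_poly_clearing_poles[of I "\<lambda>i. eval_mero (act (fst i) u)" snd "\<lambda>i. eval_mero (act (fst i) f)"]
    unfolding pole_clearable_def clears_pole_def by blast
  have "clears_pole q f A (at w)" if A: "A \<in> R" and w: "w \<in> fund_strip" for A w
  proof (cases "w \<in> poles A")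
    case True
    thus ?thesis using q(2)[of "(A, at w)"] A by (simp add: I_def)
  next
    case False
    thus ?thesis using w fund_strip_subset
      by (intro clears_pole_at_regular_point R_SL2Z A) (auto simp: poles_def)
  qed
  moreover have "clears_pole q f A at_ii_inf" if "A \<in> R" "\<not> acts_trivially G A" for A
    using that q(2)[of "(A, at_ii_inf)"] by (simp add: I_def)
  ultimately show ?thesis using that[OF q(1)] by blast
qed

lemma only_pole_infinityI:
  assumes h: "h \<in> \<A>\<^sub>0 G" and R: "transversal N SL2Z R"
    and fund_strip: "\<And>A w. A \<in> R \<Longrightarrow> w \<in> fund_strip \<Longrightarrow> \<exists>l. eval_mero (act A h) \<midarrow>w\<rightarrow> l"
    and cusps: "\<And>A. A \<in> R \<Longrightarrow> \<not> acts_trivially G A \<Longrightarrow> \<exists>L. (eval_mero (act A h) \<longlongrightarrow> L) at_ii_inf"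
  shows "only_pole_infinity h"
  unfolding only_pole_infinity_def
proof (intro conjI ballI h)
  show "holomorphic_mero h"
  proof (rule holomorphic_mero_fund_stripI[OF _ R])
    show "h \<in> \<A>\<^sub>0 \<Gamma>(N)" using h modular_functions_subset_level by blast
    fix A w assume "A \<in> R" "w \<in> fund_strip"
    then obtain l where "eval_mero (act A h) \<midarrow>w\<rightarrow> l" using fund_strip by blast
    thus "\<not> is_pole (eval_mero (act A h)) w"
      using not_tendsto_and_filterlim_at_infinity[of "at w" "eval_mero (act A h)" l]
      unfolding is_pole_def by auto
  qed
  fix A assume A: "A \<in> SL2Z"
  obtain B where B: "B \<in> R" "B \<in> SL2Z" "mat_cong N A B" using R A unfolding transversal_def by blast
  have act_eq: "act A g = act B g" if "g \<in> \<A>\<^sub>0 G" for g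
    using act_Gamma_mat_cong[OF _ A B(2,3)] that modular_functions_subset_level by blast
  show "acts_trivially G A \<or> (\<exists>L. (eval_mero (act A h) \<longlongrightarrow> L) at_ii_inf)"
  proof (cases "acts_trivially G B")
    case True
    thus ?thesis using act_eq by (simp add: acts_trivially_def)
  next
    case False
    thus ?thesis using cusps[OF B(1)] act_eq[OF h] by simp
  qed
qed

lemma eventually_eval_mero_act_peval_mult:
  assumes A: "A \<in> SL2Z" and w: "w \<in> uhp"
  shows "eventually (\<lambda>z. poly q (eval_mero (act A u) z) * eval_mero (act A f) z =
      eval_mero (act A (peval q u * f)) z) (at w)"
  using eventually_eval_mero_ops(6)[OF w, of "peval q (act A u)" "act A f"]
    eventually_at_in_open'[OF open_uhp w]
  by eventually_elim (simp add: act_mult act_peval eval_mero_peval_act A)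

lemma eventually_eval_mero_act_peval_mult_at_ii_inf:
  assumes A: "A \<in> SL2Z" and f: "f \<in> \<A>\<^sub>0 G"
  shows "eventually (\<lambda>\<tau>. poly q (eval_mero (act A u) \<tau>) * eval_mero (act A f) \<tau> =
      eval_mero (act A (peval q u * f)) \<tau>) at_ii_inf"
  using meromorphic_at_ii_inf_analytic[OF meromorphic_at_ii_inf_act[OF f A]] eventually_uhp_at_ii_inf
proof eventually_elim
  case (elim \<tau>)
  have "eval_mero (peval q (act A u)) analytic_on {\<tau>}"
    using holomorphic_mero_peval[OF holomorphic_mero_act[OF A u_holomorphic]] elim(2) holomorphic_mero_iff
    by blast
  thus ?case using elim by (simp add: act_mult act_peval A eval_mero_mult_at eval_mero_peval_act)
qed

theorem hauptmodul_generates: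
  assumes f: "f \<in> \<A>\<^sub>0 G"
  obtains p q where "peval q u \<noteq> 0" "f = peval p u / peval q u"
proof -
  obtain R where R: "transversal N SL2Z R" using exists_transversal[OF N_pos] .
  have R_SL2Z: "A \<in> SL2Z" if "A \<in> R" for A using R that unfolding transversal_def by blast
  obtain q where q: "q \<noteq> 0" "\<And>A w. A \<in> R \<Longrightarrow> w \<in> fund_strip \<Longrightarrow> clears_pole q f A (at w)"
    "\<And>A. A \<in> R \<Longrightarrow> \<not> acts_trivially G A \<Longrightarrow> clears_pole q f A at_ii_inf"
    using exists_cleared_denominator[OF f R] by blast
  have "only_pole_infinity (peval q u * f)"
  proof (rule only_pole_infinityI[OF _ R])
    show "peval q u * f \<in> \<A>\<^sub>0 G" by (intro C_subfield_mult C_subfield_peval C_subfield_invariants u_modular f)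
    show "\<exists>l. eval_mero (act A (peval q u * f)) \<midarrow>w\<rightarrow> l" if A: "A \<in> R" and w: "w \<in> fund_strip" for A w
    proof -
      have "w \<in> uhp" using w fund_strip_subset by blast
      from Lim_transform_eventually[OF _ eventually_eval_mero_act_peval_mult[OF R_SL2Z[OF A] this, of q f]]
      show ?thesis using q(2)[OF A w] unfolding clears_pole_def by blast
    qed
    show "\<exists>L. (eval_mero (act A (peval q u * f)) \<longlongrightarrow> L) at_ii_inf" if A: "A \<in> R" "\<not> acts_trivially G A" for A
      using Lim_transform_eventually[OF _ eventually_eval_mero_act_peval_mult_at_ii_inf[OF R_SL2Z[OF A(1)] f, of q]] q(3)[OF A]
      unfolding clears_pole_def by blast
  qed
  then obtain p where "peval q u * f = peval p u" using only_pole_infinity_polynomial by blast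
  moreover have "peval q u \<noteq> 0" by (rule peval_u_nonzero[OF q(1)])
  ultimately have "f = peval p u / peval q u" by (simp add: field_simps)
  with \<open>peval q u \<noteq> 0\<close> show ?thesis by (rule that)
qed

end

section \<open>Division values of level 7\<close>

definition klein7 :: "int \<Rightarrow> complex \<Rightarrow> complex" where
  "klein7 k \<tau> = klein (of_int k / 7) 0 (7 * \<tau>)"

lemma theta_a_eq_klein7: "theta_a k \<tau> = (- 1) powi k * (- \<i>) * klein7 k \<tau>"
proof -
  define x0 where "x0 = 1/2 - real_of_int k / 7"
  define c where "c = (- 1) powi (k + 1) * exp (- (of_real pi * \<i> * of_real x0))"
  have "(-1) powi (n + k + 1) * exp (2 * of_real pi * \<i> * (of_int ((14 * n + 7 - 2 * k)\<^sup>2) / 56) * \<tau>) =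
      c * theta_char_term x0 (of_real (0 + 1/2)) (7 * \<tau>) n" for n
  proof -
    define x where "x = complex_of_real (of_int n + x0)"
    have x14: "complex_of_int (14 * n + 7 - 2 * k) = 14 * x" by (simp add: x_def x0_def algebra_simps)
    have "complex_of_int ((14 * n + 7 - 2 * k)\<^sup>2) = (complex_of_int (14 * n + 7 - 2 * k))\<^sup>2" by simp
    hence sq: "complex_of_int ((14 * n + 7 - 2 * k)\<^sup>2) = 196 * x\<^sup>2" unfolding x14
      by (simp add: power_mult_distrib)
    have "(- 1) powi n * exp (2 * of_real pi * \<i> * (196 * x\<^sup>2 / 56) * \<tau>) =
        exp (- (of_real pi * \<i> * of_real x0)) *
            exp (of_real pi * \<i> * x\<^sup>2 * (7 * \<tau>) + 2 * of_real pi * \<i> * x * of_real (0 + 1/2))"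
      unfolding exp_pi_i_times_int[symmetric] exp_add[symmetric]
      by (rule arg_cong[where f = exp]) (simp add: x_def algebra_simps)
    thus ?thesis unfolding sq c_def theta_char_term_def x_def[symmetric]
      by (simp add: power_int_add mult.assoc)
  qed
  hence "theta_a k \<tau> = c * theta_char x0 (of_real (0 + 1/2)) (7 * \<tau>)"
    unfolding theta_a_def theta_char_def by (simp only: infsum_cmult_right')
  moreover have "klein (- (of_int k / 7)) (- 0) (7 * \<tau>) =
      exp (of_real pi * \<i> * of_real (of_int k / 7)) * theta_char x0 (of_real (0 + 1/2)) (7 * \<tau>)"
    unfolding klein_eq_theta_char by (simp add: x0_def)
  hence "theta_char x0 (of_real (0 + 1/2)) (7 * \<tau>) =
      - exp (- (of_real pi * \<i> * of_real (of_int k / 7))) * klein7 k \<tau>"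
    unfolding klein_minus klein7_def by (simp add: exp_minus field_simps)
  moreover have "exp (- (of_real pi * \<i> * of_real x0)) * exp (- (of_real pi * \<i> * of_real (of_int k / 7))) =
      - \<i>"
  proof -
    have "exp (- (of_real pi * \<i> * of_real x0)) * exp (- (of_real pi * \<i> * of_real (of_int k / 7))) =
        cis (- (pi / 2))"
      unfolding exp_add[symmetric] cis_conv_exp
      by (rule arg_cong[where f = exp]) (simp add: x0_def algebra_simps)
    thus ?thesis by (simp add: complex_eq_iff)
  qed
  ultimately show ?thesis by (simp add: c_def power_int_add mult_ac)
qed

lemma phi1_eq: "phi1 \<tau> = klein7 3 \<tau> / klein7 2 \<tau>"
  by (simp add: phi1_def theta_a_eq_klein7)

lemma phi2_eq: "phi2 \<tau> = klein7 2 \<tau> / klein7 1 \<tau>"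
  by (simp add: phi2_def theta_a_eq_klein7)

lemma klein7_minus: "klein7 (- k) \<tau> = - klein7 k \<tau>"
  using klein_minus[of "of_int k / 7" 0 "7 * \<tau>"] by (simp add: klein7_def)

lemma klein7_add_7: "klein7 (k + 7 * m) \<tau> = (- 1) powi m * klein7 k \<tau>"
  using klein_add_int[of "of_int k / 7" m 0 0 "7 * \<tau>"] by (simp add: klein7_def add_divide_distrib)

lemma klein7_4_5_6:
  "klein7 4 \<tau> = klein7 3 \<tau>" "klein7 5 \<tau> = klein7 2 \<tau>" "klein7 6 \<tau> = klein7 1 \<tau>"
  using klein7_add_7[of "- 3" 1 \<tau>] klein7_add_7[of "- 2" 1 \<tau>] klein7_add_7[of "- 1" 1 \<tau>]
  by (simp_all add: klein7_minus)

lemma of_int_divide_in_Ints_iff: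
  fixes k n :: int
  assumes "n \<noteq> 0"
  shows "real_of_int k / of_int n \<in> \<int> \<longleftrightarrow> n dvd k"
proof
  assume "real_of_int k / of_int n \<in> \<int>"
  then obtain j where "real_of_int k / of_int n = of_int j" by (elim Ints_cases)
  hence "real_of_int k = of_int (j * n)" using assms by (simp add: field_simps)
  thus "n dvd k" unfolding of_int_eq_iff by simp
qed (use assms in auto)

lemma klein7_nonzero:
  assumes "\<tau> \<in> uhp" "\<not> 7 dvd k"
  shows "klein7 k \<tau> \<noteq> 0"
  unfolding klein7_def using assms of_int_divide_in_Ints_iff[of 7 k]
  by (intro klein_nonzero) (auto simp: uhp_def)

lemma klein7_1_2_3_nonzero: "\<tau> \<in> uhp \<Longrightarrow> klein7 1 \<tau> \<noteq> 0" "\<tau> \<in> uhp \<Longrightarrow> klein7 2 \<tau> \<noteq> 0" "\<tau> \<in> uhp \<Longrightarrow> klein7 3 \<tau> \<noteq> 0"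
  by (intro klein7_nonzero; simp)+

lemma klein7_holomorphic: "klein7 k holomorphic_on uhp"
proof -
  have "(klein (of_int k / of_nat 7) 0 \<circ> (\<lambda>\<tau>. 7 * \<tau>)) holomorphic_on uhp"
    by (rule holomorphic_on_compose_gen[OF _ klein_holomorphic]) (auto simp: uhp_def intro!: holomorphic_intros)
  thus ?thesis by (simp add: klein7_def[abs_def] o_def)
qed

lemma klein7_leading:
  assumes "0 < k" "k < 7"
  shows "q_leading 56 (klein7 k) ((7 - 2 * k)\<^sup>2) (- \<i>)"
proof -
  have "exp (of_real pi * \<i> * of_real (0 * (of_int k / of_nat 7 - 1) - 1/2)) = cis (- (pi / 2))"
    by (simp add: cis_conv_exp mult_ac)
  also have "\<dots> = - \<i>" by (simp add: complex_eq_iff)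
  finally have "q_leading 392 (klein (of_int k / of_nat 7) 0) ((7 - 2 * k)\<^sup>2) (- \<i>)"
    using klein_leading[of k 7 0] assms by simp
  hence "q_leading (7 * 56) (klein7 k) (int 7 * (7 - 2 * k)\<^sup>2) (- \<i>)"
    using q_leading_linear[of 392 _ _ _ 7 1 0] by (simp add: klein7_def[abs_def])
  thus ?thesis by (subst (asm) q_leading_rescale) simp_all
qed

lemma klein7_Gamma0:
  assumes A: "A \<in> SL2Z" and c: "7 dvd A $ 2 $ 1" and \<tau>: "\<tau> \<in> uhp"
  obtains C where "C \<noteq> 0" "\<And>k. klein7 k (moebius_act A \<tau>) =
     C * (zeta 14 (7 * k * A $ 1 $ 2 + k\<^sup>2 * A $ 1 $ 1 * A $ 1 $ 2) * klein7 (k * A $ 1 $ 1) \<tau>)"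
proof -
  obtain c' where c': "A $ 2 $ 1 = 7 * c'" using c by (elim dvdE)
  define B where "B = mat2 (A $ 1 $ 1) (7 * A $ 1 $ 2) c' (A $ 2 $ 2)"
  have B: "B \<in> SL2Z" using A by (simp add: SL2Z_iff B_def c')
  have act_B: "moebius_act B (7 * \<tau>) = 7 * moebius_act A \<tau>"
    by (simp add: moebius_act_def B_def c' algebra_simps)
  have "7 * \<tau> \<in> uhp" using \<tau> by (simp add: uhp_def)
  then obtain C where C: "C \<noteq> 0" "\<And>\<alpha> \<beta>. klein \<alpha> \<beta> (7 * moebius_act A \<tau>) =
     C * klein (\<alpha> * of_int (B $ 1 $ 1) + \<beta> * of_int (B $ 2 $ 1))
         (\<alpha> * of_int (B $ 1 $ 2) + \<beta> * of_int (B $ 2 $ 2)) (7 * \<tau>)"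
    using klein_modular[OF B, of "7 * \<tau>"] unfolding act_B by blast
  show ?thesis
  proof (rule that[OF C(1)])
    fix k
    define a b where "a = k * A $ 1 $ 1" and "b = k * A $ 1 $ 2"
    have "klein7 k (moebius_act A \<tau>) = C * klein (of_int a / 7) (of_int b) (7 * \<tau>)"
      unfolding klein7_def C(2) by (simp add: B_def a_def b_def)
    also have "klein (of_int a / 7) (of_int b) (7 * \<tau>) =
        (- 1) powi b * exp (of_real pi * \<i> * of_real (of_int b * (of_int a / 7))) * klein7 a \<tau>"
      using klein_add_int[of "of_int a / 7" 0 0 b "7 * \<tau>"] by (simp add: klein7_def)
    also have "(- 1) powi b = zeta 14 (7 * b)" using zeta_mult_cancel[of 7 2 b] by (simp add: zeta_2)
    also have "exp (of_real pi * \<i> * of_real (of_int b * (of_int a / 7))) = zeta 14 (a * b)"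
      by (simp add: zeta_def to_q_def mult_ac)
    also have "zeta 14 (7 * b) * zeta 14 (a * b) = zeta 14 (7 * k * A $ 1 $ 2 + k\<^sup>2 * A $ 1 $ 1 * A $ 1 $ 2)"
      by (simp add: zeta_add[symmetric] a_def b_def power2_eq_square mult_ac)
    finally show "klein7 k (moebius_act A \<tau>) =
       C * (zeta 14 (7 * k * A $ 1 $ 2 + k\<^sup>2 * A $ 1 $ 1 * A $ 1 $ 2) * klein7 (k * A $ 1 $ 1) \<tau>)"
      by (simp add: a_def)
  qed
qed

lemma klein7_Gamma1:
  assumes A: "A \<in> \<Gamma>\<^sub>1(7)" and \<tau>: "\<tau> \<in> uhp"
  obtains C where "C \<noteq> 0" "\<And>k. klein7 k (moebius_act A \<tau>) = C * zeta 7 (4 * A $ 1 $ 2 * k\<^sup>2) * klein7 k \<tau>"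
proof -
  define b where "b = A $ 1 $ 2"
  have AD: "A \<in> SL2Z" "7 dvd A $ 1 $ 1 - 1" "7 dvd A $ 2 $ 1" using Gamma1D[OF A] by simp_all
  obtain m where a: "A $ 1 $ 1 = 1 + 7 * m" using AD(2) by (metis add.commute diff_add_cancel dvdE)
  have "odd ((1 + 7 * m) * A $ 2 $ 2 - b * A $ 2 $ 1)" using AD(1) by (simp add: SL2Z_iff a b_def)
  hence parity: "even (m * (1 + b))" by auto
  obtain C where C: "C \<noteq> 0" "\<And>k. klein7 k (moebius_act A \<tau>) =
     C * (zeta 14 (7 * k * b + k\<^sup>2 * (1 + 7 * m) * b) * klein7 (k * (1 + 7 * m)) \<tau>)"
    using klein7_Gamma0[OF AD(1,3) \<tau>] unfolding a b_def by blast
  show ?thesis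
  proof (rule that[OF C(1)])
    fix k :: int
    have "klein7 (k * (1 + 7 * m)) \<tau> = (- 1) powi (k * m) * klein7 k \<tau>"
      using klein7_add_7[of k "k * m" \<tau>] by (simp add: algebra_simps)
    also have "(- 1) powi (k * m) = zeta 14 (7 * (k * m))" using zeta_mult_cancel[of 7 2 "k * m"]
      by (simp add: zeta_2)
    finally have "klein7 k (moebius_act A \<tau>) =
        C * zeta 14 ((7 * k * b + k\<^sup>2 * (1 + 7 * m) * b) + 7 * (k * m)) * klein7 k \<tau>"
      by (simp add: C(2) zeta_add mult.assoc)
    also have "zeta 14 ((7 * k * b + k\<^sup>2 * (1 + 7 * m) * b) + 7 * (k * m)) = zeta 14 (int 2 * (4 * b * k\<^sup>2))"
    proof (rule zeta_cong)
      have "even (k * b + k\<^sup>2 * b * m + k * m - b * k\<^sup>2)" using parity by (cases "even k") auto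
      hence "7 * 2 dvd 7 * (k * b + k\<^sup>2 * b * m + k * m - b * k\<^sup>2)" by (intro mult_dvd_mono) simp_all
      thus "int 14 dvd (7 * k * b + k\<^sup>2 * (1 + 7 * m) * b) + 7 * (k * m) - int 2 * (4 * b * k\<^sup>2)"
        by (simp add: algebra_simps)
    qed simp
    also have "\<dots> = zeta 7 (4 * b * k\<^sup>2)" using zeta_mult_cancel[of 2 7 "4 * b * k\<^sup>2"] by simp
    finally show "klein7 k (moebius_act A \<tau>) = C * zeta 7 (4 * A $ 1 $ 2 * k\<^sup>2) * klein7 k \<tau>" unfolding b_def .
  qed
qed

lemma klein7_at_cusp:
  assumes A: "A \<in> SL2Z" and n: "n > 0"
  obtains B r and p m :: nat where "B \<in> SL2Z" "p > 0" "m > 0"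
    "mat2 (7 * int n * A $ 1 $ 1) (7 * int n * A $ 1 $ 2) (A $ 2 $ 1) (A $ 2 $ 2) =
        B ** mat2 (int p) r 0 (int m)"
    "\<And>\<tau>. \<tau> \<in> uhp \<Longrightarrow> \<exists>C. C \<noteq> 0 \<and> (\<forall>k. klein7 k (of_nat n * moebius_act A \<tau>) =
       C * klein (of_int (k * B $ 1 $ 1) / 7) (of_int (k * B $ 1 $ 2) / 7)
           ((of_nat p * \<tau> + of_int r) / of_nat m))"
proof -
  define M where "M = mat2 (7 * int n * A $ 1 $ 1) (7 * int n * A $ 1 $ 2) (A $ 2 $ 1) (A $ 2 $ 2)"
  have "det M = 7 * int n * (A $ 1 $ 1 * A $ 2 $ 2 - A $ 1 $ 2 * A $ 2 $ 1)"
    by (simp add: M_def det_2 algebra_simps)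
  hence "det M > 0" using A n by (simp add: SL2Z_iff)
  then obtain B r and p m :: nat where B: "B \<in> SL2Z" and pm: "p > 0" "m > 0"
    and M: "M = B ** mat2 (int p) r 0 (int m)"
    by (rule upper_triangular_decomposition)
  show ?thesis
  proof (rule that[OF B pm M[unfolded M_def]])
    fix \<tau> assume \<tau>: "\<tau> \<in> uhp"
    define \<sigma> where "\<sigma> = (of_nat p * \<tau> + of_int r) / of_nat m"
    have \<sigma>: "\<sigma> \<in> uhp" using \<tau> pm by (simp add: \<sigma>_def uhp_def Im_divide_of_nat)
    have "7 * (of_nat n * moebius_act A \<tau>) = moebius_act M \<tau>"
      by (simp add: M_def moebius_act_def algebra_simps)
    also have "\<dots> = moebius_act B (moebius_act (mat2 (int p) r 0 (int m)) \<tau>)"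
      unfolding M using pm by (intro moebius_mult) simp
    also have "moebius_act (mat2 (int p) r 0 (int m)) \<tau> = \<sigma>" by (simp add: moebius_act_def \<sigma>_def)
    finally have eq: "7 * (of_nat n * moebius_act A \<tau>) = moebius_act B \<sigma>" .
    obtain C where "C \<noteq> 0" "\<And>\<alpha> \<beta>. klein \<alpha> \<beta> (moebius_act B \<sigma>) =
        C * klein (\<alpha> * of_int (B $ 1 $ 1) + \<beta> * of_int (B $ 2 $ 1))
            (\<alpha> * of_int (B $ 1 $ 2) + \<beta> * of_int (B $ 2 $ 2)) \<sigma>"
      using klein_modular[OF B \<sigma>] by blast
    thus "\<exists>C. C \<noteq> 0 \<and> (\<forall>k. klein7 k (of_nat n * moebius_act A \<tau>) =
       C * klein (of_int (k * B $ 1 $ 1) / 7) (of_int (k * B $ 1 $ 2) / 7)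
           ((of_nat p * \<tau> + of_int r) / of_nat m))"
      unfolding klein7_def eq \<sigma>_def[symmetric] by (intro exI[of _ C]) simp
  qed
qed

lemma klein7_ratio_meromorphic_at_ii_inf:
  assumes A: "A \<in> SL2Z" and n: "n > 0"
  shows "meromorphic_at_ii_inf (\<lambda>\<tau>. klein7 j (of_nat n * moebius_act A \<tau>) /
      klein7 k (of_nat n * moebius_act A \<tau>))"
proof -
  obtain B :: "int ^ 2 ^ 2" and r and p m :: nat where pm: "p > 0" "m > 0"
    and cusp: "\<And>\<tau>. \<tau> \<in> uhp \<Longrightarrow> \<exists>C. C \<noteq> 0 \<and> (\<forall>k. klein7 k (of_nat n * moebius_act A \<tau>) =
       C * klein (of_int (k * B $ 1 $ 1) / 7) (of_int (k * B $ 1 $ 2) / 7)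
           ((of_nat p * \<tau> + of_int r) / of_nat m))"
    by (rule klein7_at_cusp[OF A n]) blast
  define f where "f k \<tau> = klein (of_int (k * B $ 1 $ 1) / 7) (of_int (k * B $ 1 $ 2) / 7)
      ((of_nat p * \<tau> + of_int r) / of_nat m)"
    for k \<tau>
  have "meromorphic_at_ii_inf (\<lambda>\<tau>. f j \<tau> / f k \<tau>)" unfolding f_def
    by (intro meromorphic_at_ii_inf_divide
      meromorphic_at_ii_inf_linear[OF klein_meromorphic_at_ii_inf[of 7, simplified] pm])
  moreover have "f j \<tau> / f k \<tau> = klein7 j (of_nat n * moebius_act A \<tau>) / klein7 k (of_nat n * moebius_act A \<tau>)"
    if "\<tau> \<in> uhp" for \<tau>
    using cusp[OF that] unfolding f_def[symmetric] by auto
  ultimately show ?thesis by (rule meromorphic_at_ii_inf_cong[OF _ eventually_at_ii_infI])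
qed

lemma phi_holomorphic: "phi1 holomorphic_on uhp" "phi2 holomorphic_on uhp"
proof -
  have "(\<lambda>\<tau>. klein7 3 \<tau> / klein7 2 \<tau>) holomorphic_on uhp" "(\<lambda>\<tau>. klein7 2 \<tau> / klein7 1 \<tau>) holomorphic_on uhp"
    by (intro holomorphic_intros klein7_holomorphic klein7_1_2_3_nonzero; assumption)+
  thus "phi1 holomorphic_on uhp" "phi2 holomorphic_on uhp" by (simp_all add: phi1_eq[abs_def] phi2_eq[abs_def])
qed

lemma phi_scaled_holomorphic:
  assumes "c > 0"
  shows "(\<lambda>\<tau>. phi1 (of_real c * \<tau>)) holomorphic_on uhp" "(\<lambda>\<tau>. phi2 (of_real c * \<tau>)) holomorphic_on uhp"
proof -
  have "(phi1 \<circ> (\<lambda>\<tau>. of_real c * \<tau>)) holomorphic_on uhp" "(phi2 \<circ> (\<lambda>\<tau>. of_real c * \<tau>)) holomorphic_on uhp"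
    using assms by (auto intro!: holomorphic_on_compose_gen[OF _ phi_holomorphic(1)]
      holomorphic_on_compose_gen[OF _ phi_holomorphic(2)]
        holomorphic_intros simp: uhp_def)
  thus "(\<lambda>\<tau>. phi1 (of_real c * \<tau>)) holomorphic_on uhp" "(\<lambda>\<tau>. phi2 (of_real c * \<tau>)) holomorphic_on uhp"
    by (simp_all add: o_def)
qed

lemma phi_nonzero: "\<tau> \<in> uhp \<Longrightarrow> phi1 \<tau> \<noteq> 0" "\<tau> \<in> uhp \<Longrightarrow> phi2 \<tau> \<noteq> 0"
  using klein7_1_2_3_nonzero by (simp_all add: phi1_eq phi2_eq)

lemma phi1_leading: "q_leading 7 phi1 (- 1) 1" and phi2_leading: "q_leading 7 phi2 (- 2) 1"
proof -
  have "q_leading (8 * 7) phi1 (int 8 * (- 1)) 1" "q_leading (8 * 7) phi2 (int 8 * (- 2)) 1"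
    using q_leading_divide[OF klein7_leading[of 3] klein7_leading[of 2]]
      q_leading_divide[OF klein7_leading[of 2] klein7_leading[of 1]]
    by (simp_all add: phi1_eq[abs_def] phi2_eq[abs_def])
  thus "q_leading 7 phi1 (- 1) 1" "q_leading 7 phi2 (- 2) 1" by (simp_all only: q_leading_rescale)
qed

lemma phi_Gamma1:
  assumes "A \<in> \<Gamma>\<^sub>1(7)" "\<tau> \<in> uhp"
  shows "phi1 (moebius_act A \<tau>) = zeta 7 (- A $ 1 $ 2) * phi1 \<tau>"
    "phi2 (moebius_act A \<tau>) = zeta 7 (5 * A $ 1 $ 2) * phi2 \<tau>"
proof -
  define b where "b = A $ 1 $ 2"
  obtain C where C: "C \<noteq> 0" "\<And>k. klein7 k (moebius_act A \<tau>) = C * zeta 7 (4 * b * k\<^sup>2) * klein7 k \<tau>"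
    using klein7_Gamma1[OF assms] unfolding b_def by blast
  have "zeta 7 (4 * b * 3\<^sup>2) = zeta 7 (- b) * zeta 7 (4 * b * 2\<^sup>2)"
    "zeta 7 (4 * b * 2\<^sup>2) = zeta 7 (5 * b) * zeta 7 (4 * b * 1\<^sup>2)"
    unfolding zeta_add[symmetric] by (rule zeta_cong; simp)+
  thus "phi1 (moebius_act A \<tau>) = zeta 7 (- A $ 1 $ 2) * phi1 \<tau>" "phi2 (moebius_act A \<tau>) =
      zeta 7 (5 * A $ 1 $ 2) * phi2 \<tau>"
    unfolding phi1_eq phi2_eq C(2) b_def[symmetric] using C(1) by simp_all
qed

section \<open>Modular functions of level 7\<close>

definition phi1_mero :: "nat \<Rightarrow> mero_uhp" where "phi1_mero n = mero_of (\<lambda>\<tau>. phi1 (of_nat n * \<tau>))"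

definition phi2_mero :: mero_uhp where "phi2_mero = mero_of phi2"

lemma
  assumes "n > 0"
  shows holomorphic_phi1_mero: "holomorphic_mero (phi1_mero n)"
    and eval_phi1_mero: "\<tau> \<in> uhp \<Longrightarrow> eval_mero (phi1_mero n) \<tau> = phi1 (of_nat n * \<tau>)"
proof -
  have "(\<lambda>\<tau>. phi1 (of_nat n * \<tau>)) holomorphic_on uhp" using phi_scaled_holomorphic(1)[of "real n"] assms by simp
  thus "holomorphic_mero (phi1_mero n)" "\<tau> \<in> uhp \<Longrightarrow> eval_mero (phi1_mero n) \<tau> = phi1 (of_nat n * \<tau>)"
    unfolding phi1_mero_def using holomorphic_mero_of eval_mero_of by blast+
qed

lemma holomorphic_phi2_mero: "holomorphic_mero phi2_mero"
  and eval_phi2_mero: "\<tau> \<in> uhp \<Longrightarrow> eval_mero phi2_mero \<tau> = phi2 \<tau>"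
  unfolding phi2_mero_def by (intro holomorphic_mero_of eval_mero_of phi_holomorphic; assumption)+

lemma meromorphic_at_cusps_phi1_mero:
  assumes n: "n > 0"
  shows "meromorphic_at_cusps (phi1_mero n)"
  unfolding meromorphic_at_cusps_iff
proof
  fix A assume A: "A \<in> SL2Z"
  show "meromorphic_at_ii_inf (eval_mero (act A (phi1_mero n)))"
    using klein7_ratio_meromorphic_at_ii_inf[OF A n, of 3 2]
    by (rule meromorphic_at_ii_inf_cong)
       (intro eventually_at_ii_infI, simp add: n A eval_act eval_phi1_mero moebius_in_uhp phi1_eq)
qed

lemma meromorphic_at_cusps_phi2_mero: "meromorphic_at_cusps phi2_mero"
  unfolding meromorphic_at_cusps_iff
proof
  fix A assume A: "A \<in> SL2Z"
  show "meromorphic_at_ii_inf (eval_mero (act A phi2_mero))"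
    using klein7_ratio_meromorphic_at_ii_inf[OF A zero_less_one, of 2 1]
    by (rule meromorphic_at_ii_inf_cong)
       (intro eventually_at_ii_infI, simp add: A eval_act eval_phi2_mero moebius_in_uhp phi2_eq)
qed

lemma meromorphic_at_cusps_power: "meromorphic_at_cusps f \<Longrightarrow> meromorphic_at_cusps (f ^ n)"
  by (induction n) (auto intro: meromorphic_at_cusps_mult
    simp: meromorphic_at_cusps_const[of 1, unfolded mero_const_1])

lemma mero_of_phi1_phi2: "mero_of (\<lambda>\<tau>. phi1 \<tau> * phi2 \<tau> ^ n) = phi1_mero 1 * phi2_mero ^ n"
proof (rule mero_eqI)
  fix \<tau> assume "\<tau> \<in> uhp"
  thus "eval_mero (mero_of (\<lambda>\<tau>. phi1 \<tau> * phi2 \<tau> ^ n)) \<tau> = eval_mero (phi1_mero 1 * phi2_mero ^ n) \<tau>"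
    by (subst eval_mero_of) (auto intro!: holomorphic_intros phi_holomorphic simp: eval_mero_simps
      holomorphic_mero_intros
        holomorphic_phi1_mero holomorphic_phi2_mero eval_phi1_mero eval_phi2_mero)
qed

lemma upsilon_eq: "\<upsilon> = phi1_mero 1 * phi2_mero ^ 3" and psi_eq: "\<psi> = phi1_mero 1 * phi2_mero ^ 2"
  unfolding mero_of_phi1_phi2[symmetric] upsilon_def psi_def
  by (rule arg_cong[where f = mero_of], simp add: fun_eq_iff phi1_def phi2_def power2_eq_square power3_eq_cube)+

lemma holomorphic_upsilon: "holomorphic_mero \<upsilon>" and holomorphic_psi: "holomorphic_mero \<psi>"
  unfolding upsilon_eq psi_eq
  by (intro holomorphic_mero_intros holomorphic_phi1_mero holomorphic_phi2_mero; simp)+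

lemma
  assumes "\<tau> \<in> uhp"
  shows eval_upsilon_phi: "eval_mero \<upsilon> \<tau> = phi1 \<tau> * phi2 \<tau> ^ 3"
    and eval_psi_phi: "eval_mero \<psi> \<tau> = phi1 \<tau> * phi2 \<tau> ^ 2"
  unfolding upsilon_eq psi_eq
  using assms by (simp_all add: eval_mero_simps holomorphic_mero_intros
    holomorphic_phi1_mero holomorphic_phi2_mero
      eval_phi1_mero eval_phi2_mero)

lemma
  assumes "\<tau> \<in> uhp"
  shows eval_upsilon: "eval_mero \<upsilon> \<tau> = klein7 2 \<tau> ^ 2 * klein7 3 \<tau> / klein7 1 \<tau> ^ 3"
    and eval_psi: "eval_mero \<psi> \<tau> = klein7 2 \<tau> * klein7 3 \<tau> / klein7 1 \<tau> ^ 2"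
  using assms klein7_1_2_3_nonzero[OF assms]
  by (simp_all add: eval_upsilon_phi eval_psi_phi phi1_eq phi2_eq power2_eq_square power3_eq_cube)

lemma meromorphic_at_cusps_upsilon: "meromorphic_at_cusps \<upsilon>"
  and meromorphic_at_cusps_psi: "meromorphic_at_cusps \<psi>"
  unfolding upsilon_eq psi_eq
  by (intro meromorphic_at_cusps_mult meromorphic_at_cusps_power meromorphic_at_cusps_phi1_mero
    meromorphic_at_cusps_phi2_mero; simp)+

lemma
  assumes A: "A \<in> \<Gamma>\<^sub>1(7)"
  shows act_upsilon_Gamma1: "act A \<upsilon> = \<upsilon>"
    and act_psi_Gamma1: "act A \<psi> = mero_const (zeta 7 (2 * A $ 1 $ 2)) * \<psi>"
proof -
  define b where "b = A $ 1 $ 2"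
  have SL2Z: "A \<in> SL2Z" using Gamma1D(1)[OF A] .
  have act_phi: "phi1 (moebius_act A \<tau>) * phi2 (moebius_act A \<tau>) ^ n =
      zeta 7 (- b + int n * (5 * b)) * (phi1 \<tau> * phi2 \<tau> ^ n)"
    if "\<tau> \<in> uhp" for \<tau> n
    unfolding phi_Gamma1[OF A that] b_def[symmetric]
    by (simp only: power_mult_distrib zeta_power zeta_add mult_ac)
  have "zeta 7 (- b + int 3 * (5 * b)) = 1" by (simp add: zeta_eq_1_iff)
  hence "eval_mero \<upsilon> (moebius_act A \<tau>) = eval_mero \<upsilon> \<tau>" if "\<tau> \<in> uhp" for \<tau>
    using act_phi[OF that, of 3] that by (simp add: eval_upsilon_phi moebius_in_uhp SL2Z)
  thus "act A \<upsilon> = \<upsilon>" by (intro mero_eqI) (simp add: eval_act SL2Z)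
  have "zeta 7 (- b + int 2 * (5 * b)) = zeta 7 (2 * b)" by (rule zeta_cong) simp_all
  hence "eval_mero \<psi> (moebius_act A \<tau>) = zeta 7 (2 * b) * eval_mero \<psi> \<tau>" if "\<tau> \<in> uhp" for \<tau>
    using act_phi[OF that, of 2] that by (simp add: eval_psi_phi moebius_in_uhp SL2Z)
  thus "act A \<psi> = mero_const (zeta 7 (2 * A $ 1 $ 2)) * \<psi>"
    by (intro mero_eqI) (simp add: eval_act SL2Z b_def eval_mero_simps holomorphic_mero_const holomorphic_psi)
qed

lemma upsilon_leading: "q_leading 1 (eval_mero \<upsilon>) (- 1) 1"
proof -
  have "q_leading 7 (\<lambda>\<tau>. phi1 \<tau> * phi2 \<tau> ^ 3) (- 7) 1"
    using q_leading_mult[OF phi1_leading q_leading_power[OF phi2_leading, of 3]] by simp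
  hence "q_leading (7 * 1) (eval_mero \<upsilon>) (int 7 * (- 1)) 1"
    using q_leading_cong eval_upsilon_phi by simp
  thus ?thesis by (subst (asm) q_leading_rescale) simp_all
qed

lemma klein7_cusp_exponent_nonneg:
  fixes a :: int
  assumes "\<not> 7 dvd a - 1" "\<not> 7 dvd a + 1"
  shows "2 * (7 - 2 * ((2 * a) mod 7))\<^sup>2 + (7 - 2 * ((3 * a) mod 7))\<^sup>2 - 3 * (7 - 2 * ((1 * a) mod 7))\<^sup>2 \<ge> 0"
proof -
  have "a mod 7 \<in> {0, 2, 3, 4, 5}" using assms by auto presburger
  moreover have "(k * a) mod 7 = (k * (a mod 7)) mod 7" for k by (simp add: mod_mult_right_eq)
  ultimately show ?thesis by (elim insertE emptyE) simp_all
qed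

lemma q_leading_nonneg_imp_convergent:
  assumes "N > 0" "q_leading N f e c" "e \<ge> 0"
  obtains L where "(f \<longlongrightarrow> L) at_ii_inf"
  using assms q_leading_pos_imp_tendsto_0[OF assms(1,2)] by (cases "e = 0") (auto simp: q_leading_0_iff)

lemma prime_7_dvd_mult_iff: "(7 :: int) dvd x * y \<longleftrightarrow> 7 dvd x \<or> 7 dvd y"
proof -
  have "Factorial_Ring.prime (7 :: int)" by simp
  thus ?thesis by (rule prime_dvd_mult_iff)
qed

lemma klein7_cusp_leading:
  assumes B: "B \<in> SL2Z" and k: "k \<in> {1, 2, 3}"
  obtains c where "c \<noteq> 0" "q_leading 392 (klein (of_int (k * B $ 1 $ 1) / 7) (of_int (k * B $ 1 $ 2) / 7))
    ((7 - 2 * ((k * B $ 1 $ 1) mod 7))\<^sup>2) c"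
proof -
  have "of_int (k * B $ 1 $ 2) / 7 \<notin> (\<int> :: real set)" if "int 7 dvd k * B $ 1 $ 1"
  proof
    assume "of_int (k * B $ 1 $ 2) / 7 \<in> (\<int> :: real set)"
    hence "7 dvd k * B $ 1 $ 2" using of_int_divide_in_Ints_iff[of 7 "k * B $ 1 $ 2"] by simp
    moreover have "\<not> 7 dvd k" using k by auto
    ultimately have "7 dvd B $ 1 $ 1 * B $ 2 $ 2 - B $ 1 $ 2 * B $ 2 $ 1"
      using that by (simp add: prime_7_dvd_mult_iff)
    thus False using B by (simp add: SL2Z_iff)
  qed
  thus ?thesis using that klein_leading_exists[of 7 "k * B $ 1 $ 1" "of_int (k * B $ 1 $ 2) / 7"] by auto
qed

lemma inequivalent_cusp_residue:
  assumes A: "A \<in> SL2Z" and inequivalent: "\<not> (7 dvd A $ 2 $ 1 \<and> (7 dvd A $ 1 $ 1 - 1 \<or> 7 dvd A $ 1 $ 1 + 1))"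
    and B: "B \<in> SL2Z" and "m > 0"
    and M: "mat2 (7 * A $ 1 $ 1) (7 * A $ 1 $ 2) (A $ 2 $ 1) (A $ 2 $ 2) = B ** mat2 (int p) r 0 (int m)"
  shows "\<not> 7 dvd B $ 1 $ 1 - 1 \<and> \<not> 7 dvd B $ 1 $ 1 + 1"
proof (rule ccontr)
  assume unit: "\<not> ?thesis"
  have column: "7 * A $ 1 $ 1 = B $ 1 $ 1 * int p" "A $ 2 $ 1 = B $ 2 $ 1 * int p"
    using arg_cong[OF M, of "\<lambda>M. M $ 1 $ 1"] arg_cong[OF M, of "\<lambda>M. M $ 2 $ 1"] by (simp_all add: matmul_entry)
  have det: "int p * int m = 7"
    using arg_cong[OF M, of det] A B by (simp add: det_mul SL2Z_def) (simp add: det_2 SL2Z_iff algebra_simps)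
  have "\<not> 7 dvd B $ 1 $ 1" using unit by presburger
  hence "7 dvd int p" using column(1) prime_7_dvd_mult_iff by (metis dvd_triv_left)
  hence "int p = 7" using det \<open>m > 0\<close>
    by (metis dvd_triv_left zdvd_antisym_nonneg of_nat_0_le_iff zero_le_numeral)
  thus False using column inequivalent unit by auto
qed

lemma upsilon_tendsto_at_cusp:
  assumes A: "A \<in> SL2Z" and inequivalent: "\<not> (7 dvd A $ 2 $ 1 \<and> (7 dvd A $ 1 $ 1 - 1 \<or> 7 dvd A $ 1 $ 1 + 1))"
  obtains L where "(eval_mero (act A \<upsilon>) \<longlongrightarrow> L) at_ii_inf"
proof -
  obtain B :: "int ^ 2 ^ 2" and r and p m :: nat where B: "B \<in> SL2Z" and pm: "p > 0" "m > 0"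
    and M: "mat2 (7 * int 1 * A $ 1 $ 1) (7 * int 1 * A $ 1 $ 2) (A $ 2 $ 1) (A $ 2 $ 2) =
        B ** mat2 (int p) r 0 (int m)"
    and cusp: "\<And>\<tau>. \<tau> \<in> uhp \<Longrightarrow> \<exists>C. C \<noteq> 0 \<and> (\<forall>k. klein7 k (of_nat 1 * moebius_act A \<tau>) =
       C * klein (of_int (k * B $ 1 $ 1) / 7) (of_int (k * B $ 1 $ 2) / 7)
           ((of_nat p * \<tau> + of_int r) / of_nat m))"
    by (rule klein7_at_cusp[OF A zero_less_one]) blast
  have residue: "\<not> 7 dvd B $ 1 $ 1 - 1 \<and> \<not> 7 dvd B $ 1 $ 1 + 1"
    using inequivalent_cusp_residue[OF A inequivalent B pm(2)] M by simp
  define f where "f k = klein (of_int (k * B $ 1 $ 1) / 7) (of_int (k * B $ 1 $ 2) / 7)" for k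
  define e where "e k = (7 - 2 * ((k * B $ 1 $ 1) mod 7))\<^sup>2" for k
  have "\<exists>c. k \<in> {1, 2, 3} \<longrightarrow> c \<noteq> 0 \<and> q_leading 392 (f k) (e k) c" for k
    using klein7_cusp_leading[OF B, of k] unfolding f_def e_def by blast
  then obtain c where c: "\<And>k. k \<in> {1, 2, 3} \<Longrightarrow> c k \<noteq> 0" "\<And>k. k \<in> {1, 2, 3} \<Longrightarrow> q_leading 392 (f k) (e k) (c k)"
    by metis
  have leading: "q_leading 392 (\<lambda>t. f 2 t ^ 2 * f 3 t / f 1 t ^ 3)
      (int 2 * e 2 + e 3 - int 3 * e 1) (c 2 ^ 2 * c 3 / c 1 ^ 3)"
    by (intro q_leading_divide q_leading_mult q_leading_power c(2)) (use c(1) in auto)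
  have "int 2 * e 2 + e 3 - int 3 * e 1 \<ge> 0"
    using klein7_cusp_exponent_nonneg[of "B $ 1 $ 1"] residue by (simp add: e_def)
  then obtain L where "((\<lambda>t. f 2 t ^ 2 * f 3 t / f 1 t ^ 3) \<longlongrightarrow> L) at_ii_inf"
    using q_leading_nonneg_imp_convergent[OF zero_less_numeral leading] by blast
  from filterlim_compose[OF this filterlim_at_ii_inf_linear[OF pm, of r]]
  have lim: "((\<lambda>\<tau>. f 2 ((of_nat p * \<tau> + of_int r) / of_nat m) ^ 2 * f 3 ((of_nat p * \<tau> + of_int r) / of_nat m) /
      f 1 ((of_nat p * \<tau> + of_int r) / of_nat m) ^ 3) \<longlongrightarrow> L) at_ii_inf" .
  have "f 2 ((of_nat p * \<tau> + of_int r) / of_nat m) ^ 2 * f 3 ((of_nat p * \<tau> + of_int r) / of_nat m) /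
      f 1 ((of_nat p * \<tau> + of_int r) / of_nat m) ^ 3 = eval_mero (act A \<upsilon>) \<tau>" if \<tau>: "\<tau> \<in> uhp" for \<tau>
  proof -
    obtain C where C: "C \<noteq> 0" "\<And>k. klein7 k (moebius_act A \<tau>) = C * f k ((of_nat p * \<tau> + of_int r) / of_nat m)"
      using cusp[OF \<tau>] unfolding f_def by auto
    thus ?thesis using C(1)
      by (simp add: eval_act A \<tau> eval_upsilon moebius_in_uhp C(2) power2_eq_square power3_eq_cube mult.assoc)
  qed
  hence "(eval_mero (act A \<upsilon>) \<longlongrightarrow> L) at_ii_inf"
    by (intro Lim_transform_eventually[OF lim] eventually_at_ii_infI)
  thus ?thesis by (rule that)
qed

lemma acts_trivially_Gamma1:
  assumes "A \<in> \<Gamma>\<^sub>1(N) \<or> - A \<in> \<Gamma>\<^sub>1(N)"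
  shows "acts_trivially \<Gamma>\<^sub>1(N) A"
  using assms modular_functions_iff[OF Gamma1_subset] unfolding acts_trivially_def by (metis act_uminus_matrix)

lemma upsilon_cusps:
  assumes A: "A \<in> SL2Z"
  shows "acts_trivially \<Gamma>\<^sub>1(7) A \<or> (\<exists>L. (eval_mero (act A \<upsilon>) \<longlongrightarrow> L) at_ii_inf)"
proof (cases "7 dvd A $ 2 $ 1 \<and> (7 dvd A $ 1 $ 1 - 1 \<or> 7 dvd A $ 1 $ 1 + 1)")
  case True
  moreover have "7 dvd - A $ 1 $ 1 - 1" if "7 dvd A $ 1 $ 1 + 1" using that by presburger
  ultimately have "A \<in> \<Gamma>\<^sub>1(7) \<or> - A \<in> \<Gamma>\<^sub>1(7)"
    using A SL2Z_uminus[OF A] by (auto simp: Gamma1_def)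
  thus ?thesis using acts_trivially_Gamma1 by blast
qed (use upsilon_tendsto_at_cusp[OF A] in blast)

lemma upsilon_in_Gamma1: "\<upsilon> \<in> \<A>\<^sub>0 \<Gamma>\<^sub>1(7)"
  using modular_functions_iff[OF Gamma1_subset] act_upsilon_Gamma1 meromorphic_at_cusps_upsilon by blast

interpretation upsilon: hauptmodul "\<Gamma>\<^sub>1(7)" 7 \<upsilon>
proof
  show "mat2 1 1 0 1 \<in> \<Gamma>\<^sub>1(7)" by (simp add: Gamma1_def SL2Z_iff)
  show "\<exists>c. c \<noteq> 0 \<and> q_leading 1 (eval_mero \<upsilon>) (- 1) c" using upsilon_leading by (intro exI[of _ 1]) simp
qed (use Gamma1_subset Gamma_subset_Gamma1 upsilon_in_Gamma1 holomorphic_upsilon upsilon_cusps in auto)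

lemma modular_functions_Gamma1_7_subset:
  assumes "C_subfield L" "\<upsilon> \<in> L"
  shows "\<A>\<^sub>0 \<Gamma>\<^sub>1(7) \<subseteq> L"
proof
  fix f assume "f \<in> \<A>\<^sub>0 \<Gamma>\<^sub>1(7)"
  then obtain p q where "f = peval p \<upsilon> / peval q \<upsilon>" using upsilon.hauptmodul_generates by metis
  thus "f \<in> L" using assms by (simp add: C_subfield_divide C_subfield_peval)
qed

lemma congruence_group_Gamma1:
  assumes "M dvd N" "N > 0"
  obtains R where "congruence_group \<Gamma>\<^sub>1(M) N R"
proof -
  obtain R where "transversal N \<Gamma>\<^sub>1(M) R" using exists_transversal[OF assms(2)] .
  hence "congruence_group \<Gamma>\<^sub>1(M) N R"
    using assms(2) Gamma1_subset Gamma_subset_Gamma1[of M] Gamma_antimono[OF assms(1)]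
      Gamma1_mult Gamma1_mat2_inv
    by unfold_locales blast+
  thus ?thesis by (rule that)
qed

lemma psi_nonzero: "\<psi> \<noteq> 0"
proof
  assume "\<psi> = 0"
  moreover have \<i>: "\<i> \<in> uhp" by (simp add: uhp_def)
  ultimately show False using eval_psi[OF \<i>] eval_mero_0[OF \<i>] klein7_1_2_3_nonzero[OF \<i>] by simp
qed

lemma act_psi_eq_iff:
  assumes "A \<in> \<Gamma>\<^sub>1(7)"
  shows "act A \<psi> = \<psi> \<longleftrightarrow> A \<in> \<Gamma>(7)"
proof -
  have "act A \<psi> = \<psi> \<longleftrightarrow> mero_const (zeta 7 (2 * A $ 1 $ 2)) = mero_const 1"
    using act_psi_Gamma1[OF assms] psi_nonzero by (simp add: mero_const_1)
  also have "\<dots> \<longleftrightarrow> 7 dvd 2 * A $ 1 $ 2" by (simp add: inj_eq[OF inj_mero_const] zeta_eq_1_iff)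
  also have "\<dots> \<longleftrightarrow> A \<in> \<Gamma>(7)" using assms by (simp add: Gamma_iff_Gamma1 prime_7_dvd_mult_iff)
  finally show ?thesis .
qed

lemma upsilon_in_Gamma7: "\<upsilon> \<in> \<A>\<^sub>0 \<Gamma>(7)" and psi_in_Gamma7: "\<psi> \<in> \<A>\<^sub>0 \<Gamma>(7)"
  using upsilon_in_Gamma1 modular_functions_antimono[OF Gamma_subset_Gamma1[of 7]]
    act_psi_eq_iff meromorphic_at_cusps_psi
    Gamma_subset_Gamma1[of 7] by (auto simp: modular_functions_iff[OF Gamma_subset])

theorem modular_functions_Gamma7: "\<A>\<^sub>0 \<Gamma>(7) = \<complex>({\<psi>, \<upsilon>})"
proof
  show "\<complex>({\<psi>, \<upsilon>}) \<subseteq> \<A>\<^sub>0 \<Gamma>(7)"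
    by (rule adjoin_C_least[OF C_subfield_modular_functions[OF Gamma_subset]])
      (use psi_in_Gamma7 upsilon_in_Gamma7 in auto)
  obtain R where "congruence_group \<Gamma>\<^sub>1(7) 7 R" using congruence_group_Gamma1[of 7 7] by auto
  then interpret congruence_group "\<Gamma>\<^sub>1(7)" 7 R .
  have generators: "\<psi> \<in> \<complex>({\<psi>, \<upsilon>})" "\<upsilon> \<in> \<complex>({\<psi>, \<upsilon>})" using adjoin_C_superset[of "{\<psi>, \<upsilon>}"] by auto
  show "\<A>\<^sub>0 \<Gamma>(7) \<subseteq> \<complex>({\<psi>, \<upsilon>})"
  proof (rule modular_functions_level_subset[of "[:\<psi>:]"])
    show "\<A>\<^sub>0 \<Gamma>\<^sub>1(7) \<subseteq> \<complex>({\<psi>, \<upsilon>})"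
      by (rule modular_functions_Gamma1_7_subset[OF C_subfield_adjoin_C generators(2)])
    show "A \<in> \<Gamma>(7)" if "A \<in> \<Gamma>\<^sub>1(7)" "map_poly (act A) [:\<psi>:] = [:\<psi>:]" for A
      using that act_psi_eq_iff Gamma1D(1) by (simp add: map_poly_pCons)
  qed (use psi_in_Gamma7 generators in \<open>auto simp: coeffs_in_pCons_iff coeffs_in_0
    C_subfield_level C_subfield_adjoin_C\<close>)
qed

section \<open>Theta relations behind the cubic\<close>

definition quad_exp7 :: "int \<Rightarrow> complex \<Rightarrow> complex" where
  "quad_exp7 k \<tau> = exp (of_real pi * \<i> * of_int (k\<^sup>2) * \<tau> / 7)"

definition theta7_00 :: "int \<Rightarrow> complex \<Rightarrow> complex" where
  "theta7_00 k \<tau> = quad_exp7 k \<tau> ^ 2 * theta_char 0 (2 * (of_int k * \<tau>)) (2 * (7 * \<tau>))"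

definition theta7_10 :: "int \<Rightarrow> complex \<Rightarrow> complex" where
  "theta7_10 k \<tau> = quad_exp7 k \<tau> ^ 2 * theta_char (1/2) (2 * (of_int k * \<tau>)) (2 * (7 * \<tau>))"

definition klein7_half :: "int \<Rightarrow> complex \<Rightarrow> complex" where
  "klein7_half k \<tau> = quad_exp7 k \<tau> * theta11 (of_int k * \<tau> + 1/2) (7 * \<tau>)"

lemma klein7_theta11: "klein7 k \<tau> = quad_exp7 k \<tau> * theta11 (of_int k * \<tau>) (7 * \<tau>)"
proof -
  have "of_real (of_int k / 7) * (7 * \<tau>) + of_real 0 = of_int k * \<tau>" by simp
  moreover have "exp (of_real pi * \<i> * of_real (of_int k / 7) * (of_int k * \<tau>)) = quad_exp7 k \<tau>"
    unfolding quad_exp7_def by (rule arg_cong[where f = exp]) (simp add: power2_eq_square)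
  ultimately show ?thesis unfolding klein7_def klein_def by (simp only:)
qed

lemma quad_exp7_prod: "quad_exp7 (x + y) \<tau> * quad_exp7 (x - y) \<tau> = quad_exp7 x \<tau> ^ 2 * quad_exp7 y \<tau> ^ 2"
  unfolding quad_exp7_def exp_of_nat_mult[symmetric] exp_add[symmetric]
  by (rule arg_cong[where f = exp]) (simp add: power2_eq_square algebra_simps add_divide_distrib[symmetric])

lemma klein7_prod:
  assumes "\<tau> \<in> uhp"
  shows "klein7 (x + y) \<tau> * klein7 (x - y) \<tau> = theta7_00 x \<tau> * theta7_10 y \<tau> - theta7_10 x \<tau> * theta7_00 y \<tau>"
proof -
  have "klein7 (x + y) \<tau> * klein7 (x - y) \<tau> = (quad_exp7 (x + y) \<tau> * quad_exp7 (x - y) \<tau>) *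
      (theta11 (of_int x * \<tau> + of_int y * \<tau>) (7 * \<tau>) * theta11 (of_int x * \<tau> - of_int y * \<tau>) (7 * \<tau>))"
    unfolding klein7_theta11 by (simp add: algebra_simps)
  also have "\<dots> = theta7_00 x \<tau> * theta7_10 y \<tau> - theta7_10 x \<tau> * theta7_00 y \<tau>"
    using assms unfolding quad_exp7_prod
    by (subst theta11_product) (simp_all add: uhp_def theta7_00_def theta7_10_def algebra_simps)
  finally show ?thesis .
qed

lemma theta_char_add_1: "theta_char 0 (z + 1) \<tau> = theta_char 0 z \<tau>"
  "theta_char (1/2) (z + 1) \<tau> = - theta_char (1/2) z \<tau>"
  using theta_char_add_int[of 0 z 1 \<tau>] theta_char_add_int[of "1/2" z 1 \<tau>] by simp_all

lemma klein7_half_prod: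
  assumes "\<tau> \<in> uhp"
  shows "klein7_half (x + y) \<tau> * klein7_half (x - y) \<tau> = theta7_00 x \<tau> * theta7_10 y \<tau> +
      theta7_10 x \<tau> * theta7_00 y \<tau>"
proof -
  have "klein7_half (x + y) \<tau> * klein7_half (x - y) \<tau> = (quad_exp7 (x + y) \<tau> * quad_exp7 (x - y) \<tau>) *
      (theta11 ((of_int x * \<tau> + 1/2) + of_int y * \<tau>) (7 * \<tau>) * theta11 ((of_int x * \<tau> + 1/2) - of_int y * \<tau>)
          (7 * \<tau>))"
    unfolding klein7_half_def by (simp add: algebra_simps)
  also have "theta11 ((of_int x * \<tau> + 1/2) + of_int y * \<tau>)
      (7 * \<tau>) * theta11 ((of_int x * \<tau> + 1/2) - of_int y * \<tau>) (7 * \<tau>) =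
      theta_char 0 (2 * (of_int x * \<tau>)) (2 * (7 * \<tau>)) * theta_char (1/2) (2 * (of_int y * \<tau>)) (2 * (7 * \<tau>)) +
      theta_char (1/2) (2 * (of_int x * \<tau>)) (2 * (7 * \<tau>)) * theta_char 0 (2 * (of_int y * \<tau>)) (2 * (7 * \<tau>))"
    using assms theta_char_add_1[of "2 * (of_int x * \<tau>)" "2 * (7 * \<tau>)"]
    by (subst theta11_product) (simp_all add: uhp_def distrib_left)
  finally show ?thesis unfolding quad_exp7_prod by (simp add: theta7_00_def theta7_10_def algebra_simps)
qed

lemma quad_exp7_theta_char_add_7:
  assumes periodic: "theta_char (a + 1) z (2 * (7 * \<tau>)) = theta_char a z (2 * (7 * \<tau>))"
    and z: "z = 2 * (of_int k * \<tau>)"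
  shows "quad_exp7 (k + 7) \<tau> ^ 2 * theta_char a (2 * (of_int (k + 7) * \<tau>)) (2 * (7 * \<tau>)) =
      quad_exp7 k \<tau> ^ 2 * theta_char a z (2 * (7 * \<tau>))"
proof -
  define E where "E = exp (- (of_real pi * \<i> * (of_real 1)\<^sup>2 * (2 * (7 * \<tau>))) -
      2 * of_real pi * \<i> * of_real 1 * z)"
  have "theta_char a (2 * (of_int (k + 7) * \<tau>)) (2 * (7 * \<tau>)) =
      theta_char a (z + of_real 1 * (2 * (7 * \<tau>))) (2 * (7 * \<tau>))"
    by (simp add: z algebra_simps)
  also have "\<dots> = E * theta_char a z (2 * (7 * \<tau>))" unfolding E_def theta_char_shift periodic ..
  finally have shift: "theta_char a (2 * (of_int (k + 7) * \<tau>)) (2 * (7 * \<tau>)) =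
      E * theta_char a z (2 * (7 * \<tau>))" .
  have "quad_exp7 (k + 7) \<tau> ^ 2 * E = quad_exp7 k \<tau> ^ 2"
    unfolding quad_exp7_def E_def z exp_of_nat_mult[symmetric] exp_add[symmetric]
    by (rule arg_cong[where f = exp]) (simp add: power2_eq_square algebra_simps add_divide_distrib)
  thus ?thesis unfolding shift by (simp add: mult.assoc[symmetric])
qed

lemma theta7_00_add_7: "theta7_00 (k + 7) \<tau> = theta7_00 k \<tau>"
  and theta7_10_add_7: "theta7_10 (k + 7) \<tau> = theta7_10 k \<tau>"
  unfolding theta7_00_def theta7_10_def
  using theta_char_characteristic_add_int[of 0 1] theta_char_characteristic_add_int[of "1/2" 1]
  by (intro quad_exp7_theta_char_add_7; simp)+

lemma theta7_00_even: "theta7_00 (- k) \<tau> = theta7_00 k \<tau>"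
  and theta7_10_even: "theta7_10 (- k) \<tau> = theta7_10 k \<tau>"
  using theta_char_zero_even[of "2 * (of_int k * \<tau>)"] theta_char_half_even[of "2 * (of_int k * \<tau>)"]
  by (simp_all add: theta7_00_def theta7_10_def quad_exp7_def)

lemma theta7_00_4: "theta7_00 4 \<tau> = theta7_00 3 \<tau>" and theta7_10_4: "theta7_10 4 \<tau> = theta7_10 3 \<tau>"
  using theta7_00_add_7[of "- 3" \<tau>] theta7_00_even[of 3 \<tau>] theta7_10_add_7[of "- 3" \<tau>] theta7_10_even[of 3 \<tau>]
  by simp_all

lemma klein7_half_even: "klein7_half (- k) \<tau> = klein7_half k \<tau>"
proof -
  have "theta11 (of_int (- k) * \<tau> + 1/2) (7 * \<tau>) = theta11 (- (of_int k * \<tau> - 1/2)) (7 * \<tau>)" by simp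
  also have "\<dots> = - theta11 (of_int k * \<tau> - 1/2) (7 * \<tau>)" by (rule theta11_minus)
  also have "\<dots> = theta11 (of_int k * \<tau> - 1/2 + of_int 0 * (7 * \<tau>) + of_int 1) (7 * \<tau>)"
    unfolding theta11_quasi by simp
  finally show ?thesis by (simp add: klein7_half_def quad_exp7_def add.commute)
qed

lemma klein7_half_add_7: "klein7_half (k + 7) \<tau> = klein7_half k \<tau>"
proof -
  define z where "z = of_int k * \<tau> + 1/2"
  define E where "E = exp (- (of_real pi * \<i> * (7 * \<tau>)) - 2 * of_real pi * \<i> * z)"
  have "theta11 (of_int (k + 7) * \<tau> + 1/2) (7 * \<tau>) = theta11 (z + of_int 1 * (7 * \<tau>) + of_int 0) (7 * \<tau>)"
    by (simp add: z_def algebra_simps)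
  also have "\<dots> = exp (of_real pi * \<i>) * E * theta11 z (7 * \<tau>)" unfolding theta11_quasi E_def by simp
  finally have shift: "theta11 (of_int (k + 7) * \<tau> + 1/2) (7 * \<tau>) =
      exp (of_real pi * \<i>) * E * theta11 z (7 * \<tau>)" .
  have "quad_exp7 (k + 7) \<tau> * (exp (of_real pi * \<i>) * E) = quad_exp7 k \<tau>"
    unfolding quad_exp7_def E_def z_def exp_add[symmetric]
    by (rule arg_cong[where f = exp]) (simp add: power2_eq_square algebra_simps add_divide_distrib)
  thus ?thesis unfolding klein7_half_def shift z_def[symmetric] by (simp only: mult.assoc[symmetric])
qed

lemma klein7_half_4_6: "klein7_half 4 \<tau> = klein7_half 3 \<tau>" "klein7_half 6 \<tau> = klein7_half 1 \<tau>"
  using klein7_half_add_7[of "- 3" \<tau>] klein7_half_even[of 3 \<tau>] klein7_half_add_7[of "- 1" \<tau>]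
    klein7_half_even[of 1 \<tau>] by simp_all

lemma klein7_double:
  assumes "\<tau> \<in> uhp"
  shows "klein7 k \<tau> * klein7_half k \<tau> = klein7 k (2 * \<tau>) * (- theta_char 0 (1/2) (2 * (7 * \<tau>)))"
proof -
  have "klein7 k \<tau> * klein7_half k \<tau> = quad_exp7 k \<tau> ^ 2 *
      (theta11 (of_int k * \<tau>) (7 * \<tau>) * theta11 (of_int k * \<tau> + 1/2) (7 * \<tau>))"
    unfolding klein7_theta11 klein7_half_def by (simp add: power2_eq_square)
  also have "theta11 (of_int k * \<tau>) (7 * \<tau>) * theta11 (of_int k * \<tau> + 1/2) (7 * \<tau>) =
      theta11 (2 * (of_int k * \<tau>)) (2 * (7 * \<tau>)) * (- theta_char 0 (1/2) (2 * (7 * \<tau>)))"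
    by (rule theta11_duplication) (use assms in \<open>simp add: uhp_def\<close>)
  also have "theta11 (2 * (of_int k * \<tau>)) (2 * (7 * \<tau>)) = theta11 (of_int k * (2 * \<tau>)) (7 * (2 * \<tau>))"
    by (simp add: mult_ac)
  also have "quad_exp7 k \<tau> ^ 2 = quad_exp7 k (2 * \<tau>)"
    unfolding quad_exp7_def exp_of_nat_mult[symmetric] by (rule arg_cong[where f = exp]) simp
  finally show ?thesis unfolding klein7_theta11 by (simp add: mult.assoc)
qed

lemma theta7_10_half: "theta7_10 x (\<tau> / 2) = - klein7_half x \<tau>"
proof -
  have "quad_exp7 x (\<tau> / 2) ^ 2 = quad_exp7 x \<tau>"
    unfolding quad_exp7_def exp_of_nat_mult[symmetric] by (rule arg_cong[where f = exp]) simp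
  moreover have "theta11 (of_int x * \<tau> + 1/2) (7 * \<tau>) = theta_char (1/2) (of_int x * \<tau> + 1) (7 * \<tau>)"
    by (simp add: theta11_def algebra_simps)
  ultimately show ?thesis unfolding theta7_10_def klein7_half_def
    using theta_char_add_1(2)[of "of_int x * \<tau>" "7 * \<tau>"] by simp
qed

lemma klein7_half_nonzero:
  assumes "\<tau> \<in> uhp"
  shows "klein7_half k \<tau> \<noteq> 0"
proof -
  have "(1/2 :: real) \<notin> \<int>" using of_int_divide_in_Ints_iff[of 2 1] by simp
  hence "klein (of_int k / 7) (1/2) (7 * \<tau>) \<noteq> 0" using assms by (intro klein_nonzero) (auto simp: uhp_def)
  thus ?thesis by (simp add: klein_def klein7_half_def quad_exp7_def)
qed

text \<open>All relations below are Pluecker relations for the vectors \<open>(theta7_00 k, theta7_10 k)\<close>.\<close>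

lemma klein7_products:
  assumes "\<tau> \<in> uhp"
  shows "klein7 1 \<tau> * klein7 3 \<tau> = theta7_00 2 \<tau> * theta7_10 1 \<tau> - theta7_10 2 \<tau> * theta7_00 1 \<tau>"
    "klein7 1 \<tau> * klein7 2 \<tau> = theta7_00 3 \<tau> * theta7_10 2 \<tau> - theta7_10 3 \<tau> * theta7_00 2 \<tau>"
    "klein7 2 \<tau> * klein7 3 \<tau> = theta7_00 3 \<tau> * theta7_10 1 \<tau> - theta7_10 3 \<tau> * theta7_00 1 \<tau>"
    "klein7 k \<tau> ^ 2 = theta7_00 k \<tau> * theta7_10 0 \<tau> - theta7_10 k \<tau> * theta7_00 0 \<tau>"
  using klein7_prod[OF assms, of 2 1] klein7_prod[OF assms, of 4 2]
    klein7_prod[OF assms, of 3 1] klein7_prod[OF assms, of k 0]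
  by (simp_all add: klein7_4_5_6 theta7_00_4 theta7_10_4 power2_eq_square mult.commute)

lemma klein7_half_products:
  assumes "\<tau> \<in> uhp"
  shows "klein7_half 1 \<tau> * klein7_half 3 \<tau> = theta7_00 2 \<tau> * theta7_10 1 \<tau> + theta7_10 2 \<tau> * theta7_00 1 \<tau>"
    "klein7_half 2 \<tau> * klein7_half 3 \<tau> = theta7_00 3 \<tau> * theta7_10 1 \<tau> + theta7_10 3 \<tau> * theta7_00 1 \<tau>"
    "klein7_half k \<tau> ^ 2 = theta7_00 k \<tau> * theta7_10 0 \<tau> + theta7_10 k \<tau> * theta7_00 0 \<tau>"
  using klein7_half_prod[OF assms, of 2 1] klein7_half_prod[OF assms, of 3 1] klein7_half_prod[OF assms, of k 0]
    klein7_half_even[of 1] klein7_half_4_6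
  by (simp_all add: power2_eq_square mult.commute)

lemma klein_quartic:
  assumes "\<tau> \<in> uhp"
  shows "klein7 2 \<tau> ^ 2 * (klein7 2 \<tau> * klein7 3 \<tau>) - klein7 1 \<tau> ^ 2 * (klein7 1 \<tau> * klein7 2 \<tau>) =
      klein7 3 \<tau> ^ 2 * (klein7 1 \<tau> * klein7 3 \<tau>)"
  unfolding klein7_products[OF assms] by (simp add: algebra_simps)

lemma klein7_half_squares_relation:
  assumes "\<tau> \<in> uhp"
  shows "(klein7 1 \<tau> * klein7 3 \<tau>) * klein7_half 3 \<tau> ^ 2 + (klein7 1 \<tau> * klein7 2 \<tau>) *
      klein7_half 1 \<tau> ^ 2 = (klein7 2 \<tau> * klein7 3 \<tau>) * klein7_half 2 \<tau> ^ 2"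
  unfolding klein7_products[OF assms] klein7_half_products[OF assms] by (simp add: algebra_simps)

lemma klein7_half_products_relation:
  assumes "\<tau> \<in> uhp"
  shows "(klein7 1 \<tau> * klein7 2 \<tau>) * klein7_half 1 \<tau> ^ 2 - klein7 3 \<tau> ^ 2 *
      (klein7_half 1 \<tau> * klein7_half 3 \<tau>) + klein7 2 \<tau> ^ 2 * (klein7_half 2 \<tau> * klein7_half 3 \<tau>) = 0"
  unfolding klein7_products[OF assms] klein7_half_products[OF assms] by (simp add: algebra_simps)

lemma klein7_half_linear_relation:
  assumes "\<tau> \<in> uhp"
  shows "(klein7 1 (\<tau> / 2) * klein7 3 (\<tau> / 2)) * klein7_half 3 \<tau> +
      (klein7 1 (\<tau> / 2) * klein7 2 (\<tau> / 2)) * klein7_half 1 \<tau> =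
          (klein7 2 (\<tau> / 2) * klein7 3 (\<tau> / 2)) * klein7_half 2 \<tau>"
proof -
  have "\<tau> / 2 \<in> uhp" using assms by (simp add: uhp_def)
  moreover have "klein7_half k \<tau> = - theta7_10 k (\<tau> / 2)" for k by (simp add: theta7_10_half)
  ultimately show ?thesis by (simp add: klein7_products algebra_simps)
qed

lemma phi_double:
  assumes "\<tau> \<in> uhp"
  shows "phi1 (2 * \<tau>) = klein7 3 \<tau> * klein7_half 3 \<tau> / (klein7 2 \<tau> * klein7_half 2 \<tau>)"
    "phi2 (2 * \<tau>) = klein7 2 \<tau> * klein7_half 2 \<tau> / (klein7 1 \<tau> * klein7_half 1 \<tau>)"
proof -
  define D where "D = - theta_char 0 (1/2) (2 * (7 * \<tau>))"
  have D: "klein7 k \<tau> * klein7_half k \<tau> = klein7 k (2 * \<tau>) * D" for k unfolding D_def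
    by (rule klein7_double[OF assms])
  have "klein7 1 \<tau> * klein7_half 1 \<tau> \<noteq> 0" using klein7_1_2_3_nonzero[OF assms] klein7_half_nonzero[OF assms]
    by simp
  hence "D \<noteq> 0" unfolding D by auto
  thus "phi1 (2 * \<tau>) = klein7 3 \<tau> * klein7_half 3 \<tau> / (klein7 2 \<tau> * klein7_half 2 \<tau>)"
    "phi2 (2 * \<tau>) = klein7 2 \<tau> * klein7_half 2 \<tau> / (klein7 1 \<tau> * klein7_half 1 \<tau>)"
    unfolding D phi1_eq phi2_eq by simp_all
qed

section \<open>The functions \<open>g\<^sub>1\<close>, \<open>g\<^sub>2\<close> and \<open>g\<^sub>3\<close>\<close>

lemma g_functions_holomorphic:
  shows "(\<lambda>\<tau>. phi1 \<tau> ^ 2 / phi1 (2 * \<tau>)) holomorphic_on uhp"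
    "(\<lambda>\<tau>. phi1 \<tau> * phi1 (\<tau> / 2) * phi1 (2 * \<tau>) - phi1 (2 * \<tau>) / phi2 \<tau>) holomorphic_on uhp"
    "(\<lambda>\<tau>. - phi1 \<tau> * phi1 (\<tau> / 2) * phi1 (2 * \<tau>) - phi1 \<tau> ^ 2 * phi2 \<tau> / phi2 (2 * \<tau>)) holomorphic_on uhp"
proof -
  have double: "(\<lambda>\<tau>. phi1 (2 * \<tau>)) holomorphic_on uhp" "(\<lambda>\<tau>. phi2 (2 * \<tau>)) holomorphic_on uhp"
    using phi_scaled_holomorphic[of 2] by simp_all
  have half: "(\<lambda>\<tau>. phi1 (\<tau> / 2)) holomorphic_on uhp" using phi_scaled_holomorphic(1)[of "1/2"] by simp
  have nonzero: "phi1 (2 * \<tau>) \<noteq> 0" "phi2 (2 * \<tau>) \<noteq> 0" "phi2 \<tau> \<noteq> 0" if "\<tau> \<in> uhp" for \<tau>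
    using that phi_nonzero[of "2 * \<tau>"] phi_nonzero[of \<tau>] by (auto simp: uhp_def)
  show "(\<lambda>\<tau>. phi1 \<tau> ^ 2 / phi1 (2 * \<tau>)) holomorphic_on uhp"
    "(\<lambda>\<tau>. phi1 \<tau> * phi1 (\<tau> / 2) * phi1 (2 * \<tau>) - phi1 (2 * \<tau>) / phi2 \<tau>) holomorphic_on uhp"
    "(\<lambda>\<tau>. - phi1 \<tau> * phi1 (\<tau> / 2) * phi1 (2 * \<tau>) - phi1 \<tau> ^ 2 * phi2 \<tau> / phi2 (2 * \<tau>)) holomorphic_on uhp"
    by (intro holomorphic_intros double half phi_holomorphic nonzero; assumption)+
qed

lemmas holomorphic_g1 = holomorphic_mero_of[OF g_functions_holomorphic(1), folded g1_def]
  and holomorphic_g2 = holomorphic_mero_of[OF g_functions_holomorphic(2), folded g2_def]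
  and holomorphic_g3 = holomorphic_mero_of[OF g_functions_holomorphic(3), folded g3_def]

lemmas eval_g1 = eval_mero_of[OF g_functions_holomorphic(1), folded g1_def]
  and eval_g2 = eval_mero_of[OF g_functions_holomorphic(2), folded g2_def]
  and eval_g3 = eval_mero_of[OF g_functions_holomorphic(3), folded g3_def]

lemma eval_g1_klein7:
  assumes "\<tau> \<in> uhp"
  shows "eval_mero g1 \<tau> = klein7 3 \<tau> * klein7_half 2 \<tau> / (klein7 2 \<tau> * klein7_half 3 \<tau>)"
  unfolding eval_g1[OF assms] phi_double[OF assms] phi1_eq[of \<tau>]
  using klein7_1_2_3_nonzero[OF assms] klein7_half_nonzero[OF assms] by (simp add: power2_eq_square)

lemma eval_g3_phi:
  assumes "\<tau> \<in> uhp"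
  shows "eval_mero g3 \<tau> = - (phi1 \<tau> ^ 2 * (phi1 (\<tau> / 2) * phi2 (\<tau> / 2)))"
proof -
  have half: "\<tau> / 2 \<in> uhp" using assms by (simp add: uhp_def)
  define c1 c2 c3 where "c1 = klein7 1 (\<tau> / 2)" and "c2 = klein7 2 (\<tau> / 2)" and "c3 = klein7 3 (\<tau> / 2)"
  define s1 s2 s3 where "s1 = klein7 1 \<tau>" and "s2 = klein7 2 \<tau>" and "s3 = klein7 3 \<tau>"
  define t1 t2 t3 where "t1 = klein7_half 1 \<tau>" and "t2 = klein7_half 2 \<tau>" and "t3 = klein7_half 3 \<tau>"
  note defs = c1_def c2_def c3_def s1_def s2_def s3_def t1_def t2_def t3_def
  have nonzero: "c1 \<noteq> 0" "c2 \<noteq> 0" "c3 \<noteq> 0" "s1 \<noteq> 0" "s2 \<noteq> 0" "s3 \<noteq> 0" "t1 \<noteq> 0" "t2 \<noteq> 0" "t3 \<noteq> 0"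
    using klein7_1_2_3_nonzero[OF assms] klein7_1_2_3_nonzero[OF half] klein7_half_nonzero[OF assms]
    by (simp_all add: defs)
  have relation: "(c1 * c3) * t3 + (c1 * c2) * t1 = (c2 * c3) * t2"
    using klein7_half_linear_relation[OF assms] by (simp add: defs)
  have "eval_mero g3 \<tau> = - (s3 / s2) * (c3 / c2) * (s3 * t3 / (s2 * t2)) -
      (s3 / s2) ^ 2 * (s2 / s1) / (s2 * t2 / (s1 * t1))"
    unfolding eval_g3[OF assms] phi_double[OF assms] phi1_eq[of \<tau>] phi1_eq[of "\<tau> / 2"] phi2_eq[of \<tau>]
    by (simp add: defs)
  also have "\<dots> = - ((s3 / s2) ^ 2 * (((c1 * c3) * t3 + (c1 * c2) * t1) / (c1 * c2 * t2)))"
    using nonzero by (simp add: field_simps power2_eq_square)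
  also have "\<dots> = - ((s3 / s2) ^ 2 * ((c3 / c2) * (c2 / c1)))" unfolding relation using nonzero by simp
  finally show ?thesis by (simp add: phi1_eq phi2_eq defs)
qed

lemma g_sum: "g1 + g2 + g3 = - 1"
proof (rule mero_eqI)
  fix \<tau> assume \<tau>: "\<tau> \<in> uhp"
  define s1 s2 s3 where "s1 = klein7 1 \<tau>" and "s2 = klein7 2 \<tau>" and "s3 = klein7 3 \<tau>"
  define t1 t2 t3 where "t1 = klein7_half 1 \<tau>" and "t2 = klein7_half 2 \<tau>" and "t3 = klein7_half 3 \<tau>"
  note defs = s1_def s2_def s3_def t1_def t2_def t3_def
  have nonzero: "s1 \<noteq> 0" "s2 \<noteq> 0" "s3 \<noteq> 0" "t1 \<noteq> 0" "t2 \<noteq> 0" "t3 \<noteq> 0"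
    using klein7_1_2_3_nonzero[OF \<tau>] klein7_half_nonzero[OF \<tau>] by (simp_all add: defs)
  have squares: "(s1 * s3) * t3 ^ 2 + (s1 * s2) * t1 ^ 2 = (s2 * s3) * t2 ^ 2"
    and products: "(s1 * s2) * t1 ^ 2 - s3 ^ 2 * (t1 * t3) + s2 ^ 2 * (t2 * t3) = 0"
    using klein7_half_squares_relation[OF \<tau>] klein7_half_products_relation[OF \<tau>] by (simp_all add: defs)
  have "s3 * s2 * t2 ^ 2 - s1 * s3 * t3 ^ 2 - s3 ^ 2 * t1 * t3 + s2 ^ 2 * t2 * t3 =
      ((s2 * s3) * t2 ^ 2 - ((s1 * s3) * t3 ^ 2 + (s1 * s2) * t1 ^ 2)) +
      ((s1 * s2) * t1 ^ 2 - s3 ^ 2 * (t1 * t3) + s2 ^ 2 * (t2 * t3))" by (simp add: algebra_simps)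
  hence numerator: "s3 * s2 * t2 ^ 2 - s1 * s3 * t3 ^ 2 - s3 ^ 2 * t1 * t3 + s2 ^ 2 * t2 * t3 = 0"
    unfolding squares products by simp
  have "eval_mero g1 \<tau> + eval_mero g2 \<tau> + eval_mero g3 \<tau> =
      s3 * t2 / (s2 * t3) - (s3 * t3 / (s2 * t2)) / (s2 / s1) - (s3 / s2) ^ 2 *
          (s2 / s1) / (s2 * t2 / (s1 * t1))"
    unfolding eval_g1_klein7[OF \<tau>] eval_g2[OF \<tau>] eval_g3[OF \<tau>] phi_double[OF \<tau>] phi1_eq[of \<tau>] phi2_eq[of \<tau>]
    by (simp add: defs)
  also have "\<dots> = (s3 * s2 * t2 ^ 2 - s1 * s3 * t3 ^ 2 - s3 ^ 2 * t1 * t3 +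
      s2 ^ 2 * t2 * t3) / (s2 ^ 2 * t2 * t3) - 1"
    using nonzero by (simp add: field_simps power2_eq_square)
  finally have "eval_mero g1 \<tau> + eval_mero g2 \<tau> + eval_mero g3 \<tau> = - 1" unfolding numerator by simp
  thus "eval_mero (g1 + g2 + g3) \<tau> = eval_mero (- 1) \<tau>"
    using \<tau> by (simp add: eval_mero_simps holomorphic_mero_intros holomorphic_g1 holomorphic_g2 holomorphic_g3)
qed

lemma g1_tendsto: "(eval_mero g1 \<longlongrightarrow> 1) at_ii_inf"
proof -
  have "q_leading 7 (\<lambda>\<tau>. phi1 (2 * \<tau>)) (- 2) 1"
    using q_leading_linear[OF phi1_leading, of 2 1 0] by simp
  from q_leading_divide[OF q_leading_power[OF phi1_leading, of 2] this]
  have "q_leading 7 (eval_mero g1) 0 1"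
    using q_leading_cong[of 7 "\<lambda>\<tau>. phi1 \<tau> ^ 2 / phi1 (2 * \<tau>)" 0 1 "eval_mero g1"] eval_g1 by simp
  thus ?thesis by (simp add: q_leading_0_iff)
qed

lemma g3_leading: "q_leading 2 (eval_mero g3) (- 1) (- 1)"
proof -
  have "q_leading (7 * 2) (\<lambda>\<tau>. phi1 (\<tau> / 2) * phi2 (\<tau> / 2)) (- 3) 1"
    using q_leading_mult[OF q_leading_linear[OF phi1_leading, of 1 2 0] q_leading_linear[OF phi2_leading, of 1 2 0]] by simp
  moreover have "q_leading (2 * 7) (\<lambda>\<tau>. phi1 \<tau> ^ 2) (int 2 * (- 2)) 1"
    using q_leading_power[OF phi1_leading, of 2] by (subst q_leading_rescale) simp_all
  ultimately have "q_leading 14 (\<lambda>\<tau>. - 1 * (phi1 \<tau> ^ 2 * (phi1 (\<tau> / 2) * phi2 (\<tau> / 2))))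
      (0 + (- 4 + - 3)) (- 1 * (1 * 1))"
    by (intro q_leading_mult q_leading_const) simp_all
  hence "q_leading (7 * 2) (eval_mero g3) (int 7 * (- 1)) (- 1)"
    using q_leading_cong eval_g3_phi by simp
  thus ?thesis by (subst (asm) q_leading_rescale) simp_all
qed

lemma g1_neq_g3: "g1 \<noteq> g3"
proof
  assume "g1 = g3"
  hence "filterlim (eval_mero g1) at_infinity at_ii_inf"
    using q_leading_neg_imp_filterlim_at_infinity[OF _ g3_leading] by simp
  thus False using not_tendsto_and_filterlim_at_infinity[OF at_ii_inf_neq_bot g1_tendsto] by blast
qed

section \<open>The cubic over the field of level 7\<close>

lemma numeral_mero_nonzero: "(numeral n :: mero_uhp) \<noteq> 0"
proof -
  have "mero_const (numeral n) \<noteq> mero_const 0" by (simp only: inj_eq[OF inj_mero_const]) simp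
  thus ?thesis by (simp add: mero_const_numeral mero_const_0)
qed

lemma upsilon_psi_pointwise:
  assumes "\<tau> \<in> uhp"
  shows "eval_mero \<upsilon> \<tau> \<noteq> 0" "eval_mero \<upsilon> \<tau> \<noteq> 1" "eval_mero \<psi> \<tau> \<noteq> 0"
    "eval_mero \<psi> \<tau> ^ 7 = eval_mero \<upsilon> \<tau> ^ 4 * (eval_mero \<upsilon> \<tau> - 1)"
proof -
  define s1 s2 s3 where "s1 = klein7 1 \<tau>" and "s2 = klein7 2 \<tau>" and "s3 = klein7 3 \<tau>"
  have nonzero: "s1 \<noteq> 0" "s2 \<noteq> 0" "s3 \<noteq> 0" using klein7_1_2_3_nonzero[OF assms]
    by (simp_all add: s1_def s2_def s3_def)
  have quartic: "s2 ^ 2 * (s2 * s3) - s1 ^ 2 * (s1 * s2) = s3 ^ 2 * (s1 * s3)"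
    using klein_quartic[OF assms] by (simp add: s1_def s2_def s3_def)
  have u: "eval_mero \<upsilon> \<tau> = s2 ^ 2 * s3 / s1 ^ 3" and p: "eval_mero \<psi> \<tau> = s2 * s3 / s1 ^ 2"
    using eval_upsilon[OF assms] eval_psi[OF assms] by (simp_all add: s1_def s2_def s3_def)
  have "eval_mero \<upsilon> \<tau> - 1 = (s2 ^ 2 * (s2 * s3) - s1 ^ 2 * (s1 * s2)) / (s1 ^ 3 * s2)"
    unfolding u using nonzero by (simp add: field_simps eval_nat_numeral)
  also have "\<dots> = s3 ^ 3 / (s1 ^ 2 * s2)" unfolding quartic using nonzero
    by (simp add: field_simps eval_nat_numeral)
  finally have u1: "eval_mero \<upsilon> \<tau> - 1 = s3 ^ 3 / (s1 ^ 2 * s2)" .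
  have "eval_mero \<upsilon> \<tau> - 1 \<noteq> 0" unfolding u1 using nonzero by simp
  thus "eval_mero \<upsilon> \<tau> \<noteq> 1" by simp
  show "eval_mero \<upsilon> \<tau> \<noteq> 0" "eval_mero \<psi> \<tau> \<noteq> 0" unfolding u p using nonzero by simp_all
  show "eval_mero \<psi> \<tau> ^ 7 = eval_mero \<upsilon> \<tau> ^ 4 * (eval_mero \<upsilon> \<tau> - 1)"
    unfolding u1 unfolding u p using nonzero by (simp add: field_simps eval_nat_numeral)
qed

lemma upsilon_neq: "\<upsilon> \<noteq> 0" "\<upsilon> - 1 \<noteq> 0"
proof -
  have \<i>: "\<i> \<in> uhp" by (simp add: uhp_def)
  show "\<upsilon> \<noteq> 0" using upsilon_psi_pointwise(1)[OF \<i>] eval_mero_0[OF \<i>] by auto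
  show "\<upsilon> - 1 \<noteq> 0" using upsilon_psi_pointwise(2)[OF \<i>] eval_mero_1[OF \<i>] by auto
qed

definition cubic14 :: "'a :: comm_ring_1 \<Rightarrow> 'a \<Rightarrow> 'a" where
  "cubic14 u t = u * t ^ 3 + u * t ^ 2 - (u ^ 2 - 1) * t + (u - 1) ^ 2"

text \<open>Eliminating \<open>m\<close> and \<open>r\<close> leaves a sextic in \<open>g\<close> over \<open>\<complex>(p, q)\<close>, which is divisible by \<open>g + 1\<close>.\<close>

lemma cubic14_elimination:
  fixes p q m r g :: "'a :: field"
  assumes p: "p \<noteq> 0" and quartic: "p ^ 3 * q - p = q ^ 3"
    and squares: "q + p * m ^ 2 = p * q * r ^ 2" and products: "p * m ^ 2 - q ^ 2 * m + p ^ 2 * r = 0"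
    and g: "q * r = p * g"
  shows "(g + 1) * cubic14 (p ^ 2 * q) g = 0"
proof -
  have "p ^ 2 * r + p * q * r ^ 2 - q - q ^ 2 * m = (p * m ^ 2 - q ^ 2 * m + p ^ 2 * r) -
      (q + p * m ^ 2 - p * q * r ^ 2)"
    by (simp add: algebra_simps)
  hence m: "q ^ 2 * m = p ^ 2 * r + p * q * r ^ 2 - q" unfolding squares products by simp
  have "q ^ 3 * m = q * (q ^ 2 * m)" by (simp add: eval_nat_numeral)
  also have "\<dots> = p ^ 2 * (q * r) + p * (q * r) ^ 2 - q ^ 2" unfolding m
    by (simp add: eval_nat_numeral algebra_simps)
  also have "\<dots> = p ^ 3 * (g ^ 2 + g) - q ^ 2" unfolding g by (simp add: eval_nat_numeral algebra_simps)
  finally have q3m: "q ^ 3 * m = p ^ 3 * (g ^ 2 + g) - q ^ 2" .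
  have "q ^ 6 * (q + p * m ^ 2) = q ^ 6 * (p * q * r ^ 2)" unfolding squares ..
  hence "q ^ 7 + p * (q ^ 3 * m) ^ 2 = p * q ^ 5 * (q * r) ^ 2" by (simp add: eval_nat_numeral algebra_simps)
  hence eliminated: "q ^ 7 + p * (p ^ 3 * (g ^ 2 + g) - q ^ 2) ^ 2 - p ^ 3 * q ^ 5 * g ^ 2 = 0"
    unfolding q3m g by (simp add: eval_nat_numeral algebra_simps)
  define u w where "u = p ^ 2 * q" and "w = u - 1"
  have pw: "p * w = q ^ 3" unfolding w_def u_def quartic[symmetric]
    by (simp add: eval_nat_numeral algebra_simps)
  have "p ^ 5 * cubic14 u g =
     p ^ 5 * u * (g ^ 3 + g ^ 2) - (p ^ 3 * (p * w) ^ 2 + 2 * p ^ 4 * (p * w)) * g + p ^ 3 * (p * w) ^ 2"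
    unfolding w_def cubic14_def by (simp add: eval_nat_numeral algebra_simps)
  also have "\<dots> = p ^ 7 * q * (g ^ 3 + g ^ 2) - (p ^ 3 * q ^ 6 + 2 * p ^ 4 * q ^ 3) * g + p ^ 3 * q ^ 6"
    unfolding pw u_def by (simp add: eval_nat_numeral algebra_simps)
  finally have cubic: "p ^ 5 * cubic14 u g =
      p ^ 7 * q * (g ^ 3 + g ^ 2) - (p ^ 3 * q ^ 6 + 2 * p ^ 4 * q ^ 3) * g + p ^ 3 * q ^ 6" .
  have "p ^ 5 * ((g + 1) * cubic14 u g) =
      (g + 1) * (p ^ 7 * q * (g ^ 3 + g ^ 2) - (p ^ 3 * q ^ 6 + 2 * p ^ 4 * q ^ 3) * g + p ^ 3 * q ^ 6)"
    unfolding cubic[symmetric] by (simp only: mult_ac)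
  also have "\<dots> = q * (q ^ 7 + p * (p ^ 3 * (g ^ 2 + g) - q ^ 2) ^ 2 - p ^ 3 * q ^ 5 * g ^ 2) -
      q ^ 5 * (q ^ 3 - (p ^ 3 * q - p))"
    by (simp add: eval_nat_numeral algebra_simps)
  also have "\<dots> = 0" unfolding eliminated quartic by simp
  finally show ?thesis using p by (simp add: u_def)
qed

lemma cubic14_from_theta_relations:
  fixes s1 s2 s3 t1 t2 t3 :: "'a :: field"
  assumes nonzero: "s1 \<noteq> 0" "s2 \<noteq> 0" "s3 \<noteq> 0" "t3 \<noteq> 0"
    and quartic: "s2 ^ 2 * (s2 * s3) - s1 ^ 2 * (s1 * s2) = s3 ^ 2 * (s1 * s3)"
    and squares: "(s1 * s3) * t3 ^ 2 + (s1 * s2) * t1 ^ 2 = (s2 * s3) * t2 ^ 2"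
    and products: "(s1 * s2) * t1 ^ 2 - s3 ^ 2 * (t1 * t3) + s2 ^ 2 * (t2 * t3) = 0"
  shows "(s3 * t2 / (s2 * t3) + 1) * cubic14 (s2 ^ 2 * s3 / s1 ^ 3) (s3 * t2 / (s2 * t3)) = 0"
proof -
  define p q m r where "p = s2 / s1" and "q = s3 / s1" and "m = t1 / t3" and "r = t2 / t3"
  have subst: "s2 = p * s1" "s3 = q * s1" "t1 = m * t3" "t2 = r * t3"
    using nonzero by (simp_all add: p_def q_def m_def r_def)
  have p: "p \<noteq> 0" using nonzero by (simp add: p_def)
  have u: "s2 ^ 2 * s3 / s1 ^ 3 = p ^ 2 * q" unfolding subst using nonzero by (simp add: eval_nat_numeral)
  show ?thesis unfolding u
  proof (rule cubic14_elimination[OF p])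
    have "s1 ^ 4 * (p ^ 3 * q - p) = s1 ^ 4 * q ^ 3" using quartic unfolding subst
      by (simp add: eval_nat_numeral algebra_simps)
    thus "p ^ 3 * q - p = q ^ 3" using nonzero by simp
    have "(s1 ^ 2 * t3 ^ 2) * (q + p * m ^ 2) = (s1 ^ 2 * t3 ^ 2) * (p * q * r ^ 2)"
      using squares unfolding subst by (simp add: eval_nat_numeral algebra_simps)
    thus "q + p * m ^ 2 = p * q * r ^ 2" using nonzero by simp
    have "(s1 ^ 2 * t3 ^ 2) * (p * m ^ 2 - q ^ 2 * m + p ^ 2 * r) = 0"
      using products unfolding subst by (simp add: eval_nat_numeral algebra_simps)
    thus "p * m ^ 2 - q ^ 2 * m + p ^ 2 * r = 0" using nonzero by simp
    show "q * r = p * (s3 * t2 / (s2 * t3))" unfolding subst using nonzero p by simp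
  qed
qed

lemma
  assumes "holomorphic_mero u" "holomorphic_mero f"
  shows holomorphic_mero_cubic14: "holomorphic_mero (cubic14 u f)"
    and eval_mero_cubic14: "\<tau> \<in> uhp \<Longrightarrow> eval_mero (cubic14 u f) \<tau> = cubic14 (eval_mero u \<tau>) (eval_mero f \<tau>)"
  using assms by (simp_all add: cubic14_def eval_mero_simps holomorphic_mero_intros)

lemma cubic14_g1: "cubic14 \<upsilon> g1 = 0"
proof -
  have "(g1 + 1) * cubic14 \<upsilon> g1 = 0"
  proof (rule mero_eqI)
    fix \<tau> assume \<tau>: "\<tau> \<in> uhp"
    have "(eval_mero g1 \<tau> + 1) * cubic14 (eval_mero \<upsilon> \<tau>) (eval_mero g1 \<tau>) = 0"
      unfolding eval_upsilon[OF \<tau>] eval_g1_klein7[OF \<tau>]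
      by (rule cubic14_from_theta_relations[OF klein7_1_2_3_nonzero[OF \<tau>] klein7_half_nonzero[OF \<tau>] klein_quartic[OF \<tau>]
            klein7_half_squares_relation[OF \<tau>] klein7_half_products_relation[OF \<tau>]])
    thus "eval_mero ((g1 + 1) * cubic14 \<upsilon> g1) \<tau> = eval_mero 0 \<tau>"
      using \<tau> holomorphic_upsilon holomorphic_g1
      by (simp add: eval_mero_simps holomorphic_mero_intros eval_mero_cubic14 holomorphic_mero_cubic14)
  qed
  moreover have "g1 + 1 \<noteq> 0"
  proof
    assume "g1 + 1 = 0"
    hence "eval_mero g1 \<tau> = - 1" if "\<tau> \<in> uhp" for \<tau>
      using that eval_mero_uminus[OF holomorphic_mero_1 that]
      by (simp add: eq_neg_iff_add_eq_0[symmetric] eval_mero_1)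
    hence "((\<lambda>_. - 1 :: complex) \<longlongrightarrow> 1) at_ii_inf"
      by (intro Lim_transform_eventually[OF g1_tendsto] eventually_at_ii_infI)
    thus False by (simp add: tendsto_const_iff[OF at_ii_inf_neq_bot])
  qed
  ultimately show ?thesis by simp
qed

lemma act_cubic14: "A \<in> \<Gamma>\<^sub>1(7) \<Longrightarrow> act A (cubic14 \<upsilon> f) = cubic14 \<upsilon> (act A f)"
  using Gamma1D(1)[of A 7] act_upsilon_Gamma1[of A]
  by (simp add: cubic14_def act_add act_mult act_diff act_power)

lemma act_g1_even:
  assumes A: "A \<in> \<Gamma>\<^sub>1(7)" and c: "even (A $ 2 $ 1)"
  shows "act A g1 = g1"
proof (rule mero_eqI)
  fix \<tau> assume \<tau>: "\<tau> \<in> uhp"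
  have AD: "A \<in> SL2Z" "7 dvd A $ 1 $ 1 - 1" "7 dvd A $ 2 $ 1" using Gamma1D[OF A] by simp_all
  obtain c' where c': "A $ 2 $ 1 = 2 * c'" using c by (elim evenE)
  define B where "B = mat2 (A $ 1 $ 1) (2 * A $ 1 $ 2) c' (A $ 2 $ 2)"
  have "7 dvd c'" using AD(3) c' by presburger
  hence B: "B \<in> \<Gamma>\<^sub>1(7)" using AD c' by (simp add: Gamma1_def B_def SL2Z_iff algebra_simps)
  have \<tau>2: "2 * \<tau> \<in> uhp" using \<tau> by (simp add: uhp_def)
  have "2 * moebius_act A \<tau> = moebius_act B (2 * \<tau>)"
    by (simp add: moebius_act_def B_def c' algebra_simps)
  hence "phi1 (2 * moebius_act A \<tau>) = zeta 7 (- (2 * A $ 1 $ 2)) * phi1 (2 * \<tau>)"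
    using phi_Gamma1(1)[OF B \<tau>2] by (simp add: B_def)
  moreover have "(zeta 7 (- A $ 1 $ 2))\<^sup>2 = zeta 7 (- (2 * A $ 1 $ 2))" by (simp add: zeta_power)
  ultimately show "eval_mero (act A g1) \<tau> = eval_mero g1 \<tau>"
    using \<tau> AD(1) by (simp add: eval_act eval_g1 moebius_in_uhp phi_Gamma1(1)[OF A \<tau>] power_mult_distrib)
qed

lemma act_g1_coset:
  assumes A: "A \<in> \<Gamma>\<^sub>1(7)" and B: "B \<in> \<Gamma>\<^sub>1(7)" and c: "even (A $ 2 $ 1 * B $ 2 $ 2 - A $ 2 $ 2 * B $ 2 $ 1)"
  shows "act A g1 = act B g1"
proof -
  have SL2Z: "A \<in> SL2Z" "B \<in> SL2Z" using A B Gamma1_subset by blast+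
  have "A ** mat2_inv B \<in> \<Gamma>\<^sub>1(7)" using A B Gamma1_mult Gamma1_mat2_inv by blast
  moreover have "even ((A ** mat2_inv B) $ 2 $ 1)" using c by (simp add: matmul_entry)
  ultimately have "act (A ** mat2_inv B) g1 = g1" by (rule act_g1_even)
  hence "act ((A ** mat2_inv B) ** B) g1 = act B g1"
    by (subst act_comp) (simp_all add: SL2Z SL2Z_mult SL2Z_mat2_inv)
  thus ?thesis by (simp add: SL2Z mult_mat2_inv_cancel)
qed

definition conj_g2 :: "int ^ 2 ^ 2" where "conj_g2 = mat2 1 0 7 1"
definition conj_g3 :: "int ^ 2 ^ 2" where "conj_g3 = mat2 1 1 7 8"

lemma conj_g2_Gamma1: "conj_g2 \<in> \<Gamma>\<^sub>1(7)" and conj_g3_Gamma1: "conj_g3 \<in> \<Gamma>\<^sub>1(7)"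
  by (simp_all add: conj_g2_def conj_g3_def Gamma1_def SL2Z_iff)

lemmas conj_g2_SL2Z = Gamma1D(1)[OF conj_g2_Gamma1] and conj_g3_SL2Z = Gamma1D(1)[OF conj_g3_Gamma1]

lemma act_conj_g3_g1: "act conj_g3 g1 = g3"
proof (rule mero_eqI)
  fix \<tau> assume \<tau>: "\<tau> \<in> uhp"
  define B where "B = mat2 2 1 7 4"
  have B: "B \<in> SL2Z" "7 dvd B $ 2 $ 1" by (simp_all add: B_def SL2Z_iff)
  have half: "\<tau> / 2 \<in> uhp" using \<tau> by (simp add: uhp_def)
  obtain C where C: "C \<noteq> 0" "\<And>k. klein7 k (moebius_act B (\<tau> / 2)) =
     C * (zeta 14 (7 * k * B $ 1 $ 2 + k\<^sup>2 * B $ 1 $ 1 * B $ 1 $ 2) * klein7 (k * B $ 1 $ 1) (\<tau> / 2))"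
    by (rule klein7_Gamma0[OF B half]) blast
  have "zeta 14 39 = zeta 14 7 * zeta 14 10 * zeta 14 22" unfolding zeta_add[symmetric] by simp
  also have "zeta 14 7 = - 1" using zeta_mult_cancel[of 7 2 1] by (simp add: zeta_2)
  also have "zeta 14 10 = zeta 7 5" using zeta_mult_cancel[of 2 7 5] by simp
  finally have zeta_39: "zeta 14 39 = - 1 * zeta 7 5 * zeta 14 22" .
  have "klein7 3 (moebius_act B (\<tau> / 2)) = C * (zeta 14 39 * klein7 1 (\<tau> / 2))"
    "klein7 2 (moebius_act B (\<tau> / 2)) = C * (zeta 14 22 * klein7 3 (\<tau> / 2))"
    unfolding C(2) by (simp_all add: B_def klein7_4_5_6)
  hence "phi1 (moebius_act B (\<tau> / 2)) = - zeta 7 5 / (phi1 (\<tau> / 2) * phi2 (\<tau> / 2))"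
    using C(1) klein7_1_2_3_nonzero[OF half] by (simp add: phi1_eq phi2_eq zeta_39)
  moreover have "2 * moebius_act conj_g3 \<tau> = moebius_act B (\<tau> / 2)"
    using moebius_denom_nonzero[OF conj_g3_SL2Z \<tau>] moebius_denom_nonzero[OF B(1) half]
    by (simp add: moebius_act_def B_def conj_g3_def field_simps)
  moreover have "phi1 (moebius_act conj_g3 \<tau>) ^ 2 = zeta 7 5 * phi1 \<tau> ^ 2"
  proof -
    have "zeta 7 (- 1) ^ 2 = zeta 7 5" unfolding zeta_power by (rule zeta_cong) simp_all
    thus ?thesis using phi_Gamma1(1)[OF conj_g3_Gamma1 \<tau>] by (simp add: conj_g3_def power_mult_distrib)
  qed
  ultimately show "eval_mero (act conj_g3 g1) \<tau> = eval_mero g3 \<tau>"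
    using \<tau> conj_g3_SL2Z phi_nonzero[OF half] by (simp add: eval_act eval_g1 moebius_in_uhp eval_g3_phi)
qed

lemma act_conj_g2_g1_distinct: "g1 \<noteq> act conj_g2 g1" "act conj_g2 g1 \<noteq> g3"
proof -
  define T where "T = mat2 1 7 0 1"
  have T: "T \<in> \<Gamma>\<^sub>1(7)" by (simp add: T_def Gamma1_def SL2Z_iff)
  note entries = matmul_entry conj_g2_def conj_g3_def T_def
  have "act T g1 = g1" by (rule act_g1_even[OF T]) (simp add: T_def)
  moreover have "act T (act conj_g2 g1) = g3"
    unfolding act_comp[OF conj_g2_SL2Z Gamma1D(1)[OF T], symmetric] act_conj_g3_g1[symmetric]
    by (rule act_g1_coset[OF Gamma1_mult[OF conj_g2_Gamma1 T] conj_g3_Gamma1]) (simp add: entries)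
  ultimately show "g1 \<noteq> act conj_g2 g1" using g1_neq_g3 by metis
  have "act conj_g2 (act conj_g2 g1) = g1"
    unfolding act_comp[OF conj_g2_SL2Z conj_g2_SL2Z, symmetric]
    by (rule act_g1_even[OF Gamma1_mult[OF conj_g2_Gamma1 conj_g2_Gamma1]]) (simp add: entries)
  moreover have "act conj_g2 g3 = g3"
    unfolding act_conj_g3_g1[symmetric] act_comp[OF conj_g3_SL2Z conj_g2_SL2Z, symmetric]
    by (rule act_g1_coset[OF Gamma1_mult[OF conj_g3_Gamma1 conj_g2_Gamma1] conj_g3_Gamma1]) (simp add: entries)
  ultimately show "act conj_g2 g1 \<noteq> g3" using g1_neq_g3 by metis
qed

lemma monic_cubic_vieta:
  fixes x y z b c d :: "'a :: idom"
  assumes distinct: "x \<noteq> y" "y \<noteq> z" "x \<noteq> z"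
    and roots: "x ^ 3 + b * x\<^sup>2 + c * x + d = 0" "y ^ 3 + b * y\<^sup>2 + c * y + d = 0"
      "z ^ 3 + b * z\<^sup>2 + c * z + d = 0"
  shows "x + y + z = - b" "x * y + y * z + x * z = c" "x * y * z = - d"
proof -
  have quadratic: "v\<^sup>2 + v * y + y\<^sup>2 + b * (v + y) + c = 0" if "v \<noteq> y" "v ^ 3 + b * v\<^sup>2 + c * v + d = 0" for v
  proof -
    have "(v - y) * (v\<^sup>2 + v * y + y\<^sup>2 + b * (v + y) + c) =
        (v ^ 3 + b * v\<^sup>2 + c * v + d) - (y ^ 3 + b * y\<^sup>2 + c * y + d)"
      by (simp add: algebra_simps eval_nat_numeral)
    thus ?thesis using that roots(2) by simp
  qed
  have "(x - z) * (x + y + z + b) = (x\<^sup>2 + x * y + y\<^sup>2 + b * (x + y) + c) -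
      (z\<^sup>2 + z * y + y\<^sup>2 + b * (z + y) + c)"
    by (simp add: algebra_simps eval_nat_numeral)
  also have "\<dots> = 0" using quadratic[of x] quadratic[of z] distinct roots by simp
  finally have "x + y + z + b = 0" using distinct(3) by simp
  thus sum: "x + y + z = - b" by (simp add: eq_neg_iff_add_eq_0)
  hence b: "b = - (x + y + z)" by simp
  have "c = - (x\<^sup>2 + x * y + y\<^sup>2 + b * (x + y))"
    using minus_unique[OF quadratic[OF distinct(1) roots(1)]] by simp
  thus c: "x * y + y * z + x * z = c" unfolding b by (simp add: algebra_simps power2_eq_square)
  have "d = - (x ^ 3 + b * x\<^sup>2 + c * x)" using minus_unique[OF roots(1)] by simp
  thus "x * y * z = - d" unfolding b c[symmetric] by (simp add: algebra_simps eval_nat_numeral)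
qed

lemma cubic14_eq_0_iff:
  fixes u t :: "'a :: field"
  assumes "u \<noteq> 0"
  shows "cubic14 u t = 0 \<longleftrightarrow> t ^ 3 + 1 * t\<^sup>2 + (- ((u\<^sup>2 - 1) / u)) * t + (u - 1)\<^sup>2 / u = 0"
proof -
  have "cubic14 u t = u * (t ^ 3 + 1 * t\<^sup>2 + (- ((u\<^sup>2 - 1) / u)) * t + (u - 1)\<^sup>2 / u)"
    using assms by (simp add: cubic14_def distrib_left right_diff_distrib)
  thus ?thesis using assms by simp
qed

lemma act_conj_g2_g1: "act conj_g2 g1 = g2"
  and g_symmetric: "g1 * g2 + g2 * g3 + g1 * g3 = - ((\<upsilon>\<^sup>2 - 1) / \<upsilon>)" "g1 * g2 * g3 = - ((\<upsilon> - 1)\<^sup>2 / \<upsilon>)"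
proof -
  have "cubic14 \<upsilon> (act conj_g2 g1) = 0" "cubic14 \<upsilon> g3 = 0"
    using act_cubic14[OF conj_g2_Gamma1, of g1] act_cubic14[OF conj_g3_Gamma1, of g1] conj_g2_SL2Z conj_g3_SL2Z
    by (simp_all add: cubic14_g1 act_conj_g3_g1)
  note vieta = monic_cubic_vieta[OF act_conj_g2_g1_distinct g1_neq_g3
      cubic14_g1[unfolded cubic14_eq_0_iff[OF upsilon_neq(1)]]
        this[unfolded cubic14_eq_0_iff[OF upsilon_neq(1)]]]
  have "g1 + act conj_g2 g1 + g3 = g1 + g2 + g3" unfolding vieta(1) g_sum ..
  thus g2: "act conj_g2 g1 = g2" by simp
  show "g1 * g2 + g2 * g3 + g1 * g3 = - ((\<upsilon>\<^sup>2 - 1) / \<upsilon>)" "g1 * g2 * g3 = - ((\<upsilon> - 1)\<^sup>2 / \<upsilon>)"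
    using vieta(2,3) unfolding g2 .
qed

lemmas g_distinct = act_conj_g2_g1_distinct[unfolded act_conj_g2_g1] g1_neq_g3

text \<open>Modulo 2 the bottom row of a matrix in \<open>\<Gamma>\<^sub>1(7)\<close> is one of the three nonzero vectors, and \<open>\<Gamma>\<^sub>1(7)\<close> permutes the
  three roots as it permutes these vectors.\<close>

definition g_of_row :: "int \<Rightarrow> int \<Rightarrow> mero_uhp" where
  "g_of_row c d = (if even c then g1 else if even d then g3 else g2)"

lemma act_g1:
  assumes A: "A \<in> \<Gamma>\<^sub>1(7)"
  shows "act A g1 = g_of_row (A $ 2 $ 1) (A $ 2 $ 2)"
proof -
  consider (g1) "even (A $ 2 $ 1)" | (g3) "odd (A $ 2 $ 1)"
    "even (A $ 2 $ 2)" | (g2) "odd (A $ 2 $ 1)" "odd (A $ 2 $ 2)"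
    by blast
  thus ?thesis
  proof cases
    case g1
    thus ?thesis using act_g1_even[OF A] by (simp add: g_of_row_def)
  next
    case g3
    thus ?thesis using act_g1_coset[OF A conj_g3_Gamma1]
      by (simp add: g_of_row_def conj_g3_def act_conj_g3_g1[unfolded conj_g3_def])
  next
    case g2
    thus ?thesis using act_g1_coset[OF A conj_g2_Gamma1]
      by (simp add: g_of_row_def conj_g2_def act_conj_g2_g1[unfolded conj_g2_def])
  qed
qed

lemma
  assumes A: "A \<in> \<Gamma>\<^sub>1(7)"
  shows act_g2: "act A g2 = g_of_row (A $ 1 $ 1 + A $ 2 $ 1) (A $ 1 $ 2 + A $ 2 $ 2)"
    and act_g3: "act A g3 = g_of_row (A $ 1 $ 1) (A $ 1 $ 2)"
proof -
  have SL2Z: "A \<in> SL2Z" using Gamma1D(1)[OF A] .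
  have "act A g2 = act (conj_g2 ** A) g1" "act A g3 = act (conj_g3 ** A) g1"
    by (simp_all add: act_comp SL2Z conj_g2_SL2Z conj_g3_SL2Z act_conj_g2_g1 act_conj_g3_g1)
  thus "act A g2 = g_of_row (A $ 1 $ 1 + A $ 2 $ 1) (A $ 1 $ 2 + A $ 2 $ 2)"
    "act A g3 = g_of_row (A $ 1 $ 1) (A $ 1 $ 2)"
    by (simp_all add: act_g1 Gamma1_mult A conj_g2_Gamma1 conj_g3_Gamma1)
       (simp_all add: g_of_row_def matmul_entry conj_g2_def conj_g3_def)
qed

lemma P_upsilon_factorization: "P\<^sub>\<upsilon> = [:- g1, 1:] * [:- g2, 1:] * [:- g3, 1:]"
proof -
  have "[:- g1, 1:] * [:- g2, 1:] * [:- g3, 1:] =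
      [:- (g1 * g2 * g3), g1 * g2 + g2 * g3 + g1 * g3, - (g1 + g2 + g3), 1:]"
    by (simp add: algebra_simps)
  thus ?thesis unfolding P_upsilon_def g_symmetric g_sum by simp
qed

lemma cubic_discriminant_factored:
  fixes x y z :: "'a :: comm_ring_1"
  assumes "p = [:- x, 1:] * [:- y, 1:] * [:- z, 1:]"
  shows "cubic_discriminant p = ((x - y) * (y - z) * (z - x))\<^sup>2"
proof -
  have "p = [:- (x * y * z), x * y + y * z + x * z, - (x + y + z), 1:]"
    unfolding assms by (simp add: algebra_simps)
  hence coeffs: "poly.coeff p 3 = 1" "poly.coeff p 2 = - (x + y + z)" "poly.coeff p 1 =
      x * y + y * z + x * z" "poly.coeff p 0 = - (x * y * z)"
    by (simp_all add: eval_nat_numeral)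
  show ?thesis unfolding cubic_discriminant_def Let_def coeffs by (simp add: algebra_simps eval_nat_numeral)
qed

lemma delta_times: "2 * (\<upsilon> - 1) / \<upsilon>\<^sup>2 * \<delta> = (g1 - g2) * (g2 - g3) * (g3 - g1)"
proof -
  have "2 * (\<upsilon> - 1) / \<upsilon>\<^sup>2 * (\<upsilon>\<^sup>2 / (2 * (\<upsilon> - 1))) = 1" using upsilon_neq numeral_mero_nonzero by simp
  thus ?thesis unfolding delta_def by (metis mult.assoc mult_1_left)
qed

lemma delta_discriminant: "(2 * (\<upsilon> - 1) / \<upsilon>\<^sup>2 * \<delta>)\<^sup>2 = cubic_discriminant P\<^sub>\<upsilon>"
  unfolding delta_times cubic_discriminant_factored[OF P_upsilon_factorization] ..

lemma discriminant_identity: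
  fixes u :: "'a :: field"
  assumes "u \<noteq> 0"
  shows "u ^ 3 * cubic_discriminant [: (u - 1)\<^sup>2 / u, - ((u\<^sup>2 - 1) / u), 1, 1 :] =
      4 * (u - 1) ^ 3 * (u ^ 3 - 8 * u\<^sup>2 + 5 * u + 1)"
proof -
  define D C where "D = (u - 1)\<^sup>2" and "C = - (u\<^sup>2 - 1)"
  have "cubic_discriminant [: (u - 1)\<^sup>2 / u, - ((u\<^sup>2 - 1) / u), 1, 1 :] =
      (C / u)\<^sup>2 - 4 * (C / u) ^ 3 - 4 * (D / u) - 27 * (D / u)\<^sup>2 + 18 * (C / u) * (D / u)"
  proof -
    have "- ((u\<^sup>2 - 1) / u) = C / u" unfolding C_def by (rule minus_divide_left)
    thus ?thesis unfolding D_def[symmetric] by (simp add: cubic_discriminant_def Let_def eval_nat_numeral)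
  qed
  also have "u ^ 3 * \<dots> = u * C\<^sup>2 - 4 * C ^ 3 - 4 * u\<^sup>2 * D - 27 * u * D\<^sup>2 + 18 * u * C * D"
    using assms by (simp add: field_simps eval_nat_numeral)
  also have "\<dots> = 4 * (u - 1) ^ 3 * (u ^ 3 - 8 * u\<^sup>2 + 5 * u + 1)"
    unfolding D_def C_def by (simp add: algebra_simps eval_nat_numeral)
  finally show ?thesis .
qed

lemma delta_square: "\<delta>\<^sup>2 = \<upsilon> * (\<upsilon> - 1) * (\<upsilon> ^ 3 - 8 * \<upsilon>\<^sup>2 + 5 * \<upsilon> + 1)"
proof -
  have "\<upsilon> ^ 4 * (2 * (\<upsilon> - 1) / \<upsilon>\<^sup>2 * \<delta>)\<^sup>2 = (\<upsilon> ^ 4 / (\<upsilon>\<^sup>2)\<^sup>2) * ((2 * (\<upsilon> - 1))\<^sup>2 * \<delta>\<^sup>2)"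
    by (simp add: power_mult_distrib power_divide)
  also have "\<upsilon> ^ 4 / (\<upsilon>\<^sup>2)\<^sup>2 = 1" using upsilon_neq by simp
  also have "(2 * (\<upsilon> - 1))\<^sup>2 = 4 * (\<upsilon> - 1)\<^sup>2" unfolding power_mult_distrib by simp
  finally have "4 * (\<upsilon> - 1)\<^sup>2 * \<delta>\<^sup>2 = \<upsilon> ^ 4 * cubic_discriminant P\<^sub>\<upsilon>" unfolding delta_discriminant by simp
  also have "\<dots> = \<upsilon> * (\<upsilon> ^ 3 * cubic_discriminant P\<^sub>\<upsilon>)" by (simp add: eval_nat_numeral)
  also have "\<dots> = 4 * (\<upsilon> - 1)\<^sup>2 * (\<upsilon> * (\<upsilon> - 1) * (\<upsilon> ^ 3 - 8 * \<upsilon>\<^sup>2 + 5 * \<upsilon> + 1))"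
    unfolding P_upsilon_def discriminant_identity[OF upsilon_neq(1)]
    by (simp add: power2_eq_square power3_eq_cube mult_ac)
  finally show ?thesis unfolding mult_cancel_left using upsilon_neq numeral_mero_nonzero by simp
qed

section \<open>The field of level 14\<close>

lemma Gamma_14_iff: "A \<in> \<Gamma>(14) \<longleftrightarrow> A \<in> \<Gamma>(7) \<and> even (A $ 1 $ 2) \<and> even (A $ 2 $ 1)"
proof -
  have dvd_14_iff: "14 dvd x \<longleftrightarrow> 7 dvd x \<and> 2 dvd x" for x :: int by presburger
  have "odd (A $ 1 $ 1) \<and> odd (A $ 2 $ 2)" if "A \<in> SL2Z" "even (A $ 1 $ 2)"
  proof -
    have "odd (A $ 1 $ 1 * A $ 2 $ 2 - A $ 1 $ 2 * A $ 2 $ 1)" using that by (simp add: SL2Z_iff)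
    thus ?thesis using that(2) by auto
  qed
  thus ?thesis by (auto simp: Gamma_entries dvd_14_iff)
qed

lemma Gamma_14_subset_Gamma1_7: "\<Gamma>(14) \<subseteq> \<Gamma>\<^sub>1(7)"
  using Gamma_antimono[of 7 14] Gamma_subset_Gamma1[of 7] by auto

lemma g1_eq_phi1_mero: "g1 = phi1_mero 1 ^ 2 / phi1_mero 2"
proof (rule mero_eqI)
  fix \<tau> assume \<tau>: "\<tau> \<in> uhp"
  have "eval_mero (phi1_mero 2) z \<noteq> 0" if "z \<in> uhp" for z
    using that phi_nonzero(1)[of "2 * z"] by (simp add: eval_phi1_mero uhp_def)
  thus "eval_mero g1 \<tau> = eval_mero (phi1_mero 1 ^ 2 / phi1_mero 2) \<tau>"
    using \<tau> by (simp add: eval_g1 eval_mero_divide eval_mero_power holomorphic_mero_power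
      holomorphic_phi1_mero eval_phi1_mero)
qed

lemma meromorphic_at_cusps_g1: "meromorphic_at_cusps g1"
  unfolding g1_eq_phi1_mero
  by (intro meromorphic_at_cusps_divide meromorphic_at_cusps_power meromorphic_at_cusps_phi1_mero) simp_all

lemma generators_Gamma14:
  "\<upsilon> \<in> \<A>\<^sub>0 \<Gamma>(14)" "\<psi> \<in> \<A>\<^sub>0 \<Gamma>(14)" "g1 \<in> \<A>\<^sub>0 \<Gamma>(14)" "g2 \<in> \<A>\<^sub>0 \<Gamma>(14)" "g3 \<in> \<A>\<^sub>0 \<Gamma>(14)" "\<delta> \<in> \<A>\<^sub>0 \<Gamma>(14)"
proof -
  have "\<Gamma>(14) \<subseteq> \<Gamma>(7)" by (rule Gamma_antimono) simp
  thus u: "\<upsilon> \<in> \<A>\<^sub>0 \<Gamma>(14)" and "\<psi> \<in> \<A>\<^sub>0 \<Gamma>(14)"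
    using upsilon_in_Gamma7 psi_in_Gamma7 modular_functions_antimono by blast+
  have "act A g1 = g1" if "A \<in> \<Gamma>(14)" for A
    using that Gamma_14_iff Gamma_14_subset_Gamma1_7 by (intro act_g1_even) auto
  thus g1: "g1 \<in> \<A>\<^sub>0 \<Gamma>(14)" using meromorphic_at_cusps_g1 by (simp add: modular_functions_iff[OF Gamma_subset])
  show g2: "g2 \<in> \<A>\<^sub>0 \<Gamma>(14)" using act_Gamma_closed[OF g1 conj_g2_SL2Z] by (simp add: act_conj_g2_g1)
  show g3: "g3 \<in> \<A>\<^sub>0 \<Gamma>(14)" using act_Gamma_closed[OF g1 conj_g3_SL2Z] by (simp add: act_conj_g3_g1)
  show "\<delta> \<in> \<A>\<^sub>0 \<Gamma>(14)" unfolding delta_def mero_const_numeral[symmetric]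
    by (intro C_subfield_intros C_subfield_modular_functions Gamma_subset u g1 g2 g3)
qed

lemma stabilizer_Gamma14:
  assumes A: "A \<in> \<Gamma>\<^sub>1(7)" and fixed: "act A \<psi> = \<psi>" "act A g1 = g1" "act A g2 = g2"
  shows "A \<in> \<Gamma>(14)"
proof -
  have c: "even (A $ 2 $ 1)" using fixed(2) g_distinct
    by (auto simp: act_g1[OF A] g_of_row_def split: if_splits)
  have "odd (A $ 1 $ 1 * A $ 2 $ 2 - A $ 1 $ 2 * A $ 2 $ 1)" using Gamma1D(1)[OF A] by (simp add: SL2Z_iff)
  hence "odd (A $ 1 $ 1)" "odd (A $ 2 $ 2)" using c by auto
  hence "even (A $ 1 $ 2)" using fixed(3) c g_distinct
    by (auto simp: act_g2[OF A] g_of_row_def split: if_splits)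
  thus ?thesis using c act_psi_eq_iff[OF A] fixed(1) by (simp add: Gamma_14_iff)
qed

theorem modular_functions_Gamma14_g2: "\<A>\<^sub>0 \<Gamma>(14) = \<complex>({\<upsilon>, \<psi>, g1, g2})"
proof
  let ?L = "\<complex>({\<upsilon>, \<psi>, g1, g2})"
  show "?L \<subseteq> \<A>\<^sub>0 \<Gamma>(14)"
    by (rule adjoin_C_least[OF C_subfield_modular_functions[OF Gamma_subset]]) (use generators_Gamma14 in auto)
  obtain R where "congruence_group \<Gamma>\<^sub>1(7) 14 R" using congruence_group_Gamma1[of 7 14] by auto
  then interpret congruence_group "\<Gamma>\<^sub>1(7)" 14 R .
  have generators: "\<upsilon> \<in> ?L" "\<psi> \<in> ?L" "g1 \<in> ?L" "g2 \<in> ?L" using adjoin_C_superset[of "{\<upsilon>, \<psi>, g1, g2}"] by auto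
  show "\<A>\<^sub>0 \<Gamma>(14) \<subseteq> ?L"
  proof (rule modular_functions_level_subset[of "[:\<psi>, g1, g2:]"])
    show "\<A>\<^sub>0 \<Gamma>\<^sub>1(7) \<subseteq> ?L" by (rule modular_functions_Gamma1_7_subset[OF C_subfield_adjoin_C generators(1)])
    show "A \<in> \<Gamma>(14)" if "A \<in> \<Gamma>\<^sub>1(7)" "map_poly (act A) [:\<psi>, g1, g2:] = [:\<psi>, g1, g2:]" for A
      using that stabilizer_Gamma14 Gamma1D(1) by (simp add: map_poly_pCons)
  qed (use generators_Gamma14 generators in \<open>auto simp: coeffs_in_pCons_iff
    coeffs_in_0 C_subfield_level C_subfield_adjoin_C\<close>)
qed

theorem modular_functions_Gamma14_delta: "\<A>\<^sub>0 \<Gamma>(14) = \<complex>({\<upsilon>, \<psi>, g1, \<delta>})"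
proof
  let ?L = "\<complex>({\<upsilon>, \<psi>, g1, \<delta>})"
  show "?L \<subseteq> \<A>\<^sub>0 \<Gamma>(14)"
    by (rule adjoin_C_least[OF C_subfield_modular_functions[OF Gamma_subset]]) (use generators_Gamma14 in auto)
  have L: "C_subfield ?L" by (rule C_subfield_adjoin_C)
  have generators: "\<upsilon> \<in> ?L" "\<psi> \<in> ?L" "g1 \<in> ?L" "\<delta> \<in> ?L" using adjoin_C_superset[of "{\<upsilon>, \<psi>, g1, \<delta>}"] by auto
  have two: "2 \<in> ?L" using C_subfield_const[OF L, of 2] by (simp add: mero_const_numeral)
  define s e where "s = - 1 - g1" and "e = (g1 - g2) * (g3 - g1)"
  have s: "g2 + g3 = s" unfolding s_def g_sum[symmetric] by simp
  have s_L: "s \<in> ?L" unfolding s_def by (intro C_subfield_intros L generators)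
  have "e = - (g1\<^sup>2 - g1 * (g2 + g3) + ((g1 * g2 + g2 * g3 + g1 * g3) - g1 * (g2 + g3)))"
    unfolding e_def by (simp add: algebra_simps power2_eq_square)
  also have "\<dots> \<in> ?L" unfolding s g_symmetric by (intro C_subfield_intros L generators s_L)
  finally have e_L: "e \<in> ?L" .
  have "e \<noteq> 0" using g_distinct by (simp add: e_def)
  moreover have "(g2 - g3) * e = 2 * (\<upsilon> - 1) / \<upsilon>\<^sup>2 * \<delta>" unfolding delta_times e_def by (simp add: mult_ac)
  ultimately have "g2 - g3 = 2 * (\<upsilon> - 1) / \<upsilon>\<^sup>2 * \<delta> / e" by (metis nonzero_mult_div_cancel_right)
  also have "\<dots> \<in> ?L" by (intro C_subfield_intros L generators two e_L)
  finally have "g2 - g3 \<in> ?L" .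
  hence "(s + (g2 - g3)) / 2 \<in> ?L" by (intro C_subfield_divide C_subfield_add L s_L two)
  hence "g2 \<in> ?L" unfolding s[symmetric] using numeral_mero_nonzero by simp
  thus "\<A>\<^sub>0 \<Gamma>(14) \<subseteq> ?L" unfolding modular_functions_Gamma14_g2
    using generators by (intro adjoin_C_least L) auto
qed

lemma generate_field_g: "\<A>\<^sub>0 \<Gamma>(14) = generate_field mero_field (\<A>\<^sub>0 \<Gamma>(7) \<union> {g1, g2, g3})"
proof
  let ?H = "\<A>\<^sub>0 \<Gamma>(7) \<union> {g1, g2, g3}"
  have "\<Gamma>(14) \<subseteq> \<Gamma>(7)" by (rule Gamma_antimono) simp
  thus "generate_field mero_field ?H \<subseteq> \<A>\<^sub>0 \<Gamma>(14)"
    using modular_functions_antimono generators_Gamma14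
    by (intro generate_field_least C_subfield_modular_functions Gamma_subset) auto
  have "range mero_const \<subseteq> ?H" using C_subfield_const[OF C_subfield_modular_functions[OF Gamma_subset[of 7]]]
    by auto
  hence "C_subfield (generate_field mero_field ?H)" by (rule C_subfield_generate_field)
  moreover have "{\<upsilon>, \<psi>, g1, g2} \<subseteq> generate_field mero_field ?H"
    using upsilon_in_Gamma7 psi_in_Gamma7 by (auto intro: generate_field.incl)
  ultimately show "\<A>\<^sub>0 \<Gamma>(14) \<subseteq> generate_field mero_field ?H"
    unfolding modular_functions_Gamma14_g2 by (rule adjoin_C_least)
qed

theorem splitting_field_P_upsilon: "splitting_field_over (\<A>\<^sub>0 \<Gamma>(7)) P\<^sub>\<upsilon> (\<A>\<^sub>0 \<Gamma>(14))"
  unfolding splitting_field_over_def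
proof (intro conjI exI[of _ "[g1, g2, g3]"])
  show "subfield (\<A>\<^sub>0 \<Gamma>(7)) mero_field" unfolding modular_functions_Gamma7 adjoin_C_def
    by (rule field.generate_field_is_subfield[OF field_from_type_algebra]) (simp add: mero_field_simps)
  show "P\<^sub>\<upsilon> \<noteq> 0" unfolding P_upsilon_def by simp
  have "(\<upsilon> - 1)\<^sup>2 / \<upsilon> \<in> \<A>\<^sub>0 \<Gamma>(7)" "- ((\<upsilon>\<^sup>2 - 1) / \<upsilon>) \<in> \<A>\<^sub>0 \<Gamma>(7)" "1 \<in> \<A>\<^sub>0 \<Gamma>(7)"
    by (intro C_subfield_intros C_subfield_modular_functions Gamma_subset upsilon_in_Gamma7)+
  thus "set (coeffs P\<^sub>\<upsilon>) \<subseteq> \<A>\<^sub>0 \<Gamma>(7)" by (simp add: P_upsilon_def cCons_def)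
  show "set [g1, g2, g3] \<subseteq> \<A>\<^sub>0 \<Gamma>(14)" using generators_Gamma14 by simp
  have "Polynomial.lead_coeff P\<^sub>\<upsilon> = 1" unfolding P_upsilon_def by simp
  thus "P\<^sub>\<upsilon> = Polynomial.smult (Polynomial.lead_coeff P\<^sub>\<upsilon>) (\<Prod>r\<leftarrow>[g1, g2, g3]. [:- r, 1:])"
    using P_upsilon_factorization
    by (simp only: list.map prod_list.Cons prod_list.Nil smult_1_left mult_1_right mult.assoc)
  show "\<A>\<^sub>0 \<Gamma>(14) = generate_field mero_field (\<A>\<^sub>0 \<Gamma>(7) \<union> set [g1, g2, g3])" using generate_field_g by simp
qed

section \<open>Affine varieties with a generic point\<close>

definition hom_eval :: "(complex \<Rightarrow> 'a :: comm_ring_1) \<Rightarrow> ('n :: finite \<Rightarrow> 'a) \<Rightarrow> 'n cpoly \<Rightarrow> 'a" where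
  "hom_eval \<phi> x p = (\<Sum>m\<in>Poly_Mapping.keys p. \<phi> (Poly_Mapping.lookup p m) *
      (\<Prod>i\<in>UNIV. x i ^ Poly_Mapping.lookup m i))"

lemma cpoly_const_0: "cpoly_const 0 = 0"
  by (simp add: cpoly_const_def)

definition cpoly_of_poly :: "'n \<Rightarrow> complex poly \<Rightarrow> 'n cpoly" where
  "cpoly_of_poly i q = poly (map_poly cpoly_const q) (cpoly_var i)"

lemma cpoly_eq_sum: "p = (\<Sum>m\<in>Poly_Mapping.keys p. Poly_Mapping.single m (Poly_Mapping.lookup p m))"
proof (rule poly_mapping_eqI)
  fix m
  show "Poly_Mapping.lookup p m =
      Poly_Mapping.lookup (\<Sum>m\<in>Poly_Mapping.keys p. Poly_Mapping.single m (Poly_Mapping.lookup p m)) m"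
    by (simp add: lookup_sum lookup_single when_def in_keys_iff)
qed

locale coefficient_hom =
  fixes \<phi> :: "complex \<Rightarrow> 'a :: comm_ring_1"
  assumes hom_add: "\<phi> (a + b) = \<phi> a + \<phi> b" and hom_mult: "\<phi> (a * b) = \<phi> a * \<phi> b" and hom_one: "\<phi> 1 = 1"
begin

lemma hom_zero: "\<phi> 0 = 0"
  using hom_add[of 0 0] by simp

lemma hom_eval_superset:
  assumes "finite S" "Poly_Mapping.keys p \<subseteq> S"
  shows "hom_eval \<phi> x p = (\<Sum>m\<in>S. \<phi> (Poly_Mapping.lookup p m) * (\<Prod>i\<in>UNIV. x i ^ Poly_Mapping.lookup m i))"
  unfolding hom_eval_def using assms by (intro sum.mono_neutral_left) (auto simp: in_keys_iff hom_zero)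

lemma hom_eval_add: "hom_eval \<phi> x (p + q) = hom_eval \<phi> x p + hom_eval \<phi> x q"
proof -
  let ?S = "Poly_Mapping.keys p \<union> Poly_Mapping.keys q"
  have "finite ?S" "Poly_Mapping.keys (p + q) \<subseteq> ?S" "Poly_Mapping.keys p \<subseteq> ?S" "Poly_Mapping.keys q \<subseteq> ?S"
    using keys_add[of p q] by auto
  thus ?thesis by (simp add: hom_eval_superset[of ?S] lookup_add hom_add sum.distrib distrib_right)
qed

lemma hom_eval_zero [simp]: "hom_eval \<phi> x 0 = 0" by (simp add: hom_eval_def)

lemma hom_eval_diff: "hom_eval \<phi> x (p - q) = hom_eval \<phi> x p - hom_eval \<phi> x q"
  using hom_eval_add[of x "p - q" q] by (simp add: algebra_simps)

lemma hom_eval_sum: "hom_eval \<phi> x (sum f I) = (\<Sum>i\<in>I. hom_eval \<phi> x (f i))"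
  by (induction I rule: infinite_finite_induct) (simp_all add: hom_eval_add)

lemma hom_eval_single: "hom_eval \<phi> x (Poly_Mapping.single m c) = \<phi> c * (\<Prod>i\<in>UNIV. x i ^ Poly_Mapping.lookup m i)"
  by (subst hom_eval_superset[of "{m}"]) (auto split: if_splits)

lemma hom_eval_mult: "hom_eval \<phi> x (p * q) = hom_eval \<phi> x p * hom_eval \<phi> x q"
proof -
  have "p * q = (\<Sum>m\<in>Poly_Mapping.keys p. Poly_Mapping.single m (Poly_Mapping.lookup p m)) *
      (\<Sum>m\<in>Poly_Mapping.keys q. Poly_Mapping.single m (Poly_Mapping.lookup q m))"
    using cpoly_eq_sum[of p] cpoly_eq_sum[of q] by simp
  also have "\<dots> = (\<Sum>m\<in>Poly_Mapping.keys p. \<Sum>n\<in>Poly_Mapping.keys q.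
      Poly_Mapping.single (m + n) (Poly_Mapping.lookup p m * Poly_Mapping.lookup q n))"
    by (simp add: sum_product mult_single)
  finally show ?thesis
    by (simp add: hom_eval_sum hom_eval_single hom_eval_def[of \<phi> x p] hom_eval_def[of \<phi> x q]
      sum_product hom_mult lookup_add power_add prod.distrib mult_ac)
qed

lemma hom_eval_const: "hom_eval \<phi> x (cpoly_const c) = \<phi> c"
  by (simp add: cpoly_const_def hom_eval_single)

lemma hom_eval_one [simp]: "hom_eval \<phi> x 1 = 1"
  using hom_eval_const[of x 1] by (simp add: cpoly_const_def hom_one)

lemma hom_eval_power: "hom_eval \<phi> x (p ^ n) = hom_eval \<phi> x p ^ n"
  by (induction n) (simp_all add: hom_eval_mult)

lemma hom_eval_var: "hom_eval \<phi> x (cpoly_var i) = x i"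
proof -
  have "(\<Prod>j\<in>UNIV. x j ^ Poly_Mapping.lookup (Poly_Mapping.single i 1) j) = (\<Prod>j\<in>UNIV. if j = i then x j else 1)"
    by (rule prod.cong) (auto simp: lookup_single when_def)
  thus ?thesis by (simp add: cpoly_var_def hom_eval_single hom_one)
qed

lemma hom_eval_cpoly_of_poly: "hom_eval \<phi> x (cpoly_of_poly i q) = poly (map_poly \<phi> q) (x i)"
  by (induction q)
     (simp_all add: cpoly_of_poly_def map_poly_pCons cpoly_const_0 hom_zero
       hom_eval_add hom_eval_mult hom_eval_const hom_eval_var)

lemmas hom_eval_simps =
  hom_eval_zero hom_eval_one hom_eval_const hom_eval_var hom_eval_add hom_eval_diff hom_eval_mult hom_eval_power
  hom_eval_cpoly_of_poly

end

interpretation complex_coefficients: coefficient_hom "\<lambda>c :: complex. c"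
  by unfold_locales simp_all

interpretation mero_coefficients: coefficient_hom mero_const
  by unfold_locales (simp_all add: mero_const_add mero_const_mult mero_const_1)

lemma cpoly_eval_hom_eval: "cpoly_eval p x = hom_eval (\<lambda>c. c) (($) x) p"
  by (simp add: cpoly_eval_def hom_eval_def)

lemmas cpoly_eval_simps = complex_coefficients.hom_eval_simps[of "($) x" for x, folded cpoly_eval_hom_eval]

definition mero_eval :: "mero_uhp ^ 'n :: finite \<Rightarrow> 'n cpoly \<Rightarrow> mero_uhp" where
  "mero_eval x p = hom_eval mero_const (($) x) p"

lemmas mero_eval_simps = mero_coefficients.hom_eval_simps[of "($) x" for x, folded mero_eval_def peval_def]

definition eval_point :: "mero_uhp ^ 'n :: finite \<Rightarrow> complex \<Rightarrow> complex ^ 'n" where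
  "eval_point x z = (\<chi> i. eval_mero (x $ i) z)"

lemma C_subfield_mero_eval: "C_subfield K \<Longrightarrow> (\<And>i. x $ i \<in> K) \<Longrightarrow> mero_eval x p \<in> K"
  unfolding mero_eval_def hom_eval_def by (intro C_subfield_intros)

lemma eval_mero_mero_eval:
  assumes "\<And>i. holomorphic_mero (x $ i)" "z \<in> uhp"
  shows "eval_mero (mero_eval x p) z = cpoly_eval p (eval_point x z)"
  using assms unfolding mero_eval_def hom_eval_def cpoly_eval_def eval_point_def
  by (simp add: eval_mero_simps holomorphic_mero_intros)

lemma zariski_closed_vanishing:
  assumes "zariski_closed W" "\<not> V \<subseteq> W"
  obtains p where "p \<notin> vanishing_ideal V" "\<And>v. v \<in> W \<Longrightarrow> cpoly_eval p v = 0"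
  using assms unfolding zariski_closed_def vanishing_ideal_def by blast

lemma zariski_closed_singleton: "zariski_closed {a :: complex ^ 'n :: finite}"
  unfolding zariski_closed_def
  by (rule exI[of _ "range (\<lambda>i. cpoly_var i - cpoly_const (a $ i))"]) (auto simp: cpoly_eval_simps vec_eq_iff)

lemma zariski_closed_Un:
  assumes "zariski_closed A" "zariski_closed B"
  shows "zariski_closed (A \<union> B)"
proof -
  obtain S T where S: "A = {x. \<forall>p\<in>S. cpoly_eval p x = 0}" and T: "B = {x. \<forall>p\<in>T. cpoly_eval p x = 0}"
    using assms unfolding zariski_closed_def by blast
  have "A \<union> B = {x. \<forall>r\<in>(\<lambda>(p, q). p * q) ` (S \<times> T). cpoly_eval r x = 0}"
    unfolding S T by (auto simp: cpoly_eval_simps)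
  thus ?thesis unfolding zariski_closed_def by blast
qed

lemma zariski_closed_finite: "finite F \<Longrightarrow> zariski_closed F"
proof (induction F rule: finite_induct)
  case empty
  show ?case unfolding zariski_closed_def by (rule exI[of _ "{1}"]) (simp add: cpoly_eval_simps)
next
  case (insert a F)
  thus ?case using zariski_closed_Un[OF zariski_closed_singleton[of a]] by simp
qed

lemma closed_zeros_cpoly: "closed {v. cpoly_eval p v = 0}"
  unfolding cpoly_eval_def by (intro closed_Collect_eq continuous_intros)

lemma affine_variety_singleton: "affine_variety {a :: complex ^ 'n :: finite}"
  unfolding affine_variety_def using zariski_closed_singleton by auto

lemma affine_variety_finite:
  assumes "affine_variety C" "finite C"
  obtains a where "C = {a}"
proof -
  obtain a where a: "a \<in> C" using assms unfolding affine_variety_def by blast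
  have "zariski_closed (C - {a})" using assms by (intro zariski_closed_finite) auto
  moreover have "C \<subseteq> {a} \<union> (C - {a})" by blast
  ultimately have "C \<subseteq> {a} \<or> C \<subseteq> C - {a}"
    using assms(1) zariski_closed_singleton[of a] unfolding affine_variety_def by blast
  thus ?thesis using a that by blast
qed

lemma affine_variety_chain_length_le_1:
  assumes proper_finite: "\<And>W. zariski_closed W \<Longrightarrow> W \<subset> V \<Longrightarrow> finite W"
    and chain: "\<And>i. i \<le> n \<Longrightarrow> affine_variety (C i) \<and> C i \<subseteq> V" "\<And>i. i < n \<Longrightarrow> C i \<subset> C (Suc i)"
  shows "n \<le> 1"
proof (rule ccontr)
  assume "\<not> n \<le> 1"
  hence varieties: "affine_variety (C 0)" "affine_variety (C 1)" "C 2 \<subseteq> V" and strict: "C 0 \<subset> C 1" "C 1 \<subset> C 2"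
    using chain(1)[of 0] chain(1)[of 1] chain(1)[of 2] chain(2)[of 0] chain(2)[of 1]
    by (simp_all add: numeral_2_eq_2)
  have "zariski_closed (C 1)" using varieties(2) unfolding affine_variety_def by blast
  hence "finite (C 1)" using proper_finite strict(2) varieties(3) by blast
  then obtain a where "C 1 = {a}" using affine_variety_finite[OF varieties(2)] by blast
  hence "C 0 = {}" using strict(1) by (auto simp: psubset_eq subset_singleton_iff)
  thus False using varieties(1) unfolding affine_variety_def by blast
qed

lemma affine_curveI:
  assumes V: "affine_variety V" "infinite V"
    and proper_finite: "\<And>W. zariski_closed W \<Longrightarrow> W \<subset> V \<Longrightarrow> finite W"
  shows "affine_curve V"
proof -
  have "zariski_dim V = 1" unfolding zariski_dim_def
  proof (rule antisym)
    have "n \<le> 1" if "\<forall>i\<le>n. affine_variety (C i) \<and> C i \<subseteq> V" "\<forall>i<n. C i \<subset> C (Suc i)" for n C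
      by (rule affine_variety_chain_length_le_1[of V n C]) (use that proper_finite in blast)+
    thus "Sup {enat n | n. \<exists>C. (\<forall>i\<le>n. affine_variety (C i) \<and> C i \<subseteq> V) \<and> (\<forall>i<n. C i \<subset> C (Suc i))} \<le> 1"
      by (intro Sup_least) (auto simp: one_enat_def)
    obtain a where a: "a \<in> V" using V(1) unfolding affine_variety_def by blast
    have "\<exists>C. (\<forall>i\<le>1. affine_variety (C i) \<and> C i \<subseteq> V) \<and> (\<forall>i<1. C i \<subset> C (Suc i))"
    proof (intro exI[of _ "\<lambda>i. if i = (0 :: nat) then {a} else V"] conjI allI impI)
      fix i :: nat assume "i < 1"
      have "{a} \<noteq> V" using V(2) by auto
      thus "(if i = 0 then {a} else V) \<subset> (if Suc i = 0 then {a} else V)" using a \<open>i < 1\<close> by auto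
    qed (use V a affine_variety_singleton in auto)
    thus "1 \<le> Sup {enat n | n. \<exists>C. (\<forall>i\<le>n. affine_variety (C i) \<and> C i \<subseteq> V) \<and> (\<forall>i<n. C i \<subset> C (Suc i))}"
      unfolding one_enat_def by (intro Sup_upper) blast
  qed
  thus ?thesis using V unfolding affine_curve_def by blast
qed

locale generic_point =
  fixes V :: "(complex ^ 'n :: finite) set" and x :: "mero_uhp ^ 'n"
  assumes vanishing_iff: "p \<in> vanishing_ideal V \<longleftrightarrow> mero_eval x p = 0"
begin

lemma irreducible:
  assumes "zariski_closed V"
  shows "affine_variety V"
  unfolding affine_variety_def
proof (intro conjI allI impI)
  have "1 \<notin> vanishing_ideal V" by (simp add: vanishing_iff mero_eval_simps)
  thus "V \<noteq> {}" by (auto simp: vanishing_ideal_def)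
  fix A B assume AB: "zariski_closed A" "zariski_closed B" "V \<subseteq> A \<union> B"
  show "V \<subseteq> A \<or> V \<subseteq> B"
  proof (rule ccontr)
    assume not_subset: "\<not> (V \<subseteq> A \<or> V \<subseteq> B)"
    obtain p where p: "p \<notin> vanishing_ideal V" "\<And>v. v \<in> A \<Longrightarrow> cpoly_eval p v = 0"
      using zariski_closed_vanishing[OF AB(1)] not_subset by blast
    obtain q where q: "q \<notin> vanishing_ideal V" "\<And>v. v \<in> B \<Longrightarrow> cpoly_eval q v = 0"
      using zariski_closed_vanishing[OF AB(2)] not_subset by blast
    have "p * q \<in> vanishing_ideal V"
      using AB(3) p(2) q(2) by (auto simp: vanishing_ideal_def cpoly_eval_simps)
    thus False using p(1) q(1) by (simp add: vanishing_iff mero_eval_simps)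
  qed
qed (rule assms)

definition fractions :: "mero_uhp set" where
  "fractions = {mero_eval x p / mero_eval x q | p q. mero_eval x q \<noteq> 0}"

definition ratfun_class :: "mero_uhp \<Rightarrow> ('n cpoly \<times> 'n cpoly) set" where
  "ratfun_class t = {(p, q). mero_eval x q \<noteq> 0 \<and> mero_eval x p / mero_eval x q = t}"

lemma fractionsI: "mero_eval x q \<noteq> 0 \<Longrightarrow> mero_eval x p / mero_eval x q = t \<Longrightarrow> t \<in> fractions"
  by (auto simp: fractions_def)

lemma ratfun_eq_ratfun_class: "mero_eval x q \<noteq> 0 \<Longrightarrow> ratfun V p q = ratfun_class (mero_eval x p / mero_eval x q)"
  by (auto simp: ratfun_def ratfun_rel_def ratfun_class_def vanishing_iff mero_eval_simps field_simps)

lemma C_subfield_fractions: "C_subfield fractions"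
  unfolding C_subfield_def
proof (intro conjI ballI subsetI)
  fix t assume "t \<in> range mero_const"
  thus "t \<in> fractions" by (auto intro!: fractionsI[of 1 "cpoly_const c" for c] simp: mero_eval_simps)
next
  fix s t assume "s \<in> fractions" "t \<in> fractions"
  then obtain p q p' q' where st: "s = mero_eval x p / mero_eval x q" "t = mero_eval x p' / mero_eval x q'"
    and denoms: "mero_eval x q \<noteq> 0" "mero_eval x q' \<noteq> 0"
    unfolding fractions_def by blast
  show "s + t \<in> fractions"
    by (rule fractionsI[of "q * q'" "p * q' + p' * q"])
      (use denoms in \<open>simp_all add: st mero_eval_simps add_frac_eq\<close>)
  show "s * t \<in> fractions"
    by (rule fractionsI[of "q * q'" "p * p'"]) (use denoms in \<open>simp_all add: st mero_eval_simps\<close>)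
  show "s / t \<in> fractions"
  proof (cases "t = 0")
    case True
    thus ?thesis by (intro fractionsI[of 1 0]) (simp_all add: mero_eval_simps)
  next
    case False
    thus ?thesis by (intro fractionsI[of "q * p'" "p * q'"]) (use denoms in \<open>simp_all add: st mero_eval_simps\<close>)
  qed
qed

lemma fractions_eq_adjoin: "fractions = \<complex>(range (($) x))"
proof
  show "\<complex>(range (($) x)) \<subseteq> fractions"
    by (rule adjoin_C_least[OF C_subfield_fractions])
       (auto intro!: fractionsI[of 1 "cpoly_var i" for i] simp: mero_eval_simps)
  have "mero_eval x p \<in> \<complex>(range (($) x))" for p
    by (rule C_subfield_mero_eval[OF C_subfield_adjoin_C]) (use adjoin_C_superset[of "range (($) x)"] in auto)
  thus "fractions \<subseteq> \<complex>(range (($) x))"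
    unfolding fractions_def using C_subfield_divide[OF C_subfield_adjoin_C] by blast
qed

lemma ratfun_class_nonempty: "t \<in> fractions \<Longrightarrow> ratfun_class t \<noteq> {}"
  by (auto simp: fractions_def ratfun_class_def)

lemma inj_on_ratfun_class: "inj_on ratfun_class fractions"
proof (rule inj_onI)
  fix s t assume "s \<in> fractions" and eq: "ratfun_class s = ratfun_class t"
  then obtain p q where "(p, q) \<in> ratfun_class s" using ratfun_class_nonempty[of s] by auto
  thus "s = t" using eq by (auto simp: ratfun_class_def)
qed

lemma UN_ratfun_class:
  assumes st: "s \<in> fractions" "t \<in> fractions"
    and ratfun: "\<And>p q p' q'. (p, q) \<in> ratfun_class s \<Longrightarrow> (p', q') \<in> ratfun_class t \<Longrightarrow>
      mero_eval x (Q p q p' q') \<noteq> 0 \<and> mero_eval x (P p q p' q') / mero_eval x (Q p q p' q') = r"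
  shows "(\<Union>(p, q)\<in>ratfun_class s. \<Union>(p', q')\<in>ratfun_class t. ratfun V (P p q p' q') (Q p q p' q')) =
      ratfun_class r"
proof -
  have "ratfun V (P p q p' q') (Q p q p' q') = ratfun_class r"
    if "(p, q) \<in> ratfun_class s" "(p', q') \<in> ratfun_class t" for p q p' q'
    using ratfun[OF that] ratfun_eq_ratfun_class by metis
  thus ?thesis using ratfun_class_nonempty[OF st(1)] ratfun_class_nonempty[OF st(2)] by fastforce
qed

lemma
  assumes "s \<in> fractions" "t \<in> fractions"
  shows ratfun_class_add: "add (function_field V) (ratfun_class s) (ratfun_class t) = ratfun_class (s + t)"
    and ratfun_class_mult: "mult (function_field V) (ratfun_class s) (ratfun_class t) = ratfun_class (s * t)"
  unfolding function_field_def partial_object.simps monoid.simps ring.simps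
  by (rule UN_ratfun_class[OF assms]; auto simp: ratfun_class_def mero_eval_simps add_frac_eq)+

lemma carrier_function_field: "carrier (function_field V) = ratfun_class ` fractions"
proof -
  have "carrier (function_field V) = {ratfun V p q | p q. mero_eval x q \<noteq> 0}"
    unfolding vanishing_iff[symmetric] function_field_def quotient_def ratfun_def by auto
  also have "\<dots> = {ratfun_class (mero_eval x p / mero_eval x q) | p q. mero_eval x q \<noteq> 0}"
    by (rule Collect_cong) (metis ratfun_eq_ratfun_class)
  also have "\<dots> = ratfun_class ` fractions" unfolding fractions_def by blast
  finally show ?thesis .
qed

lemma one_function_field: "one (function_field V) = ratfun_class 1"
  using ratfun_eq_ratfun_class[of 1 1] by (simp add: function_field_def mero_eval_simps)

lemma inv_ratfun_class_ring_iso: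
  "inv_into fractions ratfun_class \<in> ring_iso (function_field V) (mero_field\<lparr>carrier := fractions\<rparr>)"
proof -
  let ?h = "inv_into fractions ratfun_class"
  have h: "?h (ratfun_class t) = t" if "t \<in> fractions" for t using that inj_on_ratfun_class by simp
  have bij: "bij_betw ?h (carrier (function_field V)) fractions"
    unfolding carrier_function_field using inj_on_ratfun_class
    by (simp add: bij_betw_inv_into inj_on_imp_bij_betw)
  show ?thesis unfolding ring_iso_def
  proof (intro CollectI conjI ring_hom_memI)
    fix S assume "S \<in> carrier (function_field V)"
    then obtain s where s: "s \<in> fractions" "S = ratfun_class s" unfolding carrier_function_field by blast
    show "?h S \<in> carrier (mero_field\<lparr>carrier := fractions\<rparr>)" using s h by simp
    fix T assume "T \<in> carrier (function_field V)"
    then obtain t where t: "t \<in> fractions" "T = ratfun_class t" unfolding carrier_function_field by blast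
    have closed: "s * t \<in> fractions" "s + t \<in> fractions"
      using s(1) t(1) by (auto intro: C_subfield_intros C_subfield_fractions)
    show "?h (S \<otimes>\<^bsub>function_field V\<^esub> T) = ?h S \<otimes>\<^bsub>mero_field\<lparr>carrier := fractions\<rparr>\<^esub> ?h T"
      using s t h closed by (simp add: ratfun_class_mult mero_field_simps)
    show "?h (S \<oplus>\<^bsub>function_field V\<^esub> T) = ?h S \<oplus>\<^bsub>mero_field\<lparr>carrier := fractions\<rparr>\<^esub> ?h T"
      using s t h closed by (simp add: ratfun_class_add mero_field_simps)
  next
    show "?h \<one>\<^bsub>function_field V\<^esub> = \<one>\<^bsub>mero_field\<lparr>carrier := fractions\<rparr>\<^esub>"
      using h[OF C_subfield_1[OF C_subfield_fractions]] by (simp add: one_function_field mero_field_simps)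
    show "bij_betw ?h (carrier (function_field V)) (carrier (mero_field\<lparr>carrier := fractions\<rparr>))"
      using bij by simp
  qed
qed

theorem affine_modelI:
  assumes "affine_curve V"
  shows "affine_model \<complex>(range (($) x)) V x"
proof -
  let ?h = "inv_into fractions ratfun_class"
  have h: "?h (ratfun V p 1) = mero_eval x p" for p
    using ratfun_eq_ratfun_class[of 1 p] inj_on_ratfun_class fractionsI[of 1 p]
    by (simp add: mero_eval_simps)
  show ?thesis unfolding affine_model_def fractions_eq_adjoin[symmetric]
    using assms inv_ratfun_class_ring_iso by (auto intro!: bexI[of _ ?h] simp: h mero_eval_simps)
qed

end

lemma generic_pointI:
  assumes holomorphic: "\<And>i. holomorphic_mero (x $ i)"
    and in_V: "\<And>z. z \<in> uhp \<Longrightarrow> eval_point x z \<in> V" and dense: "V \<subseteq> closure (eval_point x ` uhp)"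
  shows "generic_point V x"
proof
  fix p
  note eval = eval_mero_mero_eval[OF holomorphic]
  show "p \<in> vanishing_ideal V \<longleftrightarrow> mero_eval x p = 0"
  proof
    assume "p \<in> vanishing_ideal V"
    thus "mero_eval x p = 0" using in_V by (intro mero_eqI) (simp add: eval eval_mero_0 vanishing_ideal_def)
  next
    assume "mero_eval x p = 0"
    hence "eval_point x ` uhp \<subseteq> {v. cpoly_eval p v = 0}" using eval[of _ p] eval_mero_0 by auto
    hence "closure (eval_point x ` uhp) \<subseteq> {v. cpoly_eval p v = 0}"
      by (rule closure_minimal) (rule closed_zeros_cpoly)
    thus "p \<in> vanishing_ideal V" using dense by (auto simp: vanishing_ideal_def)
  qed
qed

section \<open>The image of the upper half-plane in the affine model\<close>

lemma holomorphic_delta: "holomorphic_mero \<delta>"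
proof -
  have denominator: "eval_mero (2 * (\<upsilon> - 1)) \<tau> \<noteq> 0" if "\<tau> \<in> uhp" for \<tau>
    using that upsilon_psi_pointwise(2)[OF that] holomorphic_upsilon
    by (simp add: eval_mero_simps eval_mero_numeral holomorphic_mero_intros holomorphic_mero_numeral)
  show ?thesis unfolding delta_def
    by (intro holomorphic_mero_intros holomorphic_mero_divide denominator
      holomorphic_upsilon holomorphic_mero_numeral
        holomorphic_g1 holomorphic_g2 holomorphic_g3)
qed

lemma eval_delta_square:
  assumes "\<tau> \<in> uhp"
  shows "eval_mero \<delta> \<tau> ^ 2 =
    eval_mero \<upsilon> \<tau> * (eval_mero \<upsilon> \<tau> - 1) * (eval_mero \<upsilon> \<tau> ^ 3 - 8 * eval_mero \<upsilon> \<tau> ^ 2 + 5 * eval_mero \<upsilon> \<tau> + 1)"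
proof -
  have "eval_mero (\<delta>\<^sup>2) \<tau> = eval_mero (\<upsilon> * (\<upsilon> - 1) * (\<upsilon> ^ 3 - 8 * \<upsilon>\<^sup>2 + 5 * \<upsilon> + 1)) \<tau>" unfolding delta_square ..
  thus ?thesis
    using assms by (simp add: eval_mero_simps eval_mero_numeral holomorphic_mero_intros holomorphic_mero_numeral
        holomorphic_upsilon holomorphic_delta)
qed

lemma cubic14_factorization: "cubic14 \<upsilon> t = \<upsilon> * ((t - g1) * (t - g2) * (t - g3))"
proof -
  have "\<upsilon> * poly P\<^sub>\<upsilon> t = \<upsilon> * ((t - g1) * (t - g2) * (t - g3))" unfolding P_upsilon_factorization
    by (simp only: poly_mult) simp
  moreover have "poly P\<^sub>\<upsilon> t = (\<upsilon> - 1)\<^sup>2 / \<upsilon> - (\<upsilon>\<^sup>2 - 1) / \<upsilon> * t + t\<^sup>2 + t ^ 3"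
    by (simp add: P_upsilon_def eval_nat_numeral distrib_left right_diff_distrib mult_ac)
  hence "\<upsilon> * poly P\<^sub>\<upsilon> t = cubic14 \<upsilon> t"
    using upsilon_neq(1) by (simp add: cubic14_def distrib_left right_diff_distrib)
  ultimately show ?thesis by simp
qed

lemma cubic14_eval_upsilon_eq_0_iff:
  assumes \<tau>: "\<tau> \<in> uhp"
  shows "cubic14 (eval_mero \<upsilon> \<tau>) t = 0 \<longleftrightarrow> t \<in> {eval_mero g1 \<tau>, eval_mero g2 \<tau>, eval_mero g3 \<tau>}"
proof -
  have "eval_mero (cubic14 \<upsilon> (mero_const t)) \<tau> =
      eval_mero (\<upsilon> * ((mero_const t - g1) * (mero_const t - g2) * (mero_const t - g3))) \<tau>"
    unfolding cubic14_factorization ..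
  hence "cubic14 (eval_mero \<upsilon> \<tau>) t =
      eval_mero \<upsilon> \<tau> * ((t - eval_mero g1 \<tau>) * (t - eval_mero g2 \<tau>) * (t - eval_mero g3 \<tau>))"
    using \<tau> by (simp add: eval_mero_cubic14 eval_mero_simps holomorphic_mero_intros
        holomorphic_upsilon holomorphic_g1 holomorphic_g2 holomorphic_g3)
  thus ?thesis using upsilon_psi_pointwise(1)[OF \<tau>] by auto
qed

lemma X14_model_iff:
  "v \<in> X14_model \<longleftrightarrow> v $ 2 ^ 7 = v $ 1 ^ 4 * (v $ 1 - 1) \<and> cubic14 (v $ 1) (v $ 3) = 0 \<and>
     (v $ 4)\<^sup>2 = v $ 1 * (v $ 1 - 1) * (v $ 1 ^ 3 - 8 * (v $ 1)\<^sup>2 + 5 * v $ 1 + 1)"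
  by (simp add: X14_model_def Let_def cubic14_def)

lemma vector_4 [simp]:
  "(vector [a, b, c, d] :: 'a :: zero ^ 4) $ 1 = a" "(vector [a, b, c, d] :: 'a :: zero ^ 4) $ 2 = b"
  "(vector [a, b, c, d] :: 'a :: zero ^ 4) $ 3 = c" "(vector [a, b, c, d] :: 'a :: zero ^ 4) $ 4 = d"
  unfolding vector_def by simp_all

abbreviation X14_gens :: "mero_uhp ^ 4" where "X14_gens \<equiv> vector [\<upsilon>, \<psi>, g1, \<delta>]"

lemma eval_point_X14_gens:
  "eval_point X14_gens \<tau> = vector [eval_mero \<upsilon> \<tau>, eval_mero \<psi> \<tau>, eval_mero g1 \<tau>, eval_mero \<delta> \<tau>]"
  by (simp add: eval_point_def vec_eq_iff forall_4)

lemma holomorphic_X14_gens: "holomorphic_mero (X14_gens $ i)"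
  using exhaust_4[of i] holomorphic_upsilon holomorphic_psi holomorphic_g1 holomorphic_delta by auto

lemma eval_point_in_X14_model: "\<tau> \<in> uhp \<Longrightarrow> eval_point X14_gens \<tau> \<in> X14_model"
  by (simp add: X14_model_iff eval_point_X14_gens cubic14_eval_upsilon_eq_0_iff
    eval_delta_square upsilon_psi_pointwise(4))

lemma act_translation:
  fixes k :: int
  defines "T \<equiv> mat2 1 k 0 1"
  shows "T \<in> \<Gamma>\<^sub>1(7)" "act T g1 = g1" "act T \<delta> = (if even k then \<delta> else - \<delta>)"
proof -
  show T: "T \<in> \<Gamma>\<^sub>1(7)" by (simp add: T_def Gamma1_def SL2Z_iff)
  note SL2Z = Gamma1D(1)[OF T]
  show g1: "act T g1 = g1" unfolding act_g1[OF T] by (simp add: g_of_row_def T_def)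
  have g23: "act T g2 = (if even k then g2 else g3)" "act T g3 = (if even k then g3 else g2)"
    unfolding act_g2[OF T] act_g3[OF T] by (simp_all add: g_of_row_def T_def)
  have "act T 2 = 2" using act_const[OF SL2Z, of 2] by (simp add: mero_const_numeral)
  hence "act T \<delta> = \<upsilon>\<^sup>2 / (2 * (\<upsilon> - 1)) * ((g1 - act T g2) * (act T g2 - act T g3) * (act T g3 - g1))"
    by (simp add: delta_def act_mult act_divide act_diff act_power SL2Z g1 act_upsilon_Gamma1[OF T])
  moreover have "(g1 - g3) * (g3 - g2) * (g2 - g1) = - ((g1 - g2) * (g2 - g3) * (g3 - g1))"
    by (simp add: algebra_simps)
  ultimately show "act T \<delta> = (if even k then \<delta> else - \<delta>)" by (simp add: g23 delta_def)
qed

lemma eval_upsilon_Gamma1: "A \<in> \<Gamma>\<^sub>1(7) \<Longrightarrow> \<tau> \<in> uhp \<Longrightarrow> eval_mero \<upsilon> (moebius_act A \<tau>) = eval_mero \<upsilon> \<tau>"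
  using eval_act[OF Gamma1D(1)] act_upsilon_Gamma1 by metis

lemma cubic14_root_in_fibre:
  assumes \<tau>: "\<tau> \<in> uhp" and root: "cubic14 (eval_mero \<upsilon> \<tau>) z = 0"
  obtains t where "t \<in> uhp" "eval_mero \<upsilon> t = eval_mero \<upsilon> \<tau>" "eval_mero g1 t = z"
proof -
  note reached = that
  have conj: thesis if "A \<in> \<Gamma>\<^sub>1(7)" "z = eval_mero (act A g1) \<tau>" for A
    using that(2) eval_act[OF Gamma1D(1)[OF that(1)] \<tau>] moebius_in_uhp[OF Gamma1D(1)[OF that(1)] \<tau>]
      eval_upsilon_Gamma1[OF that(1) \<tau>] by (intro reached[of "moebius_act A \<tau>"]) simp_all
  from root[unfolded cubic14_eval_upsilon_eq_0_iff[OF \<tau>]]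
  consider (g1) "z = eval_mero g1 \<tau>" | (g2) "z = eval_mero g2 \<tau>" | (g3) "z = eval_mero g3 \<tau>" by blast
  thus thesis
  proof cases
    case g1
    thus thesis using reached \<tau> by blast
  next
    case g2
    thus thesis using conj[OF conj_g2_Gamma1] by (simp add: act_conj_g2_g1)
  next
    case g3
    thus thesis using conj[OF conj_g3_Gamma1] by (simp add: act_conj_g3_g1)
  qed
qed

lemma root_of_unity_zeta:
  assumes "z ^ N = 1" "N > 0"
  obtains k where "z = zeta N (int k)"
proof -
  have "z \<in> {z. z ^ N = 1}" using assms by simp
  then obtain k where "z = exp (2 * of_real pi * \<i> * of_nat k / of_nat N)"
    unfolding complex_roots_unity[OF Suc_leI[OF assms(2), folded One_nat_def]] by blast
  thus ?thesis using that[of k] by (simp add: zeta_def to_q_def mult_ac)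
qed

lemma psi_delta_in_fibre:
  assumes t: "t \<in> uhp" and y: "y ^ 7 = eval_mero \<psi> t ^ 7" and w: "w\<^sup>2 = eval_mero \<delta> t ^ 2"
  obtains s where "s \<in> uhp" "eval_point X14_gens s = vector [eval_mero \<upsilon> t, y, eval_mero g1 t, w]"
proof -
  have psi: "eval_mero \<psi> t \<noteq> 0" using upsilon_psi_pointwise(3)[OF t] .
  hence "(y / eval_mero \<psi> t) ^ 7 = 1" using y by (simp add: power_divide)
  then obtain j where j: "y / eval_mero \<psi> t = zeta 7 (int j)" using root_of_unity_zeta[of _ 7] by auto
  \<comment> \<open>A translation by \<open>k\<close> multiplies \<open>\<psi>\<close> by \<open>zeta 7 (2 * k)\<close> and \<open>\<delta>\<close> by \<open>(- 1) ^ k\<close>, which are prescribed independently.\<close>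
  define k where "k = 4 * int j + (if w = eval_mero \<delta> t then 0 else 7)"
  define T where "T = mat2 1 k 0 1"
  note T = act_translation[of k, folded T_def]
  have zeta: "zeta 7 (k * 2) = zeta 7 (int j)" by (rule zeta_cong) (simp_all add: k_def)
  have w_sign: "w = (if even k then eval_mero \<delta> t else - eval_mero \<delta> t)"
    using w by (auto simp: k_def power2_eq_iff)
  show thesis
  proof (rule that)
    show "moebius_act T t \<in> uhp" by (rule moebius_in_uhp[OF Gamma1D(1)[OF T(1)] t])
    have eval: "eval_mero f (moebius_act T t) = eval_mero (act T f) t" for f
      by (rule eval_act[OF Gamma1D(1)[OF T(1)] t, symmetric])
    have "eval_mero \<psi> (moebius_act T t) = y"
      using t psi j unfolding eval act_psi_Gamma1[OF T(1)]
      by (simp add: T_def zeta eval_mero_simps holomorphic_mero_const holomorphic_psi field_simps)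
    moreover have "eval_mero \<delta> (moebius_act T t) = w"
      using t unfolding eval T(3) by (simp add: w_sign eval_mero_uminus holomorphic_delta)
    ultimately show "eval_point X14_gens (moebius_act T t) = vector [eval_mero \<upsilon> t, y, eval_mero g1 t, w]"
      by (simp add: eval_point_X14_gens eval T(2) act_upsilon_Gamma1[OF T(1)])
  qed
qed

lemma X14_fibre_subset_image:
  assumes v: "v \<in> X14_model" and \<tau>: "\<tau> \<in> uhp" "v $ 1 = eval_mero \<upsilon> \<tau>"
  shows "v \<in> eval_point X14_gens ` uhp"
proof -
  have eqs: "v $ 2 ^ 7 = v $ 1 ^ 4 * (v $ 1 - 1)" "cubic14 (v $ 1) (v $ 3) = 0"
     "(v $ 4)\<^sup>2 = v $ 1 * (v $ 1 - 1) * (v $ 1 ^ 3 - 8 * (v $ 1)\<^sup>2 + 5 * v $ 1 + 1)"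
    using v by (simp_all add: X14_model_iff)
  obtain t where t: "t \<in> uhp" "eval_mero \<upsilon> t = v $ 1" "eval_mero g1 t = v $ 3"
    using cubic14_root_in_fibre[OF \<tau>(1) eqs(2)[unfolded \<tau>(2)]] \<tau>(2) by metis
  obtain s where s: "s \<in> uhp" "eval_point X14_gens s = vector [eval_mero \<upsilon> t, v $ 2, eval_mero g1 t, v $ 4]"
    by (rule psi_delta_in_fibre[OF t(1), of "v $ 2" "v $ 4"])
       (use eqs t in \<open>simp_all add: upsilon_psi_pointwise(4) eval_delta_square\<close>)
  have "v = eval_point X14_gens s" unfolding s(2) t by (simp add: vec_eq_iff forall_4)
  thus ?thesis using s(1) by blast
qed

lemma nearest_root:
  fixes p :: "complex poly"
  assumes "Polynomial.degree p > 0" and monic: "Polynomial.lead_coeff p = 1"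
  obtains r where "poly p r = 0" "norm (c - r) ^ Polynomial.degree p \<le> norm (poly p c)"
proof -
  obtain A where A: "size A = Polynomial.degree p" "p = (\<Prod>r\<in>#A. [:- r, 1:])"
    using alg_closed_imp_factorization[of p] monic by fastforce
  have eval: "poly p t = (\<Prod>r\<in>#A. t - r)" for t unfolding A(2) poly_prod_mset
    by (simp add: image_mset.compositionality)
  have "set_mset A \<noteq> {}" using A(1) assms(1) by auto
  then obtain r where r: "r \<in># A" "\<And>s. s \<in># A \<Longrightarrow> norm (c - r) \<le> norm (c - s)"
    using ex_is_arg_min_if_finite[of "set_mset A" "\<lambda>s. norm (c - s)"] by (auto simp: is_arg_min_linorder)
  have "norm (c - r) ^ size A \<le> norm (\<Prod>s\<in>#A. c - s)"
    using r(2) by (induction A) (auto simp: norm_mult intro!: mult_mono)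
  thus ?thesis using that[of r] r(1) by (simp add: A(1) eval prod_mset_zero_iff)
qed

lemma roots_continuous:
  fixes P :: "nat \<Rightarrow> complex poly"
  assumes P: "\<And>n. Polynomial.degree (P n) = k" "k > 0" "\<And>n. Polynomial.lead_coeff (P n) = 1"
    and lim: "(\<lambda>n. poly (P n) c) \<longlonglongrightarrow> 0"
  obtains r where "\<And>n. poly (P n) (r n) = 0" "r \<longlonglongrightarrow> c"
proof -
  have "\<exists>r. poly (P n) r = 0 \<and> norm (c - r) ^ k \<le> norm (poly (P n) c)" for n
    using nearest_root[of "P n" c] P by metis
  then obtain r where r: "\<And>n. poly (P n) (r n) = 0" "\<And>n. norm (c - r n) ^ k \<le> norm (poly (P n) c)" by metis
  have "(\<lambda>n. root k (norm (poly (P n) c))) \<longlonglongrightarrow> root k (norm (0 :: complex))"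
    by (intro tendsto_real_root tendsto_norm lim)
  hence root_lim: "(\<lambda>n. root k (norm (poly (P n) c))) \<longlonglongrightarrow> 0" by simp
  have "norm (r n - c) \<le> root k (norm (poly (P n) c))" for n
  proof -
    have "root k (norm (c - r n) ^ k) \<le> root k (norm (poly (P n) c))" using r(2) P(2) by simp
    thus ?thesis using P(2) by (simp add: real_root_power_cancel norm_minus_commute)
  qed
  hence "(\<lambda>n. r n - c) \<longlonglongrightarrow> 0" by (intro Lim_null_comparison[OF _ root_lim]) simp
  thus ?thesis using that r(1) LIM_zero_cancel by blast
qed

lemma power_root_continuous:
  assumes "c \<longlonglongrightarrow> t ^ k" "k > 0"
  obtains r :: "nat \<Rightarrow> complex" where "\<And>n. r n ^ k = c n" "r \<longlonglongrightarrow> t"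
proof -
  let ?P = "\<lambda>n. Polynomial.monom 1 k + [:- c n:]"
  have degree: "Polynomial.degree (?P n) = k" for n
    using assms(2) by (subst degree_add_eq_left) (simp_all add: degree_monom_eq)
  have lead_coeff: "Polynomial.lead_coeff (?P n) = 1" for n
    using assms(2) unfolding degree by (cases k) simp_all
  have "(\<lambda>n. t ^ k - c n) \<longlonglongrightarrow> t ^ k - t ^ k" by (intro tendsto_intros assms(1))
  hence "(\<lambda>n. poly (?P n) t) \<longlonglongrightarrow> 0" by (simp add: poly_monom)
  then obtain r where "\<And>n. poly (?P n) (r n) = 0" "r \<longlonglongrightarrow> t"
    by (rule roots_continuous[OF degree assms(2) lead_coeff]) blast
  thus ?thesis by (intro that[of r]) (simp_all add: poly_monom)
qed

lemma cubic14_root_continuous_nonzero: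
  assumes x: "x \<longlonglongrightarrow> x0" "\<And>n. x n \<noteq> 0" "x0 \<noteq> 0" and z0: "cubic14 x0 z0 = (0 :: complex)"
  obtains z where "\<And>n. cubic14 (x n) (z n) = 0" "z \<longlonglongrightarrow> z0"
proof -
  let ?P = "\<lambda>n. [:(x n - 1)\<^sup>2 / x n, - ((x n ^ 2 - 1) / x n), 1, 1:]"
  have eval: "poly (?P n) t = cubic14 (x n) t / x n" for n t
    using x(2)[of n] by (simp add: cubic14_def field_simps eval_nat_numeral)
  have "(\<lambda>n. poly (?P n) z0) \<longlonglongrightarrow> cubic14 x0 z0 / x0"
    unfolding eval unfolding cubic14_def by (intro tendsto_intros x(1,3))
  hence "(\<lambda>n. poly (?P n) z0) \<longlonglongrightarrow> 0" using z0 by simp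
  then obtain r where "\<And>n. poly (?P n) (r n) = 0" "r \<longlonglongrightarrow> z0"
    by (rule roots_continuous[of ?P 3, rotated 3]) auto
  thus ?thesis using that[of r] x(2) unfolding eval by simp
qed

text \<open>Near \<open>x = 0\<close> two of the roots escape to infinity, so the reversed polynomial is used.\<close>

lemma cubic14_root_continuous_0:
  assumes x: "x \<longlonglongrightarrow> (0 :: complex)" "\<And>n. x n \<noteq> 0" "\<And>n. x n \<noteq> 1"
  obtains z where "\<And>n. cubic14 (x n) (z n) = 0" "z \<longlonglongrightarrow> - 1"
proof -
  let ?P = "\<lambda>n. [:x n / (x n - 1)\<^sup>2, x n / (x n - 1)\<^sup>2, - ((x n ^ 2 - 1) / (x n - 1)\<^sup>2), 1:]"
  have reversed: "poly [:a / D, a / D, - (b / D), 1:] t = (a + a * t - b * t ^ 2 + D * t ^ 3) / D"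
    if "D \<noteq> 0" for a b D t :: complex
    using that by (simp add: field_simps eval_nat_numeral)
  have eval: "poly (?P n) t = (x n + x n * t - (x n ^ 2 - 1) * t ^ 2 + (x n - 1)\<^sup>2 * t ^ 3) / (x n - 1)\<^sup>2"
    for n t
    using x(3)[of n] by (intro reversed) simp
  have "(\<lambda>n. poly (?P n) (- 1)) \<longlonglongrightarrow> (0 + 0 * (- 1) - (0 ^ 2 - 1) * (- 1) ^ 2 + (0 - 1)\<^sup>2 * (- 1) ^ 3) / (0 - 1)\<^sup>2"
    unfolding eval by (intro tendsto_intros x(1)) simp
  hence "(\<lambda>n. poly (?P n) (- 1)) \<longlonglongrightarrow> 0" by simp
  then obtain r where r: "\<And>n. poly (?P n) (r n) = 0" "r \<longlonglongrightarrow> - 1"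
    by (rule roots_continuous[of ?P 3, rotated 3]) auto
  have root: "x n + x n * r n - (x n ^ 2 - 1) * r n ^ 2 + (x n - 1)\<^sup>2 * r n ^ 3 = 0" for n
    using r(1)[of n] x(3)[of n] unfolding eval divide_eq_0_iff by simp
  have nonzero: "r n \<noteq> 0" for n using root[of n] x(2)[of n] by auto
  have "r n ^ 3 * cubic14 (x n) (1 / r n) = 0" for n
    unfolding root[of n, symmetric] using nonzero[of n] by (simp add: cubic14_def field_simps eval_nat_numeral)
  moreover have "(\<lambda>n. 1 / r n) \<longlonglongrightarrow> 1 / (- 1)" by (intro tendsto_intros r(2)) simp
  ultimately show ?thesis using that[of "\<lambda>n. 1 / r n"] nonzero by simp
qed

lemma cubic14_root_continuous:
  assumes x: "x \<longlonglongrightarrow> x0" "\<And>n. x n \<noteq> 0" "\<And>n. x n \<noteq> 1" and z0: "cubic14 x0 z0 = (0 :: complex)"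
  obtains z where "\<And>n. cubic14 (x n) (z n) = 0" "z \<longlonglongrightarrow> z0"
proof (cases "x0 = 0")
  case False
  thus ?thesis using cubic14_root_continuous_nonzero[OF x(1,2) _ z0] that by blast
next
  case True
  hence "z0 = - 1" using z0 by (simp add: cubic14_def eq_neg_iff_add_eq_0)
  thus ?thesis using cubic14_root_continuous_0[OF x(1)[unfolded True] x(2,3)] that by blast
qed

lemma closure_eval_upsilon: "closure (eval_mero \<upsilon> ` uhp) = UNIV"
proof (rule modular_function_dense_image[OF upsilon_in_Gamma7 _ holomorphic_upsilon])
  show "\<upsilon> \<notin> range mero_const"
  proof
    assume "\<upsilon> \<in> range mero_const"
    then obtain c where "\<upsilon> = mero_const c" by blast
    hence "peval [:- c, 1:] \<upsilon> = mero_const (- c + c)" unfolding mero_const_add by (simp add: mero_const_1)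
    thus False using upsilon.peval_u_nonzero[of "[:- c, 1:]"] by (simp add: mero_const_0)
  qed
qed simp

lemma X14_model_subset_closure: "X14_model \<subseteq> closure (eval_point X14_gens ` uhp)"
proof
  fix v assume "v \<in> X14_model"
  hence eqs: "v $ 2 ^ 7 = v $ 1 ^ 4 * (v $ 1 - 1)" "cubic14 (v $ 1) (v $ 3) = 0"
     "(v $ 4)\<^sup>2 = v $ 1 * (v $ 1 - 1) * (v $ 1 ^ 3 - 8 * (v $ 1)\<^sup>2 + 5 * v $ 1 + 1)"
    by (simp_all add: X14_model_iff)
  have "v $ 1 \<in> closure (eval_mero \<upsilon> ` uhp)" by (simp add: closure_eval_upsilon)
  then obtain x where x: "\<And>n. x n \<in> eval_mero \<upsilon> ` uhp" "x \<longlonglongrightarrow> v $ 1" unfolding closure_sequential by blast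
  have x_neq: "x n \<noteq> 0" "x n \<noteq> 1" for n using x(1)[of n] upsilon_psi_pointwise by auto
  obtain y where y: "\<And>n. y n ^ 7 = x n ^ 4 * (x n - 1)" "y \<longlonglongrightarrow> v $ 2"
    by (rule power_root_continuous[of "\<lambda>n. x n ^ 4 * (x n - 1)" "v $ 2" 7])
       (use x(2) in \<open>auto simp: eqs(1) intro!: tendsto_intros\<close>)
  obtain z where z: "\<And>n. cubic14 (x n) (z n) = 0" "z \<longlonglongrightarrow> v $ 3"
    by (rule cubic14_root_continuous[OF x(2) x_neq eqs(2)]) blast
  obtain w where w: "\<And>n. (w n)\<^sup>2 = x n * (x n - 1) * (x n ^ 3 - 8 * (x n)\<^sup>2 + 5 * x n + 1)" "w \<longlonglongrightarrow> v $ 4"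
    by (rule power_root_continuous[of "\<lambda>n. x n * (x n - 1) * (x n ^ 3 - 8 * (x n)\<^sup>2 + 5 * x n + 1)" "v $ 4" 2])
       (use x(2) in \<open>auto simp: eqs(3) intro!: tendsto_intros\<close>)
  let ?p = "\<lambda>n. vector [x n, y n, z n, w n] :: complex ^ 4"
  have "?p n \<in> eval_point X14_gens ` uhp" for n
  proof -
    have "?p n \<in> X14_model" by (simp add: X14_model_iff y z w)
    moreover obtain \<tau> where "\<tau> \<in> uhp" "x n = eval_mero \<upsilon> \<tau>" using x(1) by blast
    ultimately show ?thesis by (intro X14_fibre_subset_image) simp_all
  qed
  moreover have "?p \<longlonglongrightarrow> v"
  proof (rule vec_tendstoI)
    fix i :: 4
    show "(\<lambda>n. ?p n $ i) \<longlonglongrightarrow> v $ i" using exhaust_4[of i] x(2) y(2) z(2) w(2) by auto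
  qed
  ultimately show "v \<in> closure (eval_point X14_gens ` uhp)"
    unfolding closure_sequential by (intro exI[of _ ?p]) blast
qed

section \<open>The affine model\<close>

interpretation X14: generic_point X14_model X14_gens
  by (rule generic_pointI[OF holomorphic_X14_gens eval_point_in_X14_model X14_model_subset_closure])

lemma zariski_closed_X14_model: "zariski_closed X14_model"
proof -
  define x :: "4 cpoly" where "x = cpoly_var 1"
  define S where "S = {cpoly_var 2 ^ 7 - x ^ 4 * (x - 1),
     x * cpoly_var 3 ^ 3 + x * cpoly_var 3 ^ 2 - (x ^ 2 - 1) * cpoly_var 3 + (x - 1) ^ 2,
     cpoly_var 4 ^ 2 - x * (x - 1) * (x ^ 3 - cpoly_const 8 * x ^ 2 + cpoly_const 5 * x + 1)}"
  have "X14_model = {v. \<forall>p\<in>S. cpoly_eval p v = 0}"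
    unfolding S_def x_def by (auto simp: X14_model_iff cpoly_eval_simps cubic14_def)
  thus ?thesis unfolding zariski_closed_def by blast
qed

lemma clear_denominators_upsilon:
  assumes "coeffs_in (\<A>\<^sub>0 \<Gamma>\<^sub>1(7)) q"
  obtains n r where "n \<noteq> 0" "peval n \<upsilon> * poly q (mero_eval X14_gens p) = mero_eval X14_gens r"
proof -
  have "\<exists>n r. n \<noteq> 0 \<and> peval n \<upsilon> * poly q (mero_eval X14_gens p) = mero_eval X14_gens r"
    using assms
  proof (induction q)
    case 0
    show ?case by (rule exI[of _ 1], rule exI[of _ 0]) (simp add: mero_eval_simps)
  next
    case (pCons a q)
    hence a: "a \<in> \<A>\<^sub>0 \<Gamma>\<^sub>1(7)" and "coeffs_in (\<A>\<^sub>0 \<Gamma>\<^sub>1(7)) q" by (simp_all add: coeffs_in_pCons_iff)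
    then obtain n r where n: "n \<noteq> 0" "peval n \<upsilon> * poly q (mero_eval X14_gens p) = mero_eval X14_gens r"
      using pCons.IH by blast
    obtain s t where st: "peval t \<upsilon> \<noteq> 0" "a = peval s \<upsilon> / peval t \<upsilon>" using upsilon.hauptmodul_generates[OF a] .
    have "peval (n * t) \<upsilon> * poly (pCons a q) (mero_eval X14_gens p) =
        peval n \<upsilon> * (peval t \<upsilon> * a) + peval t \<upsilon> * mero_eval X14_gens p *
            (peval n \<upsilon> * poly q (mero_eval X14_gens p))"
      by (simp add: peval_mult algebra_simps)
    also have "peval t \<upsilon> * a = peval s \<upsilon>" using st by simp
    finally have "peval (n * t) \<upsilon> * poly (pCons a q) (mero_eval X14_gens p) =
        mero_eval X14_gens (cpoly_of_poly 1 n * cpoly_of_poly 1 s + cpoly_of_poly 1 t * p * r)"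
      unfolding n(2) by (simp add: mero_eval_simps)
    moreover have "n * t \<noteq> 0" using n(1) st(1) by auto
    ultimately show ?case by blast
  qed
  thus ?thesis using that by blast
qed

lemma norm_in_upsilon:
  assumes p: "mero_eval X14_gens p \<noteq> 0"
  obtains n r where "n \<noteq> 0" "mero_eval X14_gens (p * r) = peval n \<upsilon>"
proof -
  obtain R where "congruence_group \<Gamma>\<^sub>1(7) 14 R" using congruence_group_Gamma1[of 7 14] by auto
  then interpret congruence_group "\<Gamma>\<^sub>1(7)" 14 R .
  have "X14_gens $ i \<in> \<A>\<^sub>0 \<Gamma>(14)" for i using exhaust_4[of i] generators_Gamma14 by auto
  hence "mero_eval X14_gens p \<in> \<A>\<^sub>0 \<Gamma>(14)" by (intro C_subfield_mero_eval C_subfield_level)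
  then obtain q c where q: "coeffs_in (\<A>\<^sub>0 \<Gamma>\<^sub>1(7)) q" "mero_eval X14_gens p * poly q (mero_eval X14_gens p) = c"
    and c: "c \<in> \<A>\<^sub>0 \<Gamma>\<^sub>1(7)" "c \<noteq> 0"
    using norm_relation[OF _ p] by metis
  obtain s t where st: "peval t \<upsilon> \<noteq> 0" "c = peval s \<upsilon> / peval t \<upsilon>" using upsilon.hauptmodul_generates[OF c(1)] .
  obtain n r where n: "n \<noteq> 0" "peval n \<upsilon> * poly q (mero_eval X14_gens p) = mero_eval X14_gens r"
    using clear_denominators_upsilon[OF q(1)] .
  have "mero_eval X14_gens (p * (r * cpoly_of_poly 1 t)) =
      peval n \<upsilon> * (mero_eval X14_gens p * poly q (mero_eval X14_gens p)) * peval t \<upsilon>"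
    by (simp add: mero_eval_simps flip: n(2))
  also have "\<dots> = peval (n * s) \<upsilon>" unfolding q(2) st(2) peval_mult using st(1) by simp
  finally have "mero_eval X14_gens (p * (r * cpoly_of_poly 1 t)) = peval (n * s) \<upsilon>" .
  moreover have "n * s \<noteq> 0" using n(1) c(2) st(2) by auto
  ultimately show ?thesis using that by blast
qed

lemma norm_polynomial_X14:
  assumes "p \<notin> vanishing_ideal X14_model"
  obtains n where "n \<noteq> 0" "\<And>v. v \<in> X14_model \<Longrightarrow> cpoly_eval p v = 0 \<Longrightarrow> poly n (v $ 1) = 0"
proof -
  obtain n r where n: "n \<noteq> 0" "mero_eval X14_gens (p * r) = peval n \<upsilon>"
    using norm_in_upsilon assms unfolding X14.vanishing_iff by blast
  have "p * r - cpoly_of_poly 1 n \<in> vanishing_ideal X14_model"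
    unfolding X14.vanishing_iff using n(2) by (simp add: mero_eval_simps)
  hence "cpoly_eval p v * cpoly_eval r v = poly n (v $ 1)" if "v \<in> X14_model" for v
    using that by (simp add: vanishing_ideal_def cpoly_eval_simps)
  thus ?thesis using that[of n] n(1) by force
qed

lemma finite_cubic14_roots: "finite {t :: complex. cubic14 a t = 0}"
proof -
  have "[:(a - 1)\<^sup>2, - (a\<^sup>2 - 1), a, a:] \<noteq> 0" by auto
  hence "finite {t. poly [:(a - 1)\<^sup>2, - (a\<^sup>2 - 1), a, a:] t = 0}" by (rule poly_roots_finite)
  thus ?thesis by (simp add: cubic14_def eval_nat_numeral algebra_simps)
qed

lemma finite_fibres_X14:
  assumes "finite S"
  shows "finite {v \<in> X14_model. v $ 1 \<in> S}"
proof -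
  define ys where "ys a = {y. y ^ 7 = a ^ 4 * (a - 1)}" for a :: complex
  define zs where "zs a = {z. cubic14 a z = 0}" for a :: complex
  define ws where "ws a = {w. w\<^sup>2 = a * (a - 1) * (a ^ 3 - 8 * a\<^sup>2 + 5 * a + 1)}" for a :: complex
  have "finite (SIGMA a:S. ys a \<times> zs a \<times> ws a)"
    unfolding ys_def zs_def ws_def by (intro finite_SigmaI finite_nth_roots finite_cubic14_roots assms) simp_all
  moreover have "{v \<in> X14_model. v $ 1 \<in> S} \<subseteq>
      (\<lambda>(a, y, z, w). vector [a, y, z, w]) ` (SIGMA a:S. ys a \<times> zs a \<times> ws a)"
  proof
    fix v assume v: "v \<in> {v \<in> X14_model. v $ 1 \<in> S}"
    have "v = vector [v $ 1, v $ 2, v $ 3, v $ 4]" by (simp add: vec_eq_iff forall_4)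
    moreover have "(v $ 1, v $ 2, v $ 3, v $ 4) \<in> (SIGMA a:S. ys a \<times> zs a \<times> ws a)"
      using v by (simp add: ys_def zs_def ws_def X14_model_iff)
    ultimately show "v \<in> (\<lambda>(a, y, z, w). vector [a, y, z, w]) ` (SIGMA a:S. ys a \<times> zs a \<times> ws a)" by force
  qed
  ultimately show ?thesis using finite_surj by blast
qed

lemma infinite_X14_model: "infinite X14_model"
proof
  assume "finite X14_model"
  moreover have "eval_mero \<upsilon> ` uhp \<subseteq> (\<lambda>v. v $ 1) ` X14_model"
    using eval_point_in_X14_model by (force simp: eval_point_X14_gens)
  ultimately have "finite (eval_mero \<upsilon> ` uhp)" by (rule finite_surj)
  thus False using closure_eval_upsilon finite_imp_closed closure_closed infinite_UNIV_char_0 by metis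
qed

lemma affine_curve_X14_model: "affine_curve X14_model"
proof (rule affine_curveI[OF X14.irreducible[OF zariski_closed_X14_model] infinite_X14_model])
  fix W :: "(complex ^ 4) set" assume W: "zariski_closed W" "W \<subset> X14_model"
  obtain p where p: "p \<notin> vanishing_ideal X14_model" "\<And>v. v \<in> W \<Longrightarrow> cpoly_eval p v = 0"
    using zariski_closed_vanishing[of W X14_model] W by blast
  obtain n where n: "n \<noteq> 0" "\<And>v. v \<in> X14_model \<Longrightarrow> cpoly_eval p v = 0 \<Longrightarrow> poly n (v $ 1) = 0"
    using norm_polynomial_X14[OF p(1)] by blast
  have "finite {v \<in> X14_model. v $ 1 \<in> {a. poly n a = 0}}" using n(1)
    by (intro finite_fibres_X14 poly_roots_finite)
  moreover have "W \<subseteq> {v \<in> X14_model. v $ 1 \<in> {a. poly n a = 0}}" using W(2) p(2) n(2) by auto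
  ultimately show "finite W" by (rule rev_finite_subset)
qed

theorem affine_model_X14: "affine_model (\<A>\<^sub>0 \<Gamma>(14)) X14_model (vector [\<upsilon>, \<psi>, g1, \<delta>])"
proof -
  have "range (($) X14_gens) = {\<upsilon>, \<psi>, g1, \<delta>}" unfolding UNIV_4 by simp
  thus ?thesis using X14.affine_modelI[OF affine_curve_X14_model] by (simp add: modular_functions_Gamma14_delta)
qed

theorem theorem1p2:
  shows "\<A>\<^sub>0 \<Gamma>(7) = \<complex>({\<psi>, \<upsilon>}) \<and>
         splitting_field_over (\<A>\<^sub>0 \<Gamma>(7)) P\<^sub>\<upsilon> (\<A>\<^sub>0 \<Gamma>(14)) \<and>
         P\<^sub>\<upsilon> = [:- g1, 1:] * [:- g2, 1:] * [:- g3, 1:] \<and>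
         (2 * (\<upsilon> - 1) / \<upsilon>\<^sup>2 * \<delta>)\<^sup>2 = cubic_discriminant P\<^sub>\<upsilon> \<and>
         \<A>\<^sub>0 \<Gamma>(14) = \<complex>({\<upsilon>, \<psi>, g1, \<delta>}) \<and>
         \<A>\<^sub>0 \<Gamma>(14) = \<complex>({\<upsilon>, \<psi>, g1, g2}) \<and>
         affine_model (\<A>\<^sub>0 \<Gamma>(14)) X14_model (vector [\<upsilon>, \<psi>, g1, \<delta>])"
  using modular_functions_Gamma7 splitting_field_P_upsilon P_upsilon_factorization delta_discriminant
    modular_functions_Gamma14_delta modular_functions_Gamma14_g2 affine_model_X14 by blast

end
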